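(* Suppose that $V$ satisfies Hypotheses A and B and that $W=g^2\omega^{-1}v^2$ satisfies Hypothesis C (all stated in the context). There exists $\varepsilon_V>0$, depending on $V$, such that, if $$\|W\|_{L^1+L^{3,\infty}}\le\varepsilon_V,$$ then the Klein--Gordon--Schrödinger energy functional $\mathcal{E}$ has a unique minimizer $(u_{\mathrm{gs}},f_{\mathrm{gs}})$ in $\mathcal{U}\times\mathcal{Z}_\omega$ such that $\langle u_{\mathrm{gs}},u_V\rangle_{L^2}>0$.
   Context: Weak Lebesgue space: $L^{3,\infty}=L^{3,\infty}(\mathbb{R}^3)$ is the set of measurable $f$ with $\|f\|_{L^{3,\infty}}=\sup_{t>0}t\,\lambda(\{|f|>t\})^{1/3}<\infty$, $\lambda$ being Lebesgue measure. $\|W\|_{L^1+L^{3,\infty}}$ is the infimum of $\|W_1\|_{L^1}+\|W_2\|_{L^{3,\infty}}$ over decompositions $W=W_1+W_2$. Particle. $V:\mathbb{R}^3\to\mathbb{R}$ is a measurable potential, $V_+=\max(V,0)$, $V_-=\max(-V,0)$. $H_V=-\Delta+V$ on $L^2(\mathbb{R}^3)$ is defined through its quadratic form, and $\mu_V=\inf\sigma(H_V)$ (similarly $H_U,\mu_U$ for other potentials $U$). Hypothesis A on $V$: there are $0\le a<1$ and $b\in\mathbb{R}$ with $V_-\le -a\Delta+b$ as quadratic forms on $H^1(\mathbb{R}^3)$, and $V=V_1+V_2$ with (i) $V_1\in L^1_{\mathrm{loc}}(\mathbb{R}^3;\mathbb{R}^+)$; (ii) $V_2\in L^{3/2}_{\mathrm{loc}}(\mathbb{R}^3;\mathbb{R})$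 and $\lim_{|x|\to\infty}V_2(x)=0$; (iii) $\mu_V<\mu_{V_1}$. Under Hypothesis A, $H_V$ is a semibounded self-adjoint operator with form domain $\mathcal{Q}_V=\{u\in H^1(\mathbb{R}^3): \int V_+|u|^2<\infty\}$. Set $\mathcal{U}=\{u\in\mathcal{Q}_V:\|u\|_{L^2}=1\}$. Hypothesis B: $\mu_V$ is a simple isolated eigenvalue of $H_V$ associated to a unique positive ground state $u_V\in L^2(\mathbb{R}^3;\mathbb{R}_+)$ with $\|u_V\|_{L^2}=1$. Field. $\omega:\mathbb{R}^3\to[0,\infty)$ is measurable with $\omega>0$ almost everywhere, $v:\mathbb{R}^3\to\mathbb{R}$ is measurable, $g\in\mathbb{R}$, and $W=g^2\omega^{-1}v^2$. $\mathcal{Z}_\omega=\{f:\mathbb{R}^3\to\mathbb{C}\text{ measurable}:\omega^{1/2}f\in L^2(\mathbb{R}^3)\}$. Hypothesis C on $W$: $W=W_1+W_2$ with $W_1\in L^1(\mathbb{R}^3)$ and $W_2\in L^{3,\infty}(\mathbb{R}^3)$. Energy. For $(u,f)\in\mathcal{U}\times\mathcal{Z}_\omega$, $$\mathcal{E}(u,f)=\int|\nabla u|^2dx+\int V|u|^2dx+\int\omega|f|^2dk+2g\,\mathrm{Re}\int_{\mathbb{R}^6}e^{ik\cdot x}v(k)f(k)|u(x)|^2dx\,dk,$$ where the last integral is understood as $\int v(k)f(k)\big(\int e^{ik\cdot x}|u(x)|^2dx\big)dk$. The constant $\varepsilon_V$ depends on $V$ but not on $\omega,v,g$. *)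

theory Defs
  imports "HOL-Analysis.Analysis"
begin

text \<open>
  Elements of Lebesgue and Sobolev spaces are represented by Lebesgue measurable functions;
  identification almost everywhere is written out wherever it matters.
\<close>

type_synonym R3 = "real^3"


section \<open>Function spaces\<close>

definition L2 :: "(R3 \<Rightarrow> 'a::euclidean_space) set" where
  "L2 = {f \<in> borel_measurable lebesgue. integrable lebesgue (\<lambda>x. (norm (f x))\<^sup>2)}"

definition L2_norm :: "(R3 \<Rightarrow> 'a::euclidean_space) \<Rightarrow> real" where
  "L2_norm f = sqrt (LINT x|lebesgue. (norm (f x))\<^sup>2)"

definition L2_inner :: "(R3 \<Rightarrow> complex) \<Rightarrow> (R3 \<Rightarrow> complex) \<Rightarrow> complex" where
  "L2_inner f h = (LINT x|lebesgue. cnj (f x) * h x)"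

text \<open>Local integrability of \<open>|f|\<^sup>p\<close>.\<close>

definition Lp_loc :: "real \<Rightarrow> (R3 \<Rightarrow> real) set" where
  "Lp_loc p = {f \<in> borel_measurable lebesgue.
     \<forall>K. compact K \<longrightarrow> set_integrable lebesgue K (\<lambda>x. \<bar>f x\<bar> powr p)}"

definition L1_norm :: "(R3 \<Rightarrow> real) \<Rightarrow> ennreal" where
  "L1_norm f = (\<integral>\<^sup>+ x. ennreal \<bar>f x\<bar> \<partial>lebesgue)"

definition L1 :: "(R3 \<Rightarrow> real) set" where
  "L1 = {f \<in> borel_measurable lebesgue. L1_norm f < \<infinity>}"

definition ennreal_cbrt :: "ennreal \<Rightarrow> ennreal" where
  "ennreal_cbrt a = (if a = \<infinity> then \<infinity> else ennreal (root 3 (enn2real a)))"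

definition weak_L3_norm :: "(R3 \<Rightarrow> real) \<Rightarrow> ennreal" where
  "weak_L3_norm f = (SUP t\<in>{0<..}. ennreal t * ennreal_cbrt (emeasure lebesgue {x. \<bar>f x\<bar> > t}))"

definition weak_L3 :: "(R3 \<Rightarrow> real) set" where
  "weak_L3 = {f \<in> borel_measurable lebesgue. weak_L3_norm f < \<infinity>}"

definition L1_weak_L3_decompositions :: "(R3 \<Rightarrow> real) \<Rightarrow> ((R3 \<Rightarrow> real) \<times> (R3 \<Rightarrow> real)) set" where
  "L1_weak_L3_decompositions W =
     {(W1, W2). W1 \<in> L1 \<and> W2 \<in> weak_L3 \<and> (AE k in lebesgue. W k = W1 k + W2 k)}"

definition L1_weak_L3_norm :: "(R3 \<Rightarrow> real) \<Rightarrow> ennreal" where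
  "L1_weak_L3_norm W =
     (INF (W1, W2) \<in> L1_weak_L3_decompositions W. L1_norm W1 + weak_L3_norm W2)"


section \<open>The Sobolev space \<open>H\<^sup>1\<close>\<close>

definition partial_deriv :: "3 \<Rightarrow> (R3 \<Rightarrow> real) \<Rightarrow> R3 \<Rightarrow> real" where
  "partial_deriv i \<phi> x = frechet_derivative \<phi> (at x) (axis i 1)"

fun C_k :: "nat \<Rightarrow> (R3 \<Rightarrow> real) \<Rightarrow> bool" where
  "C_k 0 \<phi> = continuous_on UNIV \<phi>"
| "C_k (Suc n) \<phi> = (\<phi> differentiable_on UNIV \<and> (\<forall>i. C_k n (partial_deriv i \<phi>)))"

definition test_functions :: "(R3 \<Rightarrow> real) set" where
  "test_functions = {\<phi>. (\<forall>n. C_k n \<phi>) \<and> compact (closure {x. \<phi> x \<noteq> 0})}"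

definition has_weak_gradient :: "(R3 \<Rightarrow> complex) \<Rightarrow> (R3 \<Rightarrow> complex^3) \<Rightarrow> bool" where
  "has_weak_gradient u G \<longleftrightarrow>
     (\<forall>\<phi>\<in>test_functions. \<forall>i.
        (LINT x|lebesgue. partial_deriv i \<phi> x *\<^sub>R u x) = - (LINT x|lebesgue. \<phi> x *\<^sub>R (G x $ i)))"

definition H1 :: "(R3 \<Rightarrow> complex) set" where
  "H1 = {u \<in> L2. \<exists>G\<in>L2. has_weak_gradient u G}"

text \<open>For \<open>u \<in> H1\<close> the following is determined up to equality almost everywhere.\<close>

definition weak_gradient :: "(R3 \<Rightarrow> complex) \<Rightarrow> R3 \<Rightarrow> complex^3" where
  "weak_gradient u = (SOME G. G \<in> L2 \<and> has_weak_gradient u G)"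


section \<open>Schroedinger operators\<close>

definition form_domain :: "(R3 \<Rightarrow> real) \<Rightarrow> (R3 \<Rightarrow> complex) set" where
  "form_domain V = {u \<in> H1. integrable lebesgue (\<lambda>x. max (V x) 0 * (cmod (u x))\<^sup>2)}"

definition schroedinger_form :: "(R3 \<Rightarrow> real) \<Rightarrow> (R3 \<Rightarrow> complex) \<Rightarrow> (R3 \<Rightarrow> complex) \<Rightarrow> complex" where
  "schroedinger_form V \<phi> u =
     (LINT x|lebesgue. (\<Sum>i\<in>UNIV. cnj (weak_gradient \<phi> x $ i) * (weak_gradient u x $ i)))
     + (LINT x|lebesgue. of_real (V x) * (cnj (\<phi> x) * u x))"

text \<open>
  The graph of the operator associated with the form: \<open>u\<close> lies in the operator domain and is
  mapped to \<open>w\<close>.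
\<close>

definition schroedinger_op :: "(R3 \<Rightarrow> real) \<Rightarrow> ((R3 \<Rightarrow> complex) \<times> (R3 \<Rightarrow> complex)) set" where
  "schroedinger_op V =
     {(u, w). u \<in> form_domain V \<and> w \<in> L2 \<and>
        (\<forall>\<phi>\<in>form_domain V. schroedinger_form V \<phi> u = L2_inner \<phi> w)}"

text \<open>
  \<open>z\<close> is in the resolvent set iff \<open>H - z\<close> is a bijection from the operator domain onto \<open>L2\<close> with
  bounded inverse; injectivity is contained in the bound of the second conjunct.
\<close>

definition resolvent_set :: "(R3 \<Rightarrow> real) \<Rightarrow> complex set" where
  "resolvent_set V = {z.
     (\<forall>h\<in>L2. \<exists>(u, w)\<in>schroedinger_op V. AE x in lebesgue. w x - z * u x = h x) \<and>
     (\<exists>C. \<forall>(u, w)\<in>schroedinger_op V. L2_norm u \<le> C * L2_norm (\<lambda>x. w x - z * u x))}"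

definition spectrum :: "(R3 \<Rightarrow> real) \<Rightarrow> complex set" where
  "spectrum V = - resolvent_set V"

definition ground_energy :: "(R3 \<Rightarrow> real) \<Rightarrow> real" where
  "ground_energy V = Inf {e. complex_of_real e \<in> spectrum V}"

definition eigenfunctions :: "(R3 \<Rightarrow> real) \<Rightarrow> real \<Rightarrow> (R3 \<Rightarrow> complex) set" where
  "eigenfunctions V e =
     {u. (u, \<lambda>x. of_real e * u x) \<in> schroedinger_op V \<and> \<not> (AE x in lebesgue. u x = 0)}"

definition simple_eigenvalue :: "(R3 \<Rightarrow> real) \<Rightarrow> real \<Rightarrow> bool" where
  "simple_eigenvalue V e \<longleftrightarrow>
     (\<exists>u\<in>eigenfunctions V e. \<forall>u'\<in>eigenfunctions V e. \<exists>c. AE x in lebesgue. u' x = c * u x)"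

definition isolated_in_spectrum :: "(R3 \<Rightarrow> real) \<Rightarrow> real \<Rightarrow> bool" where
  "isolated_in_spectrum V e \<longleftrightarrow>
     (\<exists>\<delta>>0. spectrum V \<inter> ball (of_real e) \<delta> = {of_real e})"

definition positive_ground_state :: "(R3 \<Rightarrow> real) \<Rightarrow> (R3 \<Rightarrow> real) \<Rightarrow> bool" where
  "positive_ground_state V uV \<longleftrightarrow>
     (\<lambda>x. complex_of_real (uV x)) \<in> eigenfunctions V (ground_energy V) \<and>
     uV \<in> L2 \<and> L2_norm uV = 1 \<and> (AE x in lebesgue. uV x > 0)"


section \<open>Hypotheses\<close>

text \<open>
  Since the decomposition of \<open>V\<close> is only required almost everywhere, \<open>V1\<close> and \<open>V2\<close> can be
  changed on null sets, so the pointwise sign and limit conditions amount to the usual ones for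
  classes of functions.
\<close>

definition hypothesis_A :: "(R3 \<Rightarrow> real) \<Rightarrow> bool" where
  "hypothesis_A V \<longleftrightarrow>
     (\<exists>a b. 0 \<le> a \<and> a < 1 \<and>
        (\<forall>u\<in>H1. integrable lebesgue (\<lambda>x. max (- V x) 0 * (cmod (u x))\<^sup>2) \<and>
           (LINT x|lebesgue. max (- V x) 0 * (cmod (u x))\<^sup>2)
             \<le> a * (L2_norm (weak_gradient u))\<^sup>2 + b * (L2_norm u)\<^sup>2)) \<and>
     (\<exists>V1 V2. (AE x in lebesgue. V x = V1 x + V2 x) \<and>
        V1 \<in> Lp_loc 1 \<and> (\<forall>x. V1 x \<ge> 0) \<and>
        V2 \<in> Lp_loc (3/2) \<and> (V2 \<longlongrightarrow> 0) at_infinity \<and>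
        ground_energy V < ground_energy V1)"

definition hypothesis_B :: "(R3 \<Rightarrow> real) \<Rightarrow> bool" where
  "hypothesis_B V \<longleftrightarrow>
     simple_eigenvalue V (ground_energy V) \<and> isolated_in_spectrum V (ground_energy V) \<and>
     (\<exists>uV. positive_ground_state V uV \<and>
        (\<forall>uV'. positive_ground_state V uV' \<longrightarrow> (AE x in lebesgue. uV' x = uV x)))"

definition hypothesis_C :: "(R3 \<Rightarrow> real) \<Rightarrow> bool" where
  "hypothesis_C W \<longleftrightarrow>
     (\<exists>W1 W2. W1 \<in> L1 \<and> W2 \<in> weak_L3 \<and> (AE k in lebesgue. W k = W1 k + W2 k))"


section \<open>The Klein--Gordon--Schroedinger energy\<close>

definition field_weight :: "(R3 \<Rightarrow> real) \<Rightarrow> (R3 \<Rightarrow> real) \<Rightarrow> real \<Rightarrow> R3 \<Rightarrow> real" where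
  "field_weight \<omega> v g k = g\<^sup>2 * (v k)\<^sup>2 / \<omega> k"

definition particle_states :: "(R3 \<Rightarrow> real) \<Rightarrow> (R3 \<Rightarrow> complex) set" where
  "particle_states V = {u \<in> form_domain V. L2_norm u = 1}"

definition field_states :: "(R3 \<Rightarrow> real) \<Rightarrow> (R3 \<Rightarrow> complex) set" where
  "field_states \<omega> = {f \<in> borel_measurable lebesgue. (\<lambda>k. sqrt (\<omega> k) *\<^sub>R f k) \<in> L2}"

definition kgs_energy ::
  "(R3 \<Rightarrow> real) \<Rightarrow> (R3 \<Rightarrow> real) \<Rightarrow> (R3 \<Rightarrow> real) \<Rightarrow> real \<Rightarrow> (R3 \<Rightarrow> complex) \<Rightarrow> (R3 \<Rightarrow> complex) \<Rightarrow> real" where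
  "kgs_energy V \<omega> v g u f =
     (LINT x|lebesgue. (norm (weak_gradient u x))\<^sup>2)
     + (LINT x|lebesgue. V x * (cmod (u x))\<^sup>2)
     + (LINT k|lebesgue. \<omega> k * (cmod (f k))\<^sup>2)
     + 2 * g * Re (LINT k|lebesgue. of_real (v k) * f k *
         (LINT x|lebesgue. exp (\<i> * of_real (k \<bullet> x)) * of_real ((cmod (u x))\<^sup>2)))"

definition kgs_minimizer ::
  "(R3 \<Rightarrow> real) \<Rightarrow> (R3 \<Rightarrow> real) \<Rightarrow> (R3 \<Rightarrow> real) \<Rightarrow> real \<Rightarrow> (R3 \<Rightarrow> complex) \<Rightarrow> (R3 \<Rightarrow> complex) \<Rightarrow> bool" where
  "kgs_minimizer V \<omega> v g u f \<longleftrightarrow>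
     u \<in> particle_states V \<and> f \<in> field_states \<omega> \<and>
     (\<forall>u'\<in>particle_states V. \<forall>f'\<in>field_states \<omega>. kgs_energy V \<omega> v g u f \<le> kgs_energy V \<omega> v g u' f')"

text \<open>Positivity of the overlap means that the complex number is real and positive.\<close>

definition positive_overlap :: "(R3 \<Rightarrow> complex) \<Rightarrow> (R3 \<Rightarrow> real) \<Rightarrow> bool" where
  "positive_overlap u uV \<longleftrightarrow>
     (let z = L2_inner u (\<lambda>x. of_real (uV x)) in Im z = 0 \<and> Re z > 0)"

end

theory Submission
  imports Defs "HOL-Probability.Probability" "HOL-Library.Function_Algebras"
begin

text \<open>
  Completing the square in \<open>f\<close> reduces the problem to the functional \<open>q(u) - N(u)\<close> on the unit sphere,
  where \<open>q\<close> is the Schroedinger form and \<open>N(u) = \<integral> W |F(|u|\<^sup>2)|\<^sup>2\<close> is quartic, \<open>F\<close> being the Fourier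
  transform. Splitting \<open>W\<^sub>2\<close> at a height and using \<open>|F| \<le> ||u||\<^sup>2\<close> above it, Bessel's inequality and
  \<open>H\<^sup>1 \<subseteq> L\<^sup>4\<close> below it, one finds that \<open>N\<close> and its second differences are bounded by \<open>||W||\<close> times
  products of form norms. As \<open>\<mu>\<close> is a simple isolated eigenvalue, \<open>q - \<mu>\<close> dominates the form norm on
  the orthogonal complement of \<open>u\<^sub>V\<close>. After fixing the phase of \<open>u\<close>, a state of low energy is close to \<open>u\<^sub>V\<close>,
  and on such states the gap beats the second differences of \<open>N\<close>: the functional is strongly convex along
  normalized midpoints. So minimizing sequences are Cauchy in form norm, and there is only one minimizer.
\<close>

section \<open>Quadratic forms\<close>

text \<open>Neither the quartic particle energy nor the unit sphere is convex, so existence and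
  uniqueness must both come out of quantitative estimates, and two choices make them close. On the
  unit sphere the bound on \<open>N\<close> has to be linear in the form norm \<open>B\<close>: only
  then can it be absorbed into the gap for states whose energy is not bounded beforehand. One form
  norm is therefore traded for \<open>||u||\<^sup>2\<close>, which is exactly what the scaling of
  weak \<open>L\<^sup>3\<close> permits, once the cutoff height and the averaging length are tied to
  the ratio of \<open>L\<^sup>2\<close> norm to form norm. Moreover, all forms are real bilinear
  although the functions are complex. The phase freedom then becomes a second null direction
  \<open>\<i> u\<^sub>V\<close> orthogonal to \<open>u\<^sub>V\<close>, and fixing the phase amounts
  to two real conditions that survive limits and normalized midpoints. The gap itself is obtained
  from resolvents at real points only: regularity on a punctured interval determines a resolvent
  norm, and iterating a damped resolvent projects onto the eigenspace.\<close>

lemma quadratic_nonneg_imp_discriminant: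
  fixes a b c :: real
  assumes "\<And>t. 0 \<le> a * t\<^sup>2 + 2 * b * t + c"
  shows "b\<^sup>2 \<le> a * c"
proof (cases "a = 0")
  case True
  have "b = 0"
  proof (rule ccontr)
    assume "b \<noteq> 0"
    with assms[of "- (c + 1) / (2 * b)"] True show False by (simp add: field_simps)
  qed
  with True show ?thesis by simp
next
  case False
  have "a \<ge> 0"
  proof (rule ccontr)
    assume "\<not> a \<ge> 0"
    \<comment> \<open>For negative \<open>a\<close> this \<open>t\<close> turns the leading term
      into \<open>t * (a - 2 * \<bar>b\<bar> - \<bar>c\<bar>)\<close>, which beats the linear and
      the constant term because \<open>t \<ge> 1\<close>.\<close>
    define t where "t = 1 + (2 * \<bar>b\<bar> + \<bar>c\<bar>) / (- a)"
    have "(2 * \<bar>b\<bar> + \<bar>c\<bar>) / (- a) \<ge> 0" using \<open>\<not> a \<ge> 0\<close> by (intro divide_nonneg_pos) auto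
    then have t1: "t \<ge> 1" unfolding t_def by linarith
    have at: "a * t = a - (2 * \<bar>b\<bar> + \<bar>c\<bar>)" using False unfolding t_def by (simp add: field_simps)
    have "a * t\<^sup>2 + 2 * b * t + c = t * a + 2 * (t * (b - \<bar>b\<bar>)) + (c - t * \<bar>c\<bar>)"
      by (simp add: power2_eq_square at mult.assoc[symmetric]) (simp add: at algebra_simps)
    moreover have "t * (b - \<bar>b\<bar>) \<le> 0" using t1 by (simp add: mult_nonneg_nonpos)
    moreover have "c - t * \<bar>c\<bar> \<le> 0" using mult_right_mono[OF t1, of "\<bar>c\<bar>"] by linarith
    moreover have "t * a < 0" using \<open>\<not> a \<ge> 0\<close> t1 by (simp add: mult_pos_neg)
    ultimately show False using assms[of t] by linarith
  qed
  with False have "a > 0" by simp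
  have "0 \<le> a * (- b / a)\<^sup>2 + 2 * b * (- b / a) + c" by (rule assms)
  also have "\<dots> = c - b\<^sup>2 / a" using \<open>a > 0\<close> by (simp add: field_simps power2_eq_square)
  finally show ?thesis using \<open>a > 0\<close> by (simp add: field_simps)
qed

text \<open>All laws are relative to \<open>Q\<close>, since the forms to come are built from
  \<open>weak_gradient\<close>, which is arbitrary off \<open>H1\<close> and linear only up to null
  sets. Scalars are real throughout: for complex functions such a form is the real part of a
  Hermitian one.\<close>

locale sym_form =
  fixes Q :: "'v::real_vector set" and B :: "'v \<Rightarrow> 'v \<Rightarrow> real"
  assumes subspace: "subspace Q"
    and sym: "x \<in> Q \<Longrightarrow> y \<in> Q \<Longrightarrow> B x y = B y x"
    and add_left: "x \<in> Q \<Longrightarrow> y \<in> Q \<Longrightarrow> z \<in> Q \<Longrightarrow> B (x + y) z = B x z + B y z"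
    and scale_left: "x \<in> Q \<Longrightarrow> y \<in> Q \<Longrightarrow> B (c *\<^sub>R x) y = c * B x y"
begin

lemma add_closed [simp, intro]: "x \<in> Q \<Longrightarrow> y \<in> Q \<Longrightarrow> x + y \<in> Q"
  and scale_closed [simp, intro]: "x \<in> Q \<Longrightarrow> c *\<^sub>R x \<in> Q"
  and diff_closed [simp, intro]: "x \<in> Q \<Longrightarrow> y \<in> Q \<Longrightarrow> x - y \<in> Q"
  using subspace by (auto simp: subspace_add subspace_scale subspace_diff)

lemma diff_left: "x \<in> Q \<Longrightarrow> y \<in> Q \<Longrightarrow> z \<in> Q \<Longrightarrow> B (x - y) z = B x z - B y z"
  using add_left[of x "(-1) *\<^sub>R y" z] scale_left[of y z "-1"] scale_closed[of y "-1"] by simp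

lemma add_right: "x \<in> Q \<Longrightarrow> y \<in> Q \<Longrightarrow> z \<in> Q \<Longrightarrow> B z (x + y) = B z x + B z y"
  and diff_right: "x \<in> Q \<Longrightarrow> y \<in> Q \<Longrightarrow> z \<in> Q \<Longrightarrow> B z (x - y) = B z x - B z y"
  and scale_right: "x \<in> Q \<Longrightarrow> y \<in> Q \<Longrightarrow> B x (c *\<^sub>R y) = c * B x y"
  using sym[of z "x + y"] sym[of z "x - y"] sym[of z x] sym[of z y] sym[of x "c *\<^sub>R y"] sym[of x y]
  by (simp_all add: add_left diff_left scale_left)

lemmas bilinear = add_left add_right diff_left diff_right scale_left scale_right

lemma quad_add: "x \<in> Q \<Longrightarrow> y \<in> Q \<Longrightarrow> B (x + y) (x + y) = B x x + 2 * B x y + B y y"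
  by (simp add: bilinear sym[of y x])

lemma quad_diff: "x \<in> Q \<Longrightarrow> y \<in> Q \<Longrightarrow> B (x - y) (x - y) = B x x - 2 * B x y + B y y"
  by (simp add: bilinear sym[of y x])

lemma quad_scale: "x \<in> Q \<Longrightarrow> B (c *\<^sub>R x) (c *\<^sub>R x) = c\<^sup>2 * B x x"
  by (simp add: bilinear power2_eq_square)

end

lemma sym_form_combination:
  assumes "sym_form Q A" "sym_form Q B"
  shows "sym_form Q (\<lambda>x y. A x y + c * B x y)"
proof -
  interpret A: sym_form Q A by fact
  interpret B: sym_form Q B by fact
  show ?thesis
    by unfold_locales (simp_all add: A.subspace A.sym B.sym A.bilinear B.bilinear algebra_simps)
qed

text \<open>Semidefinite rather than definite: the elements will be functions and not classes, so
  functions that vanish almost everywhere are null vectors.\<close>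

locale psd_form = sym_form +
  assumes nonneg: "x \<in> Q \<Longrightarrow> 0 \<le> B x x"
begin

lemma Cauchy_Schwarz:
  assumes "x \<in> Q" "y \<in> Q"
  shows "(B x y)\<^sup>2 \<le> B x x * B y y"
proof -
  have "0 \<le> B y y * t\<^sup>2 + 2 * B x y * t + B x x" for t
    using nonneg[of "x + t *\<^sub>R y"] assms quad_add[of x "t *\<^sub>R y"] quad_scale[of y t]
      scale_right[of x y t] by (simp add: algebra_simps)
  from quadratic_nonneg_imp_discriminant[OF this] show ?thesis by (simp add: mult.commute)
qed

lemma Cauchy_Schwarz_sqrt:
  assumes "x \<in> Q" "y \<in> Q"
  shows "\<bar>B x y\<bar> \<le> sqrt (B x x) * sqrt (B y y)"
  using real_sqrt_le_mono[OF Cauchy_Schwarz[OF assms]] by (simp add: real_sqrt_mult)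

lemma parallelogram:
  "x \<in> Q \<Longrightarrow> y \<in> Q \<Longrightarrow> B (x + y) (x + y) + B (x - y) (x - y) = 2 * B x x + 2 * B y y"
  by (simp add: quad_add quad_diff)

lemma quad_add_le: "x \<in> Q \<Longrightarrow> y \<in> Q \<Longrightarrow> B (x + y) (x + y) \<le> 2 * B x x + 2 * B y y"
  and quad_diff_le: "x \<in> Q \<Longrightarrow> y \<in> Q \<Longrightarrow> B (x - y) (x - y) \<le> 2 * B x x + 2 * B y y"
  using parallelogram[of x y] nonneg[of "x - y"] nonneg[of "x + y"] by simp_all

lemma sqrt_triangle:
  assumes "x \<in> Q" "y \<in> Q"
  shows "sqrt (B (x + y) (x + y)) \<le> sqrt (B x x) + sqrt (B y y)"
proof (rule real_le_lsqrt)
  have "B (x + y) (x + y) \<le> B x x + 2 * (sqrt (B x x) * sqrt (B y y)) + B y y"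
    using Cauchy_Schwarz_sqrt[OF assms] assms by (simp add: quad_add)
  also have "\<dots> = (sqrt (B x x) + sqrt (B y y))\<^sup>2"
    using assms nonneg by (simp add: power2_sum)
  finally show "B (x + y) (x + y) \<le> (sqrt (B x x) + sqrt (B y y))\<^sup>2" .
qed (use assms nonneg in auto)

lemma Cauchy_if_geometric:
  assumes u: "\<And>n. u n \<in> Q" and step: "\<And>n::nat. B (u n - u (Suc n)) (u n - u (Suc n)) \<le> K * (1 / 4) ^ n"
    and "e > 0"
  shows "\<exists>N. \<forall>m\<ge>N. \<forall>n\<ge>N. B (u m - u n) (u m - u n) < e"
proof -
  define q where "q m n = sqrt (B (u m - u n) (u m - u n))" for m n
  have "K \<ge> 0" using nonneg[of "u 0 - u 1"] step[of 0] u by force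
  have q_step: "q n (Suc n) \<le> sqrt K * (1 / 2) ^ n" for n
    using real_sqrt_le_mono[OF step[of n]] unfolding q_def by (simp add: real_sqrt_mult real_sqrt_power real_sqrt_divide)
  \<comment> \<open>The bracket is the partial geometric sum in closed form; dropping its negative
    term later gives a bound uniform in \<open>k\<close>.\<close>
  have q_add: "q n (n + k) \<le> sqrt K * (2 * (1 / 2) ^ n - 2 * (1 / 2) ^ (n + k))" for n k
  proof (induction k)
    case 0
    have "B (u n - u n) (u n - u n) = 0" using diff_left[OF u[of n] u[of n] diff_closed[OF u[of n] u[of n]]] by simp
    then show ?case unfolding q_def by simp
  next
    case (Suc k)
    have "q n (n + Suc k) \<le> q n (n + k) + q (n + k) (Suc (n + k))"
      unfolding q_def using sqrt_triangle[of "u n - u (n + k)" "u (n + k) - u (Suc (n + k))"] u by simp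
    also have "\<dots> \<le> sqrt K * (2 * (1 / 2) ^ n - 2 * (1 / 2) ^ (n + k)) + sqrt K * (1 / 2) ^ (n + k)"
      using Suc q_step by (rule add_mono)
    finally show ?case by (simp add: algebra_simps)
  qed
  have q_le: "q n m \<le> 2 * sqrt K * (1 / 2) ^ n" if "n \<le> m" for n m
  proof -
    have "q n m \<le> sqrt K * (2 * (1 / 2) ^ n - 2 * (1 / 2) ^ m)" using q_add[of n "m - n"] that by simp
    also have "\<dots> \<le> sqrt K * (2 * (1 / 2) ^ n)" using \<open>K \<ge> 0\<close> by (intro mult_left_mono) auto
    finally show ?thesis by simp
  qed
  have q_sym: "q m n = q n m" for m n
    unfolding q_def using quad_diff[OF u[of m] u[of n]] quad_diff[OF u[of n] u[of m]] sym[OF u[of m] u[of n]] by simp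
  have "(\<lambda>n. 2 * sqrt K * (1 / 2) ^ n) \<longlonglongrightarrow> 2 * sqrt K * 0"
    by (intro tendsto_intros LIMSEQ_realpow_zero) auto
  then have "\<forall>\<^sub>F n in sequentially. 2 * sqrt K * (1 / 2) ^ n < sqrt e"
    using \<open>e > 0\<close> by (intro order_tendstoD(2)[where y="2 * sqrt K * 0"]) auto
  then obtain N where N: "\<And>n. n \<ge> N \<Longrightarrow> 2 * sqrt K * (1 / 2) ^ n < sqrt e"
    unfolding eventually_sequentially by blast
  show ?thesis
  proof (intro exI[of _ N] allI impI)
    fix m n assume "N \<le> m" "N \<le> n"
    have "q m n < sqrt e"
    proof (cases "m \<le> n")
      case True
      then show ?thesis using q_le[of m n] N[OF \<open>N \<le> m\<close>] by linarith
    next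
      case False
      then show ?thesis using q_le[of n m] N[OF \<open>N \<le> n\<close>] q_sym[of m n] by linarith
    qed
    then show "B (u m - u n) (u m - u n) < e" unfolding q_def by simp
  qed
qed

text \<open>Zero energy forces stationarity: by Cauchy-Schwarz a null vector lies in the radical.
  This is how \<open>A e1 e1 = 0\<close> later acts as the eigenvalue equation for
  \<open>e1\<close>.\<close>

lemma null_left:
  assumes "x \<in> Q" "y \<in> Q" "B x x = 0"
  shows "B x y = 0"
  using Cauchy_Schwarz[OF assms(1,2)] assms(3) by simp

lemma tendsto_pairing:
  assumes "\<And>n. u n \<in> Q" "l \<in> Q" "y \<in> Q" "(\<lambda>n. B (u n - l) (u n - l)) \<longlonglongrightarrow> 0"
  shows "(\<lambda>n. B (u n) y) \<longlonglongrightarrow> B l y"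
proof -
  have "(\<lambda>n. sqrt (B (u n - l) (u n - l)) * sqrt (B y y)) \<longlonglongrightarrow> 0"
    using tendsto_mult_left_zero[OF tendsto_real_sqrt[OF assms(4), simplified]] by simp
  then have "(\<lambda>n. B (u n - l) y) \<longlonglongrightarrow> 0"
    by (rule Lim_null_comparison[rotated]) (use Cauchy_Schwarz_sqrt assms in auto)
  then show ?thesis using assms by (simp add: diff_left LIM_zero_iff)
qed

lemma tendsto_quad:
  assumes "\<And>n. u n \<in> Q" "l \<in> Q" "(\<lambda>n. B (u n - l) (u n - l)) \<longlonglongrightarrow> 0"
  shows "(\<lambda>n. B (u n) (u n)) \<longlonglongrightarrow> B l l"
proof -
  have "(\<lambda>n. B (u n - l) (u n - l) + 2 * B (u n) l - B l l) \<longlonglongrightarrow> 0 + 2 * B l l - B l l"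
    by (intro tendsto_intros tendsto_pairing assms)
  then show ?thesis using assms by (simp add: quad_diff)
qed

end

text \<open>Completeness for a seminorm, written with an explicit Cauchy condition because several
  forms of different strength live on the same functions; limits are determined only up to null
  vectors.\<close>

definition complete_form :: "'v::real_vector set \<Rightarrow> ('v \<Rightarrow> 'v \<Rightarrow> real) \<Rightarrow> bool" where
  "complete_form Q B \<longleftrightarrow> (\<forall>u::nat \<Rightarrow> 'v. (\<forall>n. u n \<in> Q) \<longrightarrow>
     (\<forall>e>0. \<exists>N. \<forall>m\<ge>N. \<forall>n\<ge>N. B (u m - u n) (u m - u n) < e) \<longrightarrow>
     (\<exists>l\<in>Q. (\<lambda>n. B (u n - l) (u n - l)) \<longlonglongrightarrow> 0))"

lemma complete_formD:
  assumes "complete_form Q B" "\<And>n. u n \<in> Q"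
    and "\<And>e. e > 0 \<Longrightarrow> \<exists>N. \<forall>m\<ge>N. \<forall>n\<ge>N. B (u m - u n) (u m - u n) < e"
  obtains l where "l \<in> Q" "(\<lambda>n. B (u n - l) (u n - l)) \<longlonglongrightarrow> 0"
proof -
  from assms(1) have "(\<forall>n. u n \<in> Q) \<longrightarrow>
     (\<forall>e>0. \<exists>N. \<forall>m\<ge>N. \<forall>n\<ge>N. B (u m - u n) (u m - u n) < e) \<longrightarrow>
     (\<exists>l\<in>Q. (\<lambda>n. B (u n - l) (u n - l)) \<longlonglongrightarrow> 0)"
    unfolding complete_form_def by (rule spec)
  with assms(2,3) have "\<exists>l\<in>Q. (\<lambda>n. B (u n - l) (u n - l)) \<longlonglongrightarrow> 0" by simp
  with that show thesis by blast
qed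

lemma complete_form_equivalent:
  assumes "complete_form Q B" "psd_form Q B" "psd_form Q A"
    and "\<And>x. x \<in> Q \<Longrightarrow> B x x \<le> K * A x x" "\<And>x. x \<in> Q \<Longrightarrow> A x x \<le> K' * B x x"
  shows "complete_form Q A"
proof -
  interpret B: psd_form Q B by fact
  interpret A: psd_form Q A by fact
  \<comment> \<open>The Cauchy condition is divided by this constant, so a \<open>K\<close> that is
    zero or negative is first raised to 1.\<close>
  define K0 where "K0 = max K 1"
  have K0: "K0 > 0" "B x x \<le> K0 * A x x" if "x \<in> Q" for x
    using assms(4)[OF that] mult_right_mono[of K K0 "A x x"] A.nonneg[OF that] unfolding K0_def by auto
  show ?thesis
    unfolding complete_form_def
  proof (intro allI impI)
    fix u :: "nat \<Rightarrow> _"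
    assume uQ: "\<forall>n. u n \<in> Q"
      and C: "\<forall>e>0. \<exists>N. \<forall>m\<ge>N. \<forall>n\<ge>N. A (u m - u n) (u m - u n) < e"
    have "\<exists>N. \<forall>m\<ge>N. \<forall>n\<ge>N. B (u m - u n) (u m - u n) < e" if "e > 0" for e
    proof -
      have "K0 > 0" using K0(1) uQ by blast
      with that have "e / K0 > 0" by simp
      then obtain N where N: "\<forall>m\<ge>N. \<forall>n\<ge>N. A (u m - u n) (u m - u n) < e / K0" using C by blast
      show ?thesis
      proof (intro exI[of _ N] allI impI)
        fix m n assume "N \<le> m" "N \<le> n"
        have "B (u m - u n) (u m - u n) \<le> K0 * A (u m - u n) (u m - u n)" using uQ by (intro K0) auto
        also have "\<dots> < e" using N \<open>N \<le> m\<close> \<open>N \<le> n\<close> \<open>K0 > 0\<close> by (simp add: field_simps)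
        finally show "B (u m - u n) (u m - u n) < e" .
      qed
    qed
    then obtain l where l: "l \<in> Q" "(\<lambda>n. B (u n - l) (u n - l)) \<longlonglongrightarrow> 0"
      by (rule complete_formD[OF assms(1) uQ[rule_format]])
    have "(\<lambda>n. K' * B (u n - l) (u n - l)) \<longlonglongrightarrow> 0" using tendsto_mult_left[OF l(2), of K'] by simp
    then have "(\<lambda>n. A (u n - l) (u n - l)) \<longlonglongrightarrow> 0"
      by (rule Lim_null_comparison[rotated]) (use A.nonneg assms(5) uQ l(1) in auto)
    with l(1) show "\<exists>l\<in>Q. (\<lambda>n. A (u n - l) (u n - l)) \<longlonglongrightarrow> 0" by blast
  qed
qed

text \<open>Variational proof: the parallelogram identity makes minimizing sequences of
  \<open>B u u - 2 * f u\<close> Cauchy, completeness supplies a limit, and the bound on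
  \<open>f\<close> keeps the functional bounded below.\<close>

lemma (in psd_form) Riesz_representation:
  assumes compl: "complete_form Q B"
    and add: "\<And>x y. x \<in> Q \<Longrightarrow> y \<in> Q \<Longrightarrow> f (x + y) = f x + f y"
    and scale: "\<And>c x. x \<in> Q \<Longrightarrow> f (c *\<^sub>R x) = c * f x"
    and bound: "\<And>x. x \<in> Q \<Longrightarrow> (f x)\<^sup>2 \<le> C * B x x"
  shows "\<exists>u\<in>Q. \<forall>x\<in>Q. B x u = f x"
proof -
  define F where "F u = B u u - 2 * f u" for u
  have lower: "F u \<ge> - max C 0" if "u \<in> Q" for u
  proof -
    have "(f u)\<^sup>2 \<le> max C 0 * B u u"
      using bound[OF that] mult_right_mono[of C "max C 0" "B u u"] nonneg[OF that] by linarith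
    then have "\<bar>f u\<bar> \<le> sqrt (max C 0) * sqrt (B u u)"
      using real_sqrt_le_mono[of "(f u)\<^sup>2" "max C 0 * B u u"] by (simp only: real_sqrt_abs real_sqrt_mult)
    moreover have "0 \<le> (sqrt (max C 0) - sqrt (B u u))\<^sup>2" by simp
    ultimately show ?thesis using nonneg[OF that] unfolding F_def by (simp add: power2_diff)
  qed
  define I where "I = (INF u\<in>Q. F u)"
  have bdd: "bdd_below (F ` Q)" using lower by (auto intro!: bdd_belowI)
  have I_le: "I \<le> F u" if "u \<in> Q" for u
    unfolding I_def by (rule cINF_lower[OF bdd that])
  have "0 \<in> Q" using subspace subspace_0 by blast
  have "\<exists>u. u \<in> Q \<and> F u < I + e" if "e > 0" for e
    using cINF_less_iff[of Q F "I + e"] bdd \<open>0 \<in> Q\<close> that unfolding I_def by auto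
  then have "\<forall>n. \<exists>u. u \<in> Q \<and> F u < I + 1 / Suc n" by simp
  then obtain u where uQ: "\<And>n. u n \<in> Q" and Fu: "\<And>n. F (u n) < I + 1 / Suc n" by metis
  have cauchy: "B (u m - u n) (u m - u n) \<le> 2 / Suc m + 2 / Suc n" for m n
  proof -
    have "I \<le> F ((1/2) *\<^sub>R (u m + u n))" by (rule I_le) (use uQ in auto)
    also have "\<dots> = B (u m + u n) (u m + u n) / 4 - (f (u m) + f (u n))"
      unfolding F_def quad_scale[OF add_closed[OF uQ uQ]] scale[OF add_closed[OF uQ uQ]] add[OF uQ uQ]
      by (simp add: power2_eq_square field_simps)
    finally have "I \<le> B (u m + u n) (u m + u n) / 4 - (f (u m) + f (u n))" .
    moreover have "2 / Suc m = 2 * (1 / Suc m)" "2 / Suc n = 2 * (1 / Suc n)" by simp_all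
    moreover note parallelogram[OF uQ[of m] uQ[of n]] Fu[of m] Fu[of n]
    ultimately show ?thesis unfolding F_def by linarith
  qed
  have "\<exists>N. \<forall>m\<ge>N. \<forall>n\<ge>N. B (u m - u n) (u m - u n) < e" if "e > 0" for e
  proof -
    obtain N where N: "1 / Suc N < e / 4" using \<open>e > 0\<close> reals_Archimedean[of "e / 4"] by (auto simp: inverse_eq_divide)
    show ?thesis
    proof (intro exI[of _ N] allI impI)
      fix m n assume "N \<le> m" "N \<le> n"
      then have "2 / Suc m \<le> 2 / Suc N" "2 / Suc n \<le> 2 / Suc N" by (auto intro!: divide_left_mono)
      with N cauchy[of m n] show "B (u m - u n) (u m - u n) < e" by linarith
    qed
  qed
  then obtain l where l: "l \<in> Q" "(\<lambda>n. B (u n - l) (u n - l)) \<longlonglongrightarrow> 0"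
    by (rule complete_formD[OF compl uQ])
  have "B x l = f x" if "x \<in> Q" for x
  proof -
    \<comment> \<open>The Euler equation holds along the sequence up to an error: moving from
      \<open>u n\<close> in the direction \<open>x\<close> changes \<open>F\<close> by a quadratic
      polynomial in \<open>t\<close> that stays above \<open>- 1 / Suc n\<close>, so its linear
      coefficient is small.\<close>
    have b1: "(B (u n) x - f x)\<^sup>2 \<le> B x x * (1 / Suc n)" for n
    proof (rule quadratic_nonneg_imp_discriminant)
      fix t
      have "I \<le> F (u n + t *\<^sub>R x)" by (rule I_le) (use uQ that in auto)
      also have "\<dots> = F (u n) + 2 * t * (B (u n) x - f x) + t\<^sup>2 * B x x"
        unfolding F_def quad_add[OF uQ scale_closed[OF that]] quad_scale[OF that] add[OF uQ scale_closed[OF that]]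
          scale[OF that] scale_right[OF uQ that]
        by (simp add: algebra_simps)
      finally show "0 \<le> B x x * t\<^sup>2 + 2 * (B (u n) x - f x) * t + 1 / Suc n"
        using Fu[of n] by (simp add: algebra_simps)
    qed
    have b2: "(\<lambda>n. B x x * (1 / Suc n)) \<longlonglongrightarrow> 0"
      using tendsto_mult_left[OF LIMSEQ_Suc[OF lim_1_over_n], of "B x x"] by simp
    have "(\<lambda>n. (B (u n) x - f x)\<^sup>2) \<longlonglongrightarrow> 0"
      by (rule tendsto_sandwich[OF _ _ tendsto_const b2])
        (rule always_eventually, rule allI, (rule b1 | rule zero_le_power2))+
    moreover have "(\<lambda>n. (B (u n) x - f x)\<^sup>2) \<longlonglongrightarrow> (B l x - f x)\<^sup>2"
      by (intro tendsto_intros tendsto_pairing uQ l that)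
    ultimately have "(B l x - f x)\<^sup>2 = 0" using LIMSEQ_unique by blast
    then show ?thesis using sym[OF that l(1)] by simp
  qed
  with l(1) show ?thesis by blast
qed

section \<open>Resolvent and spectral gap of a semibounded form\<close>

text \<open>\<open>p\<close> is the ambient inner product on \<open>L\<close>, \<open>a\<close> the
  possibly indefinite form on its domain \<open>Q\<close>, and \<open>B\<close> the squared form
  norm in which \<open>Q\<close> is complete. The assumption \<open>coercive\<close> is a Garding
  inequality with shift \<open>M\<close>.\<close>

locale semibounded_form =
  L: psd_form L p + a: sym_form Q a + B: psd_form Q B
  for L Q :: "'v::real_vector set" and p a B +
  fixes M K1 K2 :: real
  assumes Q_sub: "Q \<subseteq> L"
    and complete: "complete_form Q B"
    and p_le: "u \<in> Q \<Longrightarrow> p u u \<le> B u u"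
    and a_le: "u \<in> Q \<Longrightarrow> a u u \<le> K1 * B u u"
    and coercive: "u \<in> Q \<Longrightarrow> B u u \<le> K2 * (a u u + M * p u u)"
    and K2_pos: "K2 > 0"
begin

lemma QL: "u \<in> Q \<Longrightarrow> u \<in> L" using Q_sub by blast

sublocale P: psd_form Q p
  by unfold_locales (use a.subspace L.sym L.bilinear L.nonneg QL in auto)

text \<open>The equation \<open>(H - e) u = h\<close> for the operator \<open>H\<close> of the form
  \<open>a\<close>, tested against the form domain. As the forms are real, only real
  \<open>e\<close> can be described; \<open>regular\<close> is membership of \<open>e\<close> in the
  resolvent set, with the bound on the inverse squared.\<close>

definition weak_solution :: "real \<Rightarrow> 'v \<Rightarrow> 'v \<Rightarrow> bool" where
  "weak_solution e u h \<longleftrightarrow> u \<in> Q \<and> h \<in> L \<and> (\<forall>\<phi>\<in>Q. a \<phi> u - e * p \<phi> u = p \<phi> h)"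

definition regular :: "real \<Rightarrow> bool" where
  "regular e \<longleftrightarrow> (\<forall>h\<in>L. \<exists>u. weak_solution e u h) \<and>
     (\<exists>C. \<forall>u h. weak_solution e u h \<longrightarrow> p u u \<le> C * p h h)"

lemma regularE:
  assumes "regular e"
  obtains C where "C > 0" "\<forall>u h. weak_solution e u h \<longrightarrow> p u u \<le> C * p h h"
proof -
  from assms obtain C where C: "\<And>u h. weak_solution e u h \<Longrightarrow> p u u \<le> C * p h h"
    unfolding regular_def by blast
  have "p u u \<le> max C 1 * p h h" if "weak_solution e u h" for u h
    using C[OF that] mult_right_mono[of C "max C 1" "p h h"] L.nonneg[of h] that
    unfolding weak_solution_def by auto
  with that[of "max C 1"] show thesis by auto
qed

lemma shifted_sym: "sym_form Q (\<lambda>x y. a x y - e * p x y)"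
  using sym_form_combination[OF a.sym_form_axioms P.sym_form_axioms, of "- e"] by simp

lemma shifted_psd:
  assumes "\<And>u. u \<in> Q \<Longrightarrow> e * p u u \<le> a u u"
  shows "psd_form Q (\<lambda>x y. a x y - e * p x y)"
  using shifted_sym assms by (simp add: psd_form_def psd_form_axioms_def)

lemma shifted_complete:
  assumes bound: "\<And>u. u \<in> Q \<Longrightarrow> \<nu> * p u u \<le> a u u" and "e < \<nu>"
  shows "complete_form Q (\<lambda>x y. a x y - e * p x y)"
proof -
  define A where "A = (\<lambda>x y. a x y - e * p x y)"
  define s where "s = \<nu> - e"
  have "s > 0" using assms unfolding s_def by simp
  have pA: "s * p u u \<le> A u u" if "u \<in> Q" for u
    using bound[OF that] unfolding A_def s_def by (simp add: algebra_simps)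
  have A0: "e * p u u \<le> a u u" if "u \<in> Q" for u
    using pA[OF that] P.nonneg[OF that] \<open>s > 0\<close> unfolding A_def
    by (smt (verit) mult_nonneg_nonneg)
  interpret A: psd_form Q A unfolding A_def using A0 by (rule shifted_psd)
  show ?thesis unfolding A_def[symmetric]
  proof (rule complete_form_equivalent[OF complete B.psd_form_axioms A.psd_form_axioms])
    fix u assume u: "u \<in> Q"
    have "a u u + M * p u u = A u u + (e + M) * p u u" unfolding A_def by (simp add: algebra_simps)
    also have "\<dots> \<le> A u u + \<bar>e + M\<bar> * p u u"
      by (intro add_left_mono mult_right_mono P.nonneg u) simp
    also have "\<dots> \<le> A u u + \<bar>e + M\<bar> * (A u u / s)"
      by (intro add_left_mono mult_left_mono) (use pA[OF u] \<open>s > 0\<close> in \<open>auto simp: field_simps\<close>)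
    finally have "K2 * (a u u + M * p u u) \<le> K2 * (A u u + \<bar>e + M\<bar> * (A u u / s))"
      using K2_pos by simp
    with coercive[OF u] show "B u u \<le> (K2 * (1 + \<bar>e + M\<bar> / s)) * A u u"
      by (simp add: algebra_simps)
    have "- e * p u u \<le> \<bar>e\<bar> * p u u" by (intro mult_right_mono P.nonneg u) simp
    also have "\<dots> \<le> \<bar>e\<bar> * B u u" by (intro mult_left_mono p_le u) simp
    finally show "A u u \<le> (K1 + \<bar>e\<bar>) * B u u"
      using a_le[OF u] unfolding A_def by (simp add: algebra_simps)
  qed
qed

text \<open>Below the lower bound \<open>\<nu>\<close> the shifted form \<open>A\<close> is complete
  and dominates \<open>(\<nu> - e) * p\<close>, so the equation is solved by representing the
  functional \<open>\<phi> \<mapsto> p \<phi> h\<close> in \<open>A\<close> (Lax-Milgram).\<close>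

lemma regular_below:
  assumes bound: "\<And>u. u \<in> Q \<Longrightarrow> \<nu> * p u u \<le> a u u" and "e < \<nu>"
  shows "regular e"
proof -
  define A where "A = (\<lambda>x y. a x y - e * p x y)"
  define s where "s = \<nu> - e"
  have "s > 0" using assms unfolding s_def by simp
  have pA: "s * p u u \<le> A u u" if "u \<in> Q" for u
    using bound[OF that] unfolding A_def s_def by (simp add: algebra_simps)
  have A0: "e * p u u \<le> a u u" if "u \<in> Q" for u
    using pA[OF that] P.nonneg[OF that] \<open>s > 0\<close> unfolding A_def
    by (smt (verit) mult_nonneg_nonneg)
  interpret A: psd_form Q A unfolding A_def using A0 by (rule shifted_psd)
  have complA: "complete_form Q A" unfolding A_def by (rule shifted_complete[OF bound \<open>e < \<nu>\<close>])
  have "\<exists>u. weak_solution e u h" if h: "h \<in> L" for h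
  proof -
    have "\<exists>u\<in>Q. \<forall>x\<in>Q. A x u = p x h"
    proof (rule A.Riesz_representation[OF complA])
      fix x assume x: "x \<in> Q"
      have "(p x h)\<^sup>2 \<le> p x x * p h h" by (rule L.Cauchy_Schwarz) (use x h QL in auto)
      also have "\<dots> \<le> (A x x / s) * p h h"
        by (intro mult_right_mono L.nonneg h) (use pA[OF x] \<open>s > 0\<close> in \<open>auto simp: field_simps\<close>)
      finally show "(p x h)\<^sup>2 \<le> (p h h / s) * A x x" by (simp add: mult.commute)
    qed (use h QL in \<open>auto simp: L.bilinear\<close>)
    then show ?thesis unfolding weak_solution_def A_def using h by auto
  qed
  moreover have "p u u \<le> (1 / s\<^sup>2) * p h h" if "weak_solution e u h" for u h
  proof -
    from that have u: "u \<in> Q" and h: "h \<in> L" and eq: "A u u = p u h"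
      unfolding weak_solution_def A_def by auto
    have "(s * p u u)\<^sup>2 \<le> (p u h)\<^sup>2"
      using pA[OF u] P.nonneg[OF u] \<open>s > 0\<close> eq by (intro power_mono) auto
    also have "\<dots> \<le> p u u * p h h" by (rule L.Cauchy_Schwarz) (use u h QL in auto)
    finally have *: "p u u * (s\<^sup>2 * p u u) \<le> p u u * p h h" by (simp add: power2_eq_square mult_ac)
    have "s\<^sup>2 * p u u \<le> p h h"
    proof (cases "p u u = 0")
      case False
      then have "p u u > 0" using P.nonneg[OF u] by simp
      with * show ?thesis by simp
    qed (simp add: L.nonneg h)
    then show ?thesis using \<open>s > 0\<close> by (simp add: field_simps)
  qed
  ultimately show ?thesis unfolding regular_def by blast
qed

text \<open>Solving at the bottom with a nearly minimizing unit vector \<open>w\<close> as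
  right-hand side would give \<open>1 = A w z\<close>, whereas Cauchy-Schwarz for \<open>A\<close>
  bounds the square of this by the small energy of \<open>w\<close> times an energy of
  \<open>z\<close> that the resolvent bound controls.\<close>

lemma infimum_not_regular:
  assumes bound: "\<And>u. u \<in> Q \<Longrightarrow> \<nu> * p u u \<le> a u u"
    and attained: "\<And>\<eta>. \<eta> > 0 \<Longrightarrow> \<exists>w\<in>Q. p w w = 1 \<and> a w w < \<nu> + \<eta>"
  shows "\<not> regular \<nu>"
proof
  assume reg: "regular \<nu>"
  obtain C where C: "C > 0" "\<And>u h. weak_solution \<nu> u h \<Longrightarrow> p u u \<le> C * p h h"
    using regularE[OF reg] by blast
  define A where "A = (\<lambda>x y. a x y - \<nu> * p x y)"
  interpret A: psd_form Q A unfolding A_def using bound by (rule shifted_psd)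
  \<comment> \<open>Chosen against the bound \<open>sqrt C\<close> on \<open>A z z\<close>, so that
    the product becomes \<open>1 / 2\<close>.\<close>
  define \<eta> where "\<eta> = 1 / (2 * sqrt C)"
  have "\<eta> > 0" using C(1) unfolding \<eta>_def by simp
  then obtain w where w: "w \<in> Q" "p w w = 1" "a w w < \<nu> + \<eta>" using attained by blast
  then obtain z where z: "weak_solution \<nu> z w" using reg QL unfolding regular_def by blast
  then have zQ: "z \<in> Q" and zeq: "\<And>\<phi>. \<phi> \<in> Q \<Longrightarrow> A \<phi> z = p \<phi> w"
    unfolding weak_solution_def A_def by auto
  have "p z w \<le> sqrt (p z z) * sqrt (p w w)"
    using P.Cauchy_Schwarz_sqrt[OF zQ w(1)] by linarith
  also have "\<dots> \<le> sqrt C" using C(2)[OF z] w(2) by simp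
  finally have "A z z \<le> sqrt C" using zeq[OF zQ] by simp
  have "1 = (A w z)\<^sup>2" using zeq[OF w(1)] w(2) by simp
  also have "\<dots> \<le> A w w * A z z" by (rule A.Cauchy_Schwarz[OF w(1) zQ])
  also have "\<dots> \<le> \<eta> * sqrt C"
    using w \<open>A z z \<le> sqrt C\<close> A.nonneg[OF zQ] \<open>\<eta> > 0\<close> by (intro mult_mono) (auto simp: A_def)
  also have "\<dots> = 1 / 2" using C(1) unfolding \<eta>_def by simp
  finally show False by simp
qed

lemma form_lower_bound: "u \<in> Q \<Longrightarrow> - M * p u u \<le> a u u"
  using coercive[of u] B.nonneg[of u] K2_pos by (smt (verit) mult_minus_left zero_le_mult_iff)

text \<open>Identifies the least singular point with the bottom of the form: everything below the
  bottom is regular and the bottom is not, so the infimum is attained and carries the variational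
  lower bound. The vector \<open>u0\<close> guarantees that there are unit vectors.\<close>

lemma Inf_singular:
  assumes "u0 \<in> Q" "p u0 u0 > 0"
  defines "\<mu> \<equiv> Inf {e. \<not> regular e}"
  shows "\<not> regular \<mu>" and "\<And>u. u \<in> Q \<Longrightarrow> \<mu> * p u u \<le> a u u"
proof -
  define S where "S = {a u u |u. u \<in> Q \<and> p u u = 1}"
  define \<nu> where "\<nu> = Inf S"
  have normed: "(1 / sqrt (p u u)) *\<^sub>R u \<in> Q \<and> p ((1 / sqrt (p u u)) *\<^sub>R u) ((1 / sqrt (p u u)) *\<^sub>R u) = 1
      \<and> a ((1 / sqrt (p u u)) *\<^sub>R u) ((1 / sqrt (p u u)) *\<^sub>R u) = a u u / p u u"
    if "u \<in> Q" "p u u > 0" for u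
    using that by (simp add: P.quad_scale a.quad_scale power_divide)
  have ne: "S \<noteq> {}" unfolding S_def using normed[OF assms(1,2)] by blast
  have lower: "- M \<le> x" if "x \<in> S" for x
  proof -
    from that obtain u where "u \<in> Q" "p u u = 1" "x = a u u" unfolding S_def by blast
    with form_lower_bound[of u] show ?thesis by simp
  qed
  then have bdd: "bdd_below S" by (rule bdd_belowI)
  have bound: "\<nu> * p u u \<le> a u u" if "u \<in> Q" for u
  proof (cases "p u u = 0")
    case True
    with form_lower_bound[OF that] show ?thesis by simp
  next
    case False
    then have pos: "p u u > 0" using P.nonneg[OF that] by simp
    have "a u u / p u u \<in> S" unfolding S_def using normed[OF that pos] by force
    then have "\<nu> \<le> a u u / p u u" unfolding \<nu>_def by (rule cInf_lower[OF _ bdd])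
    with pos show ?thesis by (simp add: field_simps)
  qed
  have "\<not> regular \<nu>"
  proof (rule infimum_not_regular[OF bound])
    fix \<eta> :: real assume "\<eta> > 0"
    then have "\<exists>x\<in>S. x < \<nu> + \<eta>" using cInf_less_iff[OF ne bdd, of "\<nu> + \<eta>"] unfolding \<nu>_def by simp
    then show "\<exists>w\<in>Q. p w w = 1 \<and> a w w < \<nu> + \<eta>" unfolding S_def by blast
  qed
  moreover have "\<nu> \<le> e" if "\<not> regular e" for e
    using regular_below[OF bound, of e] that by force
  ultimately have "\<mu> = \<nu>" unfolding \<mu>_def by (intro cInf_eq_minimum) auto
  with \<open>\<not> regular \<nu>\<close> bound show "\<not> regular \<mu>" and "\<And>u. u \<in> Q \<Longrightarrow> \<mu> * p u u \<le> a u u" by auto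
qed

text \<open>If \<open>1/\<rho>\<close> is the norm of the resolvent at \<open>c\<close>, then \<open>(H - c)\<^sup>2\<close> has \<open>\<rho>\<^sup>2\<close> as an approximate
  eigenvalue, which is impossible when both \<open>c + \<rho>\<close> and \<open>c - \<rho>\<close> are regular.\<close>

lemma resolvent_bound:
  assumes "regular c" "d > 0" and reg: "\<And>\<rho>. 0 < \<rho> \<Longrightarrow> \<rho> < d \<Longrightarrow> regular (c + \<rho>) \<and> regular (c - \<rho>)"
    and sol: "weak_solution c x h"
  shows "d\<^sup>2 * p x x \<le> p h h"
proof -
  define S where "S = {p u u |u w. weak_solution c u w \<and> p w w = 1}"
  obtain C where C: "C > 0" "\<And>u h. weak_solution c u h \<Longrightarrow> p u u \<le> C * p h h"
    using regularE[OF \<open>regular c\<close>] by blast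
  have bdd: "bdd_above S" by (rule bdd_aboveI[of _ C]) (use C(2) in \<open>force simp: S_def\<close>)
  define N where "N = Sup S"
  have scale: "weak_solution e (t *\<^sub>R u) (t *\<^sub>R w)" if "weak_solution e u w" for e t u w
    using that QL unfolding weak_solution_def by (auto simp: a.bilinear L.bilinear algebra_simps)
  have scaled: "p u u / p w w \<in> S" if "weak_solution c u w" "p w w > 0" for u w
  proof -
    have "u \<in> L" "w \<in> L" using that QL unfolding weak_solution_def by auto
    then show ?thesis
      unfolding S_def using scale[OF that(1), of "1 / sqrt (p w w)"] that(2)
      by (intro CollectI exI[of _ "(1 / sqrt (p w w)) *\<^sub>R u"] exI[of _ "(1 / sqrt (p w w)) *\<^sub>R w"])
        (simp add: L.quad_scale power_divide)
  qed
  have le_N: "p u u \<le> N * p w w" if "weak_solution c u w" for u w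
  proof (cases "p w w > 0")
    case True
    from cSup_upper[OF scaled[OF that True] bdd] True show ?thesis unfolding N_def by (simp add: field_simps)
  next
    case False
    then have "p w w = 0" using L.nonneg[of w] that unfolding weak_solution_def by force
    with C(2)[OF that] show ?thesis by simp
  qed
  \<comment> \<open>\<open>N\<close> is the squared norm of the resolvent at \<open>c\<close>. If
    \<open>S\<close> is empty there are no unit vectors to solve for and \<open>Sup S\<close>
    carries no information, so that case is kept apart.\<close>
  have "N \<le> 1 / d\<^sup>2 \<or> S = {}"
  proof (rule ccontr)
    assume "\<not> ?thesis"
    then have big: "N > 1 / d\<^sup>2" and ne: "S \<noteq> {}" by auto
    have "N > 0" using big \<open>d > 0\<close> by (smt (verit) zero_le_divide_1_iff zero_le_power2)
    define \<rho> where "\<rho> = 1 / sqrt N"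
    have \<rho>: "\<rho> > 0" "\<rho>\<^sup>2 = 1 / N" unfolding \<rho>_def using \<open>N > 0\<close> by (simp_all add: power_divide)
    have "\<rho>\<^sup>2 < d\<^sup>2" using big \<open>N > 0\<close> \<open>d > 0\<close> unfolding \<rho>(2) by (simp add: field_simps)
    then have "\<rho> < d" using \<open>d > 0\<close> by (simp add: power_less_imp_less_base)
    with reg \<rho>(1) have regs: "regular (c + \<rho>)" "regular (c - \<rho>)" by auto
    obtain C1 where C1: "C1 > 0" "\<And>u h. weak_solution (c + \<rho>) u h \<Longrightarrow> p u u \<le> C1 * p h h"
      using regularE[OF regs(1)] by blast
    obtain C2 where C2: "C2 > 0" "\<And>u h. weak_solution (c - \<rho>) u h \<Longrightarrow> p u u \<le> C2 * p h h"
      using regularE[OF regs(2)] by blast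
    \<comment> \<open>\<open>\<eta>\<close> is how far the unit vector \<open>w\<close> misses the
      squared resolvent norm; the inequality, valid for every positive \<open>\<eta>\<close>, is
      contradictory for small ones.\<close>
    have small: "1 \<le> (4 * \<rho>\<^sup>2 + 4 * \<rho>\<^sup>2 * \<rho>\<^sup>2 * \<rho>\<^sup>2 * C2 * C1) * \<eta>" if "\<eta> > 0" for \<eta>
    proof -
      have "\<exists>s\<in>S. N - \<eta> < s" using less_cSup_iff[OF ne bdd, of "N - \<eta>"] that unfolding N_def by simp
      then obtain y w where yw: "weak_solution c y w" "p w w = 1" "N - \<eta> < p y y"
        unfolding S_def by blast
      then have yQ: "y \<in> Q" and wL: "w \<in> L" unfolding weak_solution_def by auto
      obtain z where z: "weak_solution c z y"
        using \<open>regular c\<close> yQ QL unfolding regular_def by blast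
      then have zQ: "z \<in> Q" unfolding weak_solution_def by auto
      note Ls = wL QL[OF yQ] QL[OF zQ]
      have "p y y \<le> N" using le_N[OF yw(1)] yw(2) by simp
      have "p z z \<le> N * p y y" by (rule le_N[OF z])
      also have "\<dots> \<le> N * N" using \<open>p y y \<le> N\<close> \<open>N > 0\<close> by simp
      finally have zz: "p z z \<le> N * N" .
      have zy: "p z w = p y y"
        using yw(1) z yQ zQ unfolding weak_solution_def by (metis a.sym P.sym)
      \<comment> \<open>With \<open>R\<close> the resolvent at \<open>c\<close>,
        \<open>y = R w\<close> and \<open>z = R y\<close>. Since \<open>R\<close> is symmetric,
        \<open>p z w = p y y\<close>, so \<open>w\<close> almost attains the norm of
        \<open>R\<^sup>2\<close> and is nearly fixed by \<open>\<rho>\<^sup>2 R\<^sup>2\<close>;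
        \<open>r\<close> is the defect.\<close>
      define r where "r = w - \<rho>\<^sup>2 *\<^sub>R z"
      have rL: "r \<in> L" unfolding r_def using Ls by auto
      have "p r r = 1 - 2 * (\<rho>\<^sup>2 * p y y) + (\<rho>\<^sup>2)\<^sup>2 * p z z"
        unfolding r_def using Ls zy yw(2)
        by (simp add: L.quad_diff L.bilinear L.sym[of w z] power2_eq_square) (simp add: algebra_simps)
      also have "\<dots> \<le> 1 - 2 * (\<rho>\<^sup>2 * (N - \<eta>)) + (\<rho>\<^sup>2)\<^sup>2 * (N * N)"
        using yw(3) zz by (intro add_mono diff_mono mult_left_mono) auto
      also have "\<dots> = 2 * \<rho>\<^sup>2 * \<eta>" using \<open>N > 0\<close> unfolding \<rho>(2) by (simp add: field_simps power2_eq_square)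
      finally have rr: "p r r \<le> 2 * \<rho>\<^sup>2 * \<eta>" .
      \<comment> \<open>This factors \<open>(H - c)\<^sup>2 - \<rho>\<^sup>2\<close>:
        \<open>H - c - \<rho>\<close> maps \<open>x\<close> to \<open>r\<close>, and
        \<open>H - c + \<rho>\<close> maps \<open>z\<close> to \<open>x\<close>. Regularity of both
        points then makes \<open>z\<close> small, hence also
        \<open>w = r + \<rho>\<^sup>2 z\<close>, although \<open>w\<close> is a unit vector.\<close>
      define x where "x = y + \<rho> *\<^sub>R z"
      have xQ: "x \<in> Q" unfolding x_def using yQ zQ by auto
      have s1: "weak_solution (c + \<rho>) x r"
        unfolding weak_solution_def
      proof (intro conjI ballI xQ rL)
        fix \<phi> assume \<phi>: "\<phi> \<in> Q"
        have "a \<phi> y - c * p \<phi> y = p \<phi> w" "a \<phi> z - c * p \<phi> z = p \<phi> y"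
          using yw(1) z \<phi> unfolding weak_solution_def by auto
        then have "a \<phi> y = c * p \<phi> y + p \<phi> w" "a \<phi> z = c * p \<phi> z + p \<phi> y" by auto
        then show "a \<phi> x - (c + \<rho>) * p \<phi> x = p \<phi> r"
          unfolding x_def r_def using \<phi> yQ zQ Ls QL
          by (simp add: a.bilinear L.bilinear) (simp add: algebra_simps power2_eq_square)
      qed
      have s2: "weak_solution (c - \<rho>) z x"
        unfolding weak_solution_def
      proof (intro conjI ballI zQ QL[OF xQ])
        fix \<phi> assume \<phi>: "\<phi> \<in> Q"
        have "a \<phi> z - c * p \<phi> z = p \<phi> y"
          using z \<phi> unfolding weak_solution_def by auto
        then show "a \<phi> z - (c - \<rho>) * p \<phi> z = p \<phi> x"
          unfolding x_def using \<phi> yQ zQ Ls QL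
          by (simp add: a.bilinear L.bilinear) (simp add: algebra_simps power2_eq_square)
      qed
      have "p z z \<le> C2 * p x x" by (rule C2(2)[OF s2])
      also have "\<dots> \<le> C2 * (C1 * p r r)" using C1(2)[OF s1] C2(1) by simp
      also have "\<dots> \<le> C2 * (C1 * (2 * \<rho>\<^sup>2 * \<eta>))" using rr C1(1) C2(1) by simp
      finally have zz': "p z z \<le> C2 * (C1 * (2 * \<rho>\<^sup>2 * \<eta>))" .
      have "w = r + \<rho>\<^sup>2 *\<^sub>R z" unfolding r_def by simp
      then have "1 = p (r + \<rho>\<^sup>2 *\<^sub>R z) (r + \<rho>\<^sup>2 *\<^sub>R z)" using yw(2) by simp
      also have "\<dots> \<le> 2 * p r r + 2 * p (\<rho>\<^sup>2 *\<^sub>R z) (\<rho>\<^sup>2 *\<^sub>R z)"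
        by (rule L.quad_add_le) (use rL Ls in auto)
      also have "\<dots> = 2 * p r r + 2 * ((\<rho>\<^sup>2)\<^sup>2 * p z z)" using Ls by (simp add: L.quad_scale)
      also have "\<dots> \<le> 2 * (2 * \<rho>\<^sup>2 * \<eta>) + 2 * ((\<rho>\<^sup>2)\<^sup>2 * (C2 * (C1 * (2 * \<rho>\<^sup>2 * \<eta>))))"
        using rr zz' by (intro add_mono mult_left_mono) auto
      finally show ?thesis by (simp add: algebra_simps power2_eq_square)
    qed
    define K where "K = 4 * \<rho>\<^sup>2 + 4 * \<rho>\<^sup>2 * \<rho>\<^sup>2 * \<rho>\<^sup>2 * C2 * C1"
    have "K > 0" unfolding K_def using \<rho>(1) C1(1) C2(1) by (simp add: add_pos_pos)
    then show False using small[of "1 / (2 * K)"] unfolding K_def[symmetric] by simp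
  qed
  then show ?thesis
  proof
    assume N: "N \<le> 1 / d\<^sup>2"
    have "p x x \<le> N * p h h" by (rule le_N[OF sol])
    also have "\<dots> \<le> (1 / d\<^sup>2) * p h h"
      using N L.nonneg[of h] sol unfolding weak_solution_def by (intro mult_right_mono) auto
    finally show ?thesis using \<open>d > 0\<close> by (simp add: field_simps)
  next
    assume "S = {}"
    then have "\<not> p h h > 0" using scaled[OF sol] by auto
    then have "p h h = 0" using L.nonneg[of h] sol unfolding weak_solution_def by force
    then show ?thesis using C(2)[OF sol] by (simp add: mult_nonneg_nonpos)
  qed
qed

text \<open>With \<open>T = H - \<mu>\<close>, the resolvent bound at \<open>\<mu> + d\<close> says
  \<open>T\<^sup>2 \<ge> 2 d T\<close>. To get a lower bound off the kernel from this,
  \<open>w\<close> is driven by the damped resolvent, the inverse of \<open>T + d\<close> times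
  \<open>d\<close>. The iterates converge to the kernel part of \<open>w\<close>, which is null by
  hypothesis, and the norm lost on the way is paid for by energy. The bookkeeping is not sharp,
  which is why \<open>4 * d / 5\<close> appears.\<close>

lemma spectral_gap:
  assumes bound: "\<And>u. u \<in> Q \<Longrightarrow> \<mu> * p u u \<le> a u u" and "d > 0"
    and reg: "\<And>e. e \<noteq> \<mu> \<Longrightarrow> \<bar>e - \<mu>\<bar> < 2 * d \<Longrightarrow> regular e"
    and w: "w \<in> Q" "\<And>u. u \<in> Q \<Longrightarrow> (\<And>\<phi>. \<phi> \<in> Q \<Longrightarrow> a \<phi> u = \<mu> * p \<phi> u) \<Longrightarrow> p u w = 0"
  shows "4 * d / 5 * p w w \<le> a w w - \<mu> * p w w"
proof -
  define A where "A = (\<lambda>x y. a x y - \<mu> * p x y)"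
  interpret A: psd_form Q A unfolding A_def using bound by (rule shifted_psd)
  \<comment> \<open>If \<open>T u = h\<close>, then \<open>(T - d) u = h - d u\<close>; in the
    resolvent bound at \<open>\<mu> + d\<close> the terms \<open>d\<^sup>2 * p u u\<close>
    cancel.\<close>
  have A_le: "2 * d * A u u \<le> p h h" if u: "u \<in> Q" and h: "h \<in> L" and eq: "\<And>\<phi>. \<phi> \<in> Q \<Longrightarrow> A \<phi> u = p \<phi> h" for u h
  proof -
    have "d\<^sup>2 * p u u \<le> p (h - d *\<^sub>R u) (h - d *\<^sub>R u)"
    proof (rule resolvent_bound[of "\<mu> + d"])
      show "weak_solution (\<mu> + d) u (h - d *\<^sub>R u)"
        unfolding weak_solution_def using u h eq QL
        by (auto simp: A_def L.bilinear algebra_simps)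
    qed (use reg \<open>d > 0\<close> in auto)
    also have "\<dots> = p h h - 2 * d * p u h + d\<^sup>2 * p u u"
      using u h QL by (simp add: L.quad_diff L.bilinear L.sym[of h u] power2_eq_square) (simp add: algebra_simps)
    finally show ?thesis using eq[OF u] by simp
  qed
  \<comment> \<open>One step of the iteration: \<open>(T + d) v = d u\<close>, solvable because
    \<open>\<mu> - d\<close> is regular.\<close>
  have "\<exists>v. v \<in> Q \<and> (\<forall>\<phi>\<in>Q. A \<phi> v = d * p \<phi> (u - v))" if u: "u \<in> Q" for u
  proof -
    have "regular (\<mu> - d)" using reg \<open>d > 0\<close> by auto
    moreover have "d *\<^sub>R u \<in> L" using u QL by auto
    ultimately obtain v where v: "weak_solution (\<mu> - d) v (d *\<^sub>R u)"
      unfolding regular_def by blast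
    then show ?thesis
      unfolding weak_solution_def A_def using u QL
      by (intro exI[of _ v]) (auto simp: L.bilinear algebra_simps)
  qed
  then obtain f where f: "\<And>u. u \<in> Q \<Longrightarrow> f u \<in> Q" "\<And>u \<phi>. u \<in> Q \<Longrightarrow> \<phi> \<in> Q \<Longrightarrow> A \<phi> (f u) = d * p \<phi> (u - f u)"
    by metis
  define W where "W n = (f ^^ n) w" for n
  have W0: "W 0 = w" and WS: "W (Suc n) = f (W n)" for n unfolding W_def by simp_all
  have WQ: "W n \<in> Q" for n by (induction n) (auto simp: W0 WS w f)
  define E where "E n = A (W n) (W n)" for n
  define D where "D n = W n - W (Suc n)" for n
  have DQ: "D n \<in> Q" for n unfolding D_def using WQ by auto
  have AD: "A \<phi> (W (Suc n)) = d * p \<phi> (D n)" if "\<phi> \<in> Q" for \<phi> n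
    unfolding WS D_def using f(2)[OF WQ that] by simp
  have E0: "0 \<le> E n" for n unfolding E_def by (rule A.nonneg[OF WQ])
  have Wsplit: "W n = W (Suc n) + D n" for n unfolding D_def by simp
  \<comment> \<open>From \<open>T (W (Suc n)) = d D n\<close> and \<open>A_le\<close> follows
    \<open>2 * E (Suc n) \<le> d * p (D n) (D n)\<close>, while expanding \<open>E n\<close> around
    \<open>W (Suc n)\<close> gains \<open>2 * d * p (D n) (D n)\<close>. Together the energy drops
    by a factor 5.\<close>
  have pD: "2 * d * p (D n) (D n) + E (Suc n) \<le> E n" and ES: "5 * E (Suc n) \<le> E n" for n
  proof -
    have "2 * d * E (Suc n) \<le> p (d *\<^sub>R D n) (d *\<^sub>R D n)"
      unfolding E_def by (rule A_le) (use WQ DQ QL AD in \<open>auto simp: L.scale_right\<close>)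
    also have "\<dots> = d * (d * p (D n) (D n))" using DQ by (simp add: P.bilinear)
    finally have 1: "2 * E (Suc n) \<le> d * p (D n) (D n)" using \<open>d > 0\<close> by simp
    have "E n = E (Suc n) + 2 * A (D n) (W (Suc n)) + A (D n) (D n)"
      unfolding E_def by (subst (1 2) Wsplit) (use A.quad_add[OF WQ DQ] A.sym[OF WQ DQ] in simp)
    also have "\<dots> \<ge> E (Suc n) + 2 * (d * p (D n) (D n))"
      using A.nonneg[OF DQ[of n]] AD[OF DQ] by simp
    finally show 2: "2 * d * p (D n) (D n) + E (Suc n) \<le> E n" by simp
    show "5 * E (Suc n) \<le> E n" using 1 2 by simp
  qed
  \<comment> \<open>The factor 5 is relaxed to 4 to match the ratio in
    \<open>Cauchy_if_geometric\<close>.\<close>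
  have decay: "E n \<le> E 0 * (1 / 4) ^ n" for n
  proof (induction n)
    case (Suc n)
    have "E (Suc n) \<le> E n / 4" using ES[of n] E0[of "Suc n"] by simp
    with Suc show ?case by simp
  qed simp
  \<comment> \<open>The squared norm lost in one step is dominated by the energy lost in that step,
    and these energy drops telescope.\<close>
  have drift: "p w w - p (W n) (W n) \<le> 5 / (4 * d) * (E 0 - E n)" for n
  proof (induction n)
    case (Suc n)
    have "p (W n) (W n) = p (W (Suc n)) (W (Suc n)) + 2 * p (W (Suc n)) (D n) + p (D n) (D n)"
      by (subst (1 2) Wsplit) (rule P.quad_add[OF WQ DQ])
    moreover have "d * p (W (Suc n)) (D n) = E (Suc n)" unfolding E_def using AD[OF WQ] by simp
    ultimately have "d * (p (W n) (W n) - p (W (Suc n)) (W (Suc n))) = 2 * E (Suc n) + d * p (D n) (D n)"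
      by (simp add: algebra_simps)
    also have "\<dots> \<le> 5 / 4 * (E n - E (Suc n))" using pD[of n] ES[of n] E0[of "Suc n"] by simp
    finally have "p (W n) (W n) - p (W (Suc n)) (W (Suc n)) \<le> 5 / (4 * d) * (E n - E (Suc n))"
      using \<open>d > 0\<close> by (simp add: field_simps)
    moreover have "5 / (4 * d) * (E 0 - E (Suc n)) = 5 / (4 * d) * (E 0 - E n) + 5 / (4 * d) * (E n - E (Suc n))"
      by (subst distrib_left[symmetric]) simp
    ultimately show ?case using Suc by linarith
  qed (simp add: W0)
  \<comment> \<open>\<open>A\<close> degenerates on the kernel where the limit will lie; lowering
    the shift by 1 adds \<open>p\<close> and gives a complete form.\<close>
  define A1 where "A1 = (\<lambda>x y. a x y - (\<mu> - 1) * p x y)"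
  have A1: "A1 x y = A x y + p x y" for x y unfolding A1_def A_def by (simp add: algebra_simps)
  interpret A1: psd_form Q A1
    unfolding A1_def by (rule shifted_psd) (smt (verit) bound P.nonneg mult_right_mono)
  have "A1 (W n - W (Suc n)) (W n - W (Suc n)) \<le> ((4 + 1 / d) * E 0) * (1 / 4) ^ n" for n
  proof -
    have "A (D n) (D n) \<le> 2 * E n + 2 * E (Suc n)"
      unfolding D_def E_def by (rule A.quad_diff_le[OF WQ WQ])
    also have "\<dots> \<le> 4 * E n" using ES[of n] E0[of "Suc n"] by simp
    finally have "A (D n) (D n) \<le> 4 * E n" .
    moreover have "p (D n) (D n) \<le> (1 / d) * E n"
    proof -
      have "0 \<le> d * p (D n) (D n)" using P.nonneg[OF DQ] \<open>d > 0\<close> by simp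
      then have "d * p (D n) (D n) \<le> E n" using pD[of n] E0[of "Suc n"] by simp
      then show ?thesis using \<open>d > 0\<close> by (simp add: field_simps)
    qed
    ultimately have "A1 (D n) (D n) \<le> (4 + 1 / d) * E n" unfolding A1 by (simp add: algebra_simps)
    also have "\<dots> \<le> (4 + 1 / d) * (E 0 * (1 / 4) ^ n)"
      using decay[of n] \<open>d > 0\<close> by (intro mult_left_mono) auto
    finally show ?thesis unfolding D_def by simp
  qed
  note cauchy = A1.Cauchy_if_geometric[OF WQ this]
  have "complete_form Q A1" unfolding A1_def by (rule shifted_complete[OF bound]) auto
  from complete_formD[OF this WQ cauchy]
  obtain l where l: "l \<in> Q" "(\<lambda>n. A1 (W n - l) (W n - l)) \<longlonglongrightarrow> 0" by blast
  have lim: "(\<lambda>n. A (W n - l) (W n - l)) \<longlonglongrightarrow> 0" "(\<lambda>n. p (W n - l) (W n - l)) \<longlonglongrightarrow> 0"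
    by (rule tendsto_sandwich[OF _ _ tendsto_const l(2)];
        intro always_eventually allI; use A.nonneg P.nonneg WQ l(1) in \<open>simp add: A1\<close>)+
  have "(\<lambda>n. E 0 * (1 / 4) ^ n) \<longlonglongrightarrow> E 0 * 0" by (intro tendsto_intros LIMSEQ_realpow_zero) auto
  then have "E \<longlonglongrightarrow> 0"
    by (intro tendsto_sandwich[OF _ _ tendsto_const, of 0 E]) (use E0 decay in auto)
  moreover have "E \<longlonglongrightarrow> A l l" unfolding E_def by (rule A.tendsto_quad[OF WQ l(1) lim(1)])
  ultimately have "A l l = 0" using LIMSEQ_unique by blast
  then have Al: "A \<phi> l = 0" if "\<phi> \<in> Q" for \<phi> using A.null_left[OF l(1) that] A.sym[OF l(1) that] by simp
  \<comment> \<open>\<open>A\<close> annihilates the limit \<open>l\<close>, so the steps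
    \<open>D n\<close> are orthogonal to \<open>l\<close> and the overlap with \<open>l\<close> is
    conserved along the iteration.\<close>
  have "p l (W n) = p l w" for n
  proof (induction n)
    case (Suc n)
    have "d * p l (D n) = 0" using AD[OF l(1)] Al[OF WQ] A.sym[OF l(1) WQ] by metis
    then show ?case using Suc \<open>d > 0\<close> l(1) WQ unfolding D_def by (simp add: P.bilinear)
  qed (simp add: W0)
  moreover have "p l w = 0" by (rule w(2)[OF l(1)]) (use Al in \<open>auto simp: A_def\<close>)
  ultimately have "p (W n) l = 0" for n using P.sym[OF l(1) WQ] by metis
  with P.tendsto_pairing[OF WQ l(1) l(1) lim(2)] have "p l l = 0" by (simp add: LIMSEQ_const_iff)
  have "(\<lambda>n. p w w - p (W n) (W n)) \<longlonglongrightarrow> p w w - p l l"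
    by (intro tendsto_intros P.tendsto_quad[OF WQ l(1) lim(2)])
  then have "p w w - p l l \<le> 5 / (4 * d) * E 0"
  proof (rule LIMSEQ_le_const2, intro exI allI impI)
    fix n
    have "5 / (4 * d) * (E 0 - E n) \<le> 5 / (4 * d) * E 0" using E0 \<open>d > 0\<close> by (intro mult_left_mono) auto
    with drift[of n] show "p w w - p (W n) (W n) \<le> 5 / (4 * d) * E 0" by linarith
  qed
  with \<open>p l l = 0\<close> have "p w w \<le> 5 / (4 * d) * A w w" unfolding E_def W0 by simp
  then show ?thesis using \<open>d > 0\<close> unfolding A_def by (simp add: field_simps)
qed

end

section \<open>Quartic perturbations of a form with a spectral gap\<close>

text \<open>\<open>A\<close> is the form minus its ground energy. \<open>e1\<close> and
  \<open>e2\<close> stand for \<open>u\<^sub>V\<close> and \<open>\<i> u\<^sub>V\<close>: over the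
  reals the complex line of ground states has dimension two, and the gap holds orthogonally to both
  vectors.\<close>

locale gapped_form =
  P: psd_form Q p + A: psd_form Q A + B: psd_form Q B
  for Q :: "'v::real_vector set" and p A B +
  fixes e1 e2 :: 'v and c K :: real
  assumes complete: "complete_form Q B"
    and p_le: "u \<in> Q \<Longrightarrow> p u u \<le> B u u"
    and A_le: "u \<in> Q \<Longrightarrow> A u u \<le> K * B u u"
    and e_in: "e1 \<in> Q" "e2 \<in> Q"
    and e1_norm: "p e1 e1 = 1" and e_orth: "p e1 e2 = 0" and e1_null: "A e1 e1 = 0"
    and c_pos: "c > 0" and K_nonneg: "K \<ge> 0"
    and gap: "w \<in> Q \<Longrightarrow> p e1 w = 0 \<Longrightarrow> p e2 w = 0 \<Longrightarrow> c * B w w \<le> A w w"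
begin

text \<open>The complex overlap with the ground state is real and nonnegative, which fixes the
  phase. The weak inequality keeps the set closed under limits; strict positivity is regained from
  low energy.\<close>

definition aligned :: "'v set" where
  "aligned = {u \<in> Q. p u u = 1 \<and> p e2 u = 0 \<and> 0 \<le> p e1 u}"

definition b where "b = B e1 e1"
definition C1 where "C1 = 2 * (2 * b + 1) / c"
definition c2 where "c2 = c / (2 * b + 2)"

text \<open>The first threshold lets the gap absorb the part of \<open>N\<close> that grows with the
  energy. The second makes \<open>\<kappa> * C1\<close>, which bounds the component of a low state
  orthogonal to \<open>e1\<close>, at most \<open>1 / 4\<close>. The third leaves half of the
  convexity rate \<open>c2\<close> after the second differences of \<open>N\<close> and the cost of
  normalizing midpoints are subtracted.\<close>

definition kappa_max where
  "kappa_max = Min {c / 4, 1 / (4 * C1), c2 / (2 * (2 * K * C1 + 7 * (2 * b + 1)))}"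

lemma b_ge: "b \<ge> 1" using p_le[OF e_in(1)] e1_norm unfolding b_def by simp

lemma consts_pos: "C1 > 0" "c2 > 0" "2 * K * C1 + 7 * (2 * b + 1) > 0"
  using b_ge c_pos K_nonneg unfolding C1_def c2_def by (simp_all add: add_nonneg_pos)

lemma kappa_max_pos: "kappa_max > 0"
  unfolding kappa_max_def using consts_pos c_pos by simp

lemma kappa_max_le:
  assumes "\<kappa> \<le> kappa_max"
  shows "\<kappa> \<le> c / 4" "\<kappa> * C1 \<le> 1 / 4" "\<kappa> * (2 * K * C1 + 7 * (2 * b + 1)) \<le> c2 / 2"
proof -
  have "\<kappa> \<le> c / 4" "\<kappa> \<le> 1 / (4 * C1)" "\<kappa> \<le> c2 / (2 * (2 * K * C1 + 7 * (2 * b + 1)))"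
    using assms unfolding kappa_max_def by auto
  with consts_pos show "\<kappa> \<le> c / 4" "\<kappa> * C1 \<le> 1 / 4" "\<kappa> * (2 * K * C1 + 7 * (2 * b + 1)) \<le> c2 / 2"
    by (simp_all add: field_simps)
qed

lemma A_e1: "x \<in> Q \<Longrightarrow> A e1 x = 0"
  by (rule A.null_left[OF e_in(1) _ e1_null])

lemma A_shift: "x \<in> Q \<Longrightarrow> A (t *\<^sub>R e1 + x) (t *\<^sub>R e1 + x) = A x x"
  using e_in A_e1[of x] A.sym[of x e1] by (simp add: A.quad_add A.scale_left A.scale_right e1_null)

section \<open>Minimizing the quartic energy over aligned unit vectors\<close>

context
  fixes N :: "'v \<Rightarrow> real" and \<kappa> :: real
  assumes \<kappa>: "0 < \<kappa>" "\<kappa> \<le> kappa_max"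
    and N_nonneg: "\<And>u. u \<in> Q \<Longrightarrow> 0 \<le> N u"
    and N_le: "\<And>u. u \<in> Q \<Longrightarrow> N u \<le> \<kappa> * p u u * B u u"
    and N_mid: "\<And>m d. m \<in> Q \<Longrightarrow> d \<in> Q \<Longrightarrow>
       N (m + d) + N (m - d) \<le> 2 * N m + 12 * \<kappa> * B m m * B d d + 2 * \<kappa> * (B d d)\<^sup>2"
    and N_scale: "\<And>t u. u \<in> Q \<Longrightarrow> N (t *\<^sub>R u) = t ^ 4 * N u"
    and N_cont: "\<And>u w. u \<in> Q \<Longrightarrow> w \<in> Q \<Longrightarrow>
       sqrt (N u) \<le> sqrt (N w) + sqrt (\<kappa> * B (u - w) (u - w) * B (u + w) (u + w))"
begin

definition J :: "'v \<Rightarrow> real" where "J u = A u u - N u"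

text \<open>The gap bounds \<open>B w w\<close> by the energy \<open>A u u\<close>, which is at most
  \<open>\<kappa> + N u\<close>. The circle closes because \<open>N_le\<close> is linear in
  \<open>B u u\<close> once \<open>p u u = 1\<close>; as \<open>B u u\<close> is not bounded
  beforehand, a bound by its square could not be absorbed.\<close>

lemma low_energy:
  assumes "u \<in> aligned" "J u \<le> \<kappa>"
  obtains \<alpha> w where "w \<in> Q" "u = \<alpha> *\<^sub>R e1 + w" "p e1 w = 0" "p e2 w = 0" "\<alpha> = p e1 u"
    "\<alpha>\<^sup>2 + p w w = 1" "\<alpha> \<ge> 1 / 2" "B w w \<le> \<kappa> * C1" "B w w \<le> 1 / 4" "p w w \<le> 1 / 4" "B u u \<le> 2 * b + 1"
proof -
  define \<alpha> where "\<alpha> = p e1 u"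
  define w where "w = u - \<alpha> *\<^sub>R e1"
  from assms have u: "u \<in> Q" "p u u = 1" "p e2 u = 0" "0 \<le> \<alpha>" unfolding aligned_def \<alpha>_def by auto
  have w: "w \<in> Q" and uw: "u = \<alpha> *\<^sub>R e1 + w" unfolding w_def using u e_in by auto
  have o: "p e1 w = 0" "p e2 w = 0"
    unfolding w_def using u e_in e1_norm e_orth P.sym[OF e_in] by (auto simp: P.bilinear \<alpha>_def)
  have unit: "\<alpha>\<^sup>2 + p w w = 1"
    using u(2) e_in w o e1_norm unfolding uw by (simp add: P.quad_add P.scale_left P.scale_right power2_eq_square)
  then have \<alpha>1: "\<alpha>\<^sup>2 \<le> 1" using P.nonneg[OF w] by linarith
  have Bu: "B u u \<le> 2 * b + 2 * B w w"
  proof -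
    have "B u u \<le> 2 * B (\<alpha> *\<^sub>R e1) (\<alpha> *\<^sub>R e1) + 2 * B w w"
      unfolding uw by (rule B.quad_add_le) (use e_in w in auto)
    also have "B (\<alpha> *\<^sub>R e1) (\<alpha> *\<^sub>R e1) = \<alpha>\<^sup>2 * b" using e_in by (simp add: B.quad_scale b_def)
    also have "\<dots> \<le> 1 * b" using \<alpha>1 b_ge by (intro mult_right_mono) auto
    finally show ?thesis by simp
  qed
  have "c * B w w \<le> A w w" by (rule gap[OF w o])
  also have "\<dots> = A u u" unfolding uw using A_shift[OF w] by simp
  also have "\<dots> \<le> \<kappa> + N u" using assms(2) unfolding J_def by simp
  also have "\<dots> \<le> \<kappa> + \<kappa> * B u u" using N_le[OF u(1)] u(2) by simp
  also have "\<dots> \<le> \<kappa> + \<kappa> * (2 * b + 2 * B w w)" using Bu \<kappa>(1) by simp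
  also have "\<dots> = \<kappa> * (2 * b + 1) + 2 * \<kappa> * B w w" by (simp add: algebra_simps)
  \<comment> \<open>Half of the gap is spent here, which accounts for the outer factor 2 in
    \<open>C1\<close>.\<close>
  also have "2 * \<kappa> * B w w \<le> (c / 2) * B w w"
    using kappa_max_le(1)[OF \<kappa>(2)] by (intro mult_right_mono B.nonneg w) simp
  finally have "c * B w w \<le> 2 * \<kappa> * (2 * b + 1)" by simp
  then have Bw: "B w w \<le> \<kappa> * C1" using c_pos unfolding C1_def by (simp add: field_simps)
  then have Bw': "B w w \<le> 1 / 4" using kappa_max_le(2)[OF \<kappa>(2)] by linarith
  then have pw: "p w w \<le> 1 / 4" using p_le[OF w] by linarith
  have "(1 / 2)\<^sup>2 \<le> \<alpha>\<^sup>2" using unit pw by (simp add: power2_eq_square)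
  then have "1 / 2 \<le> \<alpha>" using \<open>0 \<le> \<alpha>\<close> by (rule power2_le_imp_le)
  with w uw o unit Bw Bw' pw Bu show thesis by (intro that[of w \<alpha>]) (auto simp: \<alpha>_def)
qed

lemma J_lower: "u \<in> aligned \<Longrightarrow> - \<kappa> * (2 * b + 1) \<le> J u"
proof (cases "J u \<le> \<kappa>")
  case True
  assume u: "u \<in> aligned"
  then have uQ: "u \<in> Q" "p u u = 1" unfolding aligned_def by auto
  have "N u \<le> \<kappa> * B u u" using N_le[OF uQ(1)] uQ(2) by simp
  also have "\<dots> \<le> \<kappa> * (2 * b + 1)" using low_energy[OF u True] \<kappa>(1) by (metis mult_le_cancel_left_pos)
  finally show ?thesis using A.nonneg[OF uQ(1)] unfolding J_def by simp
next
  case False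
  have "\<kappa> * (2 * b + 1) \<ge> 0" using \<kappa>(1) b_ge by simp
  with False \<kappa>(1) show ?thesis by simp
qed

text \<open>\<open>A\<close> is convex at a definite rate in the direction \<open>d\<close>, and the
  second differences of \<open>N\<close> are of order \<open>\<kappa>\<close> times that rate. The
  midpoint \<open>m\<close> has lost the squared length \<open>p d d\<close>, and returning it to
  the sphere costs about \<open>p d d * A m m\<close>; low states are close to \<open>e1\<close>,
  where \<open>A\<close> vanishes, so \<open>A m m\<close> is itself of order
  \<open>\<kappa>\<close>.\<close>

lemma strong_convexity:
  assumes u: "u1 \<in> aligned" "u2 \<in> aligned" "J u1 \<le> \<kappa>" "J u2 \<le> \<kappa>"
    and I: "\<And>v. v \<in> aligned \<Longrightarrow> I \<le> J v"
  shows "c2 / 8 * B (u1 - u2) (u1 - u2) \<le> (J u1 + J u2) / 2 - I"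
proof -
  from low_energy[OF u(1,3)] obtain \<alpha>1 w1 where
    w1: "w1 \<in> Q" "u1 = \<alpha>1 *\<^sub>R e1 + w1" "p e1 w1 = 0" "p e2 w1 = 0" "\<alpha>1\<^sup>2 + p w1 w1 = 1" "\<alpha>1 \<ge> 1 / 2"
      "B w1 w1 \<le> \<kappa> * C1" "p w1 w1 \<le> 1 / 4" "B u1 u1 \<le> 2 * b + 1" by metis
  from low_energy[OF u(2,4)] obtain \<alpha>2 w2 where
    w2: "w2 \<in> Q" "u2 = \<alpha>2 *\<^sub>R e1 + w2" "p e1 w2 = 0" "p e2 w2 = 0" "\<alpha>2\<^sup>2 + p w2 w2 = 1" "\<alpha>2 \<ge> 1 / 2"
      "B w2 w2 \<le> \<kappa> * C1" "p w2 w2 \<le> 1 / 4" "B u2 u2 \<le> 2 * b + 1" by metis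
  have uQ: "u1 \<in> Q" "u2 \<in> Q" using u unfolding aligned_def by auto
  define m where "m = (1/2) *\<^sub>R (u1 + u2)"
  define d where "d = (1/2) *\<^sub>R (u1 - u2)"
  define wd where "wd = (1/2) *\<^sub>R (w1 - w2)"
  define \<beta> where "\<beta> = (\<alpha>1 - \<alpha>2) / 2"
  have Qs: "m \<in> Q" "d \<in> Q" "wd \<in> Q" unfolding m_def d_def wd_def using uQ w1(1) w2(1) by auto
  have d: "d = \<beta> *\<^sub>R e1 + wd"
    unfolding d_def wd_def \<beta>_def w1(2) w2(2) by (simp add: scaleR_diff_right scaleR_add_right scaleR_diff_left diff_divide_distrib)
  have "m + d = (1/2) *\<^sub>R (u1 + u1)" "m - d = (1/2) *\<^sub>R (u2 + u2)"
    unfolding m_def d_def by (simp_all add: scaleR_add_right scaleR_diff_right)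
  then have md: "m + d = u1" "m - d = u2" unfolding scaleR_half_double by auto
  have pwd: "p wd wd = p (w1 - w2) (w1 - w2) / 4"
    unfolding wd_def using w1(1) w2(1) by (simp add: P.quad_scale[OF P.diff_closed] power2_eq_square)
  \<comment> \<open>The gap sees only the part of \<open>d\<close> orthogonal to \<open>e1\<close>.
    The part along \<open>e1\<close> is recovered from the unit lengths: the product of
    \<open>\<alpha>1 - \<alpha>2\<close> and \<open>\<alpha>1 + \<alpha>2\<close> is
    \<open>p w2 w2 - p w1 w1\<close>, and the second factor is at least 1.\<close>
  have "1 \<le> (\<alpha>1 + \<alpha>2)\<^sup>2" using w1(6) w2(6) by (intro one_le_power) simp
  then have "(\<alpha>1 - \<alpha>2)\<^sup>2 \<le> (\<alpha>1 - \<alpha>2)\<^sup>2 * (\<alpha>1 + \<alpha>2)\<^sup>2"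
    using mult_left_mono[of 1 "(\<alpha>1 + \<alpha>2)\<^sup>2" "(\<alpha>1 - \<alpha>2)\<^sup>2"] by simp
  also have "\<dots> = (p (w1 - w2) (w1 + w2))\<^sup>2"
  proof -
    have "p (w1 - w2) (w1 + w2) = p w1 w1 - p w2 w2"
      using w1(1) w2(1) P.sym[OF w1(1) w2(1)] by (simp add: P.bilinear)
    also have "\<dots> = - ((\<alpha>1 - \<alpha>2) * (\<alpha>1 + \<alpha>2))" using w1(5) w2(5) by (simp add: algebra_simps power2_eq_square)
    finally show ?thesis by (simp add: power_mult_distrib)
  qed
  also have "\<dots> \<le> p (w1 - w2) (w1 - w2) * p (w1 + w2) (w1 + w2)"
    by (rule P.Cauchy_Schwarz) (use w1(1) w2(1) in auto)
  also have "\<dots> \<le> p (w1 - w2) (w1 - w2) * 1"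
  proof (rule mult_left_mono)
    show "p (w1 + w2) (w1 + w2) \<le> 1" using P.quad_add_le[OF w1(1) w2(1)] w1(8) w2(8) by linarith
  qed (use w1(1) w2(1) P.nonneg in auto)
  finally have \<beta>2: "\<beta>\<^sup>2 \<le> p wd wd" unfolding pwd \<beta>_def by (simp add: power_divide)
  have "B d d \<le> 2 * B (\<beta> *\<^sub>R e1) (\<beta> *\<^sub>R e1) + 2 * B wd wd"
    unfolding d by (rule B.quad_add_le) (use e_in Qs in auto)
  also have "B (\<beta> *\<^sub>R e1) (\<beta> *\<^sub>R e1) = \<beta>\<^sup>2 * b" using e_in by (simp add: B.quad_scale b_def)
  also have "\<dots> \<le> B wd wd * b" using \<beta>2 p_le[OF Qs(3)] b_ge by (intro mult_right_mono) auto
  finally have Bd: "B d d \<le> (2 * b + 2) * B wd wd" by (simp add: algebra_simps)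
  have owd: "p e1 wd = 0" "p e2 wd = 0"
    unfolding wd_def P.scale_right[OF e_in(1) P.diff_closed[OF w1(1) w2(1)]]
      P.scale_right[OF e_in(2) P.diff_closed[OF w1(1) w2(1)]]
      P.diff_right[OF w1(1) w2(1) e_in(1)] P.diff_right[OF w1(1) w2(1) e_in(2)]
    using w1(3,4) w2(3,4) by auto
  have Ad: "c2 * B d d \<le> A d d"
  proof -
    have "c2 * B d d \<le> c2 * ((2 * b + 2) * B wd wd)" using Bd consts_pos(2) by simp
    also have "\<dots> = c * B wd wd"
    proof -
      have "2 * b + 2 \<noteq> 0" using b_ge by linarith
      then have "c2 * (2 * b + 2) = c" unfolding c2_def by simp
      then show ?thesis by (simp add: mult.assoc[symmetric])
    qed
    also have "\<dots> \<le> A wd wd"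
      by (rule gap[OF Qs(3) owd])
    also have "\<dots> = A d d" unfolding d using A_shift[OF Qs(3)] by simp
    finally show ?thesis .
  qed
  have par: "X u1 u1 + X u2 u2 = 2 * X m m + 2 * X d d" if "psd_form Q X" for X
  proof -
    interpret X: psd_form Q X by fact
    show ?thesis using X.parallelogram[OF Qs(1,2)] unfolding md .
  qed
  have Bm: "B m m \<le> 2 * b + 1" and Bd': "B d d \<le> 2 * b + 1"
    using par[OF B.psd_form_axioms] w1(9) w2(9) B.nonneg[OF Qs(1)] B.nonneg[OF Qs(2)] by linarith+
  have "A u1 u1 = A w1 w1" "A u2 u2 = A w2 w2" unfolding w1(2) w2(2) using A_shift w1(1) w2(1) by auto
  then have "A m m \<le> (A w1 w1 + A w2 w2) / 2"
    using par[OF A.psd_form_axioms] A.nonneg[OF Qs(2)] by (simp add: field_simps)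
  also have "\<dots> \<le> (K * B w1 w1 + K * B w2 w2) / 2" using A_le[OF w1(1)] A_le[OF w2(1)] by simp
  also have "\<dots> \<le> (K * (\<kappa> * C1) + K * (\<kappa> * C1)) / 2"
    using w1(7) w2(7) K_nonneg by (intro divide_right_mono add_mono mult_left_mono) auto
  finally have Am: "A m m \<le> K * (\<kappa> * C1)" by simp
  have pm: "p m m = 1 - p d d" using par[OF P.psd_form_axioms] u unfolding aligned_def by simp
  have "p d d = \<beta>\<^sup>2 + p wd wd"
    unfolding d using e_in Qs(3) e1_norm owd(1) by (simp add: P.quad_add P.scale_left P.scale_right power2_eq_square)
  moreover have "p wd wd \<le> 1 / 4" unfolding pwd using P.quad_diff_le[OF w1(1) w2(1)] w1(8) w2(8) by linarith
  ultimately have pd: "p d d \<le> 1 / 2" using \<beta>2 by linarith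
  have pd0: "0 \<le> p d d" by (rule P.nonneg[OF Qs(2)])
  define s where "s = sqrt (p m m)"
  have s: "s > 0" "s\<^sup>2 = 1 - p d d" unfolding s_def using pm pd by auto
  have v: "(1 / s) *\<^sub>R m \<in> aligned"
  proof -
    have "p ((1 / s) *\<^sub>R m) ((1 / s) *\<^sub>R m) = (1 / s)\<^sup>2 * s\<^sup>2"
      unfolding P.quad_scale[OF Qs(1)] s(2) pm ..
    then have 1: "p ((1 / s) *\<^sub>R m) ((1 / s) *\<^sub>R m) = 1" using s(1) by (simp add: power_divide)
    have "p e2 m = 0" "0 \<le> p e1 m"
      unfolding m_def P.scale_right[OF e_in(1) P.add_closed[OF uQ]] P.scale_right[OF e_in(2) P.add_closed[OF uQ]]
        P.add_right[OF uQ e_in(1)] P.add_right[OF uQ e_in(2)]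
      using u(1,2) unfolding aligned_def by auto
    then have "p e2 ((1 / s) *\<^sub>R m) = 0" "0 \<le> p e1 ((1 / s) *\<^sub>R m)"
      unfolding P.scale_right[OF e_in(1) Qs(1)] P.scale_right[OF e_in(2) Qs(1)] using s(1) by auto
    with 1 show ?thesis unfolding aligned_def using P.scale_closed[OF Qs(1)] by blast
  qed
  \<comment> \<open>Normalization divides \<open>A\<close> by \<open>s\<^sup>2\<close> and
    \<open>N\<close> by \<open>s ^ 4\<close>. For \<open>A\<close> the factor costs at most
    \<open>2 * p d d\<close>, as \<open>p d d \<le> 1 / 2\<close>; for \<open>N\<close> it is at
    least 1 and may be dropped, since \<open>N\<close> enters with a minus sign.\<close>
  have "I \<le> J ((1 / s) *\<^sub>R m)" by (rule I[OF v])
  also have "\<dots> = (1 / s\<^sup>2) * A m m - (1 / s\<^sup>2)\<^sup>2 * N m"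
    unfolding J_def using Qs by (simp add: A.quad_scale N_scale power_divide)
  also have "\<dots> \<le> (1 + 2 * p d d) * A m m - 1 * N m"
  proof (intro diff_mono mult_right_mono A.nonneg N_nonneg Qs)
    have pos: "1 - p d d > 0" using pd by simp
    have "p d d * (2 * p d d) \<le> p d d * 1" using pd pd0 by (intro mult_left_mono) auto
    then have "1 \<le> (1 + 2 * p d d) * (1 - p d d)" by (simp add: algebra_simps)
    then show "1 / s\<^sup>2 \<le> 1 + 2 * p d d" unfolding s(2) pos_divide_le_eq[OF pos] .
    have "1 \<le> 1 / s\<^sup>2" unfolding s(2) pos_le_divide_eq[OF pos] using pd0 by simp
    then show "1 \<le> (1 / s\<^sup>2)\<^sup>2" by (rule one_le_power)
  qed
  also have "(1 + 2 * p d d) * A m m \<le> A m m + 2 * (B d d * (K * (\<kappa> * C1)))"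
    using mult_mono[OF p_le[OF Qs(2)] Am B.nonneg[OF Qs(2)] A.nonneg[OF Qs(1)]] by (simp add: algebra_simps)
  finally have 1: "I \<le> A m m + 2 * (B d d * (K * (\<kappa> * C1))) - N m" by simp
  have "N u1 + N u2 \<le> 2 * N m + 12 * \<kappa> * B m m * B d d + 2 * \<kappa> * (B d d)\<^sup>2"
    using N_mid[OF Qs(1,2)] unfolding md .
  also have "12 * \<kappa> * B m m * B d d \<le> 12 * \<kappa> * (2 * b + 1) * B d d"
    using Bm \<kappa>(1) by (intro mult_right_mono mult_left_mono B.nonneg Qs) auto
  also have "2 * \<kappa> * (B d d)\<^sup>2 \<le> 2 * \<kappa> * ((2 * b + 1) * B d d)"
    unfolding power2_eq_square using Bd' \<kappa>(1) by (intro mult_right_mono mult_left_mono B.nonneg Qs) auto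
  finally have 2: "N u1 + N u2 \<le> 2 * N m + 14 * (\<kappa> * (2 * b + 1) * B d d)" by (simp add: algebra_simps)
  have 3: "A u1 u1 + A u2 u2 = 2 * A m m + 2 * A d d" by (rule par[OF A.psd_form_axioms])
  \<comment> \<open>The 7 is half of 14, the sum of the coefficients 12 and 2 in
    \<open>N_mid\<close>. This combination is the one for which the last threshold in
    \<open>kappa_max\<close> is made.\<close>
  have "\<kappa> * (2 * K * C1 + 7 * (2 * b + 1)) * B d d \<le> c2 / 2 * B d d"
    by (intro mult_right_mono kappa_max_le(3)[OF \<kappa>(2)] B.nonneg Qs)
  then have 4: "2 * (B d d * (K * (\<kappa> * C1))) + 7 * (\<kappa> * (2 * b + 1) * B d d) \<le> c2 / 2 * B d d"
    by (simp add: algebra_simps)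
  have "c2 * B d d \<le> (J u1 + J u2) - 2 * I"
    using 1 2 3 4 Ad unfolding J_def by linarith
  then have "c2 / 2 * B d d \<le> (J u1 + J u2) / 2 - I" by (simp add: field_simps)
  moreover have "B d d = B (u1 - u2) (u1 - u2) / 4"
    unfolding d_def using uQ by (simp add: B.quad_scale[OF B.diff_closed] power2_eq_square)
  ultimately show ?thesis by simp
qed

text \<open>Strong convexity relative to the infimum \<open>I\<close> takes the place of
  compactness: the squared form distance of two low states is bounded by how far their energies
  exceed \<open>I\<close>. So a minimizing sequence converges in form norm, and two minimizers
  differ by a null vector.\<close>

theorem unique_aligned_minimizer:
  "\<exists>l\<in>aligned. 0 < p e1 l \<and> (\<forall>v\<in>aligned. J l \<le> J v) \<and>
     (\<forall>v\<in>aligned. (\<forall>v'\<in>aligned. J v \<le> J v') \<longrightarrow> p (v - l) (v - l) = 0)"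
proof -
  define I where "I = (INF u\<in>aligned. J u)"
  have e1: "e1 \<in> aligned" unfolding aligned_def using e_in e1_norm e_orth P.sym[OF e_in] by simp
  have bdd: "bdd_below (J ` aligned)" by (rule bdd_belowI2) (rule J_lower)
  have I: "I \<le> J v" if "v \<in> aligned" for v unfolding I_def by (rule cINF_lower[OF bdd that])
  have Je1: "J e1 \<le> 0" unfolding J_def using e1_null N_nonneg[OF e_in(1)] by simp
  then have I0: "I \<le> 0" using I[OF e1] by linarith
  \<comment> \<open>Since \<open>I \<le> 0\<close>, the minimum with \<open>\<kappa>\<close> puts
    the whole sequence, and not only its tail, into the range of \<open>low_energy\<close>.\<close>
  have "\<exists>u. u \<in> aligned \<and> J u < I + min \<kappa> (1 / Suc n)" for n
    using cINF_less_iff[OF _ bdd, of "I + min \<kappa> (1 / Suc n)"] e1 \<kappa>(1) unfolding I_def by auto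
  then obtain u where uA: "\<And>n. u n \<in> aligned" and Ju: "\<And>n. J (u n) < I + min \<kappa> (1 / Suc n)" by metis
  have Ju': "J (u n) \<le> \<kappa>" "J (u n) \<le> I + 1 / Suc n" for n using Ju[of n] I0 by (auto simp: min_def split: if_splits)
  have uQ: "u n \<in> Q" for n using uA unfolding aligned_def by auto
  have conv: "c2 / 8 * B (u m - u n) (u m - u n) \<le> (1 / Suc m + 1 / Suc n) / 2" for m n
  proof -
    have "c2 / 8 * B (u m - u n) (u m - u n) \<le> (J (u m) + J (u n)) / 2 - I"
      by (rule strong_convexity[OF uA uA Ju'(1) Ju'(1) I])
    moreover have "X \<le> (j1 + j2) / 2 - I \<Longrightarrow> j1 \<le> I + x \<Longrightarrow> j2 \<le> I + y \<Longrightarrow> X \<le> (x + y) / 2"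
      for X j1 j2 x y :: real by (simp add: field_simps)
    ultimately show ?thesis using Ju'(2)[of m] Ju'(2)[of n] by blast
  qed
  have "\<exists>N. \<forall>m\<ge>N. \<forall>n\<ge>N. B (u m - u n) (u m - u n) < e" if "e > 0" for e
  proof -
    have "c2 / 8 * e > 0" using that consts_pos by simp
    then obtain N where N: "1 / Suc N < c2 / 8 * e"
      using reals_Archimedean[of "c2 / 8 * e"] by (auto simp: inverse_eq_divide)
    show ?thesis
    proof (intro exI[of _ N] allI impI)
      fix m n assume "N \<le> m" "N \<le> n"
      then have "1 / Suc m \<le> 1 / Suc N" "1 / Suc n \<le> 1 / Suc N" by (auto intro!: divide_left_mono)
      moreover have "X \<le> (x + y) / 2 \<Longrightarrow> x \<le> z \<Longrightarrow> y \<le> z \<Longrightarrow> z < v \<Longrightarrow> X < v" for X x y z v :: real by simp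
      ultimately have "c2 / 8 * B (u m - u n) (u m - u n) < c2 / 8 * e" using conv[of m n] N by blast
      then show "B (u m - u n) (u m - u n) < e" using consts_pos(2) by simp
    qed
  qed
  from complete_formD[OF complete uQ this]
  obtain l where l: "l \<in> Q" "(\<lambda>n. B (u n - l) (u n - l)) \<longlonglongrightarrow> 0" by blast
  have Bl: "(\<lambda>n. B (u n) (u n)) \<longlonglongrightarrow> B l l" by (rule B.tendsto_quad[OF uQ l])
  have pl: "(\<lambda>n. p (u n - l) (u n - l)) \<longlonglongrightarrow> 0"
    by (rule tendsto_sandwich[OF _ _ tendsto_const l(2)])
      (intro always_eventually allI P.nonneg p_le P.diff_closed uQ l(1))+
  have "(\<lambda>n. K * B (u n - l) (u n - l)) \<longlonglongrightarrow> K * 0" by (intro tendsto_intros l(2))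
  then have Kl: "(\<lambda>n. K * B (u n - l) (u n - l)) \<longlonglongrightarrow> 0" by simp
  have Al: "(\<lambda>n. A (u n - l) (u n - l)) \<longlonglongrightarrow> 0"
    by (rule tendsto_sandwich[OF _ _ tendsto_const Kl])
      (intro always_eventually allI A.nonneg A_le P.diff_closed uQ l(1))+
  have lA: "l \<in> aligned"
  proof -
    have "(\<lambda>n. p (u n) (u n)) \<longlonglongrightarrow> p l l" by (rule P.tendsto_quad[OF uQ l(1) pl])
    moreover have "p (u n) (u n) = 1" for n using uA unfolding aligned_def by auto
    ultimately have "p l l = 1" by (simp add: LIMSEQ_const_iff)
    moreover have "(\<lambda>n. p (u n) e2) \<longlonglongrightarrow> p l e2" by (rule P.tendsto_pairing[OF uQ l(1) e_in(2) pl])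
    moreover have "p (u n) e2 = 0" for n using uA P.sym[OF e_in(2) uQ] unfolding aligned_def by auto
    ultimately have "p l e2 = 0" by (simp add: LIMSEQ_const_iff)
    moreover have "0 \<le> p l e1"
    proof (rule LIMSEQ_le_const)
      show "(\<lambda>n. p (u n) e1) \<longlonglongrightarrow> p l e1" by (rule P.tendsto_pairing[OF uQ l(1) e_in(1) pl])
      show "\<exists>N. \<forall>n\<ge>N. 0 \<le> p (u n) e1" using uA P.sym[OF e_in(1) uQ] unfolding aligned_def by auto
    qed
    ultimately show ?thesis
      using \<open>p l l = 1\<close> l(1) P.sym[OF l(1) e_in(1)] P.sym[OF l(1) e_in(2)] unfolding aligned_def by simp
  qed
  \<comment> \<open>\<open>N_cont\<close> bounds \<open>N (u n)\<close> from above by the value at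
    the limit plus a vanishing error, which is the direction in which \<open>J l \<le> I\<close>
    follows.\<close>
  define R where "R n = sqrt (\<kappa> * B (u n - l) (u n - l) * B (u n + l) (u n + l))" for n
  have "(\<lambda>n. B (u n + l) (u n + l)) \<longlonglongrightarrow> B l l + 2 * B l l + B l l"
    unfolding B.quad_add[OF uQ l(1)]
    by (intro tendsto_add tendsto_mult tendsto_const Bl B.tendsto_pairing[OF uQ l(1) l(1) l(2)])
  from tendsto_real_sqrt[OF tendsto_mult[OF tendsto_mult[OF tendsto_const[of \<kappa>] l(2)] this]]
  have R: "R \<longlonglongrightarrow> 0" unfolding R_def by simp
  have lim: "(\<lambda>n. A (u n) (u n) - (sqrt (N l) + R n)\<^sup>2) \<longlonglongrightarrow> A l l - (sqrt (N l) + 0)\<^sup>2"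
    by (intro tendsto_diff tendsto_power tendsto_add tendsto_const R A.tendsto_quad[OF uQ l(1) Al])
  have lim': "(\<lambda>n. I + 1 / real (Suc n)) \<longlonglongrightarrow> I + 0"
    by (intro tendsto_add tendsto_const LIMSEQ_Suc[OF lim_1_over_n])
  have "A (u n) (u n) - (sqrt (N l) + R n)\<^sup>2 \<le> I + 1 / real (Suc n)" for n
  proof -
    have "(sqrt (N (u n)))\<^sup>2 \<le> (sqrt (N l) + R n)\<^sup>2"
      unfolding R_def by (rule power_mono[OF N_cont[OF uQ l(1)]]) (simp add: N_nonneg[OF uQ])
    moreover have "(sqrt (N (u n)))\<^sup>2 = N (u n)" by (rule real_sqrt_pow2[OF N_nonneg[OF uQ]])
    ultimately show ?thesis using Ju'(2)[of n] unfolding J_def by linarith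
  qed
  then have "A l l - (sqrt (N l) + 0)\<^sup>2 \<le> I + 0" by (intro LIMSEQ_le[OF lim lim']) blast
  then have "J l \<le> I" unfolding J_def using N_nonneg[OF l(1)] by simp
  then have Jl: "J l \<le> J v" if "v \<in> aligned" for v using I[OF that] by linarith
  have Jl\<kappa>: "J l \<le> \<kappa>" using Jl[OF e1] Je1 \<kappa>(1) by linarith
  have "0 < p e1 l" by (rule low_energy[OF lA Jl\<kappa>]) simp
  moreover have "p (v - l) (v - l) = 0" if v: "v \<in> aligned" and min: "\<forall>v'\<in>aligned. J v \<le> J v'" for v
  proof -
    have vQ: "v \<in> Q" using v unfolding aligned_def by auto
    have "J v = J l" using min Jl[OF v] lA by force
    then have "c2 / 8 * B (v - l) (v - l) \<le> 0"
      using strong_convexity[OF v lA _ Jl\<kappa> I] Jl\<kappa> \<open>J l \<le> I\<close> by simp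
    then have "B (v - l) (v - l) \<le> 0" using consts_pos(2) by (simp add: mult_le_0_iff)
    then show ?thesis using p_le[of "v - l"] P.nonneg[of "v - l"] vQ l(1) by force
  qed
  ultimately show ?thesis using lA Jl by blast
qed

end

end

section \<open>Test functions\<close>

lemma partial_deriv_eq:
  assumes "(f has_derivative f') (at x)"
  shows "partial_deriv i f x = f' (axis i 1)"
  unfolding partial_deriv_def using frechet_derivative_at[OF assms] by simp

lemma has_derivative_frechet: "f differentiable (at x) \<Longrightarrow> (f has_derivative frechet_derivative f (at x)) (at x)"
  using frechet_derivative_works by blast

lemma C_k_SucD:
  assumes "C_k (Suc n) f"
  shows "C_k n f" "C_k n (partial_deriv i f)" "f differentiable (at x)"
proof -
  show "C_k n (partial_deriv i f)" "f differentiable (at x)"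
    using assms by (auto simp: differentiable_on_def)
  show "C_k n f" using assms
  proof (induction n arbitrary: f)
    case 0
    then show ?case by (simp add: differentiable_imp_continuous_on)
  next
    case (Suc n)
    then have "C_k (Suc n) (partial_deriv i f)" for i by simp
    then have "C_k n (partial_deriv i f)" for i by (rule Suc.IH)
    with Suc.prems show ?case by simp
  qed
qed

lemma C_k_add: "C_k n f \<Longrightarrow> C_k n g \<Longrightarrow> C_k n (\<lambda>x. f x + g x)"
proof (induction n arbitrary: f g)
  case 0
  then show ?case by (simp add: continuous_on_add)
next
  case (Suc n)
  have "partial_deriv i (\<lambda>x. f x + g x) = (\<lambda>x. partial_deriv i f x + partial_deriv i g x)" for i
  proof
    fix x
    have "((\<lambda>x. f x + g x) has_derivative (\<lambda>h. frechet_derivative f (at x) h + frechet_derivative g (at x) h)) (at x)"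
      by (intro has_derivative_add has_derivative_frechet C_k_SucD(3)[OF Suc.prems(1)] C_k_SucD(3)[OF Suc.prems(2)])
    from partial_deriv_eq[OF this] show "partial_deriv i (\<lambda>x. f x + g x) x = partial_deriv i f x + partial_deriv i g x"
      unfolding partial_deriv_def .
  qed
  moreover have "C_k n (\<lambda>x. partial_deriv i f x + partial_deriv i g x)" for i
    by (rule Suc.IH[OF C_k_SucD(2)[OF Suc.prems(1)] C_k_SucD(2)[OF Suc.prems(2)]])
  ultimately show ?case using Suc.prems by (simp add: differentiable_on_add)
qed

lemma C_k_mult: "C_k n f \<Longrightarrow> C_k n g \<Longrightarrow> C_k n (\<lambda>x. f x * g x)"
proof (induction n arbitrary: f g)
  case 0
  then show ?case by (simp add: continuous_on_mult)
next
  case (Suc n)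
  have "partial_deriv i (\<lambda>x. f x * g x) = (\<lambda>x. f x * partial_deriv i g x + partial_deriv i f x * g x)" for i
  proof
    fix x
    have "((\<lambda>x. f x * g x) has_derivative (\<lambda>h. f x * frechet_derivative g (at x) h + frechet_derivative f (at x) h * g x)) (at x)"
      by (intro has_derivative_mult has_derivative_frechet C_k_SucD(3)[OF Suc.prems(1)] C_k_SucD(3)[OF Suc.prems(2)])
    from partial_deriv_eq[OF this] show "partial_deriv i (\<lambda>x. f x * g x) x = f x * partial_deriv i g x + partial_deriv i f x * g x"
      unfolding partial_deriv_def .
  qed
  moreover have "C_k n (\<lambda>x. f x * partial_deriv i g x + partial_deriv i f x * g x)" for i
    by (intro C_k_add Suc.IH C_k_SucD[OF Suc.prems(1)] C_k_SucD[OF Suc.prems(2)])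
  ultimately show ?case using Suc.prems by (simp add: differentiable_on_mult)
qed

lemma C_k_const: "C_k n (\<lambda>x. c)"
proof (induction n arbitrary: c)
  case (Suc n)
  have "partial_deriv i (\<lambda>x. c) = (\<lambda>x. 0)" for i
    by (rule ext) (simp add: partial_deriv_eq[OF has_derivative_const])
  with Suc show ?case by (simp add: differentiable_on_const)
qed (simp add: continuous_on_const)

lemma C_k_prod: "finite I \<Longrightarrow> (\<And>i. i \<in> I \<Longrightarrow> C_k n (f i)) \<Longrightarrow> C_k n (\<lambda>x. \<Prod>i\<in>I. f i x)"
  by (induction I rule: finite_induct) (auto intro!: C_k_mult C_k_const)

lemma C_k_shift: "C_k n f \<Longrightarrow> C_k n (\<lambda>x. f (x + c))"
  and partial_deriv_shift: "(\<And>x. f differentiable (at x)) \<Longrightarrow> partial_deriv i (\<lambda>x. f (x + c)) = (\<lambda>x. partial_deriv i f (x + c))"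
proof -
  have deriv: "((\<lambda>x. f (x + c)) has_derivative frechet_derivative f (at (x + c))) (at x)"
    if "\<And>x. f differentiable (at x)" for f :: "R3 \<Rightarrow> real" and x
  proof -
    have "((\<lambda>x. x + c) has_derivative (\<lambda>h. h)) (at x)"
      by (auto intro!: derivative_eq_intros)
    from has_derivative_compose[OF this has_derivative_frechet[OF that]] show ?thesis .
  qed
  show shift: "partial_deriv i (\<lambda>x. f (x + c)) = (\<lambda>x. partial_deriv i f (x + c))"
    if "\<And>x. f differentiable (at x)" for f i
    by (rule ext) (simp add: partial_deriv_eq[OF deriv[OF that]] partial_deriv_def)
  show "C_k n f \<Longrightarrow> C_k n (\<lambda>x. f (x + c))"
  proof (induction n arbitrary: f)
    case 0
    then show ?case by (auto intro!: continuous_on_compose2[of UNIV f] continuous_intros)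
  next
    case (Suc n)
    have "(\<lambda>x. f (x + c)) differentiable_on UNIV"
      using deriv[OF C_k_SucD(3)[OF Suc.prems]] by (auto simp: differentiable_on_def differentiable_def)
    moreover have "C_k n (partial_deriv i (\<lambda>x. f (x + c)))" for i
      unfolding shift[OF C_k_SucD(3)[OF Suc.prems]] by (rule Suc.IH[OF C_k_SucD(2)[OF Suc.prems]])
    ultimately show ?case by simp
  qed
qed

text \<open>\<open>D k\<close> is the \<open>k\<close>-th derivative of \<open>D 0\<close>. The
  whole sequence is carried along because each partial derivative raises \<open>k\<close> by one and
  multiplies by a constant, so the induction has to hold for all \<open>k\<close> at once.\<close>

lemma C_k_coordinate:
  fixes D :: "nat \<Rightarrow> real \<Rightarrow> real"
  assumes "\<And>k t. (D k has_real_derivative D (Suc k) t) (at t)"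
  shows "C_k n (\<lambda>x. D k (c * (x $ i) + d))"
proof (induction n arbitrary: k)
  have deriv: "((\<lambda>x::R3. D k (c * (x $ i) + d)) has_derivative (\<lambda>h. D (Suc k) (c * (x $ i) + d) * (c * (h $ i)))) (at x)" for k x
  proof -
    have "(D k has_derivative (*) (D (Suc k) (c * (x $ i) + d))) (at (c * (x $ i) + d))"
      using assms[of k] unfolding has_field_derivative_def .
    moreover have "((\<lambda>x::R3. c * (x $ i) + d) has_derivative (\<lambda>h. c * (h $ i))) (at x)"
      by (intro has_derivative_add_const has_derivative_mult_right bounded_linear_imp_has_derivative bounded_linear_vec_nth)
    ultimately show ?thesis using has_derivative_compose by blast
  qed
  have diff: "(\<lambda>x::R3. D k (c * (x $ i) + d)) differentiable_on UNIV" for k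
    using deriv by (auto simp: differentiable_on_def differentiable_def)
  {
    case 0
    show ?case using differentiable_imp_continuous_on[OF diff] by simp
  next
    case (Suc n)
    have "partial_deriv j (\<lambda>x. D k (c * (x $ i) + d)) = (\<lambda>x. D (Suc k) (c * (x $ i) + d) * (c * (axis j 1 $ i)))" for j
      by (rule ext) (rule partial_deriv_eq[OF deriv])
    then show ?case using diff C_k_mult[OF Suc.IH C_k_const] by simp
  }
qed

section \<open>Smooth bumps approximating indicators of boxes\<close>

definition flat_step :: "real \<Rightarrow> real poly \<Rightarrow> real \<Rightarrow> real" where
  "flat_step m q t = (if t > 0 then poly q (1 / t) * exp (- (1 / (m * t))) else 0)"

lemma poly_exp_tendsto_0:
  fixes m :: real and q :: "real poly"
  assumes "m > 0"
  shows "((\<lambda>s. poly q s * exp (- (s / m))) \<longlongrightarrow> 0) at_top"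
proof -
  have pow: "((\<lambda>s. s ^ k * exp (- (s / m))) \<longlongrightarrow> 0) at_top" for k
  proof -
    have "LIM s at_top. (1 / m) * s :> at_top"
      by (rule filterlim_tendsto_pos_mult_at_top[where c="1 / m"]) (use assms in \<open>auto intro: filterlim_ident\<close>)
    from filterlim_compose[OF tendsto_power_div_exp_0[of k] this]
    have "((\<lambda>s. m ^ k * (((1 / m) * s) ^ k / exp ((1 / m) * s))) \<longlongrightarrow> m ^ k * 0) at_top"
      by (intro tendsto_mult tendsto_const)
    moreover have "m ^ k * (((1 / m) * s) ^ k / exp ((1 / m) * s)) = s ^ k * exp (- (s / m))" for s
    proof -
      have "m ^ k * ((1 / m) * s) ^ k = s ^ k" using assms by (simp flip: power_mult_distrib)
      moreover have "exp (- (s / m)) = 1 / exp ((1 / m) * s)" by (simp add: exp_minus divide_inverse mult.commute)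
      ultimately show ?thesis by simp
    qed
    ultimately show ?thesis by simp
  qed
  have "((\<lambda>s. \<Sum>i\<le>degree q. coeff q i * (s ^ i * exp (- (s / m)))) \<longlongrightarrow> (\<Sum>i\<le>degree q. coeff q i * 0)) at_top"
    by (intro tendsto_sum tendsto_mult tendsto_const pow)
  then show ?thesis by (simp add: poly_altdef sum_distrib_right mult.assoc)
qed

text \<open>With \<open>s = 1 / t\<close>, the derivative in \<open>t\<close> of
  \<open>q(s) exp (- s / m)\<close> is \<open>s\<^sup>2 (q(s) / m - q'(s)) exp (- s / m)\<close>.
  Functions of this shape are closed under differentiation, so smoothness at 0 reduces to one first
  derivative.\<close>

definition flat_step_deriv :: "real \<Rightarrow> real poly \<Rightarrow> real poly" where
  "flat_step_deriv m q = monom 1 2 * (smult (1 / m) q - pderiv q)"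

lemma flat_step_has_derivative:
  assumes "m > 0"
  shows "(flat_step m q has_real_derivative flat_step m (flat_step_deriv m q) t) (at t)"
proof -
  consider "t > 0" | "t < 0" | "t = 0" by linarith
  then show ?thesis
  proof cases
    case 1
    have "((\<lambda>t. poly q (1 / t) * exp (- (1 / (m * t)))) has_real_derivative
      flat_step m (flat_step_deriv m q) t) (at t)"
    proof -
      have inv: "((\<lambda>t. 1 / t) has_real_derivative - (1 / t)\<^sup>2) (at t)"
        using DERIV_inverse[of t UNIV] 1 by (simp add: inverse_eq_divide power2_eq_square)
      have "((\<lambda>t. poly q (1 / t)) has_real_derivative poly (pderiv q) (1 / t) * - (1 / t)\<^sup>2) (at t)"
        by (rule DERIV_chain2[OF poly_DERIV inv])
      moreover have "((\<lambda>t. exp (- (1 / m) * (1 / t))) has_real_derivative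
          exp (- (1 / m) * (1 / t)) * (- (1 / m) * - (1 / t)\<^sup>2)) (at t)"
        by (rule DERIV_chain2[OF DERIV_exp DERIV_cmult[OF inv]])
      ultimately have "((\<lambda>t. poly q (1 / t) * exp (- (1 / m) * (1 / t))) has_real_derivative
          poly (pderiv q) (1 / t) * - (1 / t)\<^sup>2 * exp (- (1 / m) * (1 / t)) +
          exp (- (1 / m) * (1 / t)) * (- (1 / m) * - (1 / t)\<^sup>2) * poly q (1 / t)) (at t)"
        by (rule DERIV_mult)
      moreover have "poly (pderiv q) (1 / t) * - (1 / t)\<^sup>2 * exp (- (1 / m) * (1 / t)) +
          exp (- (1 / m) * (1 / t)) * (- (1 / m) * - (1 / t)\<^sup>2) * poly q (1 / t)
          = flat_step m (flat_step_deriv m q) t"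
        using 1 by (simp add: flat_step_def flat_step_deriv_def poly_monom algebra_simps)
      ultimately show ?thesis by simp
    qed
    then show ?thesis
      by (rule has_field_derivative_transform_within_open[of _ _ _ "{0<..}"]) (use 1 in \<open>auto simp: flat_step_def\<close>)
  next
    case 2
    have "((\<lambda>t. 0) has_real_derivative flat_step m (flat_step_deriv m q) t) (at t)"
      using 2 by (simp add: flat_step_def)
    then show ?thesis
      by (rule has_field_derivative_transform_within_open[of _ _ _ "{..<0}"]) (use 2 in \<open>auto simp: flat_step_def\<close>)
  next
    case 3
    have "((\<lambda>h. flat_step m q h / h) \<longlongrightarrow> 0) (at_right 0)"
    proof -
      have "filterlim (\<lambda>h::real. 1 / h) at_top (at_right 0)"
        using filterlim_inverse_at_top_right by (simp add: inverse_eq_divide)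
      \<comment> \<open>\<open>pCons 0 q\<close> is \<open>s * q(s)\<close>; the additional factor
        \<open>s\<close> is the division by \<open>h = 1 / s\<close> in the difference
        quotient.\<close>
      from filterlim_compose[OF poly_exp_tendsto_0[OF assms, of "pCons 0 q"] this]
      show ?thesis
        by (rule Lim_transform_eventually)
          (use eventually_at_right_less[of "0::real"] in eventually_elim, simp add: flat_step_def)
    qed
    moreover have "((\<lambda>h. flat_step m q h / h) \<longlongrightarrow> 0) (at_left 0)"
      by (rule Lim_transform_eventually[OF tendsto_const])
        (use eventually_at_left_real[of "-1" "0::real"] in \<open>auto simp: flat_step_def elim!: eventually_mono\<close>)
    ultimately have "((\<lambda>h. flat_step m q h / h) \<longlongrightarrow> 0) (at 0)" by (rule filterlim_split_at_real[rotated])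
    then show ?thesis unfolding 3 DERIV_def by (simp add: flat_step_def)
  qed
qed

definition box_bump :: "real \<Rightarrow> R3 \<Rightarrow> R3 \<Rightarrow> R3 \<Rightarrow> real" where
  "box_bump m a b x = (\<Prod>i\<in>UNIV. flat_step m 1 (x $ i - a $ i) * flat_step m 1 (b $ i - x $ i))"

lemma flat_step_bounds: "m > 0 \<Longrightarrow> 0 \<le> flat_step m 1 t \<and> flat_step m 1 t \<le> 1"
  by (simp add: flat_step_def)

lemma box_bump_bounds: "m > 0 \<Longrightarrow> 0 \<le> box_bump m a b x \<and> box_bump m a b x \<le> indicator (box a b) x"
proof (cases "x \<in> box a b")
  case True
  assume "m > 0"
  then show ?thesis
    unfolding box_bump_def using True flat_step_bounds[OF \<open>m > 0\<close>]
    by (auto intro!: prod_nonneg prod_le_1 mult_nonneg_nonneg mult_le_one)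
next
  case False
  then obtain i where "\<not> (a $ i < x $ i \<and> x $ i < b $ i)" by (auto simp: mem_box_cart)
  then have "flat_step m 1 (x $ i - a $ i) * flat_step m 1 (b $ i - x $ i) = 0"
    by (auto simp: flat_step_def)
  then have "box_bump m a b x = 0" unfolding box_bump_def by (intro prod_zero) auto
  then show ?thesis using False by simp
qed

lemma box_bump_test:
  assumes "m > 0" shows "box_bump m a b \<in> test_functions"
proof -
  define D where "D k = flat_step m ((flat_step_deriv m ^^ k) 1)" for k
  have D: "(D k has_real_derivative D (Suc k) t) (at t)" for k t
    unfolding D_def using flat_step_has_derivative[OF assms] by simp
  have "C_k n (box_bump m a b)" for n
  proof -
    have "C_k n (\<lambda>x. \<Prod>i\<in>UNIV. D 0 (1 * (x $ i) + (- a $ i)) * D 0 ((-1) * (x $ i) + b $ i))"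
      by (intro C_k_prod C_k_mult C_k_coordinate D finite)
    then show ?thesis unfolding box_bump_def D_def by (simp add: fun_eq_iff)
  qed
  moreover have "compact (closure {x. box_bump m a b x \<noteq> 0})"
  proof -
    have "x \<in> cbox a b" if "box_bump m a b x \<noteq> 0" for x
      using box_bump_bounds[OF assms, of a b x] that box_subset_cbox[of a b] by (cases "x \<in> box a b") auto
    then have "closure {x. box_bump m a b x \<noteq> 0} \<subseteq> cbox a b" by (intro closure_minimal) auto
    then show ?thesis
      using compact_Int_closed[OF compact_cbox closed_closure, of a b "{x. box_bump m a b x \<noteq> 0}"]
      by (simp add: Int_absorb1)
  qed
  ultimately show ?thesis unfolding test_functions_def by blast
qed

lemma box_bump_tendsto: "(\<lambda>n. box_bump (real (Suc n)) a b x) \<longlonglongrightarrow> indicator (box a b) x"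
proof -
  have step: "(\<lambda>n. flat_step (real (Suc n)) 1 t) \<longlonglongrightarrow> (if t > 0 then 1 else 0)" for t
  proof (cases "t > 0")
    case True
    have "(\<lambda>n. exp (- ((1 / t) * (1 / real (Suc n))))) \<longlonglongrightarrow> exp (- ((1 / t) * 0))"
      by (intro tendsto_exp tendsto_minus tendsto_mult tendsto_const LIMSEQ_Suc[OF lim_1_over_n])
    moreover have "exp (- ((1 / t) * (1 / real (Suc n)))) = flat_step (real (Suc n)) 1 t" for n
      using True unfolding flat_step_def by (simp add: mult.commute)
    ultimately show ?thesis using True by simp
  qed (simp add: flat_step_def)
  have "(\<lambda>n. box_bump (real (Suc n)) a b x) \<longlonglongrightarrow>
      (\<Prod>i\<in>UNIV. (if x $ i - a $ i > 0 then 1 else 0) * (if b $ i - x $ i > 0 then 1 else 0))"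
    unfolding box_bump_def by (intro tendsto_prod tendsto_mult step)
  also have "(\<Prod>i\<in>UNIV. (if x $ i - a $ i > 0 then 1 else 0) * (if b $ i - x $ i > 0 then 1 else 0))
      = (indicator (box a b) x :: real)"
  proof (cases "x \<in> box a b")
    case False
    then obtain i where "\<not> (a $ i < x $ i \<and> x $ i < b $ i)" by (auto simp: mem_box_cart)
    then show ?thesis using False by (auto intro!: prod_zero)
  qed (auto simp: mem_box_cart)
  finally show ?thesis .
qed

lemma test_function_shift: "\<phi> \<in> test_functions \<Longrightarrow> (\<lambda>x. \<phi> (x + c)) \<in> test_functions"
proof -
  assume \<phi>: "\<phi> \<in> test_functions"
  define S where "S = {x. \<phi> x \<noteq> 0}"
  have "{x. \<phi> (x + c) \<noteq> 0} = (\<lambda>x. - c + x) ` S"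
  proof (intro set_eqI iffI)
    fix x assume "x \<in> {x. \<phi> (x + c) \<noteq> 0}"
    then show "x \<in> (\<lambda>x. - c + x) ` S" unfolding S_def by (intro image_eqI[of _ _ "x + c"]) auto
  qed (auto simp: S_def)
  then have "closure {x. \<phi> (x + c) \<noteq> 0} = (\<lambda>x. - c + x) ` closure S"
    by (simp only: closure_translation)
  moreover have "compact ((\<lambda>x. - c + x) ` closure S)"
    by (rule compact_translation) (use \<phi> in \<open>simp add: test_functions_def S_def\<close>)
  ultimately have "compact (closure {x. \<phi> (x + c) \<noteq> 0})" by (simp only:)
  moreover have "\<forall>n. C_k n (\<lambda>x. \<phi> (x + c))" using \<phi> C_k_shift unfolding test_functions_def by blast
  ultimately show ?thesis unfolding test_functions_def by blast
qed

lemma test_function_differentiable: "\<phi> \<in> test_functions \<Longrightarrow> \<phi> differentiable (at x)"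
  unfolding test_functions_def using C_k_SucD(3)[of 0 \<phi>] by auto

lemma test_function_continuous: "\<phi> \<in> test_functions \<Longrightarrow> continuous_on UNIV \<phi>"
  unfolding test_functions_def by (auto dest: spec[of _ 0])

lemma test_function_partial: "\<phi> \<in> test_functions \<Longrightarrow> partial_deriv i \<phi> \<in> test_functions"
proof -
  assume \<phi>: "\<phi> \<in> test_functions"
  have "C_k n (partial_deriv i \<phi>)" for n
    using \<phi> C_k_SucD(2) unfolding test_functions_def by blast
  moreover have "partial_deriv i \<phi> x = 0" if x: "x \<notin> closure {x. \<phi> x \<noteq> 0}" for x
  proof -
    have "(\<phi> has_derivative (\<lambda>h. 0)) (at x)"
      by (rule has_derivative_transform_within_open[of "\<lambda>_. 0" _ _ _ "- closure {x. \<phi> x \<noteq> 0}"])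
        (use x closure_subset[of "{x. \<phi> x \<noteq> 0}"] in auto)
    from partial_deriv_eq[OF this] show ?thesis .
  qed
  then have "closure {x. partial_deriv i \<phi> x \<noteq> 0} \<subseteq> closure {x. \<phi> x \<noteq> 0}"
    by (intro closure_minimal) auto
  then have "compact (closure {x. partial_deriv i \<phi> x \<noteq> 0})"
    using \<phi> compact_Int_closed[of "closure {x. \<phi> x \<noteq> 0}" "closure {x. partial_deriv i \<phi> x \<noteq> 0}"]
    unfolding test_functions_def by (simp add: Int_absorb1)
  ultimately show ?thesis unfolding test_functions_def by blast
qed

lemma test_function_measurable: "\<phi> \<in> test_functions \<Longrightarrow> \<phi> \<in> borel_measurable borel"
  by (rule borel_measurable_continuous_onI[OF test_function_continuous])

lemma test_function_bounded_support:
  assumes "\<phi> \<in> test_functions"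
  obtains C a b where "C \<ge> 0" "\<forall>x. \<bar>\<phi> x\<bar> \<le> C * indicator (cbox a b) x"
proof -
  define S where "S = closure {x. \<phi> x \<noteq> 0}"
  have S: "compact S" using assms unfolding test_functions_def S_def by auto
  obtain a where ab: "S \<subseteq> cbox (- a) a"
    by (rule bounded_subset_cbox_symmetric[OF compact_imp_bounded[OF S]])
  have "compact (\<phi> ` S)"
    by (rule compact_continuous_image[OF continuous_on_subset[OF test_function_continuous[OF assms]] S]) auto
  then have "\<exists>C. \<forall>y\<in>\<phi> ` S. norm y \<le> C" by (simp only: compact_imp_bounded flip: bounded_iff)
  then obtain C where C: "\<forall>y\<in>\<phi> ` S. norm y \<le> C" ..
  have bound: "\<forall>x. \<bar>\<phi> x\<bar> \<le> max C 0 * indicator (cbox (- a) a) x"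
  proof
    fix x
    show "\<bar>\<phi> x\<bar> \<le> max C 0 * indicator (cbox (- a) a) x"
  proof (cases "\<phi> x = 0")
    case True
    then show ?thesis by (simp add: indicator_def)
  next
    case False
    then have "x \<in> {x. \<phi> x \<noteq> 0}" by simp
    then have "x \<in> S" unfolding S_def by (rule subsetD[OF closure_subset])
    then have "norm (\<phi> x) \<le> C" "x \<in> cbox (- a) a" using C subsetD[OF ab] by auto
    then show ?thesis by simp
  qed
  qed
  show thesis by (rule that[of "max C 0" "- a" a, OF _ bound]) simp
qed

section \<open>Square integrable functions\<close>

text \<open>Translations and Fubini arguments are carried out for Borel functions under
  \<open>lborel\<close>, where compositions and sections stay measurable; this lemma provides the
  passage from Lebesgue measurable functions. Coordinates reduce it to the real case.\<close>

lemma lebesgue_borel_representative: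
  fixes f :: "'a::euclidean_space \<Rightarrow> 'b::euclidean_space"
  assumes "f \<in> borel_measurable lebesgue"
  obtains g where "g \<in> borel_measurable borel" "AE x in lebesgue. f x = g x"
proof -
  note assms [measurable]
  have "\<exists>g. g \<in> borel_measurable borel \<and> (AE x in lborel. f x \<bullet> b = g x)" for b
  proof -
    have "(\<lambda>x. f x \<bullet> b) \<in> borel_measurable lebesgue" by measurable
    from completion_ex_borel_measurable_real[OF this] show ?thesis by auto
  qed
  then obtain g where g: "\<And>b. g b \<in> borel_measurable borel \<and> (AE x in lborel. f x \<bullet> b = g b x)"
    using choice[of "\<lambda>b g. g \<in> borel_measurable borel \<and> (AE x in lborel. f x \<bullet> b = g x)"] by blast
  have "AE x in lborel. \<forall>b\<in>Basis. f x \<bullet> b = g b x" by (rule AE_finite_allI[OF finite_Basis]) (rule conjunct2[OF g])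
  then have "AE x in lborel. f x = (\<Sum>b\<in>Basis. g b x *\<^sub>R b)"
  proof eventually_elim
    case (elim x)
    have "f x = (\<Sum>b\<in>Basis. (f x \<bullet> b) *\<^sub>R b)" by (simp only: euclidean_representation)
    also have "\<dots> = (\<Sum>b\<in>Basis. g b x *\<^sub>R b)" using elim by (intro sum.cong) auto
    finally show ?case .
  qed
  then have "AE x in lebesgue. f x = (\<Sum>b\<in>Basis. g b x *\<^sub>R b)" by (rule AE_completion)
  moreover have "(\<lambda>x. \<Sum>b\<in>Basis. g b x *\<^sub>R b) \<in> borel_measurable borel"
    by (intro borel_measurable_sum borel_measurable_scaleR conjunct1[OF g] borel_measurable_const)
  ultimately show thesis using that by blast
qed

lemma borel_imp_lebesgue: "f \<in> borel_measurable borel \<Longrightarrow> f \<in> borel_measurable lebesgue"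
  by (simp add: measurable_completion)

lemma L2_measurable: "f \<in> L2 \<Longrightarrow> f \<in> borel_measurable lebesgue"
  and L2_integrable: "f \<in> L2 \<Longrightarrow> integrable lebesgue (\<lambda>x. (norm (f x))\<^sup>2)"
  unfolding L2_def by auto

lemma L2_norm_sq: "(L2_norm f)\<^sup>2 = (LINT x|lebesgue. (norm (f x))\<^sup>2)"
  unfolding L2_norm_def by simp

lemma L2_norm_nonneg [simp]: "0 \<le> L2_norm f"
  unfolding L2_norm_def by simp

lemma L2_nn_integral: "f \<in> L2 \<Longrightarrow> (\<integral>\<^sup>+x. ennreal ((norm (f x))\<^sup>2) \<partial>lebesgue) = ennreal ((L2_norm f)\<^sup>2)"
  unfolding L2_norm_sq by (rule nn_integral_eq_integral[OF L2_integrable]) auto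

lemma L2I_bound:
  assumes "f \<in> borel_measurable lebesgue" "integrable lebesgue h"
    "AE x in lebesgue. (norm (f x))\<^sup>2 \<le> h x"
  shows "f \<in> L2"
  unfolding L2_def using assms
  by (auto intro!: Bochner_Integration.integrable_bound[OF assms(2)] elim!: eventually_mono)

lemma L2I_nn_integral:
  assumes "f \<in> borel_measurable lebesgue" "(\<integral>\<^sup>+x. ennreal ((norm (f x))\<^sup>2) \<partial>lebesgue) < \<infinity>"
  shows "f \<in> L2"
  unfolding L2_def using assms by (auto simp: integrable_iff_bounded)

lemma norm_add_sq_le: "(norm (x + y))\<^sup>2 \<le> 2 * (norm x)\<^sup>2 + 2 * (norm y)\<^sup>2"
  for x y :: "'a::real_normed_vector"
proof -
  have "(norm (x + y))\<^sup>2 \<le> (norm x + norm y)\<^sup>2" by (intro power_mono norm_triangle_ineq) simp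
  also have "\<dots> \<le> 2 * (norm x)\<^sup>2 + 2 * (norm y)\<^sup>2"
    using sum_squares_bound[of "norm x" "norm y"] by (simp add: power2_sum)
  finally show ?thesis .
qed

lemma L2_add:
  assumes "f \<in> L2" "g \<in> L2"
  shows "(\<lambda>x. f x + g x) \<in> L2"
proof (rule L2I_bound)
  show "(\<lambda>x. f x + g x) \<in> borel_measurable lebesgue"
    by (intro borel_measurable_add L2_measurable assms)
  show "integrable lebesgue (\<lambda>x. 2 * (norm (f x))\<^sup>2 + 2 * (norm (g x))\<^sup>2)"
    by (intro Bochner_Integration.integrable_add integrable_mult_right L2_integrable assms)
  show "AE x in lebesgue. (norm (f x + g x))\<^sup>2 \<le> 2 * (norm (f x))\<^sup>2 + 2 * (norm (g x))\<^sup>2"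
    by (intro AE_I2 norm_add_sq_le)
qed

lemma L2_linear:
  fixes T :: "'a::euclidean_space \<Rightarrow> 'b::euclidean_space"
  assumes "f \<in> L2" "bounded_linear T"
  shows "(\<lambda>x. T (f x)) \<in> L2"
proof -
  from assms(2) obtain K where K: "\<And>x. norm (T x) \<le> norm x * K" using bounded_linear.bounded by blast
  show ?thesis
  proof (rule L2I_bound[where h="\<lambda>x. K\<^sup>2 * (norm (f x))\<^sup>2"])
    show "(\<lambda>x. T (f x)) \<in> borel_measurable lebesgue"
      by (rule measurable_compose[OF L2_measurable[OF assms(1)]])
        (intro borel_measurable_continuous_onI linear_continuous_on assms(2))
    show "AE x in lebesgue. (norm (T (f x)))\<^sup>2 \<le> K\<^sup>2 * (norm (f x))\<^sup>2"
      using power_mono[OF K norm_ge_zero] by (simp add: power_mult_distrib mult.commute)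
  qed (intro integrable_mult_right L2_integrable assms(1))
qed

lemma L2_scaleR: "f \<in> L2 \<Longrightarrow> (\<lambda>x. c *\<^sub>R f x) \<in> L2"
  by (rule L2_linear[OF _ bounded_linear_scaleR_right])

lemma L2_diff: "f \<in> L2 \<Longrightarrow> g \<in> L2 \<Longrightarrow> (\<lambda>x. f x - g x) \<in> L2"
  using L2_add[of f "\<lambda>x. (-1) *\<^sub>R g x"] L2_scaleR[of g "-1"] by simp

lemma L2_cong_AE:
  assumes "f \<in> L2" "g \<in> borel_measurable lebesgue" "AE x in lebesgue. f x = g x"
  shows "g \<in> L2"
  by (rule L2I_bound[OF assms(2) L2_integrable[OF assms(1)]]) (use assms(3) in \<open>auto elim: eventually_mono\<close>)

lemma L2_norm_cong_AE:
  assumes "f \<in> borel_measurable lebesgue" "g \<in> borel_measurable lebesgue" "AE x in lebesgue. f x = g x"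
  shows "L2_norm f = L2_norm g"
  unfolding L2_norm_def by (intro arg_cong[of _ _ sqrt] integral_cong_AE) (use assms in \<open>auto elim: eventually_mono\<close>)

lemma L2_pairing_integrable:
  fixes h :: "R3 \<Rightarrow> 'c::euclidean_space"
  assumes "f \<in> L2" "g \<in> L2" "h \<in> borel_measurable lebesgue"
    "\<And>x. norm (h x) \<le> norm (f x) * norm (g x)"
  shows "integrable lebesgue h"
proof (rule Bochner_Integration.integrable_bound[OF _ assms(3)])
  show "integrable lebesgue (\<lambda>x. (norm (f x))\<^sup>2 + (norm (g x))\<^sup>2)"
    by (intro Bochner_Integration.integrable_add L2_integrable assms)
  show "AE x in lebesgue. norm (h x) \<le> norm ((norm (f x))\<^sup>2 + (norm (g x))\<^sup>2)"
  proof (rule AE_I2)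
    fix x
    have "0 \<le> norm (f x) * norm (g x)" by simp
    then have "norm (f x) * norm (g x) \<le> (norm (f x))\<^sup>2 + (norm (g x))\<^sup>2"
      using sum_squares_bound[of "norm (f x)" "norm (g x)"] by linarith
    with assms(4)[of x] show "norm (h x) \<le> norm ((norm (f x))\<^sup>2 + (norm (g x))\<^sup>2)" by simp
  qed
qed

lemma L2_norm_eq_0:
  assumes "f \<in> L2" "L2_norm f = 0"
  shows "AE x in lebesgue. f x = 0"
proof -
  have "(LINT x|lebesgue. (norm (f x))\<^sup>2) = 0" using assms(2) L2_norm_sq[of f] by simp
  with integral_nonneg_eq_0_iff_AE[OF L2_integrable[OF assms(1)]] show ?thesis by simp
qed

lemma ennreal_suminf_upper:
  fixes g :: "nat \<Rightarrow> ennreal"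
  shows "g k \<le> suminf g"
proof -
  have "sum g {k} \<le> suminf g" by (rule sum_le_suminf[OF summableI]) auto
  then show ?thesis by simp
qed

text \<open>Riesz-Fischer: a rapidly converging subsequence has a pointwise limit almost everywhere,
  and Fatou's lemma carries the Cauchy estimate over to that limit.\<close>

lemma L2_complete:
  fixes f :: "nat \<Rightarrow> R3 \<Rightarrow> 'a::euclidean_space"
  assumes f: "\<And>n. f n \<in> L2"
    and cauchy: "\<And>e. e > 0 \<Longrightarrow> \<exists>N. \<forall>m\<ge>N. \<forall>n\<ge>N. (L2_norm (\<lambda>x. f m x - f n x))\<^sup>2 < e"
  shows "\<exists>g\<in>L2. (\<lambda>n. (L2_norm (\<lambda>x. f n x - g x))\<^sup>2) \<longlonglongrightarrow> 0"
proof -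
  have f_meas [measurable]: "f n \<in> borel_measurable lebesgue" for n by (rule L2_measurable[OF f])
  \<comment> \<open>The rate \<open>1 / 8\<close> leaves room for the weight \<open>4 ^ k\<close>
    below: the weighted squares still have a finite integral, and their finiteness at
    \<open>x\<close> makes the increments at \<open>x\<close> decay like
    \<open>(1 / 2) ^ k\<close>.\<close>
  have "\<forall>k. \<exists>N. \<forall>m\<ge>N. \<forall>n\<ge>N. (L2_norm (\<lambda>x. f m x - f n x))\<^sup>2 < (1 / 8) ^ k"
  proof
    fix k :: nat
    have "(0::real) < (1 / 8) ^ k" by simp
    then show "\<exists>N. \<forall>m\<ge>N. \<forall>n\<ge>N. (L2_norm (\<lambda>x. f m x - f n x))\<^sup>2 < (1 / 8) ^ k" by (rule cauchy)
  qed
  from choice[OF this] obtain N where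
    N: "\<And>k m n. m \<ge> N k \<Longrightarrow> n \<ge> N k \<Longrightarrow> (L2_norm (\<lambda>x. f m x - f n x))\<^sup>2 < (1 / 8) ^ k" by blast
  \<comment> \<open>Summing the thresholds makes \<open>r\<close> nondecreasing with
    \<open>N k \<le> r k\<close>; the summand \<open>k\<close> forces \<open>r k\<close> to
    infinity.\<close>
  define r where "r k = k + (\<Sum>j\<le>k. N j)" for k
  have r_N: "N k \<le> r k" for k unfolding r_def using member_le_sum[of k "{..k}" N] by simp
  have r_mono: "r k \<le> r (Suc k)" for k unfolding r_def by simp
  have r_ge: "k \<le> r k" for k unfolding r_def by simp
  define d where "d k x = f (r (Suc k)) x - f (r k) x" for k x
  have d_L2: "d k \<in> L2" for k unfolding d_def by (intro L2_diff f)
  note L2_measurable[OF d_L2, measurable]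
  have d_le: "(L2_norm (d k))\<^sup>2 \<le> (1 / 8) ^ k" for k
    unfolding d_def using N[of k "r (Suc k)" "r k"] r_N[of k] r_mono[of k] by simp
  have "(\<integral>\<^sup>+x. (\<Sum>k. ennreal (4 ^ k * (norm (d k x))\<^sup>2)) \<partial>lebesgue) = (\<Sum>k. \<integral>\<^sup>+x. ennreal (4 ^ k * (norm (d k x))\<^sup>2) \<partial>lebesgue)"
    by (rule nn_integral_suminf) measurable
  also have "\<dots> = (\<Sum>k. ennreal (4 ^ k * (L2_norm (d k))\<^sup>2))"
  proof (rule suminf_cong)
    fix k
    have [measurable]: "d k \<in> borel_measurable lebesgue" by (rule L2_measurable[OF d_L2])
    show "(\<integral>\<^sup>+x. ennreal (4 ^ k * (norm (d k x))\<^sup>2) \<partial>lebesgue) = ennreal (4 ^ k * (L2_norm (d k))\<^sup>2)"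
      by (simp add: ennreal_mult nn_integral_cmult L2_nn_integral[OF d_L2])
  qed
  also have "\<dots> \<le> (\<Sum>k. ennreal ((1 / 2) ^ k))"
  proof (intro suminf_le summableI ennreal_leI)
    fix k
    have "4 ^ k * (L2_norm (d k))\<^sup>2 \<le> 4 ^ k * (1 / 8) ^ k" using d_le[of k] by simp
    also have "\<dots> = (1 / 2 :: real) ^ k" by (simp flip: power_mult_distrib)
    finally show "4 ^ k * (L2_norm (d k))\<^sup>2 \<le> (1 / 2) ^ k" .
  qed
  also have "\<dots> = ennreal (\<Sum>k. (1 / 2) ^ k)" by (rule suminf_ennreal2) (auto intro: summable_geometric)
  also have "\<dots> < \<infinity>" by simp
  finally have fin: "(\<integral>\<^sup>+x. (\<Sum>k. ennreal (4 ^ k * (norm (d k x))\<^sup>2)) \<partial>lebesgue) \<noteq> \<infinity>" by simp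
  have "AE x in lebesgue. (\<Sum>k. ennreal (4 ^ k * (norm (d k x))\<^sup>2)) \<noteq> \<infinity>"
    by (rule nn_integral_PInf_AE[OF _ fin]) measurable
  then have conv: "AE x in lebesgue. convergent (\<lambda>k. f (r k) x)"
  proof eventually_elim
    case (elim x)
    define S where "S = enn2real (\<Sum>k. ennreal (4 ^ k * (norm (d k x))\<^sup>2))"
    have S: "(\<Sum>k. ennreal (4 ^ k * (norm (d k x))\<^sup>2)) = ennreal S"
      unfolding S_def using elim by (simp add: less_top)
    have le: "norm (d k x) \<le> sqrt S * (1 / 2) ^ k" for k
    proof -
      have "ennreal (4 ^ k * (norm (d k x))\<^sup>2) \<le> (\<Sum>k. ennreal (4 ^ k * (norm (d k x))\<^sup>2))"
        by (rule ennreal_suminf_upper)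
      then have "ennreal (4 ^ k * (norm (d k x))\<^sup>2) \<le> ennreal S" unfolding S .
      then have "4 ^ k * (norm (d k x))\<^sup>2 \<le> S"
        by (rule ennreal_le_iff[THEN iffD1, rotated]) (simp add: S_def)
      moreover have "(2 ^ k)\<^sup>2 = (4::real) ^ k" by (simp add: power2_eq_square flip: power_mult_distrib)
      ultimately have "(2 ^ k * norm (d k x))\<^sup>2 \<le> S" by (simp only: power_mult_distrib)
      then have le: "2 ^ k * norm (d k x) \<le> sqrt S" by (rule real_le_rsqrt)
      have "norm (d k x) = (1 / 2) ^ k * (2 ^ k * norm (d k x))" by (simp add: power_one_over)
      also have "\<dots> \<le> (1 / 2) ^ k * sqrt S" by (rule mult_left_mono[OF le]) simp
      finally show ?thesis by (subst mult.commute)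
    qed
    have "summable (\<lambda>k. d k x)"
      by (rule summable_comparison_test'[OF summable_mult[OF summable_geometric[of "1 / 2"]], where N=0])
        (simp, rule le)
    then have "convergent (\<lambda>n. \<Sum>k<n. d k x)" by (simp add: summable_iff_convergent)
    then have "convergent (\<lambda>n. (\<Sum>k<n. d k x) + f (r 0) x)" by (simp add: convergent_add_const_right_iff)
    moreover have "(\<Sum>k<n. d k x) + f (r 0) x = f (r n) x" for n
      unfolding d_def by (simp add: sum_lessThan_telescope[of "\<lambda>k. f (r k) x"])
    ultimately show ?case by simp
  qed
  define g where "g x = lim (\<lambda>k. f (r k) x)" for x
  have g_meas [measurable]: "g \<in> borel_measurable lebesgue"
    unfolding g_def by (rule borel_measurable_lim_metric) (rule f_meas)
  have bound: "(\<integral>\<^sup>+x. ennreal ((norm (f n x - g x))\<^sup>2) \<partial>lebesgue) \<le> ennreal e"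
    if M: "\<And>k. k \<ge> M \<Longrightarrow> (L2_norm (\<lambda>x. f n x - f k x))\<^sup>2 < e" for e M n
  proof -
    have "(\<integral>\<^sup>+x. ennreal ((norm (f n x - g x))\<^sup>2) \<partial>lebesgue)
        = (\<integral>\<^sup>+x. liminf (\<lambda>k. ennreal ((norm (f n x - f (r k) x))\<^sup>2)) \<partial>lebesgue)"
    proof (rule nn_integral_cong_AE, use conv in eventually_elim)
      case (elim x)
      then have "(\<lambda>k. f (r k) x) \<longlonglongrightarrow> g x" unfolding g_def by (simp add: convergent_LIMSEQ_iff)
      then have "(\<lambda>k. ennreal ((norm (f n x - f (r k) x))\<^sup>2)) \<longlonglongrightarrow> ennreal ((norm (f n x - g x))\<^sup>2)"
        by (intro tendsto_ennrealI tendsto_power tendsto_norm tendsto_diff tendsto_const)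
      then show ?case by (rule lim_imp_Liminf[OF sequentially_bot, symmetric])
    qed
    also have "\<dots> \<le> liminf (\<lambda>k. \<integral>\<^sup>+x. ennreal ((norm (f n x - f (r k) x))\<^sup>2) \<partial>lebesgue)"
      by (rule nn_integral_liminf) measurable
    also have "\<dots> \<le> limsup (\<lambda>k. \<integral>\<^sup>+x. ennreal ((norm (f n x - f (r k) x))\<^sup>2) \<partial>lebesgue)"
      by (rule Liminf_le_Limsup) simp
    also have "\<dots> \<le> ennreal e"
    proof (rule Limsup_bounded)
      show "\<forall>\<^sub>F k in sequentially. (\<integral>\<^sup>+x. ennreal ((norm (f n x - f (r k) x))\<^sup>2) \<partial>lebesgue) \<le> ennreal e"
        using eventually_ge_at_top[of M]
      proof eventually_elim
        case (elim k)
        have "(L2_norm (\<lambda>x. f n x - f (r k) x))\<^sup>2 < e" by (rule M[OF order_trans[OF elim r_ge]])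
        then show ?case using L2_nn_integral[OF L2_diff[OF f[of n] f[of "r k"]]] by (simp add: ennreal_leI)
      qed
    qed
    finally show ?thesis .
  qed
  obtain M where M: "\<forall>m\<ge>M. \<forall>n\<ge>M. (L2_norm (\<lambda>x. f m x - f n x))\<^sup>2 < 1" using cauchy[OF zero_less_one] by blast
  have "(\<lambda>x. f M x - g x) \<in> L2"
  proof (rule L2I_nn_integral)
    have "(\<integral>\<^sup>+x. ennreal ((norm (f M x - g x))\<^sup>2) \<partial>lebesgue) \<le> ennreal 1" by (rule bound) (rule M[rule_format, OF order_refl])
    also have "\<dots> < \<infinity>" by simp
    finally show "(\<integral>\<^sup>+x. ennreal ((norm (f M x - g x))\<^sup>2) \<partial>lebesgue) < \<infinity>" .
  qed measurable
  then have "(\<lambda>x. f M x - (f M x - g x)) \<in> L2" by (rule L2_diff[OF f])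
  then have g: "g \<in> L2" by simp
  have "(\<lambda>n. (L2_norm (\<lambda>x. f n x - g x))\<^sup>2) \<longlonglongrightarrow> 0"
  proof (rule LIMSEQ_I)
    fix e :: real assume "e > 0"
    then have e2: "e / 2 > 0" by simp
    obtain M where M: "\<forall>m\<ge>M. \<forall>n\<ge>M. (L2_norm (\<lambda>x. f m x - f n x))\<^sup>2 < e / 2" using cauchy[OF e2] ..
    show "\<exists>M. \<forall>n\<ge>M. norm ((L2_norm (\<lambda>x. f n x - g x))\<^sup>2 - 0) < e"
    proof (intro exI[of _ M] allI impI)
      fix n assume n: "M \<le> n"
      have "(\<integral>\<^sup>+x. ennreal ((norm (f n x - g x))\<^sup>2) \<partial>lebesgue) \<le> ennreal (e / 2)"
        by (rule bound) (rule M[rule_format, OF n])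
      then have "ennreal ((L2_norm (\<lambda>x. f n x - g x))\<^sup>2) \<le> ennreal (e / 2)"
        using L2_nn_integral[OF L2_diff[OF f g]] by simp
      then have "(L2_norm (\<lambda>x. f n x - g x))\<^sup>2 \<le> e / 2" using \<open>e > 0\<close> by (simp add: ennreal_le_iff)
      then show "norm ((L2_norm (\<lambda>x. f n x - g x))\<^sup>2 - 0) < e" using \<open>e > 0\<close> by simp
    qed
  qed
  with g show ?thesis by blast
qed

section \<open>Weak gradients\<close>

text \<open>\<open>ennreal\<close> cuts off negative values, so \<open>g\<close> and
  \<open>- g\<close> give densities for the positive and the negative part. These measures agree on
  boxes, an intersection-stable generator, hence everywhere; densities being unique, the two parts
  coincide and therefore vanish.\<close>

lemma AE_zero_if_box_integrals_zero:
  fixes g :: "'a::euclidean_space \<Rightarrow> real"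
  assumes [measurable]: "g \<in> borel_measurable borel"
    and int: "\<And>a b. integrable lborel (\<lambda>x. indicator (box a b) x * g x)"
    and zero: "\<And>a b. (LINT x|lborel. indicator (box a b) x * g x) = 0"
  shows "AE x in lborel. g x = 0"
proof -
  have meas: "emeasure (density lborel (\<lambda>x. ennreal (h x))) (box a b) = (\<integral>\<^sup>+x. ennreal (indicator (box a b) x * h x) \<partial>lborel)"
    if [measurable]: "h \<in> borel_measurable borel" for h and a b :: 'a
    by (subst emeasure_density) (auto intro!: nn_integral_cong simp: indicator_def)
  have fin: "(\<integral>\<^sup>+x. ennreal (indicator (box a b) x * g x) \<partial>lborel) < \<infinity>"
    "(\<integral>\<^sup>+x. ennreal (indicator (box a b) x * - g x) \<partial>lborel) < \<infinity>" for a b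
  proof -
    note f = int[of a b, unfolded integrable_iff_bounded, THEN conjunct2]
    show "(\<integral>\<^sup>+x. ennreal (indicator (box a b) x * g x) \<partial>lborel) < \<infinity>"
      by (rule le_less_trans[OF nn_integral_mono f]) (simp add: ennreal_leI)
    show "(\<integral>\<^sup>+x. ennreal (indicator (box a b) x * - g x) \<partial>lborel) < \<infinity>"
      by (rule le_less_trans[OF nn_integral_mono f]) (simp add: ennreal_leI)
  qed
  have eq: "(\<integral>\<^sup>+x. ennreal (indicator (box a b) x * g x) \<partial>lborel) = (\<integral>\<^sup>+x. ennreal (indicator (box a b) x * - g x) \<partial>lborel)" for a b
  proof -
    have "enn2real (\<integral>\<^sup>+x. ennreal (indicator (box a b) x * g x) \<partial>lborel)
        = enn2real (\<integral>\<^sup>+x. ennreal (indicator (box a b) x * - g x) \<partial>lborel)"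
      using real_lebesgue_integral_def[OF int[of a b]] zero[of a b] by simp
    then have "ennreal (enn2real (\<integral>\<^sup>+x. ennreal (indicator (box a b) x * g x) \<partial>lborel))
        = ennreal (enn2real (\<integral>\<^sup>+x. ennreal (indicator (box a b) x * - g x) \<partial>lborel))" by (rule arg_cong)
    then show ?thesis
      unfolding ennreal_enn2real[OF fin(1)[of a b, unfolded infinity_ennreal_def]]
        ennreal_enn2real[OF fin(2)[of a b, unfolded infinity_ennreal_def]] .
  qed
  have "density lborel (\<lambda>x. ennreal (g x)) = density lborel (\<lambda>x. ennreal (- g x))"
  proof (rule measure_eqI_generator_eq)
    let ?E = "range (\<lambda>(a, b). box a b::'a set)"
    let ?A = "\<lambda>n::nat. box (- (real n *\<^sub>R One)) (real n *\<^sub>R One) :: 'a set"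
    show "Int_stable ?E" by (auto simp: Int_stable_def box_Int_box)
    show "?E \<subseteq> Pow UNIV" "sets (density lborel (\<lambda>x. ennreal (g x))) = sigma_sets UNIV ?E"
      "sets (density lborel (\<lambda>x. ennreal (- g x))) = sigma_sets UNIV ?E"
      by (simp_all add: borel_eq_box)
    show "range ?A \<subseteq> ?E" "(\<Union>i. ?A i) = UNIV" unfolding UN_box_eq_UNIV by auto
    show "emeasure (density lborel (\<lambda>x. ennreal (g x))) (?A i) \<noteq> \<infinity>" for i
      using fin(1)[of "- (real i *\<^sub>R One)" "real i *\<^sub>R One"] by (simp add: meas)
    fix X assume "X \<in> ?E"
    then obtain a b where X: "X = box a b" by auto
    show "emeasure (density lborel (\<lambda>x. ennreal (g x))) X = emeasure (density lborel (\<lambda>x. ennreal (- g x))) X"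
      unfolding X using meas[of g a b] meas[of "\<lambda>x. - g x" a b] eq[of a b] by simp
  qed
  then have "AE x in lborel. ennreal (g x) = ennreal (- g x)"
    by (intro sigma_finite_measure.density_unique[OF sigma_finite_lborel]) measurable
  then show ?thesis
  proof eventually_elim
    case (elim x)
    show ?case
    proof (cases "0 \<le> g x")
      case True
      then have "ennreal (- g x) = 0" by (simp add: ennreal_neg)
      with elim True show ?thesis by simp
    next
      case False
      then have "ennreal (g x) = 0" by (simp add: ennreal_neg)
      with elim False show ?thesis by simp
    qed
  qed
qed

text \<open>Box bumps lie below the indicator of their box and converge to it, so dominated
  convergence passes from test functions to boxes.\<close>

lemma fundamental_lemma_real:
  fixes g :: "R3 \<Rightarrow> real"
  assumes [measurable]: "g \<in> borel_measurable borel"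
    and int: "\<And>a b. integrable lborel (\<lambda>x. indicator (box a b) x * g x)"
    and zero: "\<And>\<phi>. \<phi> \<in> test_functions \<Longrightarrow> (LINT x|lborel. \<phi> x * g x) = 0"
  shows "AE x in lborel. g x = 0"
proof (rule AE_zero_if_box_integrals_zero[OF assms(1) int])
  fix a b
  have [measurable]: "box_bump (real (Suc n)) a b \<in> borel_measurable borel" for n
    by (rule test_function_measurable[OF box_bump_test]) simp
  have "(\<lambda>n. LINT x|lborel. box_bump (real (Suc n)) a b x * g x) \<longlonglongrightarrow> (LINT x|lborel. indicator (box a b) x * g x)"
  proof (rule integral_dominated_convergence)
    show "integrable lborel (\<lambda>x. \<bar>indicator (box a b) x * g x\<bar>)" by (intro integrable_abs int)
    show "AE x in lborel. (\<lambda>n. box_bump (real (Suc n)) a b x * g x) \<longlonglongrightarrow> indicator (box a b) x * g x"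
      by (intro AE_I2 tendsto_mult tendsto_const box_bump_tendsto)
    show "AE x in lborel. norm (box_bump (real (Suc n)) a b x * g x) \<le> \<bar>indicator (box a b) x * g x\<bar>" for n
    proof (rule AE_I2)
      fix x
      have "\<bar>box_bump (real (Suc n)) a b x\<bar> \<le> \<bar>indicator (box a b) x\<bar>"
        using box_bump_bounds[of "real (Suc n)" a b x] by simp
      then show "norm (box_bump (real (Suc n)) a b x * g x) \<le> \<bar>indicator (box a b) x * g x\<bar>"
        unfolding real_norm_def abs_mult by (rule mult_right_mono) simp
    qed
  qed measurable
  moreover have "(LINT x|lborel. box_bump (real (Suc n)) a b x * g x) = 0" for n
    by (rule zero[OF box_bump_test]) simp
  ultimately show "(LINT x|lborel. indicator (box a b) x * g x) = 0"
    by (simp add: LIMSEQ_const_iff)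
qed

lemma fundamental_lemma_complex:
  fixes g :: "R3 \<Rightarrow> complex"
  assumes [measurable]: "g \<in> borel_measurable borel"
    and int: "\<And>a b. integrable lborel (\<lambda>x. indicator (box a b) x *\<^sub>R g x)"
    and int\<phi>: "\<And>\<phi>. \<phi> \<in> test_functions \<Longrightarrow> integrable lborel (\<lambda>x. \<phi> x *\<^sub>R g x)"
    and zero: "\<And>\<phi>. \<phi> \<in> test_functions \<Longrightarrow> (LINT x|lborel. \<phi> x *\<^sub>R g x) = 0"
  shows "AE x in lborel. g x = 0"
proof -
  have "AE x in lborel. Re (g x) = 0"
  proof (rule fundamental_lemma_real)
    show "integrable lborel (\<lambda>x. indicator (box a b) x * Re (g x))" for a b
      using integrable_Re[OF int[of a b]] by simp
    show "(LINT x|lborel. \<phi> x * Re (g x)) = 0" if "\<phi> \<in> test_functions" for \<phi>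
      using integral_Re[OF int\<phi>[OF that]] zero[OF that] by simp
  qed measurable
  moreover have "AE x in lborel. Im (g x) = 0"
  proof (rule fundamental_lemma_real)
    show "integrable lborel (\<lambda>x. indicator (box a b) x * Im (g x))" for a b
      using integrable_Im[OF int[of a b]] by simp
    show "(LINT x|lborel. \<phi> x * Im (g x)) = 0" if "\<phi> \<in> test_functions" for \<phi>
      using integral_Im[OF int\<phi>[OF that]] zero[OF that] by simp
  qed measurable
  ultimately show ?thesis by eventually_elim (simp add: complex_eq_iff)
qed

lemma indicator_box_L2: "(indicator (box a b) :: R3 \<Rightarrow> real) \<in> L2"
  unfolding L2_def
proof (intro CollectI conjI)
  show "(indicator (box a b) :: R3 \<Rightarrow> real) \<in> borel_measurable lebesgue" by (rule borel_imp_lebesgue) simp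
  have "integrable lborel (indicator (box a b) :: R3 \<Rightarrow> real)"
    by (rule integrable_real_indicator) (simp, rule emeasure_bounded_finite[OF bounded_box])
  then have "integrable lebesgue (indicator (box a b) :: R3 \<Rightarrow> real)"
    by (subst integrable_completion) auto
  moreover have "(norm (indicator (box a b) x :: real))\<^sup>2 = indicator (box a b) x" for x :: R3
    by (simp add: indicator_def)
  ultimately show "integrable lebesgue (\<lambda>x::R3. (norm (indicator (box a b) x :: real))\<^sup>2)" by simp
qed

lemma test_function_L2:
  assumes "\<phi> \<in> test_functions"
  shows "\<phi> \<in> L2"
proof -
  obtain C a b where C: "C \<ge> 0" "\<forall>x. \<bar>\<phi> x\<bar> \<le> C * indicator (cbox a b) x"
    by (rule test_function_bounded_support[OF assms])
  have "integrable lborel (indicator (cbox a b) :: R3 \<Rightarrow> real)"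
    by (rule integrable_real_indicator) (simp, rule emeasure_bounded_finite[OF bounded_cbox])
  then have int: "integrable lebesgue (\<lambda>x. C\<^sup>2 * indicator (cbox a b) x :: real)"
    by (subst integrable_completion) (auto intro: integrable_mult_right)
  show ?thesis
  proof (rule L2I_bound[OF borel_imp_lebesgue[OF test_function_measurable[OF assms]] int])
    show "AE x in lebesgue. (norm (\<phi> x))\<^sup>2 \<le> C\<^sup>2 * indicator (cbox a b) x"
    proof (rule AE_I2)
      fix x
      have "(norm (\<phi> x))\<^sup>2 \<le> (C * indicator (cbox a b) x)\<^sup>2" using spec[OF C(2), of x] by (intro power_mono) auto
      also have "\<dots> = C\<^sup>2 * indicator (cbox a b) x" by (simp add: indicator_def)
      finally show "(norm (\<phi> x))\<^sup>2 \<le> C\<^sup>2 * indicator (cbox a b) x" .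
    qed
  qed
qed

lemma L2_scaleR_integrable:
  fixes a :: "R3 \<Rightarrow> real" and f :: "R3 \<Rightarrow> 'a::euclidean_space"
  assumes "a \<in> L2" "f \<in> L2"
  shows "integrable lebesgue (\<lambda>x. a x *\<^sub>R f x)"
proof (rule L2_pairing_integrable[OF assms])
  show "(\<lambda>x. a x *\<^sub>R f x) \<in> borel_measurable lebesgue"
    by (intro borel_measurable_scaleR L2_measurable assms)
qed simp

lemma fundamental_lemma_L2:
  fixes g :: "R3 \<Rightarrow> complex"
  assumes g: "g \<in> L2"
    and zero: "\<And>\<phi>. \<phi> \<in> test_functions \<Longrightarrow> (LINT x|lebesgue. \<phi> x *\<^sub>R g x) = 0"
  shows "AE x in lebesgue. g x = 0"
proof -
  obtain g' where g' [measurable]: "g' \<in> borel_measurable borel" and eq: "AE x in lebesgue. g x = g' x"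
    by (rule lebesgue_borel_representative[OF L2_measurable[OF g]])
  have g'L: "g' \<in> L2" by (rule L2_cong_AE[OF g borel_imp_lebesgue[OF g'] eq])
  have "AE x in lborel. g' x = 0"
  proof (rule fundamental_lemma_complex[OF g'])
    show "integrable lborel (\<lambda>x. indicator (box a b) x *\<^sub>R g' x)" for a b
      using L2_scaleR_integrable[OF indicator_box_L2[of a b] g'L] by (subst (asm) integrable_completion) auto
    fix \<phi> assume \<phi>: "\<phi> \<in> test_functions"
    note [measurable] = test_function_measurable[OF \<phi>]
    show "integrable lborel (\<lambda>x. \<phi> x *\<^sub>R g' x)"
      using L2_scaleR_integrable[OF test_function_L2[OF \<phi>] g'L] by (subst (asm) integrable_completion) auto
    have "(LINT x|lborel. \<phi> x *\<^sub>R g' x) = (LINT x|lebesgue. \<phi> x *\<^sub>R g' x)"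
      by (rule integral_completion[symmetric]) measurable
    also have "\<dots> = (LINT x|lebesgue. \<phi> x *\<^sub>R g x)"
    proof (rule integral_cong_AE)
      show "(\<lambda>x. \<phi> x *\<^sub>R g' x) \<in> borel_measurable lebesgue" by (rule borel_imp_lebesgue) measurable
      show "(\<lambda>x. \<phi> x *\<^sub>R g x) \<in> borel_measurable lebesgue"
        by (intro borel_measurable_scaleR L2_measurable[OF g] borel_imp_lebesgue test_function_measurable \<phi>)
      show "AE x in lebesgue. \<phi> x *\<^sub>R g' x = \<phi> x *\<^sub>R g x" using eq by eventually_elim simp
    qed
    finally show "(LINT x|lborel. \<phi> x *\<^sub>R g' x) = 0" using zero[OF \<phi>] by simp
  qed
  then have "AE x in lebesgue. g' x = 0" by (rule AE_completion)
  with eq show ?thesis by eventually_elim simp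
qed

section \<open>Uniqueness and linearity of weak gradients\<close>

lemma L2_component:
  fixes G :: "R3 \<Rightarrow> complex^3"
  shows "G \<in> L2 \<Longrightarrow> (\<lambda>x. G x $ i) \<in> L2"
  by (rule L2_linear[OF _ bounded_linear_vec_nth])

lemma has_weak_gradientD:
  assumes "has_weak_gradient u G" "\<phi> \<in> test_functions"
  shows "(LINT x|lebesgue. partial_deriv i \<phi> x *\<^sub>R u x) = - (LINT x|lebesgue. \<phi> x *\<^sub>R (G x $ i))"
  using assms unfolding has_weak_gradient_def by blast

text \<open>Makes the choice in \<open>weak_gradient\<close> harmless: linearity and limits are
  established for some gradient and then transferred almost everywhere.\<close>

lemma weak_gradient_unique:
  assumes "G \<in> L2" "G' \<in> L2" "has_weak_gradient u G" "has_weak_gradient u G'"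
  shows "AE x in lebesgue. G x = G' x"
proof -
  have "AE x in lebesgue. G x $ i - G' x $ i = 0" for i
  proof (rule fundamental_lemma_L2)
    show "(\<lambda>x. G x $ i - G' x $ i) \<in> L2" by (intro L2_diff L2_component assms)
    fix \<phi> assume \<phi>: "\<phi> \<in> test_functions"
    have "(LINT x|lebesgue. \<phi> x *\<^sub>R (G x $ i)) = (LINT x|lebesgue. \<phi> x *\<^sub>R (G' x $ i))"
      using has_weak_gradientD[OF assms(3) \<phi>, of i] has_weak_gradientD[OF assms(4) \<phi>, of i] by simp
    moreover have "(LINT x|lebesgue. \<phi> x *\<^sub>R (G x $ i - G' x $ i)) =
        (LINT x|lebesgue. \<phi> x *\<^sub>R (G x $ i)) - (LINT x|lebesgue. \<phi> x *\<^sub>R (G' x $ i))"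
      unfolding scaleR_diff_right
      by (intro Bochner_Integration.integral_diff L2_scaleR_integrable test_function_L2[OF \<phi>] L2_component assms)
    ultimately show "(LINT x|lebesgue. \<phi> x *\<^sub>R (G x $ i - G' x $ i)) = 0" by simp
  qed
  then have "AE x in lebesgue. \<forall>i\<in>UNIV. G x $ i - G' x $ i = 0" by (intro AE_finite_allI) auto
  then show ?thesis by eventually_elim (simp add: vec_eq_iff)
qed

lemma weak_gradient_linear:
  assumes "u \<in> L2" "G \<in> L2" "w \<in> L2" "K \<in> L2" "has_weak_gradient u G" "has_weak_gradient w K"
  shows "has_weak_gradient (\<lambda>x. c * u x + d * w x) (\<lambda>x. \<chi> i. c * G x $ i + d * K x $ i)"
  unfolding has_weak_gradient_def
proof (intro ballI allI)
  fix \<phi> i assume \<phi>: "\<phi> \<in> test_functions"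
  have lin: "(LINT x|lebesgue. \<psi> x *\<^sub>R (c * f x + d * h x)) =
      c * (LINT x|lebesgue. \<psi> x *\<^sub>R f x) + d * (LINT x|lebesgue. \<psi> x *\<^sub>R h x)"
    if "\<psi> \<in> test_functions" "f \<in> L2" "h \<in> L2" for \<psi> and f h :: "R3 \<Rightarrow> complex"
  proof -
    have "(LINT x|lebesgue. \<psi> x *\<^sub>R (c * f x + d * h x)) =
        (LINT x|lebesgue. c * (\<psi> x *\<^sub>R f x) + d * (\<psi> x *\<^sub>R h x))"
      by (simp add: scaleR_add_right)
    also have "\<dots> = (LINT x|lebesgue. c * (\<psi> x *\<^sub>R f x)) + (LINT x|lebesgue. d * (\<psi> x *\<^sub>R h x))"
      by (intro Bochner_Integration.integral_add integrable_mult_right L2_scaleR_integrable test_function_L2 that)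
    also have "\<dots> = c * (LINT x|lebesgue. \<psi> x *\<^sub>R f x) + d * (LINT x|lebesgue. \<psi> x *\<^sub>R h x)"
      by (simp only: integral_mult_right_zero)
    finally show ?thesis .
  qed
  have "(LINT x|lebesgue. partial_deriv i \<phi> x *\<^sub>R (c * u x + d * w x)) =
      c * - (LINT x|lebesgue. \<phi> x *\<^sub>R (G x $ i)) + d * - (LINT x|lebesgue. \<phi> x *\<^sub>R (K x $ i))"
    unfolding lin[OF test_function_partial[OF \<phi>] assms(1,3)]
    unfolding has_weak_gradientD[OF assms(5) \<phi>] has_weak_gradientD[OF assms(6) \<phi>] ..
  also have "\<dots> = - (LINT x|lebesgue. \<phi> x *\<^sub>R (c * G x $ i + d * K x $ i))"
    unfolding lin[OF \<phi> L2_component[OF assms(2)] L2_component[OF assms(4)]] by simp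
  finally show "(LINT x|lebesgue. partial_deriv i \<phi> x *\<^sub>R (c * u x + d * w x)) =
      - (LINT x|lebesgue. \<phi> x *\<^sub>R ((\<chi> i. c * G x $ i + d * K x $ i) $ i))" by simp
qed

section \<open>The embedding of \<open>H\<^sup>1\<close> into \<open>L\<^sup>4\<close>\<close>

lemma L2_nn_integral_lborel:
  assumes "f \<in> L2"
  shows "(\<integral>\<^sup>+x. ennreal ((norm (f x))\<^sup>2) \<partial>lborel) = ennreal ((L2_norm f)\<^sup>2)"
  using L2_nn_integral[OF assms] by (simp only: nn_integral_completion)

lemma lborel_distr_shift:
  fixes c :: "'a::euclidean_space"
  shows "distr lborel borel (\<lambda>x. x + c) = lborel"
proof -
  have "(\<lambda>x. x + c) = (+) c" by (rule ext) (rule add.commute)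
  then show ?thesis by (simp only: lborel_distr_plus)
qed

lemma nn_integral_lborel_shift:
  fixes c :: "'a::euclidean_space"
  assumes "f \<in> borel_measurable borel"
  shows "(\<integral>\<^sup>+x. f (x + c) \<partial>lborel) = (\<integral>\<^sup>+x. f x \<partial>lborel)"
proof -
  have "(\<integral>\<^sup>+x. f x \<partial>distr lborel borel (\<lambda>x. x + c)) = (\<integral>\<^sup>+x. f (x + c) \<partial>lborel)"
    by (rule nn_integral_distr) (use assms in simp_all)
  then show ?thesis by (simp only: lborel_distr_shift)
qed

lemma lborel_integral_shift:
  fixes c :: "'a::euclidean_space" and f :: "'a \<Rightarrow> 'b::{banach, second_countable_topology}"
  assumes "f \<in> borel_measurable borel"
  shows "(LINT x|lborel. f (x + c)) = (LINT x|lborel. f x)"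
proof -
  have "(LINT x|distr lborel borel (\<lambda>x. x + c). f x) = (LINT x|lborel. f (x + c))"
    by (rule integral_distr) (use assms in simp_all)
  then show ?thesis by (simp only: lborel_distr_shift)
qed

text \<open>The translated products below are integrated along \<open>t \<mapsto> x + t\<^sup>4 h\<close>; the fourth power makes
  the weight \<open>t\<^sup>3\<close> compensate the loss of the averages over cubes of side \<open>t\<^sup>4 r\<close>.\<close>

lemma translated_product_integrable:
  fixes a :: "R3 \<Rightarrow> real" and b :: "R3 \<Rightarrow> complex" and s1 s2 :: "real \<Rightarrow> R3"
  assumes [measurable]: "a \<in> borel_measurable borel" "b \<in> borel_measurable borel"
      "s1 \<in> borel_measurable borel" "s2 \<in> borel_measurable borel"
    and L2: "a \<in> L2" "b \<in> L2"
  shows "integrable (lborel \<Otimes>\<^sub>M lborel)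
     (\<lambda>(x, t). (indicator {0..1} t * (4 * t ^ 3)) *\<^sub>R (a (x + s1 t) *\<^sub>R b (x + s2 t)))"
proof (rule integrableI_bounded)
  define X where "X = (\<integral>\<^sup>+x. ennreal ((norm (a x))\<^sup>2) \<partial>lborel) + (\<integral>\<^sup>+x. ennreal ((norm (b x))\<^sup>2) \<partial>lborel)"
  have X: "X < \<infinity>"
    unfolding X_def L2_nn_integral_lborel[OF L2(1)] L2_nn_integral_lborel[OF L2(2)] by simp
  note shift = nn_integral_lborel_shift
  have inner: "(\<integral>\<^sup>+x. norm ((indicator {0..1} t * (4 * t ^ 3)) *\<^sub>R (a (x + s1 t) *\<^sub>R b (x + s2 t))) \<partial>lborel)
      \<le> ennreal (4 * indicator {0..1} t) * X" for t :: real
  proof -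
    have "(\<integral>\<^sup>+x. norm ((indicator {0..1} t * (4 * t ^ 3)) *\<^sub>R (a (x + s1 t) *\<^sub>R b (x + s2 t))) \<partial>lborel)
      \<le> (\<integral>\<^sup>+x. ennreal (4 * indicator {0..1} t) * (ennreal ((norm (a (x + s1 t)))\<^sup>2) + ennreal ((norm (b (x + s2 t)))\<^sup>2)) \<partial>lborel)"
    proof (rule nn_integral_mono)
      fix x
      have t: "\<bar>indicator {0..1} t * (4 * t ^ 3)\<bar> \<le> 4 * indicator {0..1} t"
        by (auto simp: indicator_def power_le_one)
      have "norm (a (x + s1 t)) * norm (b (x + s2 t)) \<le> (norm (a (x + s1 t)))\<^sup>2 + (norm (b (x + s2 t)))\<^sup>2"
        using sum_squares_bound[of "norm (a (x + s1 t))" "norm (b (x + s2 t))"]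
          mult_nonneg_nonneg[OF norm_ge_zero norm_ge_zero, of "a (x + s1 t)" "b (x + s2 t)"] by linarith
      from mult_mono[OF t this]
      have "norm ((indicator {0..1} t * (4 * t ^ 3)) *\<^sub>R (a (x + s1 t) *\<^sub>R b (x + s2 t)))
        \<le> (4 * indicator {0..1} t) * ((norm (a (x + s1 t)))\<^sup>2 + (norm (b (x + s2 t)))\<^sup>2)"
        unfolding norm_scaleR real_norm_def by simp
      then show "ennreal (norm ((indicator {0..1} t * (4 * t ^ 3)) *\<^sub>R (a (x + s1 t) *\<^sub>R b (x + s2 t))))
        \<le> ennreal (4 * indicator {0..1} t) * (ennreal ((norm (a (x + s1 t)))\<^sup>2) + ennreal ((norm (b (x + s2 t)))\<^sup>2))"
        by (simp add: ennreal_leI flip: ennreal_plus ennreal_mult')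
    qed
    also have "\<dots> = ennreal (4 * indicator {0..1} t) * X"
      unfolding X_def
      using shift[of "\<lambda>x. ennreal ((norm (a x))\<^sup>2)" "s1 t"] shift[of "\<lambda>x. ennreal ((norm (b x))\<^sup>2)" "s2 t"]
      by (simp add: nn_integral_cmult nn_integral_add)
    finally show ?thesis .
  qed
  have "(\<integral>\<^sup>+z. norm (case z of (x, t) \<Rightarrow> (indicator {0..1} t * (4 * t ^ 3)) *\<^sub>R (a (x + s1 t) *\<^sub>R b (x + s2 t))) \<partial>(lborel \<Otimes>\<^sub>M lborel))
      = (\<integral>\<^sup>+t. \<integral>\<^sup>+x. norm ((indicator {0..1} t * (4 * t ^ 3)) *\<^sub>R (a (x + s1 t) *\<^sub>R b (x + s2 t))) \<partial>lborel \<partial>lborel)"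
    by (subst lborel_pair.nn_integral_snd[symmetric]) auto
  also have "\<dots> \<le> (\<integral>\<^sup>+t. ennreal (4 * indicator {0..1} t) * X \<partial>(lborel :: real measure))"
    by (intro nn_integral_mono inner)
  also have "\<dots> = (\<integral>\<^sup>+t. ennreal 4 * indicator {0..1} t \<partial>(lborel :: real measure)) * X"
    by (subst nn_integral_multc) (auto simp: ennreal_mult' ennreal_indicator)
  also have "\<dots> < \<infinity>" using X by (simp add: nn_integral_cmult ennreal_mult_less_top)
  finally show "(\<integral>\<^sup>+z. norm (case z of (x, t) \<Rightarrow> (indicator {0..1} t * (4 * t ^ 3)) *\<^sub>R (a (x + s1 t) *\<^sub>R b (x + s2 t))) \<partial>(lborel \<Otimes>\<^sub>M lborel)) < \<infinity>" .
  have "(\<lambda>z. a (fst z + s1 (snd z))) \<in> borel_measurable (lborel \<Otimes>\<^sub>M lborel)"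
    "(\<lambda>z. b (fst z + s2 (snd z))) \<in> borel_measurable (lborel \<Otimes>\<^sub>M lborel)"
    by measurable
  moreover have "(\<lambda>z::R3 \<times> real. indicator {0..1} (snd z) * (4 * snd z ^ 3) :: real) \<in> borel_measurable (lborel \<Otimes>\<^sub>M lborel)"
    by measurable
  ultimately show "(\<lambda>(x, t). (indicator {0..1} t * (4 * t ^ 3)) *\<^sub>R (a (x + s1 t) *\<^sub>R b (x + s2 t)))
      \<in> borel_measurable (lborel \<Otimes>\<^sub>M lborel)"
    unfolding case_prod_beta by (intro borel_measurable_scaleR)
qed

lemma L2_shift:
  fixes f :: "R3 \<Rightarrow> 'a::euclidean_space"
  assumes [measurable]: "f \<in> borel_measurable borel" and "f \<in> L2"
  shows "(\<lambda>x. f (x + c)) \<in> L2"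
proof (rule L2I_nn_integral)
  show "(\<lambda>x. f (x + c)) \<in> borel_measurable lebesgue" by (rule borel_imp_lebesgue) measurable
  have "(\<integral>\<^sup>+x. ennreal ((norm (f (x + c)))\<^sup>2) \<partial>lborel) = (\<integral>\<^sup>+x. ennreal ((norm (f x))\<^sup>2) \<partial>lborel)"
    by (rule nn_integral_lborel_shift[of "\<lambda>x. ennreal ((norm (f x))\<^sup>2)"]) measurable
  also have "\<dots> < \<infinity>" unfolding L2_nn_integral_lborel[OF assms(2)] by simp
  finally show "(\<integral>\<^sup>+x. ennreal ((norm (f (x + c)))\<^sup>2) \<partial>lebesgue) < \<infinity>"
    by (simp only: nn_integral_completion)
qed

lemma frechet_derivative_partial:
  assumes "\<phi> differentiable (at y)"
  shows "frechet_derivative \<phi> (at y) v = (\<Sum>i\<in>UNIV. v $ i * partial_deriv i \<phi> y)"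
proof -
  have lin: "linear (frechet_derivative \<phi> (at y))" by (rule linear_frechet_derivative[OF assms])
  have "v = (\<Sum>i\<in>UNIV. v $ i *\<^sub>R axis i 1)"
    using basis_expansion[of v] by (simp add: scalar_mult_eq_scaleR)
  then have "frechet_derivative \<phi> (at y) v = frechet_derivative \<phi> (at y) (\<Sum>i\<in>UNIV. v $ i *\<^sub>R axis i 1)"
    by (rule arg_cong)
  also have "\<dots> = (\<Sum>i\<in>UNIV. v $ i * partial_deriv i \<phi> y)"
    unfolding partial_deriv_def by (simp add: linear_sum[OF lin] linear_scale[OF lin])
  finally show ?thesis .
qed

lemma test_function_line_integral:
  assumes \<phi>: "\<phi> \<in> test_functions"
  shows "\<phi> (x - h) - \<phi> x = (\<Sum>i\<in>UNIV. - h $ i *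
      (LINT t|lborel. (indicator {0..1} t * (4 * t ^ 3)) * partial_deriv i \<phi> (x + t ^ 4 *\<^sub>R (- h))))"
    and "integrable lborel (\<lambda>t. (indicator {0..1} t * (4 * t ^ 3)) * partial_deriv i \<phi> (x + t ^ 4 *\<^sub>R (- h)))"
proof -
  define f where "f i t = (4 * t ^ 3) * partial_deriv i \<phi> (x + t ^ 4 *\<^sub>R (- h))" for i t
  have cont: "continuous_on UNIV (f i)" for i
    unfolding f_def
    by (intro continuous_intros continuous_on_compose2[OF test_function_continuous[OF test_function_partial[OF \<phi>]]] subset_UNIV)
  have int: "integrable lborel (\<lambda>t. indicator {0..1} t *\<^sub>R f i t)" for i
    using borel_integrable_compact[OF compact_Icc[of 0 1] continuous_on_subset[OF cont subset_UNIV]] by simp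
  have form: "(indicator {0..1} t * (4 * t ^ 3)) * partial_deriv i \<phi> (x + t ^ 4 *\<^sub>R (- h)) = indicator {0..1} t *\<^sub>R f i t" for i t
    unfolding f_def by simp
  show "integrable lborel (\<lambda>t. (indicator {0..1} t * (4 * t ^ 3)) * partial_deriv i \<phi> (x + t ^ 4 *\<^sub>R (- h)))"
    unfolding form by (rule int)
  have deriv: "((\<lambda>t. \<phi> (x + t ^ 4 *\<^sub>R (- h))) has_vector_derivative (\<Sum>i\<in>UNIV. - h $ i * f i t)) (at t within {0..1})" for t
  proof -
    have "((\<lambda>t. x + t ^ 4 *\<^sub>R (- h)) has_derivative (\<lambda>s. (4 * t ^ 3 * s) *\<^sub>R (- h))) (at t)"
      by (auto intro!: derivative_eq_intros)
    from has_derivative_compose[OF this has_derivative_frechet[OF test_function_differentiable[OF \<phi>]]]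
    have "((\<lambda>t. \<phi> (x + t ^ 4 *\<^sub>R (- h))) has_derivative
        (\<lambda>s. \<Sum>i\<in>UNIV. ((4 * t ^ 3 * s) *\<^sub>R (- h)) $ i * partial_deriv i \<phi> (x + t ^ 4 *\<^sub>R (- h)))) (at t)"
      unfolding frechet_derivative_partial[OF test_function_differentiable[OF \<phi>]] .
    moreover have "(\<lambda>s. \<Sum>i\<in>UNIV. ((4 * t ^ 3 * s) *\<^sub>R (- h)) $ i * partial_deriv i \<phi> (x + t ^ 4 *\<^sub>R (- h)))
        = (\<lambda>s. s *\<^sub>R (\<Sum>i\<in>UNIV. - h $ i * f i t))"
      unfolding f_def by (rule ext) (simp add: sum_distrib_left mult_ac)
    ultimately have "((\<lambda>t. \<phi> (x + t ^ 4 *\<^sub>R (- h))) has_vector_derivative (\<Sum>i\<in>UNIV. - h $ i * f i t)) (at t)"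
      unfolding has_vector_derivative_def by simp
    then show ?thesis by (rule has_vector_derivative_at_within)
  qed
  have "(LINT t|lborel. indicator {0..1} t *\<^sub>R (\<Sum>i\<in>UNIV. - h $ i * f i t))
      = \<phi> (x + 1 ^ 4 *\<^sub>R (- h)) - \<phi> (x + 0 ^ 4 *\<^sub>R (- h))"
  proof (rule integral_FTC_Icc)
    show "continuous_on {0..1} (\<lambda>t. \<Sum>i\<in>UNIV. - h $ i * f i t)"
      by (intro continuous_on_sum continuous_on_mult continuous_on_const continuous_on_subset[OF cont] subset_UNIV)
  qed (simp, rule deriv)
  also have "(LINT t|lborel. indicator {0..1} t *\<^sub>R (\<Sum>i\<in>UNIV. - h $ i * f i t))
      = (LINT t|lborel. (\<Sum>i\<in>UNIV. - h $ i * (indicator {0..1} t *\<^sub>R f i t)))"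
    by (simp add: sum_distrib_left mult_ac)
  also have "\<dots> = (\<Sum>i\<in>UNIV. - h $ i * (LINT t|lborel. indicator {0..1} t *\<^sub>R f i t))"
    by (subst Bochner_Integration.integral_sum) (intro integrable_mult_right int, simp only: integral_mult_right_zero)
  finally show "\<phi> (x - h) - \<phi> x = (\<Sum>i\<in>UNIV. - h $ i *
      (LINT t|lborel. (indicator {0..1} t * (4 * t ^ 3)) * partial_deriv i \<phi> (x + t ^ 4 *\<^sub>R (- h))))"
    unfolding form by simp
qed

text \<open>The fundamental theorem of calculus along a segment, by duality. Against a test function
  the translation moves to \<open>\<phi>\<close>, where the classical line integral applies; the
  weak gradient identity for translates of \<open>\<phi>\<close> and Fubini move everything back to
  \<open>G\<close>. The exceptional null set depends on \<open>h\<close>.\<close>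

lemma translation_formula:
  fixes u :: "R3 \<Rightarrow> complex" and G :: "R3 \<Rightarrow> complex^3"
  assumes u_meas [measurable]: "u \<in> borel_measurable borel" and G_meas [measurable]: "G \<in> borel_measurable borel"
    and uL: "u \<in> L2" and GL: "G \<in> L2" and wg: "has_weak_gradient u G"
  shows "AE x in lborel. u (x + h) - u x =
    (\<Sum>i\<in>UNIV. h $ i *\<^sub>R (LINT t|lborel. (indicator {0..1} t * (4 * t ^ 3)) *\<^sub>R (G (x + t ^ 4 *\<^sub>R h) $ i)))"
proof -
  define w :: "real \<Rightarrow> real" where "w t = indicator {0..1} t * (4 * t ^ 3)" for t
  define D where "D i x = (LINT t|lborel. w t *\<^sub>R (G (x + t ^ 4 *\<^sub>R h) $ i))" for i x
  define g where "g x = u (x + h) - u x - (\<Sum>i\<in>UNIV. h $ i *\<^sub>R D i x)" for x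
  have Gi [measurable]: "(\<lambda>x. G x $ i) \<in> borel_measurable borel" for i
    by (rule measurable_compose[OF G_meas]) (intro borel_measurable_continuous_onI continuous_intros)
  have GiL: "(\<lambda>x. G x $ i) \<in> L2" for i by (rule L2_component[OF GL])
  have s_meas [measurable]: "(\<lambda>t. t ^ 4 *\<^sub>R c) \<in> borel_measurable borel" for c :: R3
    by (intro borel_measurable_continuous_onI continuous_intros)
  have [measurable]: "w \<in> borel_measurable borel" unfolding w_def by measurable
  have pair: "integrable (lborel \<Otimes>\<^sub>M lborel) (\<lambda>(x, t). w t *\<^sub>R (a x *\<^sub>R (G (x + t ^ 4 *\<^sub>R h) $ i)))"
    if "a \<in> borel_measurable borel" "a \<in> L2" for a i
    using translated_product_integrable[OF that(1) Gi[of i] borel_measurable_const[of 0] s_meas[of h] that(2) GiL]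
    unfolding w_def by simp
  have inner: "(LINT t|lborel. w t *\<^sub>R (c *\<^sub>R (G (x + t ^ 4 *\<^sub>R h) $ i))) = c *\<^sub>R D i x" for c x i
    unfolding D_def by (subst integral_scaleR_right[symmetric]) (simp only: scaleR_left_commute)
  have int_D: "integrable lborel (\<lambda>x. a x *\<^sub>R D i x)" if "a \<in> borel_measurable borel" "a \<in> L2" for a i
    using lborel_pair.integrable_fst[OF pair[OF that]] unfolding inner .
  have [measurable]: "D i \<in> borel_measurable borel" for i
  proof -
    have "(\<lambda>x. (LINT t|lborel. w t *\<^sub>R (G (x + t ^ 4 *\<^sub>R h) $ i))) \<in> borel_measurable lborel"
      by (intro lborel.borel_measurable_lebesgue_integral) measurable
    then show ?thesis unfolding D_def by simp
  qed
  have [measurable]: "g \<in> borel_measurable borel" unfolding g_def by measurable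
  have int_u: "integrable lborel (\<lambda>x. a x *\<^sub>R f x)"
    if "a \<in> borel_measurable borel" "a \<in> L2" "f \<in> borel_measurable borel" "f \<in> L2" for a and f :: "R3 \<Rightarrow> complex"
  proof -
    have "(\<lambda>x. a x *\<^sub>R f x) \<in> borel_measurable lborel" using that(1,3) by simp
    with L2_scaleR_integrable[OF that(2,4)] show ?thesis by (simp add: integrable_completion)
  qed
  have uhL: "(\<lambda>x. u (x + h)) \<in> L2" by (rule L2_shift[OF u_meas uL])
  have uh_meas: "(\<lambda>x. u (x + h)) \<in> borel_measurable borel" by measurable
  have g_split: "a x *\<^sub>R g x = a x *\<^sub>R u (x + h) - a x *\<^sub>R u x - (\<Sum>i\<in>UNIV. h $ i *\<^sub>R (a x *\<^sub>R D i x))" for a :: "R3 \<Rightarrow> real" and x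
    unfolding g_def by (simp add: scaleR_diff_right scaleR_sum_right mult.commute)
  have int_g: "integrable lborel (\<lambda>x. a x *\<^sub>R g x)" if "a \<in> borel_measurable borel" "a \<in> L2" for a
    unfolding g_split
    by (intro Bochner_Integration.integrable_diff Bochner_Integration.integrable_sum integrable_scaleR_right
        int_u int_D that uhL uh_meas u_meas uL)
  have zero: "(LINT x|lborel. \<phi> x *\<^sub>R g x) = 0" if \<phi>: "\<phi> \<in> test_functions" for \<phi>
  proof -
    have \<phi>m [measurable]: "\<phi> \<in> borel_measurable borel" by (rule test_function_measurable[OF \<phi>])
    have \<phi>L: "\<phi> \<in> L2" by (rule test_function_L2[OF \<phi>])
    have pm [measurable]: "partial_deriv i \<phi> \<in> borel_measurable borel" for i
      by (rule test_function_measurable[OF test_function_partial[OF \<phi>]])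
    have pL: "partial_deriv i \<phi> \<in> L2" for i by (rule test_function_L2[OF test_function_partial[OF \<phi>]])
    have \<phi>h: "(\<lambda>x. \<phi> (x - h)) \<in> borel_measurable borel" "(\<lambda>x. \<phi> (x - h)) \<in> L2"
      using L2_shift[OF \<phi>m \<phi>L, of "- h"] by simp_all
    have 1: "(LINT x|lborel. \<phi> x *\<^sub>R u (x + h)) = (LINT x|lborel. \<phi> (x - h) *\<^sub>R u x)"
    proof -
      have "(LINT x|lborel. \<phi> ((x + h) - h) *\<^sub>R u (x + h)) = (LINT x|lborel. \<phi> (x - h) *\<^sub>R u x)"
        by (rule lborel_integral_shift[of "\<lambda>x. \<phi> (x - h) *\<^sub>R u x"]) measurable
      then show ?thesis by simp
    qed
    have pair1: "integrable (lborel \<Otimes>\<^sub>M lborel) (\<lambda>(x, t). w t *\<^sub>R (partial_deriv i \<phi> (x + t ^ 4 *\<^sub>R (- h)) *\<^sub>R u x))" for i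
      using translated_product_integrable[OF pm[of i] u_meas s_meas[of "- h"] borel_measurable_const[of 0] pL uL]
      unfolding w_def by simp
    have inner1: "(LINT t|lborel. w t *\<^sub>R (partial_deriv i \<phi> (x + t ^ 4 *\<^sub>R (- h)) *\<^sub>R u x)) =
        (LINT t|lborel. w t * partial_deriv i \<phi> (x + t ^ 4 *\<^sub>R (- h))) *\<^sub>R u x" for i x
    proof -
      have "(LINT t|lborel. (w t * partial_deriv i \<phi> (x + t ^ 4 *\<^sub>R (- h))) *\<^sub>R u x) =
        (LINT t|lborel. w t * partial_deriv i \<phi> (x + t ^ 4 *\<^sub>R (- h))) *\<^sub>R u x"
        by (rule integral_scaleR_left) (unfold w_def, rule test_function_line_integral(2)[OF \<phi>])
      then show ?thesis by simp
    qed
    \<comment> \<open>For fixed \<open>t\<close> the translate of \<open>\<phi>\<close> by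
      \<open>c\<close> is again a test function, so the weak gradient identity applies to it. Both
      uses of Fubini rest on \<open>translated_product_integrable\<close>.\<close>
    have 2: "(LINT x|lborel. LINT t|lborel. w t *\<^sub>R (partial_deriv i \<phi> (x + t ^ 4 *\<^sub>R (- h)) *\<^sub>R u x))
        = - (LINT x|lborel. \<phi> x *\<^sub>R D i x)" for i
    proof -
      have "(LINT x|lborel. LINT t|lborel. w t *\<^sub>R (partial_deriv i \<phi> (x + t ^ 4 *\<^sub>R (- h)) *\<^sub>R u x))
        = (LINT t|lborel. LINT x|lborel. w t *\<^sub>R (partial_deriv i \<phi> (x + t ^ 4 *\<^sub>R (- h)) *\<^sub>R u x))"
        by (rule lborel_pair.Fubini_integral[OF pair1, symmetric])
      also have "\<dots> = (LINT t|lborel. LINT x|lborel. - (w t *\<^sub>R (\<phi> x *\<^sub>R (G (x + t ^ 4 *\<^sub>R h) $ i))))"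
      proof (rule Bochner_Integration.integral_cong[OF refl])
        fix t :: real
        define c where "c = t ^ 4 *\<^sub>R (- h)"
        have e: "x - c = x + t ^ 4 *\<^sub>R h" for x unfolding c_def by simp
        have \<phi>c: "(\<lambda>x. \<phi> (x + c)) \<in> test_functions" by (rule test_function_shift[OF \<phi>])
        have pc: "partial_deriv i (\<lambda>x. \<phi> (x + c)) = (\<lambda>x. partial_deriv i \<phi> (x + c))"
          by (rule partial_deriv_shift) (rule test_function_differentiable[OF \<phi>])
        have "(LINT x|lborel. partial_deriv i \<phi> (x + c) *\<^sub>R u x) = (LINT x|lebesgue. partial_deriv i \<phi> (x + c) *\<^sub>R u x)"
          by (rule integral_completion[symmetric]) measurable
        also have "\<dots> = - (LINT x|lebesgue. \<phi> (x + c) *\<^sub>R (G x $ i))"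
          using has_weak_gradientD[OF wg \<phi>c, of i] unfolding pc .
        also have "(LINT x|lebesgue. \<phi> (x + c) *\<^sub>R (G x $ i)) = (LINT x|lborel. \<phi> (x + c) *\<^sub>R (G x $ i))"
          by (rule integral_completion) measurable
        also have "\<dots> = (LINT x|lborel. \<phi> x *\<^sub>R (G (x - c) $ i))"
        proof -
          have "(LINT x|lborel. \<phi> (x + c) *\<^sub>R (G ((x + c) - c) $ i)) = (LINT x|lborel. \<phi> x *\<^sub>R (G (x - c) $ i))"
            by (rule lborel_integral_shift[of "\<lambda>x. \<phi> x *\<^sub>R (G (x - c) $ i)"]) measurable
          then show ?thesis by simp
        qed
        finally have "(LINT x|lborel. partial_deriv i \<phi> (x + c) *\<^sub>R u x) = - (LINT x|lborel. \<phi> x *\<^sub>R (G (x - c) $ i))" .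
        then show "(LINT x|lborel. w t *\<^sub>R (partial_deriv i \<phi> (x + t ^ 4 *\<^sub>R (- h)) *\<^sub>R u x)) =
            (LINT x|lborel. - (w t *\<^sub>R (\<phi> x *\<^sub>R (G (x + t ^ 4 *\<^sub>R h) $ i))))"
          unfolding c_def[symmetric] e integral_scaleR_right Bochner_Integration.integral_minus
          by (simp only: scaleR_minus_right)
      qed
      also have "\<dots> = - (LINT t|lborel. LINT x|lborel. w t *\<^sub>R (\<phi> x *\<^sub>R (G (x + t ^ 4 *\<^sub>R h) $ i)))"
        by (simp only: Bochner_Integration.integral_minus)
      also have "(LINT t|lborel. LINT x|lborel. w t *\<^sub>R (\<phi> x *\<^sub>R (G (x + t ^ 4 *\<^sub>R h) $ i)))
          = (LINT x|lborel. LINT t|lborel. w t *\<^sub>R (\<phi> x *\<^sub>R (G (x + t ^ 4 *\<^sub>R h) $ i)))"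
        by (rule lborel_pair.Fubini_integral[OF pair[OF \<phi>m \<phi>L]])
      finally show ?thesis unfolding inner .
    qed
    have int1: "integrable lborel (\<lambda>x. (LINT t|lborel. w t * partial_deriv i \<phi> (x + t ^ 4 *\<^sub>R (- h))) *\<^sub>R u x)" for i
      using lborel_pair.integrable_fst[OF pair1[of i]] unfolding inner1 .
    have "(LINT x|lborel. \<phi> (x - h) *\<^sub>R u x) - (LINT x|lborel. \<phi> x *\<^sub>R u x)
        = (LINT x|lborel. (\<phi> (x - h) - \<phi> x) *\<^sub>R u x)"
      unfolding scaleR_diff_left
      by (rule Bochner_Integration.integral_diff[symmetric]) (intro int_u \<phi>h \<phi>m \<phi>L u_meas uL)+
    also have "\<dots> = (LINT x|lborel. (\<Sum>i\<in>UNIV. (- h $ i) *\<^sub>R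
        ((LINT t|lborel. w t * partial_deriv i \<phi> (x + t ^ 4 *\<^sub>R (- h))) *\<^sub>R u x)))"
      unfolding test_function_line_integral(1)[OF \<phi>] w_def by (simp only: scaleR_sum_left scaleR_scaleR)
    also have "\<dots> = (\<Sum>i\<in>UNIV. (- h $ i) *\<^sub>R
        (LINT x|lborel. (LINT t|lborel. w t * partial_deriv i \<phi> (x + t ^ 4 *\<^sub>R (- h))) *\<^sub>R u x))"
      by (subst Bochner_Integration.integral_sum) (intro integrable_scaleR_right int1, simp only: integral_scaleR_right)
    also have "\<dots> = (\<Sum>i\<in>UNIV. h $ i *\<^sub>R (LINT x|lborel. \<phi> x *\<^sub>R D i x))"
      using 2 unfolding inner1 by simp
    finally have 3: "(LINT x|lborel. \<phi> (x - h) *\<^sub>R u x) - (LINT x|lborel. \<phi> x *\<^sub>R u x)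
        = (\<Sum>i\<in>UNIV. h $ i *\<^sub>R (LINT x|lborel. \<phi> x *\<^sub>R D i x))" .
    have "(LINT x|lborel. \<phi> x *\<^sub>R g x) = (LINT x|lborel. \<phi> x *\<^sub>R u (x + h)) - (LINT x|lborel. \<phi> x *\<^sub>R u x)
        - (LINT x|lborel. (\<Sum>i\<in>UNIV. h $ i *\<^sub>R (\<phi> x *\<^sub>R D i x)))"
      unfolding g_split
      by (subst Bochner_Integration.integral_diff Bochner_Integration.integral_diff;
          (intro Bochner_Integration.integrable_diff Bochner_Integration.integrable_sum integrable_scaleR_right
        int_u int_D \<phi>m \<phi>L uhL uh_meas u_meas uL)?)+ simp
    also have "(LINT x|lborel. (\<Sum>i\<in>UNIV. h $ i *\<^sub>R (\<phi> x *\<^sub>R D i x))) = (\<Sum>i\<in>UNIV. h $ i *\<^sub>R (LINT x|lborel. \<phi> x *\<^sub>R D i x))"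
      by (subst Bochner_Integration.integral_sum) (intro integrable_scaleR_right int_D \<phi>m \<phi>L, simp only: integral_scaleR_right)
    finally show ?thesis unfolding 1 using 3 by simp
  qed
  have "AE x in lborel. g x = 0"
  proof (rule fundamental_lemma_complex)
    show "integrable lborel (\<lambda>x. indicator (box a b) x *\<^sub>R g x)" for a b
      by (rule int_g) (simp_all add: indicator_box_L2)
    show "integrable lborel (\<lambda>x. \<phi> x *\<^sub>R g x)" if "\<phi> \<in> test_functions" for \<phi>
      by (rule int_g[OF test_function_measurable[OF that] test_function_L2[OF that]])
  qed (simp_all add: zero)
  then show ?thesis
  proof eventually_elim
    case (elim x)
    then show ?case unfolding g_def D_def w_def by simp
  qed
qed

lemma ennreal_add_sq_le: "(a + b)\<^sup>2 \<le> 2 * a\<^sup>2 + 2 * (b::ennreal)\<^sup>2"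
proof (cases "a = top \<or> b = top")
  case True
  then have "2 * a\<^sup>2 + 2 * b\<^sup>2 = top" by (elim disjE) (simp_all add: power2_eq_square ennreal_mult_top)
  then show ?thesis by (simp only: top_greatest)
next
  case False
  then obtain r s where r: "0 \<le> r" "a = ennreal r" and s: "0 \<le> s" "b = ennreal s"
    by (cases a; cases b) auto
  have sq: "(r + s)\<^sup>2 \<le> 2 * r\<^sup>2 + 2 * s\<^sup>2" using sum_squares_bound[of r s] by (simp add: power2_sum)
  have "(a + b)\<^sup>2 = (ennreal (r + s))\<^sup>2" unfolding r(2) s(2) ennreal_plus[OF r(1) s(1)] ..
  also have "\<dots> = ennreal ((r + s)\<^sup>2)" by (rule ennreal_power) (use r(1) s(1) in simp)
  also have "\<dots> \<le> ennreal (2 * r\<^sup>2 + 2 * s\<^sup>2)" by (rule ennreal_leI[OF sq])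
  also have "\<dots> = ennreal (2 * r\<^sup>2) + ennreal (2 * s\<^sup>2)" by (rule ennreal_plus) simp_all
  also have "ennreal (2 * r\<^sup>2) = 2 * a\<^sup>2" unfolding r(2) ennreal_power[OF r(1)] by (simp add: ennreal_mult')
  also have "ennreal (2 * s\<^sup>2) = 2 * b\<^sup>2" unfolding s(2) ennreal_power[OF s(1)] by (simp add: ennreal_mult')
  finally show ?thesis .
qed

lemma ennreal_add_pow4_le: "(a + b) ^ 4 \<le> 8 * a ^ 4 + 8 * (b::ennreal) ^ 4"
proof -
  have p4: "x ^ 4 = (x\<^sup>2)\<^sup>2" for x :: ennreal by (simp flip: power_mult)
  have "(a + b) ^ 4 \<le> (2 * a\<^sup>2 + 2 * b\<^sup>2)\<^sup>2" unfolding p4[of "a + b"] by (rule power_mono[OF ennreal_add_sq_le]) simp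
  also have "\<dots> \<le> 2 * (2 * a\<^sup>2)\<^sup>2 + 2 * (2 * b\<^sup>2)\<^sup>2" by (rule ennreal_add_sq_le)
  also have "\<dots> = (2 * 2\<^sup>2) * a ^ 4 + (2 * 2\<^sup>2) * b ^ 4"
    unfolding p4[of a] p4[of b] power_mult_distrib mult.assoc ..
  also have "(2 * 2\<^sup>2 :: ennreal) = 8" by simp
  finally show ?thesis .
qed

section \<open>Averages over cubes and along segments\<close>

lemma nn_integral_lborel_scale:
  fixes f :: "R3 \<Rightarrow> ennreal"
  assumes [measurable]: "f \<in> borel_measurable borel" and s: "s > 0"
  shows "ennreal (s ^ 3) * (\<integral>\<^sup>+y. f (x + s *\<^sub>R y) \<partial>lborel) = (\<integral>\<^sup>+y. f y \<partial>lborel)"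
proof -
  have "(\<integral>\<^sup>+y. f y \<partial>lborel) = (\<integral>\<^sup>+y. f y \<partial>density (distr lborel borel (\<lambda>y. x + s *\<^sub>R y)) (\<lambda>_. ennreal (\<bar>s\<bar> ^ DIM(R3))))"
    using lborel_affine[of s x] s by simp
  also have "\<dots> = (\<integral>\<^sup>+y. ennreal (\<bar>s\<bar> ^ DIM(R3)) * f y \<partial>distr lborel borel (\<lambda>y. x + s *\<^sub>R y))"
    by (rule nn_integral_density) measurable
  also have "\<dots> = (\<integral>\<^sup>+y. ennreal (\<bar>s\<bar> ^ DIM(R3)) * f (x + s *\<^sub>R y) \<partial>lborel)"
    by (rule nn_integral_distr) measurable
  also have "\<dots> = ennreal (\<bar>s\<bar> ^ DIM(R3)) * (\<integral>\<^sup>+y. f (x + s *\<^sub>R y) \<partial>lborel)"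
    by (rule nn_integral_cmult) measurable
  finally show ?thesis using s by simp
qed

abbreviation cube :: "R3 set" where "cube \<equiv> cbox 0 One"

lemma emeasure_cube: "emeasure lborel cube = 1"
  by (simp add: emeasure_lborel_cbox_eq)

text \<open>For positive \<open>s\<close> this is the mean of \<open>f\<close> over the cube of side
  \<open>s\<close> with corner \<open>x\<close>. Pulling it back to the unit cube keeps it
  meaningful at \<open>s = 0\<close>, where it equals \<open>f x\<close>.\<close>

definition cube_average :: "real \<Rightarrow> (R3 \<Rightarrow> ennreal) \<Rightarrow> R3 \<Rightarrow> ennreal" where
  "cube_average s f x = (\<integral>\<^sup>+y. indicator cube y * f (x + s *\<^sub>R y) \<partial>lborel)"

lemma cube_average_measurable2:
  assumes [measurable]: "f \<in> borel_measurable borel" "\<sigma> \<in> borel_measurable borel"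
  shows "(\<lambda>z. cube_average (\<sigma> (snd z)) f (fst z)) \<in> borel_measurable (lborel \<Otimes>\<^sub>M (lborel :: real measure))"
  unfolding cube_average_def by (intro lborel.borel_measurable_nn_integral) measurable

lemma cube_average_measurable:
  assumes [measurable]: "f \<in> borel_measurable borel"
  shows "cube_average s f \<in> borel_measurable borel"
proof -
  have "(\<lambda>x. \<integral>\<^sup>+y. indicator cube y * f (x + s *\<^sub>R y) \<partial>lborel) \<in> borel_measurable lborel"
    by (intro lborel.borel_measurable_nn_integral) measurable
  then show ?thesis unfolding cube_average_def by simp
qed

lemma cube_average_sq:
  assumes [measurable]: "f \<in> borel_measurable borel"
  shows "(cube_average s f x)\<^sup>2 \<le> cube_average s (\<lambda>y. (f y)\<^sup>2) x"
proof -
  have "(cube_average s f x)\<^sup>2 = (\<integral>\<^sup>+y. indicator cube y * (indicator cube y * f (x + s *\<^sub>R y)) \<partial>lborel)\<^sup>2"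
    unfolding cube_average_def by (intro arg_cong[of _ _ "\<lambda>a. a\<^sup>2"] nn_integral_cong) (simp add: indicator_def)
  also have "\<dots> \<le> (\<integral>\<^sup>+y. (indicator cube y)\<^sup>2 \<partial>lborel) * (\<integral>\<^sup>+y. (indicator cube y * f (x + s *\<^sub>R y))\<^sup>2 \<partial>lborel)"
    by (rule Cauchy_Schwarz_nn_integral) measurable
  also have "(\<integral>\<^sup>+y. (indicator cube y)\<^sup>2 \<partial>lborel) = (\<integral>\<^sup>+y. indicator cube y \<partial>lborel)"
    by (rule nn_integral_cong) (simp add: indicator_def)
  also have "\<dots> = 1" using emeasure_cube by simp
  also have "(\<integral>\<^sup>+y. (indicator cube y * f (x + s *\<^sub>R y))\<^sup>2 \<partial>lborel) = cube_average s (\<lambda>y. (f y)\<^sup>2) x"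
    unfolding cube_average_def by (rule nn_integral_cong) (simp add: indicator_def)
  finally show ?thesis by simp
qed

lemma cube_average_le:
  assumes [measurable]: "f \<in> borel_measurable borel" and "s \<ge> 0"
  shows "ennreal (s ^ 3) * cube_average s f x \<le> (\<integral>\<^sup>+y. f y \<partial>lborel)"
proof (cases "s = 0")
  case False
  with assms(2) have s: "s > 0" by simp
  have "cube_average s f x \<le> (\<integral>\<^sup>+y. f (x + s *\<^sub>R y) \<partial>lborel)"
    unfolding cube_average_def by (rule nn_integral_mono) (simp add: indicator_def)
  then have "ennreal (s ^ 3) * cube_average s f x \<le> ennreal (s ^ 3) * (\<integral>\<^sup>+y. f (x + s *\<^sub>R y) \<partial>lborel)"
    by (rule mult_left_mono) simp
  also have "\<dots> = (\<integral>\<^sup>+y. f y \<partial>lborel)" by (rule nn_integral_lborel_scale[OF assms(1) s])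
  finally show ?thesis .
qed simp

lemma cube_average_integral:
  assumes [measurable]: "f \<in> borel_measurable borel"
  shows "(\<integral>\<^sup>+x. cube_average s f x \<partial>lborel) = (\<integral>\<^sup>+x. f x \<partial>lborel)"
proof -
  have "(\<lambda>(x, y). indicator cube y * f (x + s *\<^sub>R y)) \<in> borel_measurable (lborel \<Otimes>\<^sub>M lborel)"
    unfolding case_prod_beta by measurable
  from lborel_pair.Fubini'[OF this]
  have "(\<integral>\<^sup>+x. cube_average s f x \<partial>lborel) = (\<integral>\<^sup>+y. \<integral>\<^sup>+x. indicator cube y * f (x + s *\<^sub>R y) \<partial>lborel \<partial>lborel)"
    unfolding cube_average_def by simp
  also have "\<dots> = (\<integral>\<^sup>+y. (\<integral>\<^sup>+x. f x \<partial>lborel) * indicator cube y \<partial>lborel)"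
  proof (rule nn_integral_cong)
    fix y
    have "(\<integral>\<^sup>+x. indicator cube y * f (x + s *\<^sub>R y) \<partial>lborel) = indicator cube y * (\<integral>\<^sup>+x. f (x + s *\<^sub>R y) \<partial>lborel)"
      by (rule nn_integral_cmult) measurable
    then show "(\<integral>\<^sup>+x. indicator cube y * f (x + s *\<^sub>R y) \<partial>lborel) = (\<integral>\<^sup>+x. f x \<partial>lborel) * indicator cube y"
      unfolding nn_integral_lborel_shift[OF assms] by (simp only: mult.commute)
  qed
  also have "\<dots> = (\<integral>\<^sup>+x. f x \<partial>lborel) * emeasure lborel cube"
    by (rule nn_integral_cmult_indicator) simp
  finally show ?thesis unfolding emeasure_cube by simp
qed

text \<open>The squared average is bounded by the average of the square. Of the two resulting
  factors one is estimated by the full integral, at the price of the volume \<open>s ^ 3\<close>,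
  and the other stays local so that the result can be integrated in \<open>x\<close>.\<close>

lemma cube_average_pow4:
  assumes [measurable]: "f \<in> borel_measurable borel" and "s \<ge> 0"
  shows "ennreal (s ^ 3) * (cube_average s f x) ^ 4
    \<le> (\<integral>\<^sup>+y. (f y)\<^sup>2 \<partial>lborel) * cube_average s (\<lambda>y. (f y)\<^sup>2) x"
proof -
  let ?Q = "cube_average s (\<lambda>y. (f y)\<^sup>2) x"
  have "(cube_average s f x) ^ 4 = ((cube_average s f x)\<^sup>2)\<^sup>2" by (simp flip: power_mult)
  also have "\<dots> \<le> ?Q\<^sup>2" by (intro power_mono cube_average_sq assms) simp
  finally have "ennreal (s ^ 3) * (cube_average s f x) ^ 4 \<le> ennreal (s ^ 3) * ?Q\<^sup>2" by (rule mult_left_mono) simp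
  also have "\<dots> = (ennreal (s ^ 3) * ?Q) * ?Q" by (simp only: power2_eq_square mult.assoc)
  also have "\<dots> \<le> (\<integral>\<^sup>+y. (f y)\<^sup>2 \<partial>lborel) * ?Q"
    by (intro mult_right_mono cube_average_le assms(2)) simp_all
  finally show ?thesis .
qed

lemma cube_average_pow4_integral:
  assumes [measurable]: "f \<in> borel_measurable borel" and "s \<ge> 0"
  shows "ennreal (s ^ 3) * (\<integral>\<^sup>+x. (cube_average s f x) ^ 4 \<partial>lborel) \<le> (\<integral>\<^sup>+y. (f y)\<^sup>2 \<partial>lborel)\<^sup>2"
proof -
  have f2 [measurable]: "(\<lambda>y. (f y)\<^sup>2) \<in> borel_measurable borel" by measurable
  note [measurable] = cube_average_measurable[OF assms(1)] cube_average_measurable[OF f2]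
  have "ennreal (s ^ 3) * (\<integral>\<^sup>+x. (cube_average s f x) ^ 4 \<partial>lborel)
      = (\<integral>\<^sup>+x. ennreal (s ^ 3) * (cube_average s f x) ^ 4 \<partial>lborel)"
    by (rule nn_integral_cmult[symmetric]) measurable
  also have "\<dots> \<le> (\<integral>\<^sup>+x. (\<integral>\<^sup>+y. (f y)\<^sup>2 \<partial>lborel) * cube_average s (\<lambda>y. (f y)\<^sup>2) x \<partial>lborel)"
    by (intro nn_integral_mono cube_average_pow4 assms)
  also have "\<dots> = (\<integral>\<^sup>+y. (f y)\<^sup>2 \<partial>lborel) * (\<integral>\<^sup>+x. cube_average s (\<lambda>y. (f y)\<^sup>2) x \<partial>lborel)"
    by (rule nn_integral_cmult) measurable
  also have "\<dots> = (\<integral>\<^sup>+y. (f y)\<^sup>2 \<partial>lborel)\<^sup>2"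
    unfolding cube_average_integral[OF f2] by (simp only: power2_eq_square)
  finally show ?thesis .
qed

text \<open>Up to the factor 4 this is the integral of \<open>f\<close> along the segment from
  \<open>x\<close> to \<open>x + r y\<close> in the parametrization by \<open>t ^ 4\<close>,
  averaged over \<open>y\<close> in the unit cube.\<close>

definition line_average :: "real \<Rightarrow> (R3 \<Rightarrow> ennreal) \<Rightarrow> R3 \<Rightarrow> ennreal" where
  "line_average r f x = (\<integral>\<^sup>+t. indicator {0..1} t * (ennreal (t ^ 3) * cube_average (t ^ 4 * r) f x) \<partial>lborel)"

lemma unit_interval_sq:
  fixes f :: "real \<Rightarrow> ennreal"
  assumes [measurable]: "f \<in> borel_measurable borel"
  shows "(\<integral>\<^sup>+t. indicator {0..1} t * f t \<partial>lborel)\<^sup>2 \<le> (\<integral>\<^sup>+t. indicator {0..1} t * (f t)\<^sup>2 \<partial>lborel)"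
proof -
  have "(\<integral>\<^sup>+t. indicator {0..1} t * f t \<partial>lborel)\<^sup>2 = (\<integral>\<^sup>+t. indicator {0..1} t * (indicator {0..1} t * f t) \<partial>lborel)\<^sup>2"
    by (intro arg_cong[of _ _ "\<lambda>a. a\<^sup>2"] nn_integral_cong) (simp add: indicator_def)
  also have "\<dots> \<le> (\<integral>\<^sup>+t. (indicator {0..1::real} t)\<^sup>2 \<partial>lborel) * (\<integral>\<^sup>+t. (indicator {0..1} t * f t)\<^sup>2 \<partial>lborel)"
    by (rule Cauchy_Schwarz_nn_integral) measurable
  also have "(\<integral>\<^sup>+t. (indicator {0..1::real} t)\<^sup>2 \<partial>lborel) = (\<integral>\<^sup>+t. indicator {0..1::real} t \<partial>lborel)"
    by (rule nn_integral_cong) (simp add: indicator_def)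
  also have "\<dots> = 1" by simp
  also have "(\<integral>\<^sup>+t. (indicator {0..1} t * f t)\<^sup>2 \<partial>lborel) = (\<integral>\<^sup>+t. indicator {0..1} t * (f t)\<^sup>2 \<partial>lborel)"
    by (rule nn_integral_cong) (simp add: indicator_def)
  finally show ?thesis by simp
qed

lemma line_average_measurable:
  assumes f: "f \<in> borel_measurable borel"
  shows "line_average r f \<in> borel_measurable borel"
proof -
  have s_meas: "(\<lambda>t::real. t ^ 4 * r) \<in> borel_measurable borel" by measurable
  note [measurable] = cube_average_measurable2[OF f s_meas]
  have "(\<lambda>z. indicator {0..1} (snd z) * (ennreal (snd z ^ 3) * cube_average (snd z ^ 4 * r) f (fst z)))
      \<in> borel_measurable (lborel \<Otimes>\<^sub>M lborel)" by measurable
  then have "(\<lambda>x. \<integral>\<^sup>+t. indicator {0..1} t * (ennreal (t ^ 3) * cube_average (t ^ 4 * r) f x) \<partial>lborel) \<in> borel_measurable lborel"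
    by (intro lborel.borel_measurable_nn_integral) (simp only: case_prod_unfold)
  then show ?thesis unfolding line_average_def by simp
qed

text \<open>Two applications of Cauchy-Schwarz on the unit interval move the fourth power inside.
  Since \<open>r ^ 3 * (t ^ 3) ^ 4 = (t ^ 4 * r) ^ 3\<close>, the weight is exactly the volume
  factor that \<open>cube_average_pow4\<close> asks for on a cube of side \<open>t ^ 4 * r\<close>,
  and nothing singular remains at \<open>t = 0\<close>.\<close>

lemma line_average_pow4_integral:
  assumes f [measurable]: "f \<in> borel_measurable borel" and "r \<ge> 0"
  shows "ennreal (r ^ 3) * (\<integral>\<^sup>+x. (line_average r f x) ^ 4 \<partial>lborel) \<le> (\<integral>\<^sup>+y. (f y)\<^sup>2 \<partial>lborel)\<^sup>2"
proof -
  define B where "B = (\<integral>\<^sup>+y. (f y)\<^sup>2 \<partial>lborel)"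
  have f2 [measurable]: "(\<lambda>y. (f y)\<^sup>2) \<in> borel_measurable borel" by measurable
  define q where "q x t = cube_average (t ^ 4 * r) f x" for x t
  define Q where "Q x t = cube_average (t ^ 4 * r) (\<lambda>y. (f y)\<^sup>2) x" for x t
  have s_meas: "(\<lambda>t::real. t ^ 4 * r) \<in> borel_measurable borel" by measurable
  have q2: "(\<lambda>z. q (fst z) (snd z)) \<in> borel_measurable (lborel \<Otimes>\<^sub>M lborel)"
    and Q2: "(\<lambda>z. Q (fst z) (snd z)) \<in> borel_measurable (lborel \<Otimes>\<^sub>M lborel)"
    unfolding q_def Q_def by (rule cube_average_measurable2[OF f s_meas] cube_average_measurable2[OF f2 s_meas])+
  have q1 [measurable]: "q x \<in> borel_measurable borel" and Q1 [measurable]: "Q x \<in> borel_measurable borel" for x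
    using measurable_compose[OF measurable_Pair1'[of x lborel lborel] q2] measurable_compose[OF measurable_Pair1'[of x lborel lborel] Q2]
    by simp_all
  have pointwise: "ennreal (r ^ 3) * (line_average r f x) ^ 4 \<le> (\<integral>\<^sup>+t. B * (indicator {0..1} t * Q x t) \<partial>lborel)" for x
  proof -
    have "(line_average r f x) ^ 4 = ((line_average r f x)\<^sup>2)\<^sup>2" by (simp flip: power_mult)
    also have "\<dots> \<le> (\<integral>\<^sup>+t. indicator {0..1} t * (ennreal (t ^ 3) * q x t)\<^sup>2 \<partial>lborel)\<^sup>2"
      unfolding line_average_def q_def[symmetric] by (intro power_mono unit_interval_sq) simp_all
    also have "\<dots> \<le> (\<integral>\<^sup>+t. indicator {0..1} t * ((ennreal (t ^ 3) * q x t)\<^sup>2)\<^sup>2 \<partial>lborel)"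
      by (rule unit_interval_sq) measurable
    finally have "ennreal (r ^ 3) * (line_average r f x) ^ 4
        \<le> ennreal (r ^ 3) * (\<integral>\<^sup>+t. indicator {0..1} t * ((ennreal (t ^ 3) * q x t)\<^sup>2)\<^sup>2 \<partial>lborel)"
      by (rule mult_left_mono) simp
    also have "\<dots> = (\<integral>\<^sup>+t. ennreal (r ^ 3) * (indicator {0..1} t * ((ennreal (t ^ 3) * q x t)\<^sup>2)\<^sup>2) \<partial>lborel)"
      by (rule nn_integral_cmult[symmetric]) measurable
    also have "\<dots> \<le> (\<integral>\<^sup>+t. B * (indicator {0..1} t * Q x t) \<partial>lborel)"
    proof (rule nn_integral_mono)
      fix t :: real
      show "ennreal (r ^ 3) * (indicator {0..1} t * ((ennreal (t ^ 3) * q x t)\<^sup>2)\<^sup>2) \<le> B * (indicator {0..1} t * Q x t)"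
      proof (cases "t \<in> {0..1}")
        case True
        then have t: "t \<ge> 0" by simp
        have "ennreal (r ^ 3) * ((ennreal (t ^ 3) * q x t)\<^sup>2)\<^sup>2 = ennreal (r ^ 3) * (ennreal (t ^ 3) ^ 4 * q x t ^ 4)"
          by (simp add: power_mult_distrib flip: power_mult)
        also have "\<dots> = ennreal ((t ^ 4 * r) ^ 3) * q x t ^ 4"
        proof -
          have "ennreal (r ^ 3) * ennreal (t ^ 3) ^ 4 = ennreal ((t ^ 4 * r) ^ 3)"
          proof -
            have "ennreal (t ^ 3) ^ 4 = ennreal ((t ^ 3) ^ 4)" by (rule ennreal_power) (use t in simp)
            moreover have "ennreal (r ^ 3) * ennreal ((t ^ 3) ^ 4) = ennreal (r ^ 3 * (t ^ 3) ^ 4)"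
              by (rule ennreal_mult[symmetric]) (use t assms(2) in simp_all)
            moreover have "r ^ 3 * (t ^ 3) ^ 4 = (t ^ 4 * r) ^ 3" by algebra
            ultimately show ?thesis by (simp only:)
          qed
          then show ?thesis by (simp only: mult.assoc[symmetric])
        qed
        also have "\<dots> \<le> B * Q x t"
          unfolding q_def Q_def B_def by (rule cube_average_pow4) (use t assms(2) in simp_all)
        finally show ?thesis using True by simp
      qed simp
    qed
    finally show ?thesis .
  qed
  note [measurable] = line_average_measurable[OF f, of r]
  have "ennreal (r ^ 3) * (\<integral>\<^sup>+x. (line_average r f x) ^ 4 \<partial>lborel)
      = (\<integral>\<^sup>+x. ennreal (r ^ 3) * (line_average r f x) ^ 4 \<partial>lborel)"
    by (rule nn_integral_cmult[symmetric]) measurable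
  also have "\<dots> \<le> (\<integral>\<^sup>+x. \<integral>\<^sup>+t. B * (indicator {0..1} t * Q x t) \<partial>lborel \<partial>lborel)"
    by (intro nn_integral_mono pointwise)
  also have "\<dots> = (\<integral>\<^sup>+t. \<integral>\<^sup>+x. B * (indicator {0..1} t * Q x t) \<partial>lborel \<partial>lborel)"
  proof -
    have "(\<lambda>z. B * (indicator {0..1} (snd z) * Q (fst z) (snd z))) \<in> borel_measurable (lborel \<Otimes>\<^sub>M lborel)"
      using Q2 by measurable
    then have "(\<lambda>(x, t). B * (indicator {0..1} t * Q x t)) \<in> borel_measurable (lborel \<Otimes>\<^sub>M lborel)"
      by (simp only: case_prod_unfold)
    from lborel_pair.Fubini'[OF this] show ?thesis by simp
  qed
  also have "\<dots> = (\<integral>\<^sup>+t. (B * B) * indicator {0..1} t \<partial>(lborel :: real measure))"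
  proof (rule nn_integral_cong)
    fix t :: real
    have Qt [measurable]: "(\<lambda>x. Q x t) \<in> borel_measurable borel"
      unfolding Q_def by (rule cube_average_measurable[OF f2])
    have "(\<integral>\<^sup>+x. B * (indicator {0..1} t * Q x t) \<partial>lborel) = B * (indicator {0..1} t * (\<integral>\<^sup>+x. Q x t \<partial>lborel))"
      by (simp add: nn_integral_cmult)
    also have "(\<integral>\<^sup>+x. Q x t \<partial>lborel) = B" unfolding Q_def B_def by (rule cube_average_integral[OF f2])
    finally show "(\<integral>\<^sup>+x. B * (indicator {0..1} t * Q x t) \<partial>lborel) = (B * B) * indicator {0..1} t"
      by (simp add: mult_ac)
  qed
  also have "\<dots> = (B * B) * emeasure lborel {0..1::real}" by (rule nn_integral_cmult_indicator) simp
  also have "\<dots> = B\<^sup>2" by (simp add: power2_eq_square)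
  finally show ?thesis unfolding B_def .
qed

text \<open>The modulus of \<open>u x\<close> is at most its mean over a cube of side
  \<open>r\<close> plus a multiple of \<open>r\<close> times the line average of the gradient, and
  both have finite fourth moments. The 12 is 3 coordinates times the 4 of \<open>4 * t ^ 3\<close>,
  and 8 comes from the fourth power of a sum. The side \<open>r\<close> stays free; tuning it later
  gives an interpolated form of the embedding.\<close>

lemma L4_bound:
  fixes u :: "R3 \<Rightarrow> complex" and G :: "R3 \<Rightarrow> complex^3"
  assumes u_meas [measurable]: "u \<in> borel_measurable borel" and G_meas [measurable]: "G \<in> borel_measurable borel"
    and uL: "u \<in> L2" and GL: "G \<in> L2" and wg: "has_weak_gradient u G" and "r > 0"
  shows "ennreal (r ^ 3) * (\<integral>\<^sup>+x. ennreal (norm (u x)) ^ 4 \<partial>lborel)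
    \<le> 8 * (ennreal ((L2_norm u)\<^sup>2))\<^sup>2 + 8 * (ennreal (12 * r) ^ 4 * (ennreal ((L2_norm G)\<^sup>2))\<^sup>2)"
proof -
  define U where "U x = ennreal (norm (u x))" for x
  define \<Gamma> where "\<Gamma> x = ennreal (norm (G x))" for x
  have U [measurable]: "U \<in> borel_measurable borel" and \<Gamma> [measurable]: "\<Gamma> \<in> borel_measurable borel"
    unfolding U_def \<Gamma>_def by measurable
  have Gi: "(\<lambda>x. G x $ i) \<in> borel_measurable borel" for i
    by (rule measurable_compose[OF G_meas]) (intro borel_measurable_continuous_onI continuous_intros)
  define k where "k x y = (\<integral>\<^sup>+t. indicator {0..1} t * (ennreal (t ^ 3) * \<Gamma> (x + (t ^ 4 * r) *\<^sub>R y)) \<partial>lborel)" for x y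
  have k_meas: "(\<lambda>z. k (fst z) (snd z)) \<in> borel_measurable (lborel \<Otimes>\<^sub>M lborel)"
  proof -
    have "(\<lambda>w. indicator {0..1} (snd w) * (ennreal (snd w ^ 3) * \<Gamma> (fst (fst w) + (snd w ^ 4 * r) *\<^sub>R snd (fst w))))
        \<in> borel_measurable ((lborel \<Otimes>\<^sub>M lborel) \<Otimes>\<^sub>M lborel)" by measurable
    then have "(\<lambda>z. \<integral>\<^sup>+t. indicator {0..1} t * (ennreal (t ^ 3) * \<Gamma> (fst z + (t ^ 4 * r) *\<^sub>R snd z)) \<partial>lborel)
        \<in> borel_measurable (lborel \<Otimes>\<^sub>M lborel)"
      by (intro lborel.borel_measurable_nn_integral) (simp only: case_prod_unfold)
    then show ?thesis unfolding k_def .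
  qed
  have shift: "AE x in lborel. indicator cube y * U x \<le> indicator cube y * (U (x + r *\<^sub>R y) + ennreal (12 * r) * k x y)" for y
  proof (cases "y \<in> cube")
    case True
    have yi: "\<bar>(r *\<^sub>R y) $ i\<bar> \<le> r" for i
    proof -
      have "0 \<le> y $ i \<and> y $ i \<le> 1"
      proof -
        have ax: "(axis i 1 :: R3) \<in> Basis" by (simp add: axis_in_Basis_iff)
        have "(One::R3) \<bullet> axis i 1 = (\<Sum>x\<in>Basis. (x::R3) \<bullet> axis i 1)" by (rule inner_sum_left)
        also have "\<dots> = (\<Sum>x\<in>Basis. if (x::R3) = axis i 1 then 1 else 0)"
          by (rule sum.cong[OF refl]) (simp add: inner_Basis ax)
        also have "\<dots> = 1" using ax by simp
        finally have one: "(One::R3) \<bullet> axis i 1 = 1" .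
        have "(0::R3) \<bullet> axis i 1 \<le> y \<bullet> axis i 1 \<and> y \<bullet> axis i 1 \<le> (One::R3) \<bullet> axis i 1"
          using True ax unfolding mem_box by blast
        then show ?thesis unfolding one by (simp add: inner_axis)
      qed
      then show ?thesis using \<open>r > 0\<close> by (simp add: abs_mult mult_left_le)
    qed
    from translation_formula[OF u_meas G_meas uL GL wg, of "r *\<^sub>R y"]
    show ?thesis
    proof eventually_elim
      case (elim x)
      define I where "I i = (LINT t|lborel. (indicator {0..1} t * (4 * t ^ 3)) *\<^sub>R (G (x + t ^ 4 *\<^sub>R r *\<^sub>R y) $ i))" for i
      have I_le: "ennreal (norm (I i)) \<le> 4 * k x y" for i
      proof -
        have "ennreal (norm (I i)) \<le> (\<integral>\<^sup>+t. norm ((indicator {0..1} t * (4 * t ^ 3)) *\<^sub>R (G (x + t ^ 4 *\<^sub>R r *\<^sub>R y) $ i)) \<partial>lborel)"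
          unfolding I_def
        proof (cases "integrable lborel (\<lambda>t. (indicator {0..1} t * (4 * t ^ 3)) *\<^sub>R (G (x + t ^ 4 *\<^sub>R r *\<^sub>R y) $ i))")
          case True
          then show "ennreal (norm (LINT t|lborel. (indicator {0..1} t * (4 * t ^ 3)) *\<^sub>R (G (x + t ^ 4 *\<^sub>R r *\<^sub>R y) $ i)))
            \<le> (\<integral>\<^sup>+t. norm ((indicator {0..1} t * (4 * t ^ 3)) *\<^sub>R (G (x + t ^ 4 *\<^sub>R r *\<^sub>R y) $ i)) \<partial>lborel)"
            by (rule integral_norm_bound_ennreal)
        next
          \<comment> \<open>The Bochner integral of a non-integrable function is 0, which makes the
            bound trivial.\<close>
          case False
          then show "ennreal (norm (LINT t|lborel. (indicator {0..1} t * (4 * t ^ 3)) *\<^sub>R (G (x + t ^ 4 *\<^sub>R r *\<^sub>R y) $ i)))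
            \<le> (\<integral>\<^sup>+t. norm ((indicator {0..1} t * (4 * t ^ 3)) *\<^sub>R (G (x + t ^ 4 *\<^sub>R r *\<^sub>R y) $ i)) \<partial>lborel)"
            by (simp add: not_integrable_integral_eq)
        qed
        also have "\<dots> \<le> (\<integral>\<^sup>+t. 4 * (indicator {0..1} t * (ennreal (t ^ 3) * \<Gamma> (x + (t ^ 4 * r) *\<^sub>R y))) \<partial>lborel)"
        proof (rule nn_integral_mono)
          fix t :: real
          show "ennreal (norm ((indicator {0..1} t * (4 * t ^ 3)) *\<^sub>R (G (x + t ^ 4 *\<^sub>R r *\<^sub>R y) $ i)))
            \<le> 4 * (indicator {0..1} t * (ennreal (t ^ 3) * \<Gamma> (x + (t ^ 4 * r) *\<^sub>R y)))"
          proof (cases "t \<in> {0..1}")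
            case True
            then have t: "t \<ge> 0" by simp
            have "norm ((indicator {0..1} t * (4 * t ^ 3)) *\<^sub>R (G (x + t ^ 4 *\<^sub>R r *\<^sub>R y) $ i))
              = 4 * (t ^ 3 * norm (G (x + t ^ 4 *\<^sub>R r *\<^sub>R y) $ i))" using True t by (simp add: abs_mult)
            also have "\<dots> \<le> 4 * (t ^ 3 * norm (G (x + (t ^ 4 * r) *\<^sub>R y)))"
              using t by (intro mult_left_mono) (simp_all add: Finite_Cartesian_Product.norm_nth_le)
            finally have "ennreal (norm ((indicator {0..1} t * (4 * t ^ 3)) *\<^sub>R (G (x + t ^ 4 *\<^sub>R r *\<^sub>R y) $ i)))
              \<le> ennreal (4 * (t ^ 3 * norm (G (x + (t ^ 4 * r) *\<^sub>R y))))" by (rule ennreal_leI)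
            also have "\<dots> = 4 * (ennreal (t ^ 3) * \<Gamma> (x + (t ^ 4 * r) *\<^sub>R y))"
              unfolding \<Gamma>_def using t by (simp add: ennreal_mult)
            finally show ?thesis using True by simp
          qed simp
        qed
        also have "\<dots> = 4 * k x y" unfolding k_def by (rule nn_integral_cmult) measurable
        finally show ?thesis .
      qed
      have "u x = u (x + r *\<^sub>R y) - (\<Sum>i\<in>UNIV. (r *\<^sub>R y) $ i *\<^sub>R I i)"
        using elim unfolding I_def by (simp add: algebra_simps)
      then have "norm (u x) \<le> norm (u (x + r *\<^sub>R y)) + norm (\<Sum>i\<in>UNIV. (r *\<^sub>R y) $ i *\<^sub>R I i)"
        using norm_triangle_ineq4[of "u (x + r *\<^sub>R y)" "\<Sum>i\<in>UNIV. (r *\<^sub>R y) $ i *\<^sub>R I i"] by simp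
      also have "norm (\<Sum>i\<in>UNIV. (r *\<^sub>R y) $ i *\<^sub>R I i) \<le> (\<Sum>i\<in>UNIV. r * norm (I i))"
      proof (rule sum_norm_le)
        fix i :: 3
        show "norm ((r *\<^sub>R y) $ i *\<^sub>R I i) \<le> r * norm (I i)"
          unfolding norm_scaleR by (rule mult_right_mono[OF yi]) simp
      qed
      finally have "U x \<le> ennreal (norm (u (x + r *\<^sub>R y)) + (\<Sum>i\<in>UNIV. r * norm (I i)))"
        unfolding U_def by (simp add: ennreal_leI)
      also have "\<dots> = U (x + r *\<^sub>R y) + (\<Sum>i\<in>UNIV. ennreal r * ennreal (norm (I i)))"
      proof -
        have "ennreal (\<Sum>i\<in>UNIV. r * norm (I i)) = (\<Sum>i\<in>UNIV. ennreal (r * norm (I i)))"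
          by (rule sum_ennreal[symmetric]) (use \<open>r > 0\<close> in simp)
        also have "\<dots> = (\<Sum>i\<in>UNIV. ennreal r * ennreal (norm (I i)))"
          by (intro sum.cong refl ennreal_mult) (use \<open>r > 0\<close> in simp_all)
        finally have "ennreal (\<Sum>i\<in>UNIV. r * norm (I i)) = (\<Sum>i\<in>UNIV. ennreal r * ennreal (norm (I i)))" .
        moreover have "0 \<le> (\<Sum>i\<in>UNIV. r * norm (I i))" by (rule sum_nonneg) (use \<open>r > 0\<close> in simp)
        ultimately show ?thesis unfolding U_def by (subst ennreal_plus) simp_all
      qed
      also have "(\<Sum>i\<in>UNIV. ennreal r * ennreal (norm (I i))) \<le> (\<Sum>i\<in>(UNIV :: 3 set). ennreal r * (4 * k x y))"
        by (intro sum_mono mult_left_mono I_le) simp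
      also have "\<dots> = 3 * (ennreal r * (4 * k x y))" by simp
      also have "\<dots> = (3 * 4) * ennreal r * k x y" by (simp only: mult_ac)
      also have "(3 * 4) * ennreal r = ennreal (12 * r)" using \<open>r > 0\<close> by (simp add: ennreal_mult)
      finally have "U x \<le> U (x + r *\<^sub>R y) + ennreal (12 * r) * k x y" by (simp add: add_left_mono)
      then show ?case by (rule mult_left_mono) simp
    qed
  qed simp
  \<comment> \<open>\<open>shift\<close> has an exceptional set of \<open>x\<close> for each
    \<open>y\<close>. Exchanging the quantifiers is Fubini for null sets and rests on the joint
    measurability of the inequality.\<close>
  have AE2: "AE x in lborel. AE y in lborel. indicator cube y * U x \<le> indicator cube y * (U (x + r *\<^sub>R y) + ennreal (12 * r) * k x y)"
  proof (subst lborel_pair.AE_commute)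
    have "(\<lambda>z. U (fst z)) \<in> borel_measurable (lborel \<Otimes>\<^sub>M lborel)" by measurable
    moreover have "(\<lambda>z. indicator cube (snd z) :: ennreal) \<in> borel_measurable ((lborel :: R3 measure) \<Otimes>\<^sub>M lborel)"
      by measurable
    moreover have "(\<lambda>z. U (fst z + r *\<^sub>R snd z)) \<in> borel_measurable (lborel \<Otimes>\<^sub>M lborel)" by measurable
    ultimately show "{z \<in> space (lborel \<Otimes>\<^sub>M lborel). indicator cube (snd z) * U (fst z)
        \<le> indicator cube (snd z) * (U (fst z + r *\<^sub>R snd z) + ennreal (12 * r) * k (fst z) (snd z))} \<in> sets (lborel \<Otimes>\<^sub>M lborel)"
      by (intro borel_measurable_le borel_measurable_times_ennreal borel_measurable_add k_meas borel_measurable_const)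
    show "AE y in lborel. AE x in lborel. indicator cube y * U x \<le> indicator cube y * (U (x + r *\<^sub>R y) + ennreal (12 * r) * k x y)"
      by (intro AE_I2 shift)
  qed
  have main: "AE x in lborel. U x \<le> cube_average r U x + ennreal (12 * r) * line_average r \<Gamma> x"
    using AE2
  proof eventually_elim
    case (elim x)
    have kx [measurable]: "k x \<in> borel_measurable borel"
      using measurable_compose[OF measurable_Pair1'[of x lborel lborel] k_meas] by simp
    have "U x = (\<integral>\<^sup>+y. U x * indicator cube y \<partial>lborel)"
      using nn_integral_cmult_indicator[of cube lborel "U x"] emeasure_cube by simp
    also have "\<dots> = (\<integral>\<^sup>+y. indicator cube y * U x \<partial>lborel)" by (simp only: mult.commute)
    also have "\<dots> \<le> (\<integral>\<^sup>+y. indicator cube y * (U (x + r *\<^sub>R y) + ennreal (12 * r) * k x y) \<partial>lborel)"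
      by (rule nn_integral_mono_AE[OF elim])
    also have "\<dots> = (\<integral>\<^sup>+y. indicator cube y * U (x + r *\<^sub>R y) + ennreal (12 * r) * (indicator cube y * k x y) \<partial>lborel)"
      by (rule nn_integral_cong) (simp add: indicator_def)
    also have "\<dots> = cube_average r U x + ennreal (12 * r) * (\<integral>\<^sup>+y. indicator cube y * k x y \<partial>lborel)"
      unfolding cube_average_def by (simp add: nn_integral_add nn_integral_cmult)
    also have "(\<integral>\<^sup>+y. indicator cube y * k x y \<partial>lborel) = line_average r \<Gamma> x"
    proof -
      have "(\<integral>\<^sup>+y. indicator cube y * k x y \<partial>lborel) = (\<integral>\<^sup>+y. \<integral>\<^sup>+t. indicator cube y * (indicator {0..1} t * (ennreal (t ^ 3) * \<Gamma> (x + (t ^ 4 * r) *\<^sub>R y))) \<partial>lborel \<partial>lborel)"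
        unfolding k_def by (intro nn_integral_cong nn_integral_cmult[symmetric]) measurable
      also have "\<dots> = (\<integral>\<^sup>+t. \<integral>\<^sup>+y. indicator cube y * (indicator {0..1} t * (ennreal (t ^ 3) * \<Gamma> (x + (t ^ 4 * r) *\<^sub>R y))) \<partial>lborel \<partial>lborel)"
      proof -
        have "(\<lambda>z. indicator cube (fst z) * (indicator {0..1} (snd z) * (ennreal (snd z ^ 3) * \<Gamma> (x + (snd z ^ 4 * r) *\<^sub>R fst z)))) \<in> borel_measurable (lborel \<Otimes>\<^sub>M lborel)"
          by measurable
        then have "(\<lambda>(y, t). indicator cube y * (indicator {0..1} t * (ennreal (t ^ 3) * \<Gamma> (x + (t ^ 4 * r) *\<^sub>R y)))) \<in> borel_measurable (lborel \<Otimes>\<^sub>M lborel)"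
          by (simp only: case_prod_unfold)
        from lborel_pair.Fubini'[OF this] show ?thesis by simp
      qed
      also have "\<dots> = line_average r \<Gamma> x"
        unfolding line_average_def
      proof (rule nn_integral_cong)
        fix t :: real
        have "(\<integral>\<^sup>+y. indicator cube y * (indicator {0..1} t * (ennreal (t ^ 3) * \<Gamma> (x + (t ^ 4 * r) *\<^sub>R y))) \<partial>lborel)
          = (\<integral>\<^sup>+y. (indicator {0..1} t * ennreal (t ^ 3)) * (indicator cube y * \<Gamma> (x + (t ^ 4 * r) *\<^sub>R y)) \<partial>lborel)"
          by (rule nn_integral_cong) (simp only: mult_ac)
        also have "\<dots> = (indicator {0..1} t * ennreal (t ^ 3)) * cube_average (t ^ 4 * r) \<Gamma> x"
          unfolding cube_average_def by (rule nn_integral_cmult) measurable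
        finally show "(\<integral>\<^sup>+y. indicator cube y * (indicator {0..1} t * (ennreal (t ^ 3) * \<Gamma> (x + (t ^ 4 * r) *\<^sub>R y))) \<partial>lborel)
          = indicator {0..1} t * (ennreal (t ^ 3) * cube_average (t ^ 4 * r) \<Gamma> x)" by (simp only: mult.assoc)
      qed
      finally show ?thesis .
    qed
    finally show ?case .
  qed
  have "(\<integral>\<^sup>+x. U x ^ 4 \<partial>lborel) \<le> (\<integral>\<^sup>+x. 8 * cube_average r U x ^ 4 + 8 * (ennreal (12 * r) ^ 4 * line_average r \<Gamma> x ^ 4) \<partial>lborel)"
  proof (rule nn_integral_mono_AE, use main in eventually_elim)
    case (elim x)
    have "U x ^ 4 \<le> (cube_average r U x + ennreal (12 * r) * line_average r \<Gamma> x) ^ 4" by (rule power_mono[OF elim]) simp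
    also have "\<dots> \<le> 8 * cube_average r U x ^ 4 + 8 * (ennreal (12 * r) * line_average r \<Gamma> x) ^ 4" by (rule ennreal_add_pow4_le)
    finally show ?case by (simp only: power_mult_distrib)
  qed
  also have "\<dots> = 8 * (\<integral>\<^sup>+x. cube_average r U x ^ 4 \<partial>lborel) + 8 * (ennreal (12 * r) ^ 4 * (\<integral>\<^sup>+x. line_average r \<Gamma> x ^ 4 \<partial>lborel))"
  proof -
    note [measurable] = cube_average_measurable[OF U] line_average_measurable[OF \<Gamma>]
    show ?thesis by (simp add: nn_integral_add nn_integral_cmult)
  qed
  finally have "ennreal (r ^ 3) * (\<integral>\<^sup>+x. U x ^ 4 \<partial>lborel) \<le> ennreal (r ^ 3) *
      (8 * (\<integral>\<^sup>+x. cube_average r U x ^ 4 \<partial>lborel) + 8 * (ennreal (12 * r) ^ 4 * (\<integral>\<^sup>+x. line_average r \<Gamma> x ^ 4 \<partial>lborel)))"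
    by (rule mult_left_mono) simp
  also have "\<dots> = 8 * (ennreal (r ^ 3) * (\<integral>\<^sup>+x. cube_average r U x ^ 4 \<partial>lborel)) +
      8 * (ennreal (12 * r) ^ 4 * (ennreal (r ^ 3) * (\<integral>\<^sup>+x. line_average r \<Gamma> x ^ 4 \<partial>lborel)))"
    by (simp only: distrib_left mult_ac)
  also have "\<dots> \<le> 8 * (\<integral>\<^sup>+y. (U y)\<^sup>2 \<partial>lborel)\<^sup>2 + 8 * (ennreal (12 * r) ^ 4 * (\<integral>\<^sup>+y. (\<Gamma> y)\<^sup>2 \<partial>lborel)\<^sup>2)"
    by (intro add_mono mult_left_mono cube_average_pow4_integral line_average_pow4_integral U \<Gamma>)
      (use \<open>r > 0\<close> in simp_all)
  also have "(\<integral>\<^sup>+y. (U y)\<^sup>2 \<partial>lborel) = ennreal ((L2_norm u)\<^sup>2)"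
    unfolding U_def using L2_nn_integral_lborel[OF uL] by (simp add: ennreal_power)
  also have "(\<integral>\<^sup>+y. (\<Gamma> y)\<^sup>2 \<partial>lborel) = ennreal ((L2_norm G)\<^sup>2)"
    unfolding \<Gamma>_def using L2_nn_integral_lborel[OF GL] by (simp add: ennreal_power)
  finally show ?thesis unfolding U_def .
qed

section \<open>Bessel's inequality for the Fourier transform\<close>

lemma lborel_product_integral:
  fixes f :: "'a::euclidean_space \<Rightarrow> real \<Rightarrow> complex"
  assumes int: "\<And>b. b \<in> Basis \<Longrightarrow> integrable lborel (f b)"
  shows "(LINT x|(lborel :: 'a measure). (\<Prod>b\<in>Basis. f b (x \<bullet> b))) = (\<Prod>b\<in>Basis. LINT t|lborel. f b t)"
proof -
  interpret product_sigma_finite "\<lambda>b::'a. lborel :: real measure" ..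
  have m: "f b \<in> borel_measurable borel" if "b \<in> Basis" for b
    using borel_measurable_integrable[OF int[OF that]] by simp
  have "(LINT x|(lborel :: 'a measure). (\<Prod>b\<in>Basis. f b (x \<bullet> b)))
     = (LINT x|distr (\<Pi>\<^sub>M b\<in>Basis. lborel) borel (\<lambda>g. \<Sum>b\<in>Basis. g b *\<^sub>R b). (\<Prod>b\<in>Basis. f b ((x::'a) \<bullet> b)))"
    by (simp only: lborel_eq[symmetric])
  also have "\<dots> = (LINT g|(\<Pi>\<^sub>M b\<in>(Basis :: 'a set). lborel). (\<Prod>b\<in>Basis. f b ((\<Sum>b\<in>Basis. g b *\<^sub>R b) \<bullet> b)))"
  proof (rule integral_distr)
    show "(\<lambda>g. \<Sum>b\<in>Basis. g b *\<^sub>R b) \<in> (\<Pi>\<^sub>M b\<in>(Basis :: 'a set). lborel) \<rightarrow>\<^sub>M borel" by measurable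
    show "(\<lambda>x::'a. \<Prod>b\<in>Basis. f b (x \<bullet> b)) \<in> borel_measurable borel"
      by (intro borel_measurable_prod measurable_compose[OF _ m]) measurable
  qed
  also have "\<dots> = (LINT g|(\<Pi>\<^sub>M b\<in>(Basis :: 'a set). lborel). (\<Prod>b\<in>Basis. f b (g b)))"
    by (intro Bochner_Integration.integral_cong prod.cong refl) simp
  also have "\<dots> = (\<Prod>b\<in>Basis. LINT t|lborel. f b t)"
    by (rule product_integral_prod) (simp_all add: int)
  finally show ?thesis .
qed

text \<open>A rescaling of the characteristic function of the standard normal distribution.\<close>

lemma gaussian_Fourier_real:
  fixes z \<epsilon> :: real
  assumes \<epsilon>: "\<epsilon> > 0"
  shows "integrable lborel (\<lambda>t. exp (\<i> * of_real (t * z)) * of_real (exp (- (\<epsilon> * t)\<^sup>2 / 2)))"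
    and "(LINT t|lborel. exp (\<i> * of_real (t * z)) * of_real (exp (- (\<epsilon> * t)\<^sup>2 / 2)))
      = of_real (sqrt (2 * pi) / \<epsilon> * exp (- (z / \<epsilon>)\<^sup>2 / 2))"
proof -
  define g where "g y = std_normal_density y *\<^sub>R exp (\<i> * of_real (z / \<epsilon> * y))" for y
  have dens: "(\<lambda>y. std_normal_density y) \<in> borel_measurable lborel" by measurable
  have e_meas [measurable]: "(\<lambda>y. exp (\<i> * complex_of_real (c * y))) \<in> borel_measurable borel" for c
    by (intro borel_measurable_continuous_onI continuous_intros)
  have gI: "integrable lborel g"
  proof (rule Bochner_Integration.integrable_bound[where f=std_normal_density])
    show "integrable lborel std_normal_density" by (rule integrable_normal_density) simp
    show "g \<in> borel_measurable lborel" unfolding g_def by measurable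
    show "AE y in lborel. norm (g y) \<le> norm (std_normal_density y)"
      unfolding g_def by (intro AE_I2) (simp add: normal_density_nonneg)
  qed
  have "(LINT y|lborel. g y) = char std_normal_distribution (z / \<epsilon>)"
    unfolding char_def g_def
    by (rule integral_density[symmetric]) (simp_all add: normal_density_nonneg e_meas)
  also have "\<dots> = of_real (exp (- (z / \<epsilon>)\<^sup>2 / 2))" unfolding char_std_normal_distribution ..
  finally have gi: "(LINT y|lborel. g y) = of_real (exp (- (z / \<epsilon>)\<^sup>2 / 2))" .
  have form: "exp (\<i> * of_real (t * z)) * of_real (exp (- (\<epsilon> * t)\<^sup>2 / 2)) = of_real (sqrt (2 * pi)) * g (0 + \<epsilon> * t)" for t
    unfolding g_def std_normal_density_def using \<epsilon> by (simp add: scaleR_conv_of_real mult.commute)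
  show "integrable lborel (\<lambda>t. exp (\<i> * of_real (t * z)) * of_real (exp (- (\<epsilon> * t)\<^sup>2 / 2)))"
    unfolding form by (rule integrable_mult_right[OF lborel_integrable_real_affine[OF gI]]) (use \<epsilon> in simp)
  have "(LINT t|lborel. g (0 + \<epsilon> * t)) = (LINT y|lborel. g y) / of_real \<epsilon>"
    using lborel_integral_real_affine[of \<epsilon> g 0] \<epsilon> by (simp add: scaleR_conv_of_real)
  then show "(LINT t|lborel. exp (\<i> * of_real (t * z)) * of_real (exp (- (\<epsilon> * t)\<^sup>2 / 2)))
      = of_real (sqrt (2 * pi) / \<epsilon> * exp (- (z / \<epsilon>)\<^sup>2 / 2))"
    unfolding form integral_mult_right_zero gi by simp
qed

definition gauss_weight :: "real \<Rightarrow> R3 \<Rightarrow> real" where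
  "gauss_weight \<epsilon> k = (\<Prod>b\<in>Basis. exp (- (\<epsilon> * (k \<bullet> b))\<^sup>2 / 2))"

text \<open>The Fourier transform of \<open>gauss_weight\<close>: an approximate identity whose mass
  is \<open>(2 * pi) ^ 3\<close> for every \<open>\<epsilon>\<close>. That mass becomes the constant
  in Bessel's inequality.\<close>

definition gauss_kernel :: "real \<Rightarrow> R3 \<Rightarrow> real" where
  "gauss_kernel \<epsilon> z = (\<Prod>b\<in>Basis. sqrt (2 * pi) / \<epsilon> * exp (- ((z \<bullet> b) / \<epsilon>)\<^sup>2 / 2))"

lemma gauss_measurable [measurable]:
  "gauss_weight \<epsilon> \<in> borel_measurable borel" "gauss_kernel \<epsilon> \<in> borel_measurable borel"
  unfolding gauss_weight_def gauss_kernel_def by measurable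

lemma gauss_weight_bounds: "0 \<le> gauss_weight \<epsilon> k" "gauss_weight \<epsilon> k \<le> 1"
  unfolding gauss_weight_def by (auto intro!: prod_nonneg prod_le_1)

lemma gauss_kernel_nonneg: "\<epsilon> > 0 \<Longrightarrow> 0 \<le> gauss_kernel \<epsilon> z"
  unfolding gauss_kernel_def by (intro prod_nonneg) simp

lemma gauss_real_integral:
  assumes "\<epsilon> > 0"
  shows "(\<integral>\<^sup>+t. ennreal (sqrt (2 * pi) / \<epsilon> * exp (- (t / \<epsilon>)\<^sup>2 / 2)) \<partial>lborel) = ennreal (2 * pi)"
    and "(\<integral>\<^sup>+t. ennreal (exp (- (\<epsilon> * t)\<^sup>2 / 2)) \<partial>lborel) = ennreal (sqrt (2 * pi) / \<epsilon>)"
proof -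
  have one: "(\<integral>\<^sup>+t. ennreal (normal_density 0 s t) \<partial>lborel) = 1" if "s > 0" for s
    using nn_integral_eq_integral[OF integrable_normal_density[OF that, of 0]] integral_normal_density[OF that, of 0]
    by (simp add: normal_density_nonneg)
  have "(\<integral>\<^sup>+t. ennreal (sqrt (2 * pi) / \<epsilon> * exp (- (t / \<epsilon>)\<^sup>2 / 2)) \<partial>lborel)
      = (\<integral>\<^sup>+t. ennreal (2 * pi) * ennreal (normal_density 0 \<epsilon> t) \<partial>lborel)"
  proof (rule nn_integral_cong)
    fix t
    have "sqrt (2 * pi) / \<epsilon> * exp (- (t / \<epsilon>)\<^sup>2 / 2) = 2 * pi * normal_density 0 \<epsilon> t"
    proof -
      have "sqrt (2 * pi * \<epsilon>\<^sup>2) = sqrt (2 * pi) * \<epsilon>" using assms by (simp add: real_sqrt_mult)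
      then have "2 * pi * (1 / sqrt (2 * pi * \<epsilon>\<^sup>2)) = (2 * pi / sqrt (2 * pi)) / \<epsilon>" by simp
      also have "2 * pi / sqrt (2 * pi) = sqrt (2 * pi)" by (rule real_div_sqrt) simp
      finally have c: "2 * pi * (1 / sqrt (2 * pi * \<epsilon>\<^sup>2)) = sqrt (2 * pi) / \<epsilon>" .
      have e: "- (t - 0)\<^sup>2 / (2 * \<epsilon>\<^sup>2) = - (t / \<epsilon>)\<^sup>2 / 2" by (simp add: power_divide mult.commute)
      show ?thesis unfolding normal_density_def e mult.assoc[symmetric] c ..
    qed
    then show "ennreal (sqrt (2 * pi) / \<epsilon> * exp (- (t / \<epsilon>)\<^sup>2 / 2)) = ennreal (2 * pi) * ennreal (normal_density 0 \<epsilon> t)"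
      by (simp add: ennreal_mult normal_density_nonneg)
  qed
  also have "\<dots> = ennreal (2 * pi)" by (simp add: nn_integral_cmult one[OF assms])
  finally show "(\<integral>\<^sup>+t. ennreal (sqrt (2 * pi) / \<epsilon> * exp (- (t / \<epsilon>)\<^sup>2 / 2)) \<partial>lborel) = ennreal (2 * pi)" .
  have "(\<integral>\<^sup>+t. ennreal (exp (- (\<epsilon> * t)\<^sup>2 / 2)) \<partial>lborel)
      = (\<integral>\<^sup>+t. ennreal (sqrt (2 * pi) / \<epsilon>) * ennreal (normal_density 0 (1 / \<epsilon>) t) \<partial>lborel)"
  proof (rule nn_integral_cong)
    fix t
    have "sqrt (2 * pi * (1 / \<epsilon>)\<^sup>2) = sqrt (2 * pi) / \<epsilon>"
      using assms by (simp add: real_sqrt_mult real_sqrt_divide power_divide)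
    moreover have "- (t - 0)\<^sup>2 / (2 * (1 / \<epsilon>)\<^sup>2) = - (\<epsilon> * t)\<^sup>2 / 2"
      using assms by (simp add: power_divide power_mult_distrib)
    ultimately have "exp (- (\<epsilon> * t)\<^sup>2 / 2) = sqrt (2 * pi) / \<epsilon> * normal_density 0 (1 / \<epsilon>) t"
      unfolding normal_density_def using assms by simp
    then show "ennreal (exp (- (\<epsilon> * t)\<^sup>2 / 2)) = ennreal (sqrt (2 * pi) / \<epsilon>) * ennreal (normal_density 0 (1 / \<epsilon>) t)"
      using assms ennreal_mult[of "sqrt (2 * pi) / \<epsilon>" "normal_density 0 (1 / \<epsilon>) t"]
      by (simp add: normal_density_nonneg)
  qed
  also have "\<dots> = ennreal (sqrt (2 * pi) / \<epsilon>)" using assms by (simp add: nn_integral_cmult one)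
  finally show "(\<integral>\<^sup>+t. ennreal (exp (- (\<epsilon> * t)\<^sup>2 / 2)) \<partial>lborel) = ennreal (sqrt (2 * pi) / \<epsilon>)" .
qed

lemma gauss_integrals:
  assumes \<epsilon>: "\<epsilon> > 0"
  shows "(\<integral>\<^sup>+z. ennreal (gauss_kernel \<epsilon> z) \<partial>lborel) = ennreal ((2 * pi) ^ 3)"
    and "integrable lborel (gauss_weight \<epsilon>)"
    and "(LINT k|lborel. exp (\<i> * of_real (k \<bullet> z)) * of_real (gauss_weight \<epsilon> k)) = of_real (gauss_kernel \<epsilon> z)"
proof -
  have card: "card (Basis :: R3 set) = 3" using DIM_cart[where 'a=real and 'b=3] by simp
  have "(\<integral>\<^sup>+z. ennreal (gauss_kernel \<epsilon> z) \<partial>lborel) = (\<integral>\<^sup>+z. (\<Prod>b\<in>Basis. ennreal (sqrt (2 * pi) / \<epsilon> * exp (- ((z \<bullet> b) / \<epsilon>)\<^sup>2 / 2))) \<partial>(lborel :: R3 measure))"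
    unfolding gauss_kernel_def by (intro nn_integral_cong prod_ennreal[symmetric]) (use \<epsilon> in simp)
  also have "\<dots> = (\<Prod>b\<in>(Basis :: R3 set). \<integral>\<^sup>+t. ennreal (sqrt (2 * pi) / \<epsilon> * exp (- (t / \<epsilon>)\<^sup>2 / 2)) \<partial>lborel)"
    by (rule nn_integral_lborel_prod) auto
  also have "\<dots> = ennreal ((2 * pi) ^ 3)"
    unfolding gauss_real_integral(1)[OF \<epsilon>] prod_constant card by (rule ennreal_power) simp
  finally show "(\<integral>\<^sup>+z. ennreal (gauss_kernel \<epsilon> z) \<partial>lborel) = ennreal ((2 * pi) ^ 3)" .
  show "integrable lborel (gauss_weight \<epsilon>)"
  proof (rule integrableI_nonneg)
    have "(\<integral>\<^sup>+k. ennreal (gauss_weight \<epsilon> k) \<partial>lborel) = (\<integral>\<^sup>+k. (\<Prod>b\<in>Basis. ennreal (exp (- (\<epsilon> * (k \<bullet> b))\<^sup>2 / 2))) \<partial>(lborel :: R3 measure))"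
      unfolding gauss_weight_def by (intro nn_integral_cong prod_ennreal[symmetric]) simp
    also have "\<dots> = (\<Prod>b\<in>(Basis :: R3 set). \<integral>\<^sup>+t. ennreal (exp (- (\<epsilon> * t)\<^sup>2 / 2)) \<partial>lborel)"
      by (rule nn_integral_lborel_prod) auto
    also have "\<dots> = ennreal ((sqrt (2 * pi) / \<epsilon>) ^ 3)"
      unfolding gauss_real_integral(2)[OF \<epsilon>] prod_constant card by (rule ennreal_power) (use \<epsilon> in simp)
    also have "\<dots> < \<infinity>" by simp
    finally show "(\<integral>\<^sup>+k. ennreal (gauss_weight \<epsilon> k) \<partial>lborel) < \<infinity>" .
  qed (simp_all add: gauss_weight_bounds)
  have "(LINT k|lborel. exp (\<i> * of_real (k \<bullet> z)) * of_real (gauss_weight \<epsilon> k))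
      = (LINT k|lborel. (\<Prod>b\<in>Basis. exp (\<i> * of_real ((k \<bullet> b) * (z \<bullet> b))) * of_real (exp (- (\<epsilon> * (k \<bullet> b))\<^sup>2 / 2))))"
  proof (rule Bochner_Integration.integral_cong[OF refl])
    fix k :: R3
    have "exp (\<i> * of_real (k \<bullet> z)) = (\<Prod>b\<in>Basis. exp (\<i> * of_real ((k \<bullet> b) * (z \<bullet> b))))"
      by (subst euclidean_inner) (simp add: sum_distrib_left exp_sum)
    then show "exp (\<i> * of_real (k \<bullet> z)) * of_real (gauss_weight \<epsilon> k)
      = (\<Prod>b\<in>Basis. exp (\<i> * of_real ((k \<bullet> b) * (z \<bullet> b))) * of_real (exp (- (\<epsilon> * (k \<bullet> b))\<^sup>2 / 2)))"
      unfolding gauss_weight_def by (simp only: prod.distrib of_real_prod)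
  qed
  also have "\<dots> = (\<Prod>b\<in>(Basis :: R3 set). LINT t|lborel. exp (\<i> * of_real (t * (z \<bullet> b))) * of_real (exp (- (\<epsilon> * t)\<^sup>2 / 2)))"
    by (rule lborel_product_integral[of "\<lambda>b t. exp (\<i> * of_real (t * (z \<bullet> b))) * of_real (exp (- (\<epsilon> * t)\<^sup>2 / 2))"])
      (rule gaussian_Fourier_real(1)[OF \<epsilon>])
  also have "\<dots> = of_real (gauss_kernel \<epsilon> z)"
    unfolding gaussian_Fourier_real(2)[OF \<epsilon>] gauss_kernel_def by (simp only: of_real_prod)
  finally show "(LINT k|lborel. exp (\<i> * of_real (k \<bullet> z)) * of_real (gauss_weight \<epsilon> k)) = of_real (gauss_kernel \<epsilon> z)" .
qed

section \<open>The transform of a density and the bound on its square integral\<close>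

definition Fourier :: "(R3 \<Rightarrow> real) \<Rightarrow> R3 \<Rightarrow> complex" where
  "Fourier \<rho> k = (LINT x|lebesgue. exp (\<i> * of_real (k \<bullet> x)) * of_real (\<rho> x))"

lemma exp_i_measurable [measurable]:
  "(\<lambda>x. exp (\<i> * complex_of_real (f x))) \<in> borel_measurable M" if "f \<in> borel_measurable M" for f
  by (rule measurable_compose[OF that]) (intro borel_measurable_continuous_onI continuous_intros)

lemma Fourier_lborel:
  assumes [measurable]: "\<rho> \<in> borel_measurable borel"
  shows "Fourier \<rho> k = (LINT x|lborel. exp (\<i> * of_real (k \<bullet> x)) * of_real (\<rho> x))"
  unfolding Fourier_def by (rule integral_completion) measurable

lemma Fourier_borel_measurable:
  assumes [measurable]: "\<rho> \<in> borel_measurable borel"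
  shows "Fourier \<rho> \<in> borel_measurable borel"
proof -
  have "(\<lambda>z. exp (\<i> * of_real (fst z \<bullet> snd z)) * of_real (\<rho> (snd z)) :: complex) \<in> borel_measurable (lborel \<Otimes>\<^sub>M lborel)"
    by measurable
  then have "(\<lambda>k. LINT x|lborel. exp (\<i> * of_real (k \<bullet> x)) * of_real (\<rho> x) :: complex) \<in> borel_measurable lborel"
    by (intro lborel.borel_measurable_lebesgue_integral) (simp only: case_prod_unfold)
  then show ?thesis unfolding Fourier_lborel[OF assms, abs_def] by simp
qed

lemma Fourier_norm_le:
  assumes "integrable lebesgue \<rho>"
  shows "norm (Fourier \<rho> k) \<le> (LINT x|lebesgue. \<bar>\<rho> x\<bar>)"
proof -
  have "norm (Fourier \<rho> k) \<le> (LINT x|lebesgue. norm (exp (\<i> * of_real (k \<bullet> x)) * of_real (\<rho> x) :: complex))"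
    unfolding Fourier_def by (rule integral_norm_bound)
  then show ?thesis by (simp add: norm_mult)
qed

lemma nn_integral_combination:
  assumes [measurable]: "f \<in> borel_measurable M" "g \<in> borel_measurable M"
  shows "(\<integral>\<^sup>+x. c * f x + d * g x \<partial>M) = c * (\<integral>\<^sup>+x. f x \<partial>M) + d * (\<integral>\<^sup>+x. g x \<partial>M)"
  by (simp add: nn_integral_add nn_integral_cmult)

text \<open>The Gaussian weight makes the threefold integral absolutely convergent, so Fubini turns
  the left side into the double integral of \<open>\<rho> x * \<rho> y\<close> against
  \<open>gauss_kernel \<epsilon> (x - y)\<close>. Schur's test bounds this by the mass of the
  kernel, uniformly in \<open>\<epsilon>\<close>.\<close>

lemma Bessel_gauss:
  assumes \<rho> [measurable]: "\<rho> \<in> borel_measurable borel" and int: "integrable lborel \<rho>" and \<epsilon>: "\<epsilon> > 0"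
  shows "(\<integral>\<^sup>+k. ennreal ((norm (Fourier \<rho> k))\<^sup>2 * gauss_weight \<epsilon> k) \<partial>lborel)
    \<le> ennreal ((2 * pi) ^ 3) * (\<integral>\<^sup>+x. ennreal ((\<rho> x)\<^sup>2) \<partial>lborel)"
proof -
  define F where "F = Fourier \<rho>"
  define N where "N = (LINT x|lborel. \<bar>\<rho> x\<bar>)"
  note w_int = gauss_integrals(2)[OF \<epsilon>]
  have F_eq: "F k = (LINT x|lborel. exp (\<i> * of_real (k \<bullet> x)) * of_real (\<rho> x))" for k
    unfolding F_def by (rule Fourier_lborel[OF \<rho>])
  have F_le: "norm (F k) \<le> N" for k
  proof -
    have "norm (F k) \<le> (LINT x|lborel. norm (exp (\<i> * of_real (k \<bullet> x)) * of_real (\<rho> x) :: complex))"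
      unfolding F_eq by (rule integral_norm_bound)
    then show ?thesis unfolding N_def by (simp add: norm_mult)
  qed
  have N: "N \<ge> 0" using norm_ge_zero[of "F 0"] F_le[of 0] by linarith
  have F_meas [measurable]: "F \<in> borel_measurable borel"
  proof -
    have "(\<lambda>z. exp (\<i> * of_real (fst z \<bullet> snd z)) * of_real (\<rho> (snd z)) :: complex) \<in> borel_measurable (lborel \<Otimes>\<^sub>M lborel)"
      by measurable
    then have "(\<lambda>k. LINT x|lborel. exp (\<i> * of_real (k \<bullet> x)) * of_real (\<rho> x) :: complex) \<in> borel_measurable lborel"
      by (intro lborel.borel_measurable_lebesgue_integral) (simp only: case_prod_unfold)
    then show ?thesis unfolding F_eq[abs_def] by simp
  qed
  \<comment> \<open>Stated for an arbitrary bounded factor \<open>c\<close> because Fubini is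
    applied twice, once with a pure phase and once with a phase times
    \<open>cnj (F k)\<close>.\<close>
  have prod_int: "integrable (lborel \<Otimes>\<^sub>M lborel) (\<lambda>(k, x). c k x * (of_real (h k) * of_real (\<rho> x)))"
    if c: "(\<lambda>z. c (fst z) (snd z)) \<in> borel_measurable (lborel \<Otimes>\<^sub>M lborel)" "\<And>k x. norm (c k x) \<le> C" and h: "integrable lborel h"
    for c :: "R3 \<Rightarrow> R3 \<Rightarrow> complex" and h :: "R3 \<Rightarrow> real" and C
  proof -
    have hm [measurable]: "h \<in> borel_measurable borel" using borel_measurable_integrable[OF h] by simp
    have "integrable (lborel \<Otimes>\<^sub>M lborel) (\<lambda>(k, x). h k * \<rho> x)"
    proof (rule lborel_pair.Fubini_integrable)
      show "(\<lambda>(k, x). h k * \<rho> x) \<in> borel_measurable (lborel \<Otimes>\<^sub>M lborel)" by measurable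
      show "integrable lborel (\<lambda>k. LINT x|lborel. norm (case (k, x) of (k, x) \<Rightarrow> h k * \<rho> x))"
        using integrable_mult_left[OF integrable_norm[OF h], of N] unfolding N_def by (simp add: abs_mult)
      show "AE k in lborel. integrable lborel (\<lambda>x. case (k, x) of (k, x) \<Rightarrow> h k * \<rho> x)"
        using int by simp
    qed
    then have i: "integrable (lborel \<Otimes>\<^sub>M lborel) (\<lambda>z. C * (h (fst z) * \<rho> (snd z)))"
      by (simp only: case_prod_unfold integrable_mult_right)
    have "(\<lambda>z. c (fst z) (snd z) * (of_real (h (fst z)) * of_real (\<rho> (snd z)))) \<in> borel_measurable (lborel \<Otimes>\<^sub>M lborel)"
      by (intro borel_measurable_times c(1)) measurable
    moreover have "norm (c (fst z) (snd z) * (of_real (h (fst z)) * of_real (\<rho> (snd z)))) \<le> norm (C * (h (fst z) * \<rho> (snd z)))" for z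
    proof -
      have "norm (c (fst z) (snd z)) * \<bar>h (fst z) * \<rho> (snd z)\<bar> \<le> \<bar>C\<bar> * \<bar>h (fst z) * \<rho> (snd z)\<bar>"
        using c(2)[of "fst z" "snd z"] by (intro mult_right_mono) auto
      then show ?thesis by (simp add: norm_mult abs_mult)
    qed
    ultimately have "integrable (lborel \<Otimes>\<^sub>M lborel) (\<lambda>z. c (fst z) (snd z) * (of_real (h (fst z)) * of_real (\<rho> (snd z))))"
      by (intro Bochner_Integration.integrable_bound[OF i]) simp_all
    then show ?thesis by (simp only: case_prod_unfold)
  qed
  have inner: "(LINT k|lborel. exp (\<i> * of_real (k \<bullet> x)) * (cnj (F k) * of_real (gauss_weight \<epsilon> k)))
      = (LINT y|lborel. of_real (\<rho> y * gauss_kernel \<epsilon> (x - y)))" for x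
  proof -
    define c where "c k y = exp (\<i> * complex_of_real (k \<bullet> (x - y)))" for k y :: R3
    have c1: "(\<lambda>z. c (fst z) (snd z)) \<in> borel_measurable (lborel \<Otimes>\<^sub>M lborel)" unfolding c_def by measurable
    have c2: "norm (c k y) \<le> 1" for k y unfolding c_def by simp
    have "(LINT k|lborel. exp (\<i> * of_real (k \<bullet> x)) * (cnj (F k) * of_real (gauss_weight \<epsilon> k)))
      = (LINT k|lborel. LINT y|lborel. c k y * (of_real (gauss_weight \<epsilon> k) * of_real (\<rho> y)))"
    proof (rule Bochner_Integration.integral_cong[OF refl])
      fix k
      have "cnj (F k) = (LINT y|lborel. cnj (exp (\<i> * of_real (k \<bullet> y)) * of_real (\<rho> y)))"
        unfolding F_eq by (rule integral_bounded_linear'[OF bounded_linear_cnj bounded_linear_cnj, symmetric]) simp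
      also have "\<dots> = (LINT y|lborel. exp (- (\<i> * of_real (k \<bullet> y))) * of_real (\<rho> y))"
        by (simp add: exp_cnj)
      finally have "exp (\<i> * of_real (k \<bullet> x)) * (cnj (F k) * of_real (gauss_weight \<epsilon> k))
        = (exp (\<i> * of_real (k \<bullet> x)) * of_real (gauss_weight \<epsilon> k)) * (LINT y|lborel. exp (- (\<i> * of_real (k \<bullet> y))) * of_real (\<rho> y))"
        by (simp only: mult_ac)
      also have "\<dots> = (LINT y|lborel. (exp (\<i> * of_real (k \<bullet> x)) * of_real (gauss_weight \<epsilon> k)) * (exp (- (\<i> * of_real (k \<bullet> y))) * of_real (\<rho> y)))"
        by (rule integral_mult_right_zero[symmetric])
      also have "\<dots> = (LINT y|lborel. c k y * (of_real (gauss_weight \<epsilon> k) * of_real (\<rho> y)))"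
      proof (rule Bochner_Integration.integral_cong[OF refl])
        fix y
        have "c k y = exp (\<i> * of_real (k \<bullet> x)) * exp (- (\<i> * of_real (k \<bullet> y)))"
          unfolding c_def exp_add[symmetric] by (simp add: inner_diff_right algebra_simps)
        then show "(exp (\<i> * of_real (k \<bullet> x)) * of_real (gauss_weight \<epsilon> k)) * (exp (- (\<i> * of_real (k \<bullet> y))) * of_real (\<rho> y))
          = c k y * (of_real (gauss_weight \<epsilon> k) * of_real (\<rho> y))" by (simp only: mult_ac)
      qed
      finally show "exp (\<i> * of_real (k \<bullet> x)) * (cnj (F k) * of_real (gauss_weight \<epsilon> k))
        = (LINT y|lborel. c k y * (of_real (gauss_weight \<epsilon> k) * of_real (\<rho> y)))" .
    qed
    also have "\<dots> = (LINT y|lborel. LINT k|lborel. c k y * (of_real (gauss_weight \<epsilon> k) * of_real (\<rho> y)))"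
      by (rule lborel_pair.Fubini_integral[OF prod_int[OF c1 c2 w_int], symmetric])
    also have "\<dots> = (LINT y|lborel. of_real (\<rho> y * gauss_kernel \<epsilon> (x - y)))"
    proof (rule Bochner_Integration.integral_cong[OF refl])
      fix y
      have "(LINT k|lborel. c k y * (of_real (gauss_weight \<epsilon> k) * of_real (\<rho> y)))
        = (LINT k|lborel. exp (\<i> * of_real (k \<bullet> (x - y))) * of_real (gauss_weight \<epsilon> k)) * of_real (\<rho> y)"
        unfolding c_def by (simp only: mult.assoc[symmetric] integral_mult_left_zero)
      then show "(LINT k|lborel. c k y * (of_real (gauss_weight \<epsilon> k) * of_real (\<rho> y))) = of_real (\<rho> y * gauss_kernel \<epsilon> (x - y))"
        unfolding gauss_integrals(3)[OF \<epsilon>] by (simp add: mult.commute)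
    qed
    finally show ?thesis .
  qed
  define R where "R x = (LINT y|lborel. \<rho> y * gauss_kernel \<epsilon> (x - y))" for x
  have total: "(LINT k|lborel. of_real ((norm (F k))\<^sup>2 * gauss_weight \<epsilon> k)) = (LINT x|lborel. complex_of_real (\<rho> x * R x))"
  proof -
    define c where "c k x = cnj (F k) * exp (\<i> * complex_of_real (k \<bullet> x))" for k x :: R3
    have c1: "(\<lambda>z. c (fst z) (snd z)) \<in> borel_measurable (lborel \<Otimes>\<^sub>M lborel)"
      unfolding c_def
    proof (rule borel_measurable_times)
      have "(\<lambda>k. cnj (F k)) \<in> borel_measurable borel"
        by (rule measurable_compose[OF F_meas]) (intro borel_measurable_continuous_onI continuous_intros)
      then show "(\<lambda>z. cnj (F (fst z))) \<in> borel_measurable (lborel \<Otimes>\<^sub>M lborel)"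
        by (rule measurable_compose[rotated]) measurable
      show "(\<lambda>z. exp (\<i> * complex_of_real (fst z \<bullet> snd z))) \<in> borel_measurable (lborel \<Otimes>\<^sub>M lborel)" by measurable
    qed
    have c2: "norm (c k x) \<le> N" for k x unfolding c_def using F_le[of k] by (simp add: norm_mult)
    have "(LINT k|lborel. of_real ((norm (F k))\<^sup>2 * gauss_weight \<epsilon> k)) =
      (LINT k|lborel. LINT x|lborel. c k x * (of_real (gauss_weight \<epsilon> k) * of_real (\<rho> x)))"
    proof (rule Bochner_Integration.integral_cong[OF refl])
      fix k
      have "of_real ((norm (F k))\<^sup>2 * gauss_weight \<epsilon> k) = (cnj (F k) * of_real (gauss_weight \<epsilon> k)) * F k"
        using complex_norm_square[of "F k"] by (simp add: mult_ac)
      also have "\<dots> = (LINT x|lborel. (cnj (F k) * of_real (gauss_weight \<epsilon> k)) * (exp (\<i> * of_real (k \<bullet> x)) * of_real (\<rho> x)))"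
        unfolding F_eq[of k] by (rule integral_mult_right_zero[symmetric])
      also have "\<dots> = (LINT x|lborel. c k x * (of_real (gauss_weight \<epsilon> k) * of_real (\<rho> x)))"
        unfolding c_def by (simp only: mult_ac)
      finally show "of_real ((norm (F k))\<^sup>2 * gauss_weight \<epsilon> k) = (LINT x|lborel. c k x * (of_real (gauss_weight \<epsilon> k) * of_real (\<rho> x)))" .
    qed
    also have "\<dots> = (LINT x|lborel. LINT k|lborel. c k x * (of_real (gauss_weight \<epsilon> k) * of_real (\<rho> x)))"
      by (rule lborel_pair.Fubini_integral[OF prod_int[OF c1 c2 w_int], symmetric])
    also have "\<dots> = (LINT x|lborel. complex_of_real (\<rho> x * R x))"
    proof (rule Bochner_Integration.integral_cong[OF refl])
      fix x
      have "(LINT k|lborel. c k x * (of_real (gauss_weight \<epsilon> k) * of_real (\<rho> x)))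
        = (LINT k|lborel. (exp (\<i> * of_real (k \<bullet> x)) * (cnj (F k) * of_real (gauss_weight \<epsilon> k))) * of_real (\<rho> x))"
        unfolding c_def by (simp only: mult_ac)
      also have "\<dots> = (LINT k|lborel. exp (\<i> * of_real (k \<bullet> x)) * (cnj (F k) * of_real (gauss_weight \<epsilon> k))) * of_real (\<rho> x)"
        by (rule integral_mult_left_zero)
      also have "\<dots> = complex_of_real (\<rho> x * R x)"
        unfolding inner R_def integral_complex_of_real by simp
      finally show "(LINT k|lborel. c k x * (of_real (gauss_weight \<epsilon> k) * of_real (\<rho> x))) = complex_of_real (\<rho> x * R x)" .
    qed
    finally show ?thesis .
  qed
  have int_total: "integrable lborel (\<lambda>k. (norm (F k))\<^sup>2 * gauss_weight \<epsilon> k)"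
  proof (rule Bochner_Integration.integrable_bound[OF integrable_mult_right[OF w_int, of "N\<^sup>2"]])
    show "AE k in lborel. norm ((norm (F k))\<^sup>2 * gauss_weight \<epsilon> k) \<le> norm (N\<^sup>2 * gauss_weight \<epsilon> k)"
    proof (rule AE_I2)
      fix k
      have "(norm (F k))\<^sup>2 * gauss_weight \<epsilon> k \<le> N\<^sup>2 * gauss_weight \<epsilon> k"
        by (intro mult_right_mono power_mono F_le gauss_weight_bounds) simp
      then show "norm ((norm (F k))\<^sup>2 * gauss_weight \<epsilon> k) \<le> norm (N\<^sup>2 * gauss_weight \<epsilon> k)"
        by (simp add: gauss_weight_bounds abs_mult)
    qed
  qed measurable
  have "complex_of_real (LINT k|lborel. (norm (F k))\<^sup>2 * gauss_weight \<epsilon> k) = complex_of_real (LINT x|lborel. \<rho> x * R x)"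
    using total unfolding integral_complex_of_real .
  then have real_total: "(LINT k|lborel. (norm (F k))\<^sup>2 * gauss_weight \<epsilon> k) = (LINT x|lborel. \<rho> x * R x)"
    by (simp only: of_real_eq_iff)
  define A where "A = (\<integral>\<^sup>+x. ennreal ((\<rho> x)\<^sup>2) \<partial>lborel)"
  define \<kappa> where "\<kappa> x y = ennreal (gauss_kernel \<epsilon> (x - y))" for x y
  have norm_le: "ennreal (norm (LINT x|lborel. g x)) \<le> (\<integral>\<^sup>+x. ennreal (norm (g x)) \<partial>lborel)" for g :: "R3 \<Rightarrow> real"
  proof (cases "integrable lborel g")
    case True
    then show ?thesis by (rule integral_norm_bound_ennreal)
  qed (simp add: not_integrable_integral_eq)
  have "(\<integral>\<^sup>+k. ennreal ((norm (F k))\<^sup>2 * gauss_weight \<epsilon> k) \<partial>lborel) = ennreal (LINT k|lborel. (norm (F k))\<^sup>2 * gauss_weight \<epsilon> k)"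
    by (rule nn_integral_eq_integral[OF int_total]) (simp add: gauss_weight_bounds)
  also have "\<dots> \<le> ennreal (norm (LINT x|lborel. \<rho> x * R x))" unfolding real_total by (rule ennreal_leI) simp
  also have "\<dots> \<le> (\<integral>\<^sup>+x. ennreal (norm (\<rho> x * R x)) \<partial>lborel)" by (rule norm_le)
  also have "\<dots> \<le> (\<integral>\<^sup>+x. \<integral>\<^sup>+y. ennreal \<bar>\<rho> x\<bar> * (ennreal \<bar>\<rho> y\<bar> * \<kappa> x y) \<partial>lborel \<partial>lborel)"
  proof (rule nn_integral_mono)
    fix x
    have "ennreal (norm (\<rho> x * R x)) = ennreal \<bar>\<rho> x\<bar> * ennreal (norm (R x))" by (simp add: abs_mult ennreal_mult)
    also have "\<dots> \<le> ennreal \<bar>\<rho> x\<bar> * (\<integral>\<^sup>+y. ennreal (norm (\<rho> y * gauss_kernel \<epsilon> (x - y))) \<partial>lborel)"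
      unfolding R_def by (rule mult_left_mono[OF norm_le]) simp
    also have "\<dots> = (\<integral>\<^sup>+y. ennreal \<bar>\<rho> x\<bar> * ennreal (norm (\<rho> y * gauss_kernel \<epsilon> (x - y))) \<partial>lborel)"
      by (rule nn_integral_cmult[symmetric]) measurable
    also have "\<dots> = (\<integral>\<^sup>+y. ennreal \<bar>\<rho> x\<bar> * (ennreal \<bar>\<rho> y\<bar> * \<kappa> x y) \<partial>lborel)"
      unfolding \<kappa>_def using gauss_kernel_nonneg[OF \<epsilon>] by (simp add: abs_mult ennreal_mult)
    finally show "ennreal (norm (\<rho> x * R x)) \<le> (\<integral>\<^sup>+y. ennreal \<bar>\<rho> x\<bar> * (ennreal \<bar>\<rho> y\<bar> * \<kappa> x y) \<partial>lborel)" .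
  qed
  \<comment> \<open>Schur's test: the product is split into two half squares; integrating out the
    other variable of each leaves only the mass of the kernel.\<close>
  also have "\<dots> \<le> (\<integral>\<^sup>+x. \<integral>\<^sup>+y. ennreal (1/2) * (ennreal ((\<rho> x)\<^sup>2) * \<kappa> x y) + ennreal (1/2) * (ennreal ((\<rho> y)\<^sup>2) * \<kappa> x y) \<partial>lborel \<partial>lborel)"
  proof (intro nn_integral_mono)
    fix x y
    have "\<bar>\<rho> x\<bar> * \<bar>\<rho> y\<bar> \<le> 1/2 * (\<rho> x)\<^sup>2 + 1/2 * (\<rho> y)\<^sup>2"
      using sum_squares_bound[of "\<bar>\<rho> x\<bar>" "\<bar>\<rho> y\<bar>"] by simp
    then have "ennreal (\<bar>\<rho> x\<bar> * \<bar>\<rho> y\<bar>) \<le> ennreal (1/2 * (\<rho> x)\<^sup>2 + 1/2 * (\<rho> y)\<^sup>2)" by (rule ennreal_leI)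
    also have "ennreal (1/2 * (\<rho> x)\<^sup>2 + 1/2 * (\<rho> y)\<^sup>2) = ennreal (1/2) * ennreal ((\<rho> x)\<^sup>2) + ennreal (1/2) * ennreal ((\<rho> y)\<^sup>2)"
      by (subst ennreal_plus) (simp_all only: ennreal_mult zero_le_power2 zero_le_divide_1_iff mult_nonneg_nonneg zero_le_numeral)
    finally have "ennreal (\<bar>\<rho> x\<bar> * \<bar>\<rho> y\<bar>) * \<kappa> x y \<le> (ennreal (1/2) * ennreal ((\<rho> x)\<^sup>2) + ennreal (1/2) * ennreal ((\<rho> y)\<^sup>2)) * \<kappa> x y"
      by (rule mult_right_mono) simp
    then show "ennreal \<bar>\<rho> x\<bar> * (ennreal \<bar>\<rho> y\<bar> * \<kappa> x y) \<le> ennreal (1/2) * (ennreal ((\<rho> x)\<^sup>2) * \<kappa> x y) + ennreal (1/2) * (ennreal ((\<rho> y)\<^sup>2) * \<kappa> x y)"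
      by (simp only: ennreal_mult abs_ge_zero distrib_right mult.assoc)
  qed
  also have "\<dots> = ennreal (1/2) * (\<integral>\<^sup>+x. \<integral>\<^sup>+y. ennreal ((\<rho> x)\<^sup>2) * \<kappa> x y \<partial>lborel \<partial>lborel)
      + ennreal (1/2) * (\<integral>\<^sup>+x. \<integral>\<^sup>+y. ennreal ((\<rho> y)\<^sup>2) * \<kappa> x y \<partial>lborel \<partial>lborel)"
  proof -
    have \<kappa>m: "(\<lambda>z. \<kappa> (fst z) (snd z)) \<in> borel_measurable (lborel \<Otimes>\<^sub>M lborel)" unfolding \<kappa>_def by measurable
    have \<kappa>1: "(\<lambda>y. \<kappa> x y) \<in> borel_measurable lborel" for x unfolding \<kappa>_def by measurable
    have m1: "(\<lambda>x. \<integral>\<^sup>+y. ennreal ((\<rho> x)\<^sup>2) * \<kappa> x y \<partial>lborel) \<in> borel_measurable lborel"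
      by (intro lborel.borel_measurable_nn_integral) (simp only: case_prod_unfold, intro borel_measurable_times_ennreal \<kappa>m, measurable)
    have m2: "(\<lambda>x. \<integral>\<^sup>+y. ennreal ((\<rho> y)\<^sup>2) * \<kappa> x y \<partial>lborel) \<in> borel_measurable lborel"
      by (intro lborel.borel_measurable_nn_integral) (simp only: case_prod_unfold, intro borel_measurable_times_ennreal \<kappa>m, measurable)
    have \<rho>2: "(\<lambda>y. ennreal ((\<rho> y)\<^sup>2)) \<in> borel_measurable lborel" by measurable
    have "(\<integral>\<^sup>+y. ennreal (1/2) * (ennreal ((\<rho> x)\<^sup>2) * \<kappa> x y) + ennreal (1/2) * (ennreal ((\<rho> y)\<^sup>2) * \<kappa> x y) \<partial>lborel)
      = ennreal (1/2) * (\<integral>\<^sup>+y. ennreal ((\<rho> x)\<^sup>2) * \<kappa> x y \<partial>lborel) + ennreal (1/2) * (\<integral>\<^sup>+y. ennreal ((\<rho> y)\<^sup>2) * \<kappa> x y \<partial>lborel)" for x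
      by (rule nn_integral_combination) (intro borel_measurable_times_ennreal \<kappa>1 \<rho>2 borel_measurable_const)+
    then have "(\<integral>\<^sup>+x. \<integral>\<^sup>+y. ennreal (1/2) * (ennreal ((\<rho> x)\<^sup>2) * \<kappa> x y) + ennreal (1/2) * (ennreal ((\<rho> y)\<^sup>2) * \<kappa> x y) \<partial>lborel \<partial>lborel)
      = (\<integral>\<^sup>+x. ennreal (1/2) * (\<integral>\<^sup>+y. ennreal ((\<rho> x)\<^sup>2) * \<kappa> x y \<partial>lborel) + ennreal (1/2) * (\<integral>\<^sup>+y. ennreal ((\<rho> y)\<^sup>2) * \<kappa> x y \<partial>lborel) \<partial>lborel)"
      by (intro nn_integral_cong)
    also have "\<dots> = ennreal (1/2) * (\<integral>\<^sup>+x. \<integral>\<^sup>+y. ennreal ((\<rho> x)\<^sup>2) * \<kappa> x y \<partial>lborel \<partial>lborel)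
      + ennreal (1/2) * (\<integral>\<^sup>+x. \<integral>\<^sup>+y. ennreal ((\<rho> y)\<^sup>2) * \<kappa> x y \<partial>lborel \<partial>lborel)"
      by (rule nn_integral_combination[OF m1 m2])
    finally show ?thesis .
  qed
  also have "(\<integral>\<^sup>+x. \<integral>\<^sup>+y. ennreal ((\<rho> x)\<^sup>2) * \<kappa> x y \<partial>lborel \<partial>lborel) = A * ennreal ((2 * pi) ^ 3)"
  proof -
    have "(\<integral>\<^sup>+y. ennreal ((\<rho> x)\<^sup>2) * \<kappa> x y \<partial>lborel) = ennreal ((\<rho> x)\<^sup>2) * ennreal ((2 * pi) ^ 3)" for x
    proof -
      have "(\<integral>\<^sup>+y. ennreal ((\<rho> x)\<^sup>2) * \<kappa> x y \<partial>lborel) = ennreal ((\<rho> x)\<^sup>2) * (\<integral>\<^sup>+y. \<kappa> x y \<partial>lborel)"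
        unfolding \<kappa>_def by (rule nn_integral_cmult) measurable
      also have "(\<integral>\<^sup>+y. \<kappa> x y \<partial>lborel) = (\<integral>\<^sup>+y. ennreal (gauss_kernel \<epsilon> (y + - x)) \<partial>lborel)"
      proof (rule nn_integral_cong)
        fix y
        have "gauss_kernel \<epsilon> (x - y) = gauss_kernel \<epsilon> (y + - x)"
          unfolding gauss_kernel_def by (intro prod.cong refl) (simp add: inner_diff_left power2_commute power_divide)
        then show "\<kappa> x y = ennreal (gauss_kernel \<epsilon> (y + - x))" unfolding \<kappa>_def by simp
      qed
      also have "\<dots> = (\<integral>\<^sup>+y. ennreal (gauss_kernel \<epsilon> y) \<partial>lborel)"
        by (rule nn_integral_lborel_shift[of "\<lambda>y. ennreal (gauss_kernel \<epsilon> y)"]) measurable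
      finally show ?thesis unfolding gauss_integrals(1)[OF \<epsilon>] .
    qed
    then show ?thesis unfolding A_def by (simp add: nn_integral_multc)
  qed
  also have "(\<integral>\<^sup>+x. \<integral>\<^sup>+y. ennreal ((\<rho> y)\<^sup>2) * \<kappa> x y \<partial>lborel \<partial>lborel) = A * ennreal ((2 * pi) ^ 3)"
  proof -
    have "(\<lambda>z. ennreal ((\<rho> (snd z))\<^sup>2) * \<kappa> (fst z) (snd z)) \<in> borel_measurable (lborel \<Otimes>\<^sub>M lborel)"
      unfolding \<kappa>_def by measurable
    then have m: "(\<lambda>(x, y). ennreal ((\<rho> y)\<^sup>2) * \<kappa> x y) \<in> borel_measurable (lborel \<Otimes>\<^sub>M lborel)"
      by (simp only: case_prod_unfold)
    have "(\<integral>\<^sup>+x. \<integral>\<^sup>+y. ennreal ((\<rho> y)\<^sup>2) * \<kappa> x y \<partial>lborel \<partial>lborel) = (\<integral>\<^sup>+y. \<integral>\<^sup>+x. ennreal ((\<rho> y)\<^sup>2) * \<kappa> x y \<partial>lborel \<partial>lborel)"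
      using lborel_pair.Fubini'[OF m] by simp
    also have "\<dots> = (\<integral>\<^sup>+y. ennreal ((\<rho> y)\<^sup>2) * ennreal ((2 * pi) ^ 3) \<partial>lborel)"
    proof (rule nn_integral_cong)
      fix y
      have "(\<integral>\<^sup>+x. ennreal ((\<rho> y)\<^sup>2) * \<kappa> x y \<partial>lborel) = ennreal ((\<rho> y)\<^sup>2) * (\<integral>\<^sup>+x. ennreal (gauss_kernel \<epsilon> (x + - y)) \<partial>lborel)"
        unfolding \<kappa>_def diff_conv_add_uminus by (rule nn_integral_cmult) measurable
      also have "(\<integral>\<^sup>+x. ennreal (gauss_kernel \<epsilon> (x + - y)) \<partial>lborel) = (\<integral>\<^sup>+y. ennreal (gauss_kernel \<epsilon> y) \<partial>lborel)"
        by (rule nn_integral_lborel_shift[of "\<lambda>y. ennreal (gauss_kernel \<epsilon> y)"]) measurable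
      finally show "(\<integral>\<^sup>+x. ennreal ((\<rho> y)\<^sup>2) * \<kappa> x y \<partial>lborel) = ennreal ((\<rho> y)\<^sup>2) * ennreal ((2 * pi) ^ 3)"
        unfolding gauss_integrals(1)[OF \<epsilon>] .
    qed
    also have "\<dots> = A * ennreal ((2 * pi) ^ 3)" unfolding A_def by (simp add: nn_integral_multc)
    finally show ?thesis .
  qed
  also have "ennreal (1/2) * (A * ennreal ((2 * pi) ^ 3)) + ennreal (1/2) * (A * ennreal ((2 * pi) ^ 3)) = ennreal ((2 * pi) ^ 3) * A"
  proof -
    have "ennreal (1/2) + ennreal (1/2) = 1" by (subst ennreal_plus[symmetric]) simp_all
    then show ?thesis unfolding distrib_right[symmetric] by (simp add: mult.commute)
  qed
  finally show ?thesis unfolding A_def F_def .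
qed

text \<open>The Gaussian weights tend to 1 pointwise as their parameter \<open>1 / Suc n\<close>
  tends to 0, and Fatou's lemma removes them.\<close>

theorem Bessel_inequality:
  assumes \<rho> [measurable]: "\<rho> \<in> borel_measurable borel" and int: "integrable lborel \<rho>"
  shows "(\<integral>\<^sup>+k. ennreal ((norm (Fourier \<rho> k))\<^sup>2) \<partial>lborel) \<le> ennreal ((2 * pi) ^ 3) * (\<integral>\<^sup>+x. ennreal ((\<rho> x)\<^sup>2) \<partial>lborel)"
proof -
  have F_meas [measurable]: "Fourier \<rho> \<in> borel_measurable borel"
    by (rule Fourier_borel_measurable[OF \<rho>])
  define w where "w n = gauss_weight (1 / real (Suc n))" for n
  have lim: "(\<lambda>n. w n k) \<longlonglongrightarrow> 1" for k
  proof -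
    have "(\<lambda>n. exp (- (1 / real (Suc n) * (k \<bullet> b))\<^sup>2 / 2)) \<longlonglongrightarrow> exp (- (0 * (k \<bullet> b))\<^sup>2 / 2)" for b
      by (intro tendsto_exp tendsto_divide tendsto_minus tendsto_power tendsto_mult tendsto_const LIMSEQ_Suc[OF lim_1_over_n]) simp
    then have "(\<lambda>n. w n k) \<longlonglongrightarrow> (\<Prod>b\<in>(Basis :: R3 set). exp (- (0 * (k \<bullet> b))\<^sup>2 / 2))"
      unfolding w_def gauss_weight_def by (intro tendsto_prod)
    then show ?thesis by simp
  qed
  have "(\<integral>\<^sup>+k. ennreal ((norm (Fourier \<rho> k))\<^sup>2) \<partial>lborel)
      = (\<integral>\<^sup>+k. liminf (\<lambda>n. ennreal ((norm (Fourier \<rho> k))\<^sup>2 * w n k)) \<partial>lborel)"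
  proof (rule nn_integral_cong)
    fix k
    have "(\<lambda>n. ennreal ((norm (Fourier \<rho> k))\<^sup>2 * w n k)) \<longlonglongrightarrow> ennreal ((norm (Fourier \<rho> k))\<^sup>2 * 1)"
      by (intro tendsto_ennrealI tendsto_mult tendsto_const lim)
    then have "liminf (\<lambda>n. ennreal ((norm (Fourier \<rho> k))\<^sup>2 * w n k)) = ennreal ((norm (Fourier \<rho> k))\<^sup>2 * 1)"
      by (rule lim_imp_Liminf[OF sequentially_bot])
    then show "ennreal ((norm (Fourier \<rho> k))\<^sup>2) = liminf (\<lambda>n. ennreal ((norm (Fourier \<rho> k))\<^sup>2 * w n k))" by simp
  qed
  also have "\<dots> \<le> liminf (\<lambda>n. \<integral>\<^sup>+k. ennreal ((norm (Fourier \<rho> k))\<^sup>2 * w n k) \<partial>lborel)"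
    unfolding w_def by (rule nn_integral_liminf) measurable
  also have "\<dots> \<le> limsup (\<lambda>n. \<integral>\<^sup>+k. ennreal ((norm (Fourier \<rho> k))\<^sup>2 * w n k) \<partial>lborel)"
    by (rule Liminf_le_Limsup) simp
  also have "\<dots> \<le> ennreal ((2 * pi) ^ 3) * (\<integral>\<^sup>+x. ennreal ((\<rho> x)\<^sup>2) \<partial>lborel)"
    unfolding w_def by (rule Limsup_bounded) (intro always_eventually allI Bessel_gauss assms, simp)
  finally show ?thesis .
qed

section \<open>Tails of weak \<open>L\<^sup>3\<close> functions\<close>

lemma weak_L3_tail_measure:
  assumes "weak_L3_norm f \<le> ennreal M" "M \<ge> 0" "t > 0"
  shows "emeasure lebesgue {x. \<bar>f x\<bar> > t} \<le> ennreal ((M / t) ^ 3)"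
proof -
  define e where "e = emeasure lebesgue {x. \<bar>f x\<bar> > t}"
  have le: "ennreal t * ennreal_cbrt e \<le> ennreal M"
    unfolding e_def by (rule order_trans[OF SUP_upper assms(1)[unfolded weak_L3_norm_def]]) (use assms(3) in simp)
  have "e \<noteq> \<infinity>"
  proof
    assume "e = \<infinity>"
    then have "ennreal t * ennreal_cbrt e = top" using assms(3) by (simp add: ennreal_cbrt_def ennreal_mult_top)
    with le show False by (simp add: top_unique)
  qed
  then obtain m where m: "m \<ge> 0" "e = ennreal m" by (cases e) auto
  then have "ennreal t * ennreal_cbrt e = ennreal (t * root 3 m)"
    using assms(3) by (simp add: ennreal_cbrt_def ennreal_mult)
  with le have "ennreal (t * root 3 m) \<le> ennreal M" by simp
  then have "t * root 3 m \<le> M" using assms(2) by (simp add: ennreal_le_iff)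
  then have "root 3 m \<le> M / t" using assms(3) by (simp add: pos_le_divide_eq mult.commute)
  then have "root 3 m ^ 3 \<le> (M / t) ^ 3" by (rule power_mono) (use m(1) in simp)
  then have "m \<le> (M / t) ^ 3" using m(1) by simp
  then show ?thesis unfolding e_def[symmetric] m(2) by (rule ennreal_leI)
qed

text \<open>A dyadic layer cake in which a single term suffices: if
  \<open>2 ^ j * t < y \<le> 2 ^ Suc j * t\<close>, the \<open>j\<close>-th summand alone is at
  least \<open>y\<close>.\<close>

lemma dyadic_upper_bound:
  fixes y t :: real
  assumes "t > 0" "y > t"
  shows "ennreal y \<le> (\<Sum>j. ennreal (2 ^ Suc j * t) * (if y > 2 ^ j * t then 1 else 0))"
proof -
  obtain n where n: "y / t < 2 ^ n" using real_arch_pow[of 2 "y / t"] by auto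
  define m where "m = (LEAST n. y \<le> 2 ^ n * t)"
  have ex: "y \<le> 2 ^ n * t" using n assms(1) by (simp add: pos_divide_less_eq less_imp_le)
  have m: "y \<le> 2 ^ m * t" unfolding m_def by (rule LeastI[of "\<lambda>n. y \<le> 2 ^ n * t", OF ex])
  have "m \<noteq> 0"
  proof
    assume "m = 0"
    with m assms(2) show False by simp
  qed
  then obtain j where j: "m = Suc j" using not0_implies_Suc by blast
  have "j < m" using j by simp
  then have "\<not> y \<le> 2 ^ j * t" unfolding m_def by (rule not_less_Least)
  then have "y > 2 ^ j * t" by simp
  then have "ennreal y \<le> ennreal (2 ^ Suc j * t) * (if y > 2 ^ j * t then 1 else 0)"
    using m j by (simp add: ennreal_leI)
  also have "\<dots> \<le> (\<Sum>j. ennreal (2 ^ Suc j * t) * (if y > 2 ^ j * t then 1 else 0))"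
    by (rule ennreal_suminf_upper)
  finally show ?thesis .
qed

text \<open>The dyadic level \<open>2 ^ j * t\<close> contributes \<open>2 ^ Suc j * t\<close> times
  the measure bound \<open>(M / (2 ^ j * t)) ^ 3\<close>. This is a geometric series of ratio
  \<open>1 / 4\<close> with first term \<open>2 * M ^ 3 / t\<^sup>2\<close>, whence the constant
  \<open>8 / 3\<close>.\<close>

lemma weak_L3_tail_integral:
  assumes [measurable]: "f \<in> borel_measurable lebesgue"
    and M: "weak_L3_norm f \<le> ennreal M" "M \<ge> 0" and t: "t > 0"
  shows "(\<integral>\<^sup>+x. ennreal \<bar>f x\<bar> * indicator {x. \<bar>f x\<bar> > t} x \<partial>lebesgue) \<le> ennreal (8 / 3 * M ^ 3 / t\<^sup>2)"
proof -
  have [measurable]: "{x. \<bar>f x\<bar> > s} \<in> sets lebesgue" for s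
  proof -
    have "{x \<in> space lebesgue. \<bar>f x\<bar> > s} \<in> sets lebesgue" by measurable
    then show ?thesis by simp
  qed
  have "(\<integral>\<^sup>+x. ennreal \<bar>f x\<bar> * indicator {x. \<bar>f x\<bar> > t} x \<partial>lebesgue)
      \<le> (\<integral>\<^sup>+x. (\<Sum>j. ennreal (2 ^ Suc j * t) * indicator {x. \<bar>f x\<bar> > 2 ^ j * t} x) \<partial>lebesgue)"
  proof (rule nn_integral_mono)
    fix x
    show "ennreal \<bar>f x\<bar> * indicator {x. \<bar>f x\<bar> > t} x \<le> (\<Sum>j. ennreal (2 ^ Suc j * t) * indicator {x. \<bar>f x\<bar> > 2 ^ j * t} x)"
    proof (cases "\<bar>f x\<bar> > t")
      case True
      have "(indicator {x. \<bar>f x\<bar> > 2 ^ j * t} x :: ennreal) = (if \<bar>f x\<bar> > 2 ^ j * t then 1 else 0)" for j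
        by (simp add: indicator_def)
      with dyadic_upper_bound[OF t True] True show ?thesis by simp
    qed simp
  qed
  also have "\<dots> = (\<Sum>j. \<integral>\<^sup>+x. ennreal (2 ^ Suc j * t) * indicator {x. \<bar>f x\<bar> > 2 ^ j * t} x \<partial>lebesgue)"
    by (rule nn_integral_suminf) measurable
  also have "\<dots> = (\<Sum>j. ennreal (2 ^ Suc j * t) * emeasure lebesgue {x. \<bar>f x\<bar> > 2 ^ j * t})"
    by (intro suminf_cong nn_integral_cmult_indicator) measurable
  also have "\<dots> \<le> (\<Sum>j. ennreal (2 * M ^ 3 / t\<^sup>2 * (1 / 4) ^ j))"
  proof (intro suminf_le summableI)
    fix j
    have "ennreal (2 ^ Suc j * t) * emeasure lebesgue {x. \<bar>f x\<bar> > 2 ^ j * t}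
        \<le> ennreal (2 ^ Suc j * t) * ennreal ((M / (2 ^ j * t)) ^ 3)"
      by (intro mult_left_mono weak_L3_tail_measure M) (use t in simp_all)
    also have "\<dots> = ennreal (2 ^ Suc j * t * (M / (2 ^ j * t)) ^ 3)"
      by (rule ennreal_mult[symmetric]) (use t M(2) in simp_all)
    also have "2 ^ Suc j * t * (M / (2 ^ j * t)) ^ 3 = 2 * M ^ 3 / t\<^sup>2 * (1 / 4) ^ j"
    proof -
      define a :: real where "a = 2 ^ j"
      have a: "a > 0" "(1 / 4 :: real) ^ j = 1 / (a * a)"
        unfolding a_def by (simp_all add: power_one_over flip: power_mult_distrib)
      have "2 * a * t * (M / (a * t)) ^ 3 = 2 * M ^ 3 / t\<^sup>2 * (1 / (a * a))"
        using a(1) t by (simp add: power3_eq_cube power2_eq_square mult_ac)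
      then show ?thesis unfolding a(2) by (simp add: a_def)
    qed
    finally show "ennreal (2 ^ Suc j * t) * emeasure lebesgue {x. \<bar>f x\<bar> > 2 ^ j * t} \<le> ennreal (2 * M ^ 3 / t\<^sup>2 * (1 / 4) ^ j)" .
  qed
  also have "\<dots> = ennreal (\<Sum>j. 2 * M ^ 3 / t\<^sup>2 * (1 / 4) ^ j)"
  proof (rule suminf_ennreal2)
    show "summable (\<lambda>j. 2 * M ^ 3 / t\<^sup>2 * (1 / 4) ^ j)" by (intro summable_mult summable_geometric) simp
  qed (use M(2) in simp)
  also have "(\<Sum>j. 2 * M ^ 3 / t\<^sup>2 * (1 / 4) ^ j) = 2 * M ^ 3 / t\<^sup>2 * (\<Sum>j. (1 / 4) ^ j)"
    by (intro suminf_mult summable_geometric) simp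
  also have "\<dots> = 8 / 3 * M ^ 3 / t\<^sup>2" by (subst suminf_geometric) simp_all
  finally show ?thesis .
qed

section \<open>Schroedinger forms\<close>

text \<open>Pointwise real scalars turn sets of functions into subspaces in the sense of the
  abstract part.\<close>

instantiation "fun" :: (type, real_vector) real_vector
begin

definition "scaleR r f = (\<lambda>x. r *\<^sub>R f x)"

instance
  by standard (simp_all add: scaleR_fun_def fun_eq_iff scaleR_add_right scaleR_add_left)

end

lemma scaleR_fun_apply [simp]: "(r *\<^sub>R f) x = r *\<^sub>R f x"
  by (simp add: scaleR_fun_def)

text \<open>For complex values \<open>\<bullet>\<close> is the real part of the Hermitian product,
  so this is the real part of \<open>L2_inner\<close>.\<close>

definition L2_form :: "(R3 \<Rightarrow> 'a::euclidean_space) \<Rightarrow> (R3 \<Rightarrow> 'a) \<Rightarrow> real" where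
  "L2_form f g = (LINT x|lebesgue. f x \<bullet> g x)"

lemma L2_form_integrable:
  assumes f: "f \<in> L2" and g: "g \<in> L2"
  shows "integrable lebesgue (\<lambda>x. f x \<bullet> g x)"
proof (rule L2_pairing_integrable[OF f g])
  show "(\<lambda>x. f x \<bullet> g x) \<in> borel_measurable lebesgue"
    by (intro borel_measurable_inner L2_measurable f g)
  show "norm (f x \<bullet> g x) \<le> norm (f x) * norm (g x)" for x
    using Cauchy_Schwarz_ineq2[of "f x" "g x"] by simp
qed

lemma L2_zero: "(\<lambda>x. 0) \<in> L2"
  unfolding L2_def by simp

lemma L2_form_sq: "L2_form f f = (L2_norm f)\<^sup>2"
  unfolding L2_form_def L2_norm_sq by (simp add: power2_norm_eq_inner)

lemma L2_form_cong_AE: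
  assumes "f \<in> L2" "g \<in> L2" "f' \<in> L2" "g' \<in> L2"
    and "AE x in lebesgue. f x = f' x" "AE x in lebesgue. g x = g' x"
  shows "L2_form f g = L2_form f' g'"
  unfolding L2_form_def
proof (rule integral_cong_AE)
  show "AE x in lebesgue. f x \<bullet> g x = f' x \<bullet> g' x" using assms(5,6) by eventually_elim simp
qed (intro borel_measurable_inner L2_measurable assms)+

lemma L2_subspace: "subspace (L2 :: (R3 \<Rightarrow> 'a::euclidean_space) set)"
proof (rule subspaceI)
  show "(0 :: R3 \<Rightarrow> 'a) \<in> L2" unfolding zero_fun_def by (rule L2_zero)
  show "x + y \<in> L2" if "x \<in> L2" "y \<in> L2" for x y :: "R3 \<Rightarrow> 'a"
    unfolding plus_fun_def by (rule L2_add[OF that])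
  show "c *\<^sub>R x \<in> L2" if "x \<in> L2" for c and x :: "R3 \<Rightarrow> 'a"
    unfolding scaleR_fun_def by (rule L2_scaleR[OF that])
qed

text \<open>The gradient, the weighted copies of \<open>u\<close> and \<open>u\<close> itself are
  maps into \<open>L2\<close> that are linear up to null sets. Each piece of the Schroedinger form
  is the pullback of the \<open>L2\<close> product under one of them.\<close>

lemma psd_form_embedding:
  fixes T :: "'v::real_vector \<Rightarrow> R3 \<Rightarrow> 'b::euclidean_space"
  assumes Q: "subspace Q" and T: "\<And>u. u \<in> Q \<Longrightarrow> T u \<in> L2"
    and add: "\<And>u w. u \<in> Q \<Longrightarrow> w \<in> Q \<Longrightarrow> AE x in lebesgue. T (u + w) x = T u x + T w x"
    and scale: "\<And>c u. u \<in> Q \<Longrightarrow> AE x in lebesgue. T (c *\<^sub>R u) x = c *\<^sub>R T u x"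
  shows "psd_form Q (\<lambda>u w. L2_form (T u) (T w))"
proof (unfold_locales)
  show "subspace Q" by fact
  fix x y z assume xyz: "x \<in> Q" "y \<in> Q"
  show "L2_form (T x) (T y) = L2_form (T y) (T x)" unfolding L2_form_def by (simp only: inner_commute)
  show "L2_form (T (c *\<^sub>R x)) (T y) = c * L2_form (T x) (T y)" for c
  proof -
    have "L2_form (T (c *\<^sub>R x)) (T y) = L2_form (\<lambda>a. c *\<^sub>R T x a) (T y)"
      by (rule L2_form_cong_AE[OF T[OF subspace_scale[OF Q xyz(1)]] T[OF xyz(2)] L2_scaleR[OF T[OF xyz(1)]] T[OF xyz(2)] scale[OF xyz(1)]]) simp
    then show ?thesis unfolding L2_form_def by simp
  qed
  assume z: "z \<in> Q"
  have "L2_form (T (x + y)) (T z) = L2_form (\<lambda>a. T x a + T y a) (T z)"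
    by (rule L2_form_cong_AE[OF T[OF subspace_add[OF Q xyz]] T[OF z] L2_add[OF T[OF xyz(1)] T[OF xyz(2)]] T[OF z] add[OF xyz]]) simp
  also have "\<dots> = L2_form (T x) (T z) + L2_form (T y) (T z)"
    unfolding L2_form_def inner_add_left
    by (rule Bochner_Integration.integral_add) (intro L2_form_integrable T xyz z)+
  finally show "L2_form (T (x + y)) (T z) = L2_form (T x) (T z) + L2_form (T y) (T z)" .
next
  fix x assume "x \<in> Q"
  show "0 \<le> L2_form (T x) (T x)" unfolding L2_form_sq by simp
qed

lemma psd_form_L2: "psd_form (L2 :: (R3 \<Rightarrow> 'a::euclidean_space) set) L2_form"
  using psd_form_embedding[OF L2_subspace, of "\<lambda>u. u"] by simp

lemma psd_form_add:
  assumes "psd_form Q A" "psd_form Q B"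
  shows "psd_form Q (\<lambda>x y. A x y + B x y)"
proof -
  interpret A: psd_form Q A by fact
  interpret B: psd_form Q B by fact
  show ?thesis
    using sym_form_combination[OF A.sym_form_axioms B.sym_form_axioms, of 1] A.nonneg B.nonneg
    by (simp add: psd_form_def psd_form_axioms_def)
qed

lemma L2_norm_scaleR_integral_le:
  fixes f :: "R3 \<Rightarrow> 'a::euclidean_space"
  assumes \<phi>: "\<phi> \<in> L2" and f: "f \<in> L2"
  shows "norm (LINT x|lebesgue. \<phi> x *\<^sub>R f x) \<le> L2_norm \<phi> * L2_norm f"
proof -
  interpret R: psd_form "L2 :: (R3 \<Rightarrow> real) set" L2_form by (rule psd_form_L2)
  have n\<phi>: "(\<lambda>x. norm (\<phi> x)) \<in> L2" and nf: "(\<lambda>x. norm (f x)) \<in> L2"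
    using \<phi> f unfolding L2_def by (auto intro: borel_measurable_norm)
  have "norm (LINT x|lebesgue. \<phi> x *\<^sub>R f x) \<le> (LINT x|lebesgue. norm (\<phi> x *\<^sub>R f x))"
    by (rule integral_norm_bound)
  also have "\<dots> = L2_form (\<lambda>x. norm (\<phi> x)) (\<lambda>x. norm (f x))" unfolding L2_form_def by simp
  also have "\<dots> \<le> sqrt (L2_form (\<lambda>x. norm (\<phi> x)) (\<lambda>x. norm (\<phi> x))) * sqrt (L2_form (\<lambda>x. norm (f x)) (\<lambda>x. norm (f x)))"
    using R.Cauchy_Schwarz_sqrt[OF n\<phi> nf] by linarith
  also have "\<dots> = L2_norm \<phi> * L2_norm f" unfolding L2_form_sq by (simp add: L2_norm_def)
  finally show ?thesis .
qed

lemma weak_gradient_spec: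
  assumes "u \<in> H1"
  shows "weak_gradient u \<in> L2" "has_weak_gradient u (weak_gradient u)"
proof -
  from assms have "\<exists>G. G \<in> L2 \<and> has_weak_gradient u G" unfolding H1_def by blast
  from someI_ex[OF this] show "weak_gradient u \<in> L2" "has_weak_gradient u (weak_gradient u)"
    unfolding weak_gradient_def by auto
qed

lemma weak_gradient_eqI:
  assumes "u \<in> L2" "G \<in> L2" "has_weak_gradient u G"
  shows "u \<in> H1" "AE x in lebesgue. weak_gradient u x = G x"
proof -
  show H: "u \<in> H1" using assms unfolding H1_def by blast
  show "AE x in lebesgue. weak_gradient u x = G x"
    by (rule weak_gradient_unique[OF weak_gradient_spec(1)[OF H] assms(2) weak_gradient_spec(2)[OF H] assms(3)])
qed

lemma bounded_linear_mult_vec: "bounded_linear (\<lambda>v. \<chi> i. c * (v :: complex^3) $ i)"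
proof (rule linear_conv_bounded_linear[THEN iffD1])
  show "linear (\<lambda>v. \<chi> i. c * (v :: complex^3) $ i)"
    by (rule linearI) (simp_all add: vec_eq_iff algebra_simps)
qed

lemma L2_mult: "u \<in> L2 \<Longrightarrow> (\<lambda>x. c * u x :: complex) \<in> L2"
  by (rule L2_linear[OF _ bounded_linear_mult_right])

lemma H1_combination:
  assumes "u \<in> H1" "w \<in> H1"
  shows "(\<lambda>x. c * u x + d * w x) \<in> H1"
    "AE x in lebesgue. weak_gradient (\<lambda>x. c * u x + d * w x) x = (\<chi> i. c * weak_gradient u x $ i + d * weak_gradient w x $ i)"
proof -
  have u: "u \<in> L2" and w: "w \<in> L2" using assms unfolding H1_def by auto
  note gu = weak_gradient_spec[OF assms(1)] and gw = weak_gradient_spec[OF assms(2)]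
  have "(\<lambda>x. (\<chi> i. c * weak_gradient u x $ i) + (\<chi> i. d * weak_gradient w x $ i)) \<in> L2"
    by (intro L2_add L2_linear[OF gu(1) bounded_linear_mult_vec] L2_linear[OF gw(1) bounded_linear_mult_vec])
  moreover have "(\<chi> i. c * weak_gradient u x $ i) + (\<chi> i. d * weak_gradient w x $ i)
      = (\<chi> i. c * weak_gradient u x $ i + d * weak_gradient w x $ i)" for x
    by (simp add: vec_eq_iff)
  ultimately have G: "(\<lambda>x. \<chi> i. c * weak_gradient u x $ i + d * weak_gradient w x $ i) \<in> L2" by simp
  have "(\<lambda>x. c * u x + d * w x) \<in> L2" by (intro L2_add L2_mult u w)
  from weak_gradient_eqI[OF this G weak_gradient_linear[OF u gu(1) w gw(1) gu(2) gw(2)]]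
  show "(\<lambda>x. c * u x + d * w x) \<in> H1"
    "AE x in lebesgue. weak_gradient (\<lambda>x. c * u x + d * w x) x = (\<chi> i. c * weak_gradient u x $ i + d * weak_gradient w x $ i)" by auto
qed

lemma H1_scale:
  assumes "u \<in> H1"
  shows "(\<lambda>x. c * u x) \<in> H1"
    "AE x in lebesgue. weak_gradient (\<lambda>x. c * u x) x = (\<chi> i. c * weak_gradient u x $ i)"
  using H1_combination[OF assms assms, of c 0] by simp_all

lemma H1_L2: "u \<in> H1 \<Longrightarrow> u \<in> L2"
  unfolding H1_def by blast

section \<open>The Schroedinger form and its completeness\<close>

locale schroedinger_potential =
  fixes V :: "R3 \<Rightarrow> real" and \<alpha> \<beta> :: real
  assumes V_meas: "V \<in> borel_measurable lebesgue"
    and \<alpha>: "0 \<le> \<alpha>" "\<alpha> < 1"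
    and V_minus: "\<And>u. u \<in> H1 \<Longrightarrow> integrable lebesgue (\<lambda>x. max (- V x) 0 * (cmod (u x))\<^sup>2)"
      "\<And>u. u \<in> H1 \<Longrightarrow> (LINT x|lebesgue. max (- V x) 0 * (cmod (u x))\<^sup>2)
        \<le> \<alpha> * (L2_norm (weak_gradient u))\<^sup>2 + \<beta> * (L2_norm u)\<^sup>2"
begin

definition plus_part :: "(R3 \<Rightarrow> complex) \<Rightarrow> R3 \<Rightarrow> complex" where
  "plus_part u x = sqrt (max (V x) 0) *\<^sub>R u x"

definition minus_part :: "(R3 \<Rightarrow> complex) \<Rightarrow> R3 \<Rightarrow> complex" where
  "minus_part u x = sqrt (max (- V x) 0) *\<^sub>R u x"

abbreviation Q where "Q \<equiv> form_domain V"

lemma part_measurable: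
  assumes "u \<in> borel_measurable lebesgue"
  shows "plus_part u \<in> borel_measurable lebesgue" "minus_part u \<in> borel_measurable lebesgue"
  unfolding plus_part_def[abs_def] minus_part_def[abs_def] using assms V_meas by measurable

lemma part_norm:
  "(norm (plus_part u x))\<^sup>2 = max (V x) 0 * (cmod (u x))\<^sup>2"
  "(norm (minus_part u x))\<^sup>2 = max (- V x) 0 * (cmod (u x))\<^sup>2"
  unfolding plus_part_def minus_part_def by (simp_all add: power_mult_distrib)

lemma form_domain_iff: "u \<in> Q \<longleftrightarrow> u \<in> H1 \<and> plus_part u \<in> L2"
  unfolding form_domain_def L2_def[of, where 'a=complex] mem_Collect_eq part_norm
  using part_measurable(1)[OF L2_measurable[OF H1_L2]] by blast

lemma form_domain_H1: "u \<in> Q \<Longrightarrow> u \<in> H1"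
  and form_domain_L2: "u \<in> Q \<Longrightarrow> u \<in> L2"
  and plus_part_L2: "u \<in> Q \<Longrightarrow> plus_part u \<in> L2"
  using form_domain_iff H1_L2 by auto

lemma minus_part_L2: "u \<in> H1 \<Longrightarrow> minus_part u \<in> L2"
  unfolding L2_def mem_Collect_eq part_norm
  using part_measurable(2)[OF L2_measurable[OF H1_L2]] V_minus(1) by blast

lemma form_domain_combination: "u \<in> Q \<Longrightarrow> w \<in> Q \<Longrightarrow> (\<lambda>x. c * u x + d * w x) \<in> Q"
proof -
  assume u: "u \<in> Q" and w: "w \<in> Q"
  have "plus_part (\<lambda>x. c * u x + d * w x) = (\<lambda>x. c * plus_part u x + d * plus_part w x)"
    unfolding plus_part_def by (rule ext) (simp add: scaleR_add_right)
  moreover have "(\<lambda>x. c * plus_part u x + d * plus_part w x) \<in> L2"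
    by (intro L2_add L2_mult plus_part_L2 u w)
  ultimately show ?thesis
    unfolding form_domain_iff using H1_combination(1)[OF form_domain_H1[OF u] form_domain_H1[OF w]] by simp
qed

lemma form_domain_scale: "u \<in> Q \<Longrightarrow> (\<lambda>x. c * u x) \<in> Q"
  using form_domain_combination[of u u c 0] by simp

lemma scaleR_as_mult: "c *\<^sub>R u = (\<lambda>x. of_real c * u x)" for u :: "R3 \<Rightarrow> complex"
  by (rule ext) (simp add: scaleR_conv_of_real)

lemma subspace_form_domain: "subspace Q"
proof (rule subspaceI)
  have z: "has_weak_gradient (\<lambda>x. 0) (\<lambda>x. 0)" unfolding has_weak_gradient_def by simp
  have "\<exists>G\<in>L2. has_weak_gradient (\<lambda>x. 0) G" by (intro bexI[where x="\<lambda>x. 0"] z L2_zero)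
  then have "(\<lambda>x::R3. 0::complex) \<in> H1" unfolding H1_def using L2_zero by simp
  then have "(\<lambda>x. 0) \<in> Q" unfolding form_domain_def by simp
  then show "0 \<in> Q" by (simp add: zero_fun_def)
  show "x + y \<in> Q" if "x \<in> Q" "y \<in> Q" for x y
    using form_domain_combination[OF that, of 1 1] by (simp add: plus_fun_def)
  show "c *\<^sub>R x \<in> Q" if "x \<in> Q" for c x
    unfolding scaleR_as_mult by (rule form_domain_scale[OF that])
qed

definition D where "D u w = L2_form (weak_gradient u) (weak_gradient w)"
definition P where "P u w = L2_form (plus_part u) (plus_part w)"
definition Mi where "Mi u w = L2_form (minus_part u) (minus_part w)"
text \<open>The squared form norm contains only the positive part of the potential, so all its
  pieces are squares of \<open>L2\<close> norms. The negative part enters \<open>a\<close> alone,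
  where the form bound controls it.\<close>

definition B where "B u w = (D u w + P u w) + L2_form u w"
definition a where "a u w = (D u w + P u w) + (-1) * Mi u w"

lemma psd_D: "psd_form Q D"
  unfolding D_def
proof (rule psd_form_embedding[OF subspace_form_domain])
  show "weak_gradient u \<in> L2" if "u \<in> Q" for u by (rule weak_gradient_spec[OF form_domain_H1[OF that]])
  show "AE x in lebesgue. weak_gradient (u + w) x = weak_gradient u x + weak_gradient w x" if "u \<in> Q" "w \<in> Q" for u w
    using H1_combination(2)[OF form_domain_H1[OF that(1)] form_domain_H1[OF that(2)], of 1 1]
    by (simp add: plus_fun_def plus_vec_def)
  show "AE x in lebesgue. weak_gradient (c *\<^sub>R u) x = c *\<^sub>R weak_gradient u x" if "u \<in> Q" for c u
  proof -
    have "(\<chi> i. complex_of_real c * v $ i) = c *\<^sub>R v" for v :: "complex^3"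
      by (simp add: vec_eq_iff scaleR_conv_of_real[where 'a=complex])
    then show ?thesis unfolding scaleR_as_mult using H1_scale(2)[OF form_domain_H1[OF that], of "of_real c"] by simp
  qed
qed

lemma psd_P: "psd_form Q P"
  unfolding P_def
  by (rule psd_form_embedding[OF subspace_form_domain plus_part_L2]) (simp_all add: plus_part_def scaleR_add_right)

lemma psd_Mi: "psd_form Q Mi"
  unfolding Mi_def
  by (rule psd_form_embedding[OF subspace_form_domain minus_part_L2[OF form_domain_H1]]) (simp_all add: minus_part_def scaleR_add_right)

lemma psd_p: "psd_form Q L2_form"
  by (rule psd_form_embedding[OF subspace_form_domain form_domain_L2]) simp_all

lemma psd_B: "psd_form Q B"
  unfolding B_def by (intro psd_form_add psd_D psd_P psd_p)

lemma sym_a: "sym_form Q a"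
  unfolding a_def
  by (intro sym_form_combination psd_form.axioms(1)[OF psd_form_add[OF psd_D psd_P]] psd_form.axioms(1)[OF psd_Mi])

sublocale p: psd_form Q L2_form by (rule psd_p)

lemma sq_forms:
  "D u u = (L2_norm (weak_gradient u))\<^sup>2" "P u u = (L2_norm (plus_part u))\<^sup>2" "Mi u u = (L2_norm (minus_part u))\<^sup>2"
  unfolding D_def P_def Mi_def L2_form_sq by auto

lemma Mi_le: "u \<in> Q \<Longrightarrow> Mi u u \<le> \<alpha> * D u u + \<beta> * L2_form u u"
  using V_minus(2)[OF form_domain_H1] unfolding sq_forms L2_norm_sq[of "minus_part u"] part_norm L2_form_sq by blast

text \<open>Multiplication by the square root of the positive part is a closed operator: on each set
  \<open>{V \<le> m}\<close> it is bounded, so the two limits agree there, and these sets exhaust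
  the space.\<close>

lemma L2_norm_sq_tendsto_weighted:
  assumes u: "\<And>n. u n \<in> Q" and l: "l \<in> L2" and K: "K \<in> L2"
    and ul: "(\<lambda>n. (L2_norm (\<lambda>x. u n x - l x))\<^sup>2) \<longlonglongrightarrow> 0"
    and uK: "(\<lambda>n. (L2_norm (\<lambda>x. plus_part (u n) x - K x))\<^sup>2) \<longlonglongrightarrow> 0"
  shows "AE x in lebesgue. plus_part l x = K x"
proof -
  note [measurable] = V_meas L2_measurable[OF l] L2_measurable[OF K] part_measurable(1)[OF L2_measurable[OF l]]
  have "AE x in lebesgue. V x \<le> real m \<longrightarrow> plus_part l x = K x" for m
  proof -
    define X where "X x = (if V x \<le> real m then 1 else 0) *\<^sub>R (plus_part l x - K x)" for x
    have [measurable]: "X \<in> borel_measurable lebesgue" unfolding X_def[abs_def] by measurable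
    have bound: "(\<integral>\<^sup>+x. ennreal ((norm (X x))\<^sup>2) \<partial>lebesgue) \<le>
        ennreal (2 * real m * (L2_norm (\<lambda>x. u n x - l x))\<^sup>2 + 2 * (L2_norm (\<lambda>x. plus_part (u n) x - K x))\<^sup>2)" for n
    proof -
      have d1: "(\<lambda>x. u n x - l x) \<in> L2" and d2: "(\<lambda>x. plus_part (u n) x - K x) \<in> L2"
        by (intro L2_diff form_domain_L2 plus_part_L2 u l K)+
      have "(\<integral>\<^sup>+x. ennreal ((norm (X x))\<^sup>2) \<partial>lebesgue)
        \<le> (\<integral>\<^sup>+x. ennreal (2 * real m * (norm (u n x - l x))\<^sup>2 + 2 * (norm (plus_part (u n) x - K x))\<^sup>2) \<partial>lebesgue)"
      proof (intro nn_integral_mono ennreal_leI)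
        fix x
        show "(norm (X x))\<^sup>2 \<le> 2 * real m * (norm (u n x - l x))\<^sup>2 + 2 * (norm (plus_part (u n) x - K x))\<^sup>2"
        proof (cases "V x \<le> real m")
          case True
          have "X x = - plus_part (\<lambda>x. u n x - l x) x + (plus_part (u n) x - K x)"
            unfolding X_def plus_part_def using True by (simp add: scaleR_diff_right)
          then have "(norm (X x))\<^sup>2 \<le> 2 * (norm (plus_part (\<lambda>x. u n x - l x) x))\<^sup>2 + 2 * (norm (plus_part (u n) x - K x))\<^sup>2"
            using norm_add_sq_le[of "- plus_part (\<lambda>x. u n x - l x) x" "plus_part (u n) x - K x"] by simp
          also have "(norm (plus_part (\<lambda>x. u n x - l x) x))\<^sup>2 \<le> real m * (norm (u n x - l x))\<^sup>2"
            unfolding part_norm using True by (intro mult_right_mono) auto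
          finally show ?thesis by simp
        qed (simp add: X_def)
      qed
      also have "\<dots> = ennreal (LINT x|lebesgue. 2 * real m * (norm (u n x - l x))\<^sup>2 + 2 * (norm (plus_part (u n) x - K x))\<^sup>2)"
        by (rule nn_integral_eq_integral)
          (intro Bochner_Integration.integrable_add integrable_mult_right L2_integrable d1 d2, simp)
      also have "(LINT x|lebesgue. 2 * real m * (norm (u n x - l x))\<^sup>2 + 2 * (norm (plus_part (u n) x - K x))\<^sup>2)
        = 2 * real m * (L2_norm (\<lambda>x. u n x - l x))\<^sup>2 + 2 * (L2_norm (\<lambda>x. plus_part (u n) x - K x))\<^sup>2"
      proof -
        have "(LINT x|lebesgue. 2 * real m * (norm (u n x - l x))\<^sup>2 + 2 * (norm (plus_part (u n) x - K x))\<^sup>2)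
          = (LINT x|lebesgue. 2 * real m * (norm (u n x - l x))\<^sup>2) + (LINT x|lebesgue. 2 * (norm (plus_part (u n) x - K x))\<^sup>2)"
          by (rule Bochner_Integration.integral_add) (intro integrable_mult_right L2_integrable d1 d2)+
        then show ?thesis unfolding L2_norm_sq by (simp only: integral_mult_right_zero)
      qed
      finally show ?thesis .
    qed
    have "(\<lambda>n. ennreal (2 * real m * (L2_norm (\<lambda>x. u n x - l x))\<^sup>2 + 2 * (L2_norm (\<lambda>x. plus_part (u n) x - K x))\<^sup>2))
      \<longlonglongrightarrow> ennreal (2 * real m * 0 + 2 * 0)"
      by (intro tendsto_ennrealI tendsto_add tendsto_mult tendsto_const ul uK)
    then have "(\<integral>\<^sup>+x. ennreal ((norm (X x))\<^sup>2) \<partial>lebesgue) \<le> ennreal (2 * real m * 0 + 2 * 0)"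
      by (rule LIMSEQ_le_const) (use bound in blast)
    then have "(\<integral>\<^sup>+x. ennreal ((norm (X x))\<^sup>2) \<partial>lebesgue) = 0" by simp
    then have "AE x in lebesgue. ennreal ((norm (X x))\<^sup>2) = 0"
      by (subst (asm) nn_integral_0_iff_AE) measurable
    then show ?thesis
      by eventually_elim (auto simp: X_def split: if_splits)
  qed
  then have "AE x in lebesgue. \<forall>m. V x \<le> real m \<longrightarrow> plus_part l x = K x" unfolding AE_all_countable by (rule allI)
  then show ?thesis
  proof eventually_elim
    case (elim x)
    obtain m where "V x \<le> real m" using real_arch_simple by blast
    with elim show ?case by blast
  qed
qed

end

lemma L2_norm_weighted_limit:
  fixes f :: "nat \<Rightarrow> R3 \<Rightarrow> 'a::euclidean_space"
  assumes \<phi>: "\<phi> \<in> L2" and f: "\<And>n. f n \<in> L2" and l: "l \<in> L2"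
    and lim: "(\<lambda>n. (L2_norm (\<lambda>x. f n x - l x))\<^sup>2) \<longlonglongrightarrow> 0"
  shows "(\<lambda>n. LINT x|lebesgue. \<phi> x *\<^sub>R f n x) \<longlonglongrightarrow> (LINT x|lebesgue. \<phi> x *\<^sub>R l x)"
proof (rule LIM_zero_cancel)
  have "(\<lambda>n. sqrt ((L2_norm (\<lambda>x. f n x - l x))\<^sup>2)) \<longlonglongrightarrow> sqrt 0"
    by (rule tendsto_real_sqrt[OF lim])
  then have n0: "(\<lambda>n. L2_norm (\<lambda>x. f n x - l x)) \<longlonglongrightarrow> 0" by simp
  have c0: "(\<lambda>n. L2_norm \<phi> * L2_norm (\<lambda>x. f n x - l x)) \<longlonglongrightarrow> 0"
    using tendsto_mult_left[OF n0, of "L2_norm \<phi>"] by simp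
  have "norm ((LINT x|lebesgue. \<phi> x *\<^sub>R f n x) - (LINT x|lebesgue. \<phi> x *\<^sub>R l x)) \<le> L2_norm \<phi> * L2_norm (\<lambda>x. f n x - l x)" for n
  proof -
    have "(LINT x|lebesgue. \<phi> x *\<^sub>R f n x) - (LINT x|lebesgue. \<phi> x *\<^sub>R l x)
      = (LINT x|lebesgue. \<phi> x *\<^sub>R f n x - \<phi> x *\<^sub>R l x)"
      by (rule Bochner_Integration.integral_diff[OF L2_scaleR_integrable[OF \<phi> f] L2_scaleR_integrable[OF \<phi> l], THEN sym])
    also have "\<dots> = (LINT x|lebesgue. \<phi> x *\<^sub>R (f n x - l x))" by (simp only: scaleR_diff_right)
    finally show ?thesis using L2_norm_scaleR_integral_le[OF \<phi> L2_diff[OF f l], of n] by simp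
  qed
  then show "(\<lambda>n. (LINT x|lebesgue. \<phi> x *\<^sub>R f n x) - (LINT x|lebesgue. \<phi> x *\<^sub>R l x)) \<longlonglongrightarrow> 0"
    by (intro Lim_null_comparison[OF _ c0] always_eventually allI)
qed

text \<open>The weak gradient is closed, since both sides of its defining identity are pairings with
  fixed \<open>L2\<close> functions.\<close>

lemma has_weak_gradient_limit:
  assumes u: "\<And>n. u n \<in> L2" "\<And>n. G n \<in> L2" "\<And>n. has_weak_gradient (u n) (G n)"
    and l: "l \<in> L2" "K \<in> L2"
    and lim: "(\<lambda>n. (L2_norm (\<lambda>x. u n x - l x))\<^sup>2) \<longlonglongrightarrow> 0" "(\<lambda>n. (L2_norm (\<lambda>x. G n x - K x))\<^sup>2) \<longlonglongrightarrow> 0"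
  shows "has_weak_gradient l K"
  unfolding has_weak_gradient_def
proof (intro ballI allI)
  fix \<phi> :: "R3 \<Rightarrow> real" and i :: 3
  assume \<phi>: "\<phi> \<in> test_functions"
  have 1: "(\<lambda>n. LINT x|lebesgue. partial_deriv i \<phi> x *\<^sub>R u n x) \<longlonglongrightarrow> (LINT x|lebesgue. partial_deriv i \<phi> x *\<^sub>R l x)"
    by (rule L2_norm_weighted_limit[OF test_function_L2[OF test_function_partial[OF \<phi>]] u(1) l(1) lim(1)])
  have nth: "(LINT x|lebesgue. \<phi> x *\<^sub>R (F x $ i)) = (LINT x|lebesgue. \<phi> x *\<^sub>R F x) $ i" if "F \<in> L2" for F :: "R3 \<Rightarrow> complex^3"
    using integral_bounded_linear[OF bounded_linear_vec_nth[of i] L2_scaleR_integrable[OF test_function_L2[OF \<phi>] that]]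
    by simp
  have 2: "(\<lambda>n. - (LINT x|lebesgue. \<phi> x *\<^sub>R (G n x $ i))) \<longlonglongrightarrow> - (LINT x|lebesgue. \<phi> x *\<^sub>R (K x $ i))"
    unfolding nth[OF u(2)] nth[OF l(2)]
    by (intro tendsto_minus tendsto_vec_nth L2_norm_weighted_limit[OF test_function_L2[OF \<phi>] u(2) l(2) lim(2)])
  have "(LINT x|lebesgue. partial_deriv i \<phi> x *\<^sub>R u n x) = - (LINT x|lebesgue. \<phi> x *\<^sub>R (G n x $ i))" for n
    by (rule has_weak_gradientD[OF u(3) \<phi>])
  with 2 have 2: "(\<lambda>n. LINT x|lebesgue. partial_deriv i \<phi> x *\<^sub>R u n x) \<longlonglongrightarrow> - (LINT x|lebesgue. \<phi> x *\<^sub>R (K x $ i))" by simp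
  show "(LINT x|lebesgue. partial_deriv i \<phi> x *\<^sub>R l x) = - (LINT x|lebesgue. \<phi> x *\<^sub>R (K x $ i))"
    by (rule LIMSEQ_unique[OF 1 2])
qed

context schroedinger_potential
begin

lemma minus_fun: "u - w = (\<lambda>x. u x - w x)" for u w :: "R3 \<Rightarrow> complex"
  by (rule ext) simp

lemma B_diff:
  assumes u: "u \<in> Q" and w: "w \<in> Q"
  shows "B (u - w) (u - w) = (L2_norm (\<lambda>x. weak_gradient u x - weak_gradient w x))\<^sup>2
     + (L2_norm (\<lambda>x. plus_part u x - plus_part w x))\<^sup>2 + (L2_norm (\<lambda>x. u x - w x))\<^sup>2"
proof -
  note gu = weak_gradient_spec(1)[OF form_domain_H1[OF u]] and gw = weak_gradient_spec(1)[OF form_domain_H1[OF w]]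
  have uw: "(\<lambda>x. u x - w x) \<in> H1"
    using H1_combination(1)[OF form_domain_H1[OF u] form_domain_H1[OF w], of 1 "-1"] by simp
  have v: "(\<chi> i. p $ i - q $ i) = p - q" for p q :: "complex^3" by (simp add: vec_eq_iff)
  have "AE x in lebesgue. weak_gradient (\<lambda>x. u x - w x) x = weak_gradient u x - weak_gradient w x"
    using H1_combination(2)[OF form_domain_H1[OF u] form_domain_H1[OF w], of 1 "-1"] by (simp add: v)
  then have "L2_norm (weak_gradient (\<lambda>x. u x - w x)) = L2_norm (\<lambda>x. weak_gradient u x - weak_gradient w x)"
    by (rule L2_norm_cong_AE[OF L2_measurable[OF weak_gradient_spec(1)[OF uw]] L2_measurable[OF L2_diff[OF gu gw]]])
  moreover have "plus_part (\<lambda>x. u x - w x) = (\<lambda>x. plus_part u x - plus_part w x)"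
    unfolding plus_part_def by (rule ext) (simp add: scaleR_diff_right)
  ultimately show ?thesis unfolding minus_fun B_def sq_forms L2_form_sq by simp
qed

text \<open>A Cauchy sequence for \<open>B\<close> converges in each of its three \<open>L2\<close>
  parts; closedness of the gradient and of the weight identifies the limits as coming from one
  function.\<close>

lemma complete_B: "complete_form Q B"
  unfolding complete_form_def
proof (intro allI impI)
  fix u :: "nat \<Rightarrow> R3 \<Rightarrow> complex"
  assume uQ: "\<forall>n. u n \<in> Q" and C: "\<forall>e>0. \<exists>N. \<forall>m\<ge>N. \<forall>n\<ge>N. B (u m - u n) (u m - u n) < e"
  have u: "u n \<in> Q" for n using uQ by (rule spec)
  note g = weak_gradient_spec(1)[OF form_domain_H1[OF u]]
  define X where "X m n = (L2_norm (\<lambda>x. weak_gradient (u m) x - weak_gradient (u n) x))\<^sup>2" for m n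
  define Y where "Y m n = (L2_norm (\<lambda>x. plus_part (u m) x - plus_part (u n) x))\<^sup>2" for m n
  define Z where "Z m n = (L2_norm (\<lambda>x. u m x - u n x))\<^sup>2" for m n
  have BX: "B (u m - u n) (u m - u n) = X m n + Y m n + Z m n" for m n
    unfolding X_def Y_def Z_def by (rule B_diff[OF u u])
  have nn: "X m n \<ge> 0" "Y m n \<ge> 0" "Z m n \<ge> 0" for m n unfolding X_def Y_def Z_def by simp_all
  have CX: "\<exists>N. \<forall>m\<ge>N. \<forall>n\<ge>N. X m n < e \<and> Y m n < e \<and> Z m n < e" if "e > 0" for e
  proof -
    from C that have "\<exists>N. \<forall>m\<ge>N. \<forall>n\<ge>N. B (u m - u n) (u m - u n) < e" by simp
    then obtain N where N: "\<forall>m\<ge>N. \<forall>n\<ge>N. B (u m - u n) (u m - u n) < e" by (rule exE)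
    show ?thesis
    proof (intro exI[of _ N] allI impI)
      fix m n assume "m \<ge> N" "n \<ge> N"
      with N have "X m n + Y m n + Z m n < e" unfolding BX by blast
      then show "X m n < e \<and> Y m n < e \<and> Z m n < e" using nn[of m n] by linarith
    qed
  qed
  have "\<exists>G\<in>L2. (\<lambda>n. (L2_norm (\<lambda>x. weak_gradient (u n) x - G x))\<^sup>2) \<longlonglongrightarrow> 0"
    by (rule L2_complete[OF g]) (use CX in \<open>unfold X_def, meson\<close>)
  then obtain G where G: "G \<in> L2" "(\<lambda>n. (L2_norm (\<lambda>x. weak_gradient (u n) x - G x))\<^sup>2) \<longlonglongrightarrow> 0" by blast
  have "\<exists>K\<in>L2. (\<lambda>n. (L2_norm (\<lambda>x. plus_part (u n) x - K x))\<^sup>2) \<longlonglongrightarrow> 0"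
    by (rule L2_complete[OF plus_part_L2[OF u]]) (use CX in \<open>unfold Y_def, meson\<close>)
  then obtain K where K: "K \<in> L2" "(\<lambda>n. (L2_norm (\<lambda>x. plus_part (u n) x - K x))\<^sup>2) \<longlonglongrightarrow> 0" by blast
  have "\<exists>l\<in>L2. (\<lambda>n. (L2_norm (\<lambda>x. u n x - l x))\<^sup>2) \<longlonglongrightarrow> 0"
    by (rule L2_complete[OF form_domain_L2[OF u]]) (use CX in \<open>unfold Z_def, meson\<close>)
  then obtain l where l: "l \<in> L2" "(\<lambda>n. (L2_norm (\<lambda>x. u n x - l x))\<^sup>2) \<longlonglongrightarrow> 0" by blast
  have "has_weak_gradient l G"
    by (rule has_weak_gradient_limit[OF form_domain_L2[OF u] g weak_gradient_spec(2)[OF form_domain_H1[OF u]] l(1) G(1) l(2) G(2)])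
  note lH = weak_gradient_eqI[OF l(1) G(1) this]
  have lK: "AE x in lebesgue. plus_part l x = K x"
    by (rule L2_norm_sq_tendsto_weighted[OF u l(1) K(1) l(2) K(2)])
  then have Kl: "AE x in lebesgue. K x = plus_part l x" by eventually_elim simp
  have "plus_part l \<in> L2" by (rule L2_cong_AE[OF K(1) part_measurable(1)[OF L2_measurable[OF l(1)]] Kl])
  with lH(1) have lQ: "l \<in> Q" unfolding form_domain_iff by simp
  have "B (u n - l) (u n - l) = (L2_norm (\<lambda>x. weak_gradient (u n) x - G x))\<^sup>2
     + (L2_norm (\<lambda>x. plus_part (u n) x - K x))\<^sup>2 + (L2_norm (\<lambda>x. u n x - l x))\<^sup>2" for n
  proof -
    have "L2_norm (\<lambda>x. weak_gradient (u n) x - weak_gradient l x) = L2_norm (\<lambda>x. weak_gradient (u n) x - G x)"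
      by (rule L2_norm_cong_AE[OF L2_measurable[OF L2_diff[OF g weak_gradient_spec(1)[OF lH(1)]]] L2_measurable[OF L2_diff[OF g G(1)]]])
        (use lH(2) in eventually_elim, simp)
    moreover have "L2_norm (\<lambda>x. plus_part (u n) x - plus_part l x) = L2_norm (\<lambda>x. plus_part (u n) x - K x)"
      by (rule L2_norm_cong_AE[OF L2_measurable[OF L2_diff[OF plus_part_L2[OF u] plus_part_L2[OF lQ]]] L2_measurable[OF L2_diff[OF plus_part_L2[OF u] K(1)]]])
        (use lK in eventually_elim, simp)
    ultimately show ?thesis unfolding B_diff[OF u lQ] by simp
  qed
  moreover have "(\<lambda>n. (L2_norm (\<lambda>x. weak_gradient (u n) x - G x))\<^sup>2
     + (L2_norm (\<lambda>x. plus_part (u n) x - K x))\<^sup>2 + (L2_norm (\<lambda>x. u n x - l x))\<^sup>2) \<longlonglongrightarrow> 0 + 0 + 0"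
    by (intro tendsto_add G(2) K(2) l(2))
  ultimately have "(\<lambda>n. B (u n - l) (u n - l)) \<longlonglongrightarrow> 0" by simp
  then show "\<exists>l\<in>Q. (\<lambda>n. B (u n - l) (u n - l)) \<longlonglongrightarrow> 0" using lQ by (intro bexI[where x=l])
qed

lemma part_forms_nonneg: "0 \<le> D u u" "0 \<le> P u u" "0 \<le> Mi u u" "0 \<le> L2_form u u"
  unfolding sq_forms L2_form_sq by simp_all

lemma semibounded: "semibounded_form L2 Q L2_form a B (\<beta> + 1) 1 (1 / (1 - \<alpha>))"
proof -
  interpret L: psd_form "L2 :: (R3 \<Rightarrow> complex) set" L2_form by (rule psd_form_L2)
  interpret a: sym_form Q a by (rule sym_a)
  interpret B: psd_form Q B by (rule psd_B)
  show ?thesis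
  proof unfold_locales
    show "Q \<subseteq> L2" using form_domain_L2 by blast
    show "complete_form Q B" by (rule complete_B)
    show "0 < 1 / (1 - \<alpha>)" using \<alpha> by simp
    fix u assume u: "u \<in> Q"
    note nn = part_forms_nonneg[of u]
    show "L2_form u u \<le> B u u" unfolding B_def using nn by simp
    show "a u u \<le> 1 * B u u" unfolding B_def a_def using nn by simp
    \<comment> \<open>As \<open>Mi\<close> is at most \<open>\<alpha> D + \<beta> p\<close>, the
      shift by \<open>\<beta>\<close> leaves \<open>(1 - \<alpha>) D + P\<close>; the additional 1
      in the shift provides the \<open>L2\<close> part of \<open>B\<close>.\<close>
    have "(1 - \<alpha>) * P u u \<le> 1 * P u u" "(1 - \<alpha>) * L2_form u u \<le> 1 * L2_form u u"
      by (rule mult_right_mono, use \<alpha> nn in simp, fact nn)+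
    then have "(1 - \<alpha>) * B u u \<le> a u u + (\<beta> + 1) * L2_form u u"
      using Mi_le[OF u] unfolding B_def a_def by (simp add: algebra_simps)
    then show "B u u \<le> 1 / (1 - \<alpha>) * (a u u + (\<beta> + 1) * L2_form u u)"
      using \<alpha> by (simp add: field_simps)
  qed
qed

sublocale S: semibounded_form L2 Q L2_form a B "\<beta> + 1" 1 "1 / (1 - \<alpha>)"
  by (rule semibounded)

end

section \<open>From sesquilinear forms to real bilinear ones\<close>

lemma inner_complex: "z \<bullet> w = Re (cnj z * w)"
  by (simp add: inner_complex_def)

lemma L2_cnj_integrable:
  fixes f h :: "R3 \<Rightarrow> complex"
  assumes f: "f \<in> L2" and h: "h \<in> L2"
  shows "integrable lebesgue (\<lambda>x. cnj (f x) * h x)"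
proof (rule L2_pairing_integrable[OF f h])
  note [measurable] = L2_measurable[OF f] L2_measurable[OF h]
  have "(\<lambda>x. cnj (f x)) \<in> borel_measurable lebesgue"
    by (rule borel_measurable_continuous_on[OF _ L2_measurable[OF f]]) (intro continuous_intros)
  then show "(\<lambda>x. cnj (f x) * h x) \<in> borel_measurable lebesgue"
    by (rule borel_measurable_times[OF _ L2_measurable[OF h]])
  show "norm (cnj (f x) * h x) \<le> norm (f x) * norm (h x)" for x by (simp add: norm_mult)
qed

lemma Re_L2_inner: "f \<in> L2 \<Longrightarrow> h \<in> L2 \<Longrightarrow> Re (L2_inner f h) = L2_form f h"
  unfolding L2_inner_def L2_form_def inner_complex
  by (rule integral_bounded_linear[OF bounded_linear_Re L2_cnj_integrable, THEN sym])

lemma L2_inner_mult_left: "L2_inner (\<lambda>x. c * f x) h = cnj c * L2_inner f h"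
proof -
  have "L2_inner (\<lambda>x. c * f x) h = (LINT x|lebesgue. cnj c * (cnj (f x) * h x))"
    unfolding L2_inner_def by (simp add: mult.assoc)
  then show ?thesis unfolding L2_inner_def by simp
qed

lemma Im_L2_inner: "f \<in> L2 \<Longrightarrow> h \<in> L2 \<Longrightarrow> Im (L2_inner f h) = L2_form (\<lambda>x. \<i> * f x) h"
  using Re_L2_inner[OF L2_mult[of f \<i>], of h] unfolding L2_inner_mult_left by simp

context schroedinger_potential
begin

lemma gradient_pairing:
  assumes "u \<in> H1" "w \<in> H1"
  shows "integrable lebesgue (\<lambda>x. \<Sum>i\<in>UNIV. cnj (weak_gradient u x $ i) * (weak_gradient w x $ i))"
    "Re (LINT x|lebesgue. (\<Sum>i\<in>UNIV. cnj (weak_gradient u x $ i) * (weak_gradient w x $ i))) = D u w"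
proof -
  show *: "integrable lebesgue (\<lambda>x. \<Sum>i\<in>UNIV. cnj (weak_gradient u x $ i) * (weak_gradient w x $ i))"
    by (intro Bochner_Integration.integrable_sum L2_cnj_integrable L2_component weak_gradient_spec(1) assms)
  have e: "Re (\<Sum>i\<in>UNIV. cnj (p $ i) * (q $ i)) = p \<bullet> q" for p q :: "complex^3"
    by (simp only: inner_vec_def inner_complex Re_sum)
  show "Re (LINT x|lebesgue. (\<Sum>i\<in>UNIV. cnj (weak_gradient u x $ i) * (weak_gradient w x $ i))) = D u w"
    unfolding D_def L2_form_def integral_bounded_linear[OF bounded_linear_Re *, THEN sym] e ..
qed

lemma potential_split:
  "of_real (V x) * (cnj (u x) * w x) = cnj (plus_part u x) * plus_part w x - cnj (minus_part u x) * minus_part w x"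
proof -
  have s: "of_real (sqrt c) * z * (of_real (sqrt c) * y) = of_real c * (z * y)" if "c \<ge> 0" for c and z y :: complex
  proof -
    have "of_real (sqrt c) * z * (of_real (sqrt c) * y) = of_real (sqrt c * sqrt c) * (z * y)" by (simp only: of_real_mult mult_ac)
    then show ?thesis using that by simp
  qed
  have "V x = max (V x) 0 - max (- V x) 0" by simp
  then have "of_real (V x) * (cnj (u x) * w x) = of_real (max (V x) 0) * (cnj (u x) * w x) - of_real (max (- V x) 0) * (cnj (u x) * w x)"
    by (metis (no_types) left_diff_distrib of_real_diff)
  then show ?thesis unfolding plus_part_def minus_part_def scaleR_conv_of_real complex_cnj_mult complex_cnj_complex_of_real
    by (subst s, simp, subst s, simp)
qed

lemma potential_pairing:
  assumes u: "u \<in> Q" and w: "w \<in> Q"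
  shows "Re (LINT x|lebesgue. of_real (V x) * (cnj (u x) * w x)) = P u w - Mi u w"
proof -
  note i1 = L2_cnj_integrable[OF plus_part_L2[OF u] plus_part_L2[OF w]]
  note i2 = L2_cnj_integrable[OF minus_part_L2[OF form_domain_H1[OF u]] minus_part_L2[OF form_domain_H1[OF w]]]
  have "(LINT x|lebesgue. of_real (V x) * (cnj (u x) * w x)) = L2_inner (plus_part u) (plus_part w) - L2_inner (minus_part u) (minus_part w)"
    unfolding potential_split L2_inner_def by (rule Bochner_Integration.integral_diff[OF i1 i2])
  then show ?thesis
    using Re_L2_inner[OF plus_part_L2[OF u] plus_part_L2[OF w]]
      Re_L2_inner[OF minus_part_L2[OF form_domain_H1[OF u]] minus_part_L2[OF form_domain_H1[OF w]]]
    unfolding P_def Mi_def by simp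
qed

lemma Re_schroedinger_form:
  assumes u: "u \<in> Q" and w: "w \<in> Q"
  shows "Re (schroedinger_form V u w) = a u w"
  unfolding schroedinger_form_def a_def
  using gradient_pairing(2)[OF form_domain_H1[OF u] form_domain_H1[OF w]] potential_pairing[OF u w] by simp

lemma schroedinger_form_i:
  assumes u: "u \<in> Q" and w: "w \<in> Q"
  shows "schroedinger_form V (\<lambda>x. \<i> * u x) w = - \<i> * schroedinger_form V u w"
proof -
  note uH = form_domain_H1[OF u] and wH = form_domain_H1[OF w]
  note iuH = H1_scale(1)[OF uH, of \<i>]
  note int1 = gradient_pairing(1)[OF iuH wH] and int2 = gradient_pairing(1)[OF uH wH]
  have "(LINT x|lebesgue. (\<Sum>i\<in>UNIV. cnj (weak_gradient (\<lambda>x. \<i> * u x) x $ i) * (weak_gradient w x $ i)))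
    = (LINT x|lebesgue. - \<i> * (\<Sum>i\<in>UNIV. cnj (weak_gradient u x $ i) * (weak_gradient w x $ i)))"
  proof (rule integral_cong_AE)
    show "AE x in lebesgue. (\<Sum>i\<in>UNIV. cnj (weak_gradient (\<lambda>x. \<i> * u x) x $ i) * (weak_gradient w x $ i))
       = - \<i> * (\<Sum>i\<in>UNIV. cnj (weak_gradient u x $ i) * (weak_gradient w x $ i))"
      using H1_scale(2)[OF uH, of \<i>]
      by eventually_elim (simp add: sum_distrib_left mult.assoc)
  qed (rule borel_measurable_integrable[OF int1], rule borel_measurable_integrable, rule integrable_mult_right[OF int2])
  moreover have "(LINT x|lebesgue. of_real (V x) * (cnj (\<i> * u x) * w x)) = (LINT x|lebesgue. - \<i> * (of_real (V x) * (cnj (u x) * w x)))"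
    by (rule Bochner_Integration.integral_cong) (simp_all add: algebra_simps)
  ultimately show ?thesis unfolding schroedinger_form_def integral_mult_right_zero by (simp add: algebra_simps)
qed

text \<open>A complex identity for all \<open>\<phi>\<close> follows from its real part, because
  \<open>\<i> \<phi>\<close> is an admissible test function as well and exposes the imaginary
  part.\<close>

lemma schroedinger_op_iff:
  "(u, w) \<in> schroedinger_op V \<longleftrightarrow> u \<in> Q \<and> w \<in> L2 \<and> (\<forall>\<phi>\<in>Q. a \<phi> u = L2_form \<phi> w)"
proof (cases "u \<in> Q \<and> w \<in> L2")
  case True
  then have u: "u \<in> Q" and w: "w \<in> L2" by auto
  have re: "Re (schroedinger_form V \<phi> u) = a \<phi> u" "Re (L2_inner \<phi> w) = L2_form \<phi> w" if "\<phi> \<in> Q" for \<phi>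
    using Re_schroedinger_form[OF that u] Re_L2_inner[OF form_domain_L2[OF that] w] by auto
  have im: "Im (schroedinger_form V \<phi> u) = a (\<lambda>x. \<i> * \<phi> x) u" "Im (L2_inner \<phi> w) = L2_form (\<lambda>x. \<i> * \<phi> x) w" if "\<phi> \<in> Q" for \<phi>
    using re[OF form_domain_scale[OF that, of \<i>]] Im_L2_inner[OF form_domain_L2[OF that] w]
    unfolding schroedinger_form_i[OF that u] by auto
  have "(\<forall>\<phi>\<in>Q. schroedinger_form V \<phi> u = L2_inner \<phi> w) \<longleftrightarrow> (\<forall>\<phi>\<in>Q. a \<phi> u = L2_form \<phi> w)"
  proof (intro iffI ballI)
    fix \<phi> assume "\<forall>\<phi>\<in>Q. schroedinger_form V \<phi> u = L2_inner \<phi> w" and \<phi>: "\<phi> \<in> Q"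
    then have "schroedinger_form V \<phi> u = L2_inner \<phi> w" by simp
    then show "a \<phi> u = L2_form \<phi> w" using re[OF \<phi>] by simp
  next
    fix \<phi> assume *: "\<forall>\<phi>\<in>Q. a \<phi> u = L2_form \<phi> w" and \<phi>: "\<phi> \<in> Q"
    have "a \<phi> u = L2_form \<phi> w" "a (\<lambda>x. \<i> * \<phi> x) u = L2_form (\<lambda>x. \<i> * \<phi> x) w"
      using bspec[OF * \<phi>] bspec[OF * form_domain_scale[OF \<phi>, of \<i>]] by auto
    then show "schroedinger_form V \<phi> u = L2_inner \<phi> w"
      by (intro complex_eqI) (simp_all only: re[OF \<phi>] im[OF \<phi>])
  qed
  then show ?thesis unfolding schroedinger_op_def using True by simp
next
  case False
  then show ?thesis unfolding schroedinger_op_def by auto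
qed

lemma L2_shift: "u \<in> Q \<Longrightarrow> h \<in> L2 \<Longrightarrow> (\<lambda>x. h x + of_real e * u x) \<in> L2"
  by (rule L2_add[OF _ L2_mult[OF form_domain_L2]])

lemma weak_solution_iff:
  "S.weak_solution e u h \<longleftrightarrow> h \<in> L2 \<and> (u, \<lambda>x. h x + of_real e * u x) \<in> schroedinger_op V"
proof (cases "u \<in> Q \<and> h \<in> L2")
  case True
  then have u: "u \<in> Q" and h: "h \<in> L2" by auto
  have "h + e *\<^sub>R u = (\<lambda>x. h x + of_real e * u x)" by (rule ext) (simp add: scaleR_conv_of_real)
  then have "L2_form \<phi> (\<lambda>x. h x + of_real e * u x) = L2_form \<phi> h + e * L2_form \<phi> u" if "\<phi> \<in> Q" for \<phi>
    using S.L.add_right[of h "e *\<^sub>R u" \<phi>] S.L.scale_right[of \<phi> u e] h form_domain_L2[OF u] form_domain_L2[OF that]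
      S.L.scale_closed[of u e] by simp
  then have "(\<forall>\<phi>\<in>Q. a \<phi> u = L2_form \<phi> (\<lambda>x. h x + of_real e * u x)) \<longleftrightarrow> (\<forall>\<phi>\<in>Q. a \<phi> u - e * L2_form \<phi> u = L2_form \<phi> h)"
    by (intro ball_cong refl) (simp add: algebra_simps)
  with u h L2_shift[OF u h, of e] show ?thesis unfolding schroedinger_op_iff S.weak_solution_def by simp
next
  case False
  then show ?thesis unfolding schroedinger_op_iff S.weak_solution_def by auto
qed

lemma schroedinger_op_solution:
  assumes op: "(u, w) \<in> schroedinger_op V" and h: "h \<in> L2"
    and eq: "AE x in lebesgue. w x - of_real e * u x = h x"
  shows "S.weak_solution e u h"
proof -
  from op have u: "u \<in> Q" and w: "w \<in> L2" and a: "\<forall>\<phi>\<in>Q. a \<phi> u = L2_form \<phi> w"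
    unfolding schroedinger_op_iff by auto
  have "L2_form \<phi> w = L2_form \<phi> (\<lambda>x. h x + of_real e * u x)" if "\<phi> \<in> Q" for \<phi>
  proof (rule L2_form_cong_AE[OF form_domain_L2[OF that] w form_domain_L2[OF that] L2_shift[OF u h]])
    show "AE x in lebesgue. w x = h x + of_real e * u x" using eq by eventually_elim (simp add: algebra_simps)
  qed simp
  with a have "\<forall>\<phi>\<in>Q. a \<phi> u = L2_form \<phi> (\<lambda>x. h x + of_real e * u x)" by simp
  then show ?thesis unfolding weak_solution_iff schroedinger_op_iff using u h L2_shift[OF u h, of e] by simp
qed

text \<open>Bridges the operator picture and the form picture at real points, which is where the
  ground energy and the isolation of the eigenvalue are read off. The operator graph consists of
  functions while the resolvent equation holds almost everywhere, so the image \<open>w\<close> is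
  first replaced by \<open>h + e u\<close>.\<close>

lemma resolvent_iff: "complex_of_real e \<in> resolvent_set V \<longleftrightarrow> S.regular e"
proof
  assume "complex_of_real e \<in> resolvent_set V"
  then have sol: "\<forall>h\<in>L2. \<exists>(u, w)\<in>schroedinger_op V. AE x in lebesgue. w x - of_real e * u x = h x"
    and "\<exists>C. \<forall>(u, w)\<in>schroedinger_op V. L2_norm u \<le> C * L2_norm (\<lambda>x. w x - of_real e * u x)"
    unfolding resolvent_set_def by simp_all
  then obtain C where C: "\<forall>(u, w)\<in>schroedinger_op V. L2_norm u \<le> C * L2_norm (\<lambda>x. w x - of_real e * u x)" by blast
  show "S.regular e" unfolding S.regular_def
  proof (intro conjI ballI exI[of _ "C\<^sup>2"] allI impI)
    fix h :: "R3 \<Rightarrow> complex" assume h: "h \<in> L2"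
    with sol obtain u w where "(u, w) \<in> schroedinger_op V" "AE x in lebesgue. w x - of_real e * u x = h x" by blast
    from schroedinger_op_solution[OF this(1) h this(2)] show "\<exists>u. S.weak_solution e u h" by blast
  next
    fix u h assume "S.weak_solution e u h"
    then have "(u, \<lambda>x. h x + of_real e * u x) \<in> schroedinger_op V" unfolding weak_solution_iff by blast
    from bspec[OF C this] have "L2_norm u \<le> C * L2_norm h" by simp
    from power_mono[OF this L2_norm_nonneg, of 2] show "L2_form u u \<le> C\<^sup>2 * L2_form h h"
      unfolding L2_form_sq by (simp add: power_mult_distrib)
  qed
next
  assume reg: "S.regular e"
  obtain C where C: "C > 0" "\<forall>u h. S.weak_solution e u h \<longrightarrow> L2_form u u \<le> C * L2_form h h"
    using S.regularE[OF reg] by blast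
  have sol: "\<exists>(u, w)\<in>schroedinger_op V. AE x in lebesgue. w x - of_real e * u x = h x" if "h \<in> L2" for h
  proof -
    from that reg obtain u where "S.weak_solution e u h" unfolding S.regular_def by blast
    then have "(u, \<lambda>x. h x + of_real e * u x) \<in> schroedinger_op V" unfolding weak_solution_iff by blast
    then show ?thesis by (intro bexI[where x="(u, \<lambda>x. h x + of_real e * u x)"]) simp_all
  qed
  have "L2_norm u \<le> sqrt C * L2_norm (\<lambda>x. w x - of_real e * u x)" if "(u, w) \<in> schroedinger_op V" for u w
  proof -
    from that have u: "u \<in> L2" and w: "w \<in> L2" unfolding schroedinger_op_iff using form_domain_L2 by auto
    then have h: "(\<lambda>x. w x - of_real e * u x) \<in> L2" by (intro L2_diff L2_mult)
    have "S.weak_solution e u (\<lambda>x. w x - of_real e * u x)" by (rule schroedinger_op_solution[OF that h]) simp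
    with C(2) have "(L2_norm u)\<^sup>2 \<le> C * (L2_norm (\<lambda>x. w x - of_real e * u x))\<^sup>2" unfolding L2_form_sq by blast
    then have "sqrt ((L2_norm u)\<^sup>2) \<le> sqrt (C * (L2_norm (\<lambda>x. w x - of_real e * u x))\<^sup>2)" by (rule real_sqrt_le_mono)
    then show ?thesis by (simp add: real_sqrt_mult)
  qed
  then have "\<forall>(u, w)\<in>schroedinger_op V. L2_norm u \<le> sqrt C * L2_norm (\<lambda>x. w x - of_real e * u x)"
    by (intro ballI) (simp only: case_prod_unfold prod.collapse)
  then have "\<exists>C. \<forall>(u, w)\<in>schroedinger_op V. L2_norm u \<le> C * L2_norm (\<lambda>x. w x - of_real e * u x)"
    by (rule exI)
  with sol show "complex_of_real e \<in> resolvent_set V" unfolding resolvent_set_def by simp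
qed

lemma ground_energy_eq: "ground_energy V = Inf {e. \<not> S.regular e}"
  unfolding ground_energy_def spectrum_def Compl_iff resolvent_iff ..

lemma form_mult_kernel:
  assumes u: "u \<in> Q" and w: "w \<in> L2"
  shows "L2_form (\<lambda>x. c * u x) w = Re c * L2_form u w + Im c * L2_form (\<lambda>x. \<i> * u x) w"
proof -
  have "L2_form (\<lambda>x. c * u x) w = Re (cnj c * L2_inner u w)"
    using Re_L2_inner[OF L2_mult[OF form_domain_L2[OF u]] w, of c] unfolding L2_inner_mult_left by simp
  then show ?thesis
    using Re_L2_inner[OF form_domain_L2[OF u] w] Im_L2_inner[OF form_domain_L2[OF u] w] by simp
qed

text \<open>The forms are real bilinear, so the complex line spanned by the ground state \<open>e1\<close> is the real span of
  \<open>e1\<close> and \<open>\<i> e1\<close>.\<close>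

lemma ground_state_gap:
  assumes simple: "simple_eigenvalue V (ground_energy V)" and isolated: "isolated_in_spectrum V (ground_energy V)"
    and state: "positive_ground_state V uV"
  defines "e1 \<equiv> \<lambda>x. complex_of_real (uV x)" and "A \<equiv> \<lambda>u w. a u w - ground_energy V * L2_form u w"
  shows "\<exists>c>0. gapped_form Q L2_form A B e1 (\<lambda>x. \<i> * e1 x) c (1 + \<bar>ground_energy V\<bar>)"
proof -
  define \<mu> where "\<mu> = ground_energy V"
  have eig: "e1 \<in> eigenfunctions V \<mu>" and uV: "uV \<in> L2" "L2_norm uV = 1"
    using state unfolding positive_ground_state_def e1_def \<mu>_def by auto
  then have op1: "(e1, \<lambda>x. of_real \<mu> * e1 x) \<in> schroedinger_op V" and ne1: "\<not> (AE x in lebesgue. e1 x = 0)"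
    unfolding eigenfunctions_def by auto
  have e1: "e1 \<in> Q" using op1 unfolding schroedinger_op_iff by blast
  have e1L: "e1 \<in> L2" by (rule form_domain_L2[OF e1])
  have n1: "L2_form e1 e1 = 1" unfolding L2_form_sq using uV(2) unfolding e1_def L2_norm_def by simp
  have \<mu>p: "L2_form \<phi> (\<lambda>x. of_real \<mu> * u x) = \<mu> * L2_form \<phi> u" for \<phi> u
    unfolding L2_form_def scaleR_conv_of_real[THEN sym] by simp
  have "L2_form e1 e1 > 0" using n1 by simp
  note sing = S.Inf_singular[OF e1 this]
  have bound: "\<mu> * L2_form u u \<le> a u u" if "u \<in> Q" for u
    using sing(2)[OF that] unfolding \<mu>_def ground_energy_eq by simp
  from isolated obtain \<delta> where \<delta>: "\<delta> > 0" "spectrum V \<inter> ball (of_real \<mu>) \<delta> = {of_real \<mu>}"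
    unfolding isolated_in_spectrum_def \<mu>_def by blast
  have reg: "S.regular e" if "e \<noteq> \<mu>" "\<bar>e - \<mu>\<bar> < 2 * (\<delta> / 2)" for e
  proof -
    have "dist (complex_of_real \<mu>) (of_real e) = \<bar>e - \<mu>\<bar>"
      unfolding dist_norm of_real_diff[THEN sym] norm_of_real by simp
    then have "complex_of_real e \<in> ball (of_real \<mu>) \<delta>" using that(2) by simp
    moreover have "complex_of_real e \<noteq> of_real \<mu>" using that(1) by simp
    ultimately have "complex_of_real e \<notin> spectrum V" using \<delta>(2) by blast
    then show ?thesis unfolding spectrum_def Compl_iff resolvent_iff by simp
  qed
  from simple obtain u0 where u0: "\<forall>u'\<in>eigenfunctions V \<mu>. \<exists>c. AE x in lebesgue. u' x = c * u0 x"
    unfolding simple_eigenvalue_def \<mu>_def by blast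
  \<comment> \<open>Simplicity refers to some eigenfunction \<open>u0\<close>. As \<open>e1\<close>
    is a nonzero multiple of it, every eigenfunction is a multiple of \<open>e1\<close>.\<close>
  obtain c1 where c1: "AE x in lebesgue. e1 x = c1 * u0 x" using u0 eig by blast
  have "c1 \<noteq> 0"
  proof
    assume "c1 = 0"
    with c1 have "AE x in lebesgue. e1 x = 0" by simp
    with ne1 show False by blast
  qed
  \<comment> \<open>The constant of \<open>spectral_gap\<close> for \<open>d = \<delta> / 2\<close>:
    the isolating ball of radius \<open>\<delta>\<close> is its interval of half-length
    \<open>2 * d\<close>.\<close>
  define \<gamma> where "\<gamma> = 4 * (\<delta> / 2) / 5"
  have "\<gamma> > 0" using \<delta>(1) unfolding \<gamma>_def by simp
  have gap: "\<gamma> * L2_form w w \<le> A w w" if w: "w \<in> Q" "L2_form e1 w = 0" "L2_form (\<lambda>x. \<i> * e1 x) w = 0" for w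
  proof -
    have wL: "w \<in> L2" by (rule form_domain_L2[OF w(1)])
    \<comment> \<open>Real orthogonality to \<open>e1\<close> and to \<open>\<i> e1\<close> is
      orthogonality to every complex multiple of \<open>e1\<close>, and up to null sets these
      multiples exhaust the eigenspace.\<close>
    have "L2_form u w = 0" if u: "u \<in> Q" "\<And>\<phi>. \<phi> \<in> Q \<Longrightarrow> a \<phi> u = \<mu> * L2_form \<phi> u" for u
    proof -
      have uL: "u \<in> L2" by (rule form_domain_L2[OF u(1)])
      have "\<exists>c. AE x in lebesgue. u x = c * e1 x"
      proof (cases "AE x in lebesgue. u x = 0")
        case True
        then have "AE x in lebesgue. u x = 0 * e1 x" by simp
        then show ?thesis by (rule exI)
      next
        case False
        have "\<forall>\<phi>\<in>Q. a \<phi> u = \<mu> * L2_form \<phi> u" by (rule ballI) (rule u(2))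
        then have "(u, \<lambda>x. of_real \<mu> * u x) \<in> schroedinger_op V"
          unfolding schroedinger_op_iff \<mu>p by (intro conjI u(1) L2_mult[OF uL])
        with False have "u \<in> eigenfunctions V \<mu>" unfolding eigenfunctions_def mem_Collect_eq by (rule conjI[rotated])
        from bspec[OF u0 this] obtain c2 where c2: "AE x in lebesgue. u x = c2 * u0 x" by (rule exE)
        have "AE x in lebesgue. u x = (c2 / c1) * e1 x"
          using c1 c2 by eventually_elim (use \<open>c1 \<noteq> 0\<close> in simp)
        then show ?thesis by (rule exI)
      qed
      then obtain c where c: "AE x in lebesgue. u x = c * e1 x" by (rule exE)
      have "L2_form u w = L2_form (\<lambda>x. c * e1 x) w"
        by (rule L2_form_cong_AE[OF uL wL L2_mult[OF e1L] wL c]) simp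
      also have "\<dots> = 0" using form_mult_kernel[OF e1 wL, of c] w by simp
      finally show ?thesis .
    qed
    note kernel = this
    have "4 * (\<delta> / 2) / 5 * L2_form w w \<le> a w w - \<mu> * L2_form w w"
    proof (rule S.spectral_gap[where \<mu>=\<mu> and d="\<delta> / 2" and w=w])
      show "\<mu> * L2_form u u \<le> a u u" if "u \<in> Q" for u by (rule bound[OF that])
      show "\<delta> / 2 > 0" using \<delta>(1) by simp
      show "S.regular e" if "e \<noteq> \<mu>" "\<bar>e - \<mu>\<bar> < 2 * (\<delta> / 2)" for e by (rule reg[OF that])
      show "w \<in> Q" by (rule w(1))
      show "L2_form u w = 0" if u: "u \<in> Q" "\<And>\<phi>. \<phi> \<in> Q \<Longrightarrow> a \<phi> u = \<mu> * L2_form \<phi> u" for u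
        by (rule kernel[OF u(1)]) (rule u(2))
    qed
    then show ?thesis by (simp only: \<gamma>_def A_def \<mu>_def)
  qed
  define K where "K = 1 / (1 - \<alpha>)"
  have K: "K > 0" using \<alpha> unfolding K_def by simp
  \<comment> \<open>Upgrades the gap from \<open>L2\<close> norm to form norm: in the coercivity
    estimate \<open>a\<close> is written as \<open>A + \<mu> p\<close>, and then \<open>p\<close> is
    replaced by \<open>A / \<gamma>\<close>.\<close>
  define c where "c = 1 / (K * (1 + \<bar>\<beta> + 1 + \<mu>\<bar> / \<gamma>))"
  have den: "1 + \<bar>\<beta> + 1 + \<mu>\<bar> / \<gamma> > 0" using \<open>\<gamma> > 0\<close> by (intro add_pos_nonneg) simp_all
  have "c > 0" unfolding c_def using K den by simp
  interpret A: psd_form Q A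
    unfolding A_def \<mu>_def[THEN sym] by (rule S.shifted_psd[OF bound])
  have Ap: "a u u = A u u + \<mu> * L2_form u u" for u unfolding A_def \<mu>_def by simp
  have "gapped_form Q L2_form A B e1 (\<lambda>x. \<i> * e1 x) c (1 + \<bar>\<mu>\<bar>)"
  proof unfold_locales
    show "complete_form Q B" by (rule complete_B)
    show "e1 \<in> Q" "(\<lambda>x. \<i> * e1 x) \<in> Q" using e1 form_domain_scale[OF e1] by auto
    show "L2_form e1 e1 = 1" by (rule n1)
    have "z \<bullet> (\<i> * z) = 0" for z by (simp add: inner_complex_def)
    then show "L2_form e1 (\<lambda>x. \<i> * e1 x) = 0" unfolding L2_form_def by simp
    have "a e1 e1 = \<mu> * L2_form e1 e1" using op1 e1 unfolding schroedinger_op_iff \<mu>p by blast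
    then show "A e1 e1 = 0" unfolding Ap by simp
    show "c > 0" by fact
    show "0 \<le> 1 + \<bar>\<mu>\<bar>" by simp
    fix u assume u: "u \<in> Q"
    show pB: "L2_form u u \<le> B u u" by (rule S.p_le[OF u])
    have "- (\<mu> * L2_form u u) \<le> \<bar>\<mu>\<bar> * L2_form u u"
      using mult_right_mono[of "- \<mu>" "\<bar>\<mu>\<bar>" "L2_form u u"] part_forms_nonneg(4) by simp
    also have "\<dots> \<le> \<bar>\<mu>\<bar> * B u u" using pB by (intro mult_left_mono) simp_all
    finally show "A u u \<le> (1 + \<bar>\<mu>\<bar>) * B u u" using S.a_le[OF u] Ap[of u] by (simp add: algebra_simps)
    assume o: "L2_form e1 u = 0" "L2_form (\<lambda>x. \<i> * e1 x) u = 0"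
    have "(\<beta> + 1 + \<mu>) * L2_form u u \<le> \<bar>\<beta> + 1 + \<mu>\<bar> * L2_form u u"
      using part_forms_nonneg(4) by (intro mult_right_mono) simp_all
    also have "\<dots> \<le> \<bar>\<beta> + 1 + \<mu>\<bar> * (A u u / \<gamma>)"
      using gap[OF u o] \<open>\<gamma> > 0\<close> by (intro mult_left_mono) (simp_all add: field_simps)
    finally have "a u u + (\<beta> + 1) * L2_form u u \<le> (1 + \<bar>\<beta> + 1 + \<mu>\<bar> / \<gamma>) * A u u"
      unfolding Ap by (simp add: algebra_simps)
    then have "K * (a u u + (\<beta> + 1) * L2_form u u) \<le> K * ((1 + \<bar>\<beta> + 1 + \<mu>\<bar> / \<gamma>) * A u u)"
      using K by (intro mult_left_mono) simp_all
    then have "B u u \<le> K * (1 + \<bar>\<beta> + 1 + \<mu>\<bar> / \<gamma>) * A u u"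
      using S.coercive[OF u] unfolding K_def[THEN sym] by (simp only: mult.assoc)
    then have "B u u / (K * (1 + \<bar>\<beta> + 1 + \<mu>\<bar> / \<gamma>)) \<le> A u u"
      using pos_divide_le_eq[OF mult_pos_pos[OF K den], of "B u u" "A u u"] by (simp only: mult.commute)
    then show "c * B u u \<le> A u u" unfolding c_def by simp
  qed
  with \<open>c > 0\<close> show ?thesis unfolding \<mu>_def by blast
qed

end

section \<open>The particle-field coupling\<close>

lemma Fourier_cong_AE:
  assumes "\<rho> \<in> borel_measurable lebesgue" "\<rho>' \<in> borel_measurable lebesgue" "AE x in lebesgue. \<rho> x = \<rho>' x"
  shows "Fourier \<rho> k = Fourier \<rho>' k"
  unfolding Fourier_def
proof (rule integral_cong_AE)
  note [measurable] = assms(1,2)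
  have [measurable]: "(\<lambda>x. exp (\<i> * complex_of_real (k \<bullet> x))) \<in> borel_measurable lebesgue"
    by (rule borel_imp_lebesgue) measurable
  show "(\<lambda>x. exp (\<i> * of_real (k \<bullet> x)) * of_real (\<rho> x) :: complex) \<in> borel_measurable lebesgue"
    "(\<lambda>x. exp (\<i> * of_real (k \<bullet> x)) * of_real (\<rho>' x) :: complex) \<in> borel_measurable lebesgue"
    by measurable
  show "AE x in lebesgue. exp (\<i> * of_real (k \<bullet> x)) * of_real (\<rho> x) = (exp (\<i> * of_real (k \<bullet> x)) * of_real (\<rho>' x) :: complex)"
    using assms(3) by eventually_elim simp
qed

lemma Fourier_measurable:
  assumes "\<rho> \<in> borel_measurable lebesgue"
  shows "Fourier \<rho> \<in> borel_measurable borel"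
proof -
  obtain \<rho>' where \<rho>': "\<rho>' \<in> borel_measurable borel" and eq: "AE x in lebesgue. \<rho> x = \<rho>' x"
    using lebesgue_borel_representative[OF assms] by blast
  have "Fourier \<rho> = Fourier \<rho>'"
    by (rule ext, rule Fourier_cong_AE[OF assms borel_imp_lebesgue[OF \<rho>'] eq])
  with Fourier_borel_measurable[OF \<rho>'] show ?thesis by simp
qed

lemma Bessel_lebesgue:
  assumes \<rho>: "integrable lebesgue \<rho>"
  shows "(\<integral>\<^sup>+k. ennreal ((norm (Fourier \<rho> k))\<^sup>2) \<partial>lebesgue) \<le> ennreal ((2 * pi) ^ 3) * (\<integral>\<^sup>+x. ennreal ((\<rho> x)\<^sup>2) \<partial>lebesgue)"
proof -
  note m = borel_measurable_integrable[OF \<rho>]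
  obtain \<rho>' where \<rho>': "\<rho>' \<in> borel_measurable borel" and eq: "AE x in lebesgue. \<rho> x = \<rho>' x"
    using lebesgue_borel_representative[OF m] by blast
  have "integrable lebesgue \<rho>'"
    using integrable_cong_AE[OF m borel_imp_lebesgue[OF \<rho>'] eq] \<rho> by simp
  then have int: "integrable lborel \<rho>'" using integrable_completion[of \<rho>' lborel] \<rho>' by simp
  have F: "Fourier \<rho> = Fourier \<rho>'"
    by (rule ext, rule Fourier_cong_AE[OF m borel_imp_lebesgue[OF \<rho>'] eq])
  have "(\<integral>\<^sup>+x. ennreal ((\<rho> x)\<^sup>2) \<partial>lebesgue) = (\<integral>\<^sup>+x. ennreal ((\<rho>' x)\<^sup>2) \<partial>lebesgue)"
    by (rule nn_integral_cong_AE) (use eq in eventually_elim, simp)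
  then show ?thesis using Bessel_inequality[OF \<rho>' int] unfolding F nn_integral_completion by simp
qed

lemma has_weak_gradient_cong_AE:
  assumes "has_weak_gradient u G" "u \<in> L2" "G \<in> L2" "u' \<in> L2" "G' \<in> L2"
    and "AE x in lebesgue. u x = u' x" "AE x in lebesgue. G x = G' x"
  shows "has_weak_gradient u' G'"
  unfolding has_weak_gradient_def
proof (intro ballI allI)
  fix \<phi> :: "R3 \<Rightarrow> real" and i :: 3
  assume \<phi>: "\<phi> \<in> test_functions"
  note \<phi>L = test_function_L2[OF \<phi>] and dL = test_function_L2[OF test_function_partial[OF \<phi>]]
  have 1: "(LINT x|lebesgue. partial_deriv i \<phi> x *\<^sub>R u x) = (LINT x|lebesgue. partial_deriv i \<phi> x *\<^sub>R u' x)"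
    by (rule integral_cong_AE[OF borel_measurable_integrable[OF L2_scaleR_integrable[OF dL assms(2)]]
        borel_measurable_integrable[OF L2_scaleR_integrable[OF dL assms(4)]]])
      (use assms(6) in eventually_elim, simp)
  have 2: "(LINT x|lebesgue. \<phi> x *\<^sub>R (G x $ i)) = (LINT x|lebesgue. \<phi> x *\<^sub>R (G' x $ i))"
    by (rule integral_cong_AE[OF borel_measurable_integrable[OF L2_scaleR_integrable[OF \<phi>L L2_component[OF assms(3)]]]
        borel_measurable_integrable[OF L2_scaleR_integrable[OF \<phi>L L2_component[OF assms(5)]]]])
      (use assms(7) in eventually_elim, simp)
  show "(LINT x|lebesgue. partial_deriv i \<phi> x *\<^sub>R u' x) = - (LINT x|lebesgue. \<phi> x *\<^sub>R (G' x $ i))"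
    using has_weak_gradientD[OF assms(1) \<phi>, of i] unfolding 1 2 .
qed

lemma H1_L4_bound:
  assumes u: "u \<in> H1" and r: "r > 0"
  shows "(\<integral>\<^sup>+x. ennreal ((norm (u x)) ^ 4) \<partial>lebesgue)
    \<le> ennreal ((8 * ((L2_norm u)\<^sup>2)\<^sup>2 + 8 * ((12 * r) ^ 4 * ((L2_norm (weak_gradient u))\<^sup>2)\<^sup>2)) / r ^ 3)"
proof -
  define G where "G = weak_gradient u"
  note uL = H1_L2[OF u] and GL = weak_gradient_spec(1)[OF u, folded G_def] and wg = weak_gradient_spec(2)[OF u, folded G_def]
  obtain u' where u': "u' \<in> borel_measurable borel" and equ: "AE x in lebesgue. u x = u' x"
    using lebesgue_borel_representative[OF L2_measurable[OF uL]] by blast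
  obtain G' where G': "G' \<in> borel_measurable borel" and eqG: "AE x in lebesgue. G x = G' x"
    using lebesgue_borel_representative[OF L2_measurable[OF GL]] by blast
  note uL' = L2_cong_AE[OF uL borel_imp_lebesgue[OF u'] equ] and GL' = L2_cong_AE[OF GL borel_imp_lebesgue[OF G'] eqG]
  have wg': "has_weak_gradient u' G'" by (rule has_weak_gradient_cong_AE[OF wg uL GL uL' GL' equ eqG])
  define X where "X = 8 * ((L2_norm u)\<^sup>2)\<^sup>2 + 8 * ((12 * r) ^ 4 * ((L2_norm G)\<^sup>2)\<^sup>2)"
  define I where "I = (\<integral>\<^sup>+x. ennreal ((norm (u x)) ^ 4) \<partial>lebesgue)"
  have nu: "L2_norm u' = L2_norm u" "L2_norm G' = L2_norm G"
    using L2_norm_cong_AE[OF L2_measurable[OF uL] L2_measurable[OF uL'] equ]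
      L2_norm_cong_AE[OF L2_measurable[OF GL] L2_measurable[OF GL'] eqG] by auto
  have "I = (\<integral>\<^sup>+x. ennreal ((norm (u' x)) ^ 4) \<partial>lebesgue)"
    unfolding I_def by (rule nn_integral_cong_AE) (use equ in eventually_elim, simp)
  then have I: "I = (\<integral>\<^sup>+x. ennreal (norm (u' x)) ^ 4 \<partial>lborel)"
    unfolding nn_integral_completion by (simp add: ennreal_power)
  have "8 * (ennreal ((L2_norm u)\<^sup>2))\<^sup>2 + 8 * (ennreal (12 * r) ^ 4 * (ennreal ((L2_norm G)\<^sup>2))\<^sup>2) = ennreal X"
  proof -
    have e8: "(8::ennreal) = ennreal 8" by simp
    have "8 * ennreal a + 8 * (ennreal b * ennreal c) = ennreal (8 * a + 8 * (b * c))" if "a \<ge> 0" "b \<ge> 0" "c \<ge> 0" for a b c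
      unfolding e8 using that by (simp add: ennreal_mult ennreal_plus del: ennreal_numeral)
    moreover have "12 * r \<ge> 0" using r by simp
    ultimately show ?thesis unfolding X_def by (simp only: ennreal_power zero_le_power2 zero_le_power)
  qed
  with L4_bound[OF u' G' uL' GL' wg' r] have L: "ennreal (r ^ 3) * I \<le> ennreal X" unfolding I nu by simp
  have "I = ennreal (1 / r ^ 3) * (ennreal (r ^ 3) * I)"
    unfolding mult.assoc[THEN sym] using r by (simp add: ennreal_mult'[THEN sym])
  also have "\<dots> \<le> ennreal (1 / r ^ 3) * ennreal X" by (rule mult_left_mono[OF L]) simp
  also have "\<dots> = ennreal (X / r ^ 3)" using r by (simp add: ennreal_mult'[THEN sym])
  finally show ?thesis unfolding I_def X_def G_def .
qed

lemma L2_norm_of_norm: "L2_norm (\<lambda>x. norm (f x)) = L2_norm f"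
  unfolding L2_norm_def by simp

lemma L2_norm_fun: "f \<in> L2 \<Longrightarrow> (\<lambda>x. norm (f x)) \<in> L2"
  unfolding L2_def by (auto intro: borel_measurable_norm)

lemma Fourier_density_bound:
  fixes u w :: "R3 \<Rightarrow> 'a::euclidean_space"
  assumes u: "u \<in> L2" and w: "w \<in> L2"
  shows "norm (Fourier (\<lambda>x. u x \<bullet> w x) k) \<le> L2_norm u * L2_norm w"
proof -
  note int = L2_form_integrable[OF u w]
  note nu = L2_norm_fun[OF u] and nw = L2_norm_fun[OF w]
  have i2: "integrable lebesgue (\<lambda>x. norm (u x) *\<^sub>R norm (w x))" by (rule L2_scaleR_integrable[OF nu nw])
  have "norm (Fourier (\<lambda>x. u x \<bullet> w x) k) \<le> (LINT x|lebesgue. \<bar>u x \<bullet> w x\<bar>)" by (rule Fourier_norm_le[OF int])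
  also have "\<dots> \<le> (LINT x|lebesgue. norm (u x) *\<^sub>R norm (w x))"
    by (rule integral_mono[OF integrable_abs[OF int] i2]) (simp add: Cauchy_Schwarz_ineq2)
  also have "\<dots> \<le> L2_norm u * L2_norm w"
    using L2_norm_scaleR_integral_le[OF nu nw] unfolding L2_norm_of_norm by simp
  finally show ?thesis .
qed

lemma density_sq_bound:
  fixes u w :: "R3 \<Rightarrow> 'a::euclidean_space"
  assumes u: "u \<in> L2" and w: "w \<in> L2" and K: "Ku \<ge> 0" "Kw \<ge> 0"
    and u4: "(\<integral>\<^sup>+x. ennreal ((norm (u x)) ^ 4) \<partial>lebesgue) \<le> ennreal (Ku\<^sup>2)"
    and w4: "(\<integral>\<^sup>+x. ennreal ((norm (w x)) ^ 4) \<partial>lebesgue) \<le> ennreal (Kw\<^sup>2)"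
  shows "(\<integral>\<^sup>+x. ennreal ((u x \<bullet> w x)\<^sup>2) \<partial>lebesgue) \<le> ennreal (Ku * Kw)"
proof -
  define X where "X = (\<integral>\<^sup>+x. ennreal ((norm (u x))\<^sup>2) * ennreal ((norm (w x))\<^sup>2) \<partial>lebesgue)"
  note [measurable] = L2_measurable[OF u] L2_measurable[OF w]
  have sq: "(ennreal ((norm z)\<^sup>2))\<^sup>2 = ennreal ((norm z) ^ 4)" for z :: 'a
    by (simp add: ennreal_power power_mult[THEN sym])
  have "X\<^sup>2 \<le> (\<integral>\<^sup>+x. (ennreal ((norm (u x))\<^sup>2))\<^sup>2 \<partial>lebesgue) * (\<integral>\<^sup>+x. (ennreal ((norm (w x))\<^sup>2))\<^sup>2 \<partial>lebesgue)"
    unfolding X_def by (rule Cauchy_Schwarz_nn_integral) measurable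
  also have "\<dots> \<le> ennreal (Ku\<^sup>2) * ennreal (Kw\<^sup>2)" unfolding sq by (intro mult_mono u4 w4) simp_all
  also have "\<dots> = ennreal ((Ku * Kw)\<^sup>2)" by (simp add: ennreal_mult'[THEN sym] power_mult_distrib)
  finally have X2: "X\<^sup>2 \<le> ennreal ((Ku * Kw)\<^sup>2)" .
  have "X \<le> ennreal (Ku * Kw)"
  proof (cases X)
    case (real x)
    with X2 have "ennreal (x\<^sup>2) \<le> ennreal ((Ku * Kw)\<^sup>2)" by (simp add: ennreal_power)
    then have "x\<^sup>2 \<le> (Ku * Kw)\<^sup>2" by (subst (asm) ennreal_le_iff) simp_all
    then have "x \<le> Ku * Kw" by (rule power2_le_imp_le) (use K in simp)
    then show ?thesis unfolding real by (rule ennreal_leI)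
  next
    case top
    with X2 show ?thesis by (simp add: power2_eq_square top_unique)
  qed
  moreover have "(\<integral>\<^sup>+x. ennreal ((u x \<bullet> w x)\<^sup>2) \<partial>lebesgue) \<le> X"
    unfolding X_def
  proof (rule nn_integral_mono)
    fix x
    have "(u x \<bullet> w x)\<^sup>2 \<le> (norm (u x))\<^sup>2 * (norm (w x))\<^sup>2"
      using Cauchy_Schwarz_ineq[of "u x" "w x"] by (simp only: power2_norm_eq_inner)
    then have "ennreal ((u x \<bullet> w x)\<^sup>2) \<le> ennreal ((norm (u x))\<^sup>2 * (norm (w x))\<^sup>2)" by (rule ennreal_leI)
    then show "ennreal ((u x \<bullet> w x)\<^sup>2) \<le> ennreal ((norm (u x))\<^sup>2) * ennreal ((norm (w x))\<^sup>2)"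
      by (simp add: ennreal_mult')
  qed
  ultimately show ?thesis by (rule order_trans[rotated])
qed

text \<open>\<open>W1\<close> and the high part of \<open>W2\<close> are integrable and are paired
  with the supremum of the transform; the low part of \<open>W2\<close> is at most the cutoff and is
  paired with Bessel's inequality. The parameter \<open>s\<close> moves weight between the two and
  is left free for the diagonal estimate.\<close>

lemma weighted_Fourier_bound:
  fixes u w :: "R3 \<Rightarrow> 'a::euclidean_space" and W W1 W2 :: "R3 \<Rightarrow> real"
  assumes u: "u \<in> L2" and w: "w \<in> L2" and K: "Ku \<ge> 0" "Kw \<ge> 0"
    and u4: "(\<integral>\<^sup>+x. ennreal ((norm (u x)) ^ 4) \<partial>lebesgue) \<le> ennreal (Ku\<^sup>2)"
    and w4: "(\<integral>\<^sup>+x. ennreal ((norm (w x)) ^ 4) \<partial>lebesgue) \<le> ennreal (Kw\<^sup>2)"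
    and W12: "W1 \<in> borel_measurable lebesgue" "W2 \<in> borel_measurable lebesgue"
    and W: "AE k in lebesgue. W k = W1 k + W2 k"
    and \<eta>: "\<eta> > 0" "L1_norm W1 \<le> ennreal \<eta>" "weak_L3_norm W2 \<le> ennreal \<eta>" and s: "s > 0"
  shows "(\<integral>\<^sup>+k. ennreal (W k * (norm (Fourier (\<lambda>x. u x \<bullet> w x) k))\<^sup>2) \<partial>lebesgue)
    \<le> ennreal (\<eta> * ((1 + 8 / (3 * s\<^sup>2)) * ((L2_norm u)\<^sup>2 * (L2_norm w)\<^sup>2) + s * (2 * pi) ^ 3 * (Ku * Kw)))"
proof -
  define F where "F k = norm (Fourier (\<lambda>x. u x \<bullet> w x) k)" for k
  define P where "P = (L2_norm u)\<^sup>2 * (L2_norm w)\<^sup>2"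
  \<comment> \<open>A cutoff proportional to \<open>\<eta>\<close> makes the tail
    \<open>8 / 3 * \<eta> ^ 3 / t\<^sup>2\<close> linear in \<open>\<eta>\<close>, like the other
    two terms.\<close>
  define t where "t = \<eta> * s"
  have t: "t > 0" using \<eta>(1) s unfolding t_def by simp
  have P: "P \<ge> 0" unfolding P_def by simp
  note int = L2_form_integrable[OF u w]
  note [measurable] = W12 borel_imp_lebesgue[OF Fourier_measurable[OF borel_measurable_integrable[OF int]]]
  have [measurable]: "F \<in> borel_measurable lebesgue" unfolding F_def[abs_def] by measurable
  have set [measurable]: "{k. \<bar>W2 k\<bar> > t} \<in> sets lebesgue"
  proof -
    have "{x \<in> space lebesgue. \<bar>W2 x\<bar> > t} \<in> sets lebesgue" by measurable
    then show ?thesis by simp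
  qed
  have FP: "(F k)\<^sup>2 \<le> P" for k
    using power_mono[OF Fourier_density_bound[OF u w, of k], of 2] unfolding F_def P_def by (simp add: power_mult_distrib)
  have "(\<integral>\<^sup>+k. ennreal (W k * (F k)\<^sup>2) \<partial>lebesgue)
    \<le> (\<integral>\<^sup>+k. (ennreal P * ennreal \<bar>W1 k\<bar> + ennreal P * (ennreal \<bar>W2 k\<bar> * indicator {k. \<bar>W2 k\<bar> > t} k)) + ennreal t * ennreal ((F k)\<^sup>2) \<partial>lebesgue)"
  proof (rule nn_integral_mono_AE)
    show "AE k in lebesgue. ennreal (W k * (F k)\<^sup>2) \<le> (ennreal P * ennreal \<bar>W1 k\<bar> + ennreal P * (ennreal \<bar>W2 k\<bar> * indicator {k. \<bar>W2 k\<bar> > t} k)) + ennreal t * ennreal ((F k)\<^sup>2)"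
      using W
    proof eventually_elim
      case (elim k)
      define z where "z = (if \<bar>W2 k\<bar> > t then \<bar>W2 k\<bar> else 0)"
      have "\<bar>W1 k\<bar> * (F k)\<^sup>2 \<le> \<bar>W1 k\<bar> * P" by (rule mult_left_mono[OF FP]) simp
      moreover have "\<bar>W2 k\<bar> * (F k)\<^sup>2 \<le> z * P + t * (F k)\<^sup>2"
      proof (cases "\<bar>W2 k\<bar> > t")
        case True
        have "\<bar>W2 k\<bar> * (F k)\<^sup>2 \<le> \<bar>W2 k\<bar> * P" by (rule mult_left_mono[OF FP]) simp
        moreover have "0 \<le> t * (F k)\<^sup>2" using t by simp
        ultimately show ?thesis unfolding z_def using True by simp
      next
        case False
        have "\<bar>W2 k\<bar> * (F k)\<^sup>2 \<le> t * (F k)\<^sup>2" by (rule mult_right_mono) (use False in simp_all)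
        then show ?thesis unfolding z_def using False by simp
      qed
      moreover have "W k * (F k)\<^sup>2 \<le> \<bar>W1 k\<bar> * (F k)\<^sup>2 + \<bar>W2 k\<bar> * (F k)\<^sup>2"
        unfolding elim distrib_right[THEN sym] by (rule mult_right_mono) simp_all
      ultimately have "W k * (F k)\<^sup>2 \<le> (P * \<bar>W1 k\<bar> + P * z) + t * (F k)\<^sup>2" by (simp add: mult.commute)
      then have "ennreal (W k * (F k)\<^sup>2) \<le> ennreal ((P * \<bar>W1 k\<bar> + P * z) + t * (F k)\<^sup>2)" by (rule ennreal_leI)
      also have "\<dots> = (ennreal P * ennreal \<bar>W1 k\<bar> + ennreal P * ennreal z) + ennreal t * ennreal ((F k)\<^sup>2)"
      proof -
        have "z \<ge> 0" unfolding z_def by simp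
        then show ?thesis using P t by (simp add: ennreal_plus ennreal_mult)
      qed
      also have "ennreal z = ennreal \<bar>W2 k\<bar> * indicator {k. \<bar>W2 k\<bar> > t} k" unfolding z_def by simp
      finally show ?case .
    qed
  qed
  also have "\<dots> = (ennreal P * L1_norm W1 + ennreal P * (\<integral>\<^sup>+k. ennreal \<bar>W2 k\<bar> * indicator {k. \<bar>W2 k\<bar> > t} k \<partial>lebesgue)) + ennreal t * (\<integral>\<^sup>+k. ennreal ((F k)\<^sup>2) \<partial>lebesgue)"
    unfolding L1_norm_def by (simp add: nn_integral_add nn_integral_cmult)
  also have "\<dots> \<le> (ennreal P * ennreal \<eta> + ennreal P * ennreal (8 / 3 * \<eta> ^ 3 / t\<^sup>2)) + ennreal t * (ennreal ((2 * pi) ^ 3) * ennreal (Ku * Kw))"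
  proof (intro add_mono mult_left_mono \<eta>(2))
    show "(\<integral>\<^sup>+k. ennreal \<bar>W2 k\<bar> * indicator {k. \<bar>W2 k\<bar> > t} k \<partial>lebesgue) \<le> ennreal (8 / 3 * \<eta> ^ 3 / t\<^sup>2)"
      by (rule weak_L3_tail_integral[OF W12(2) \<eta>(3) _ t]) (use \<eta>(1) in simp)
    have "(\<integral>\<^sup>+k. ennreal ((F k)\<^sup>2) \<partial>lebesgue) \<le> ennreal ((2 * pi) ^ 3) * (\<integral>\<^sup>+x. ennreal ((u x \<bullet> w x)\<^sup>2) \<partial>lebesgue)"
      unfolding F_def by (rule Bessel_lebesgue[OF int])
    also have "\<dots> \<le> ennreal ((2 * pi) ^ 3) * ennreal (Ku * Kw)"
      by (rule mult_left_mono[OF density_sq_bound[OF u w K u4 w4]]) simp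
    finally show "(\<integral>\<^sup>+k. ennreal ((F k)\<^sup>2) \<partial>lebesgue) \<le> ennreal ((2 * pi) ^ 3) * ennreal (Ku * Kw)" .
  qed simp_all
  also have "\<dots> = ennreal ((P * \<eta> + P * (8 / 3 * \<eta> ^ 3 / t\<^sup>2)) + t * ((2 * pi) ^ 3 * (Ku * Kw)))"
  proof -
    have "(ennreal P * ennreal a + ennreal P * ennreal b) + ennreal t * (ennreal c * ennreal d)
        = ennreal ((P * a + P * b) + t * (c * d))" if "a \<ge> 0" "b \<ge> 0" "c \<ge> 0" "d \<ge> 0" for a b c d
      using that P t by (simp add: ennreal_plus ennreal_mult)
    moreover have "0 \<le> \<eta>" "0 \<le> 8 / 3 * \<eta> ^ 3 / t\<^sup>2" "0 \<le> (2 * pi) ^ 3" "0 \<le> Ku * Kw" using \<eta>(1) K by simp_all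
    ultimately show ?thesis by blast
  qed
  also have "(P * \<eta> + P * (8 / 3 * \<eta> ^ 3 / t\<^sup>2)) + t * ((2 * pi) ^ 3 * (Ku * Kw)) = \<eta> * ((1 + 8 / (3 * s\<^sup>2)) * P + s * (2 * pi) ^ 3 * (Ku * Kw))"
  proof -
    have "8 / 3 * \<eta> ^ 3 / t\<^sup>2 = \<eta> * (8 / (3 * s\<^sup>2))"
      using \<eta>(1) s unfolding t_def by (simp add: field_simps power2_eq_square power3_eq_cube)
    then show ?thesis unfolding t_def by (simp add: algebra_simps)
  qed
  finally show ?thesis unfolding F_def P_def .
qed

text \<open>\<open>11 / 3 = 1 + 8 / 3\<close> collects the integrable parts at \<open>s = 1\<close>,
  \<open>(2 * pi) ^ 3\<close> is Bessel's constant, and \<open>8 + 8 * 12 ^ 4\<close> is the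
  \<open>L\<^sup>4\<close> constant at \<open>r = 1\<close>.\<close>

definition field_constant :: real where
  "field_constant = 11 / 3 + (2 * pi) ^ 3 * (8 + 8 * 12 ^ 4)"

lemma field_constant_pos: "field_constant > 0"
  unfolding field_constant_def by (intro add_pos_nonneg mult_nonneg_nonneg) simp_all

text \<open>The first bound, with two form norms, serves the second differences of the quartic
  energy. The second trades one form norm for the \<open>L2\<close> norm and is the critical
  estimate behind the linear absorption at low energy.\<close>

lemma weighted_Fourier_energy_bound:
  fixes u w :: "R3 \<Rightarrow> complex" and W W1 W2 :: "R3 \<Rightarrow> real"
  assumes u: "u \<in> H1" and w: "w \<in> H1"
    and E: "(L2_norm u)\<^sup>2 + (L2_norm (weak_gradient u))\<^sup>2 \<le> Eu" "(L2_norm w)\<^sup>2 + (L2_norm (weak_gradient w))\<^sup>2 \<le> Ew"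
    and W12: "W1 \<in> borel_measurable lebesgue" "W2 \<in> borel_measurable lebesgue"
    and W: "AE k in lebesgue. W k = W1 k + W2 k"
    and \<eta>: "\<eta> > 0" "L1_norm W1 \<le> ennreal \<eta>" "weak_L3_norm W2 \<le> ennreal \<eta>"
  shows "(\<integral>\<^sup>+k. ennreal (W k * (norm (Fourier (\<lambda>x. u x \<bullet> w x) k))\<^sup>2) \<partial>lebesgue) \<le> ennreal (\<eta> * field_constant * (Eu * Ew))"
    and "(\<integral>\<^sup>+k. ennreal (W k * (norm (Fourier (\<lambda>x. u x \<bullet> u x) k))\<^sup>2) \<partial>lebesgue) \<le> ennreal (\<eta> * field_constant * ((L2_norm u)\<^sup>2 * Eu))"
proof -
  define K where "K = (8 + 8 * 12 ^ 4 :: real)"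
  have L4: "(\<integral>\<^sup>+x. ennreal ((norm (f x)) ^ 4) \<partial>lebesgue) \<le> ennreal (K / r ^ 3 * q\<^sup>2)"
    if f: "f \<in> H1" and r: "r > 0" and q: "(L2_norm f)\<^sup>2 \<le> q" "r\<^sup>2 * (L2_norm (weak_gradient f))\<^sup>2 \<le> q" for f r q
  proof -
    have "((L2_norm f)\<^sup>2)\<^sup>2 \<le> q\<^sup>2" by (rule power_mono[OF q(1)]) simp
    moreover have "(r\<^sup>2 * (L2_norm (weak_gradient f))\<^sup>2)\<^sup>2 \<le> q\<^sup>2" by (rule power_mono[OF q(2)]) simp
    moreover have "(12 * r) ^ 4 * ((L2_norm (weak_gradient f))\<^sup>2)\<^sup>2 = 12 ^ 4 * (r\<^sup>2 * (L2_norm (weak_gradient f))\<^sup>2)\<^sup>2"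
      by (simp add: power_mult_distrib power_mult[THEN sym])
    ultimately have "8 * ((L2_norm f)\<^sup>2)\<^sup>2 + 8 * ((12 * r) ^ 4 * ((L2_norm (weak_gradient f))\<^sup>2)\<^sup>2) \<le> K * q\<^sup>2"
      unfolding K_def by simp
    then have "(8 * ((L2_norm f)\<^sup>2)\<^sup>2 + 8 * ((12 * r) ^ 4 * ((L2_norm (weak_gradient f))\<^sup>2)\<^sup>2)) / r ^ 3 \<le> K / r ^ 3 * q\<^sup>2"
      using r by (simp add: divide_right_mono)
    then show ?thesis by (rule order_trans[OF H1_L4_bound[OF f r] ennreal_leI])
  qed
  have K: "K > 0" unfolding K_def by simp
  note uL = H1_L2[OF u] and wL = H1_L2[OF w]
  have pE: "(L2_norm u)\<^sup>2 \<le> Eu" "(L2_norm w)\<^sup>2 \<le> Ew" "(L2_norm (weak_gradient u))\<^sup>2 \<le> Eu" "(L2_norm (weak_gradient w))\<^sup>2 \<le> Ew"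
    using E zero_le_power2[of "L2_norm u"] zero_le_power2[of "L2_norm (weak_gradient u)"]
      zero_le_power2[of "L2_norm w"] zero_le_power2[of "L2_norm (weak_gradient w)"] by linarith+
  have E0: "Eu \<ge> 0" "Ew \<ge> 0" by (rule order_trans[OF zero_le_power2 pE(1)], rule order_trans[OF zero_le_power2 pE(2)])
  have root: "(sqrt K * c)\<^sup>2 = K * c\<^sup>2" for c using K by (simp add: power_mult_distrib)
  have u4: "(\<integral>\<^sup>+x. ennreal ((norm (u x)) ^ 4) \<partial>lebesgue) \<le> ennreal ((sqrt K * Eu)\<^sup>2)"
    using L4[OF u zero_less_one, of Eu] pE unfolding root by simp
  have w4: "(\<integral>\<^sup>+x. ennreal ((norm (w x)) ^ 4) \<partial>lebesgue) \<le> ennreal ((sqrt K * Ew)\<^sup>2)"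
    using L4[OF w zero_less_one, of Ew] pE unfolding root by simp
  have KE: "0 \<le> sqrt K * Eu" "0 \<le> sqrt K * Ew" using K E0 by simp_all
  have KK: "sqrt K * a * (sqrt K * b) = K * (a * b)" for a b
  proof -
    have "sqrt K * a * (sqrt K * b) = (sqrt K * sqrt K) * (a * b)" by (simp only: mult_ac)
    then show ?thesis using K by simp
  qed
  have "(1 + 8 / (3 * 1\<^sup>2)) * ((L2_norm u)\<^sup>2 * (L2_norm w)\<^sup>2) + 1 * (2 * pi) ^ 3 * (sqrt K * Eu * (sqrt K * Ew))
    \<le> 11 / 3 * (Eu * Ew) + (2 * pi) ^ 3 * (K * (Eu * Ew))"
    unfolding KK using mult_mono[OF pE(1,2) E0(1) zero_le_power2] by simp
  also have "\<dots> = field_constant * (Eu * Ew)" unfolding field_constant_def K_def by (simp only: distrib_right mult.assoc)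
  finally have "\<eta> * ((1 + 8 / (3 * 1\<^sup>2)) * ((L2_norm u)\<^sup>2 * (L2_norm w)\<^sup>2) + 1 * (2 * pi) ^ 3 * (sqrt K * Eu * (sqrt K * Ew)))
    \<le> \<eta> * (field_constant * (Eu * Ew))" using \<eta>(1) by (intro mult_left_mono) simp_all
  from order_trans[OF weighted_Fourier_bound[OF uL wL KE u4 w4 W12 W \<eta> zero_less_one] ennreal_leI[OF this]]
  show "(\<integral>\<^sup>+k. ennreal (W k * (norm (Fourier (\<lambda>x. u x \<bullet> w x) k))\<^sup>2) \<partial>lebesgue) \<le> ennreal (\<eta> * field_constant * (Eu * Ew))"
    by (simp only: mult.assoc)
  show "(\<integral>\<^sup>+k. ennreal (W k * (norm (Fourier (\<lambda>x. u x \<bullet> u x) k))\<^sup>2) \<partial>lebesgue) \<le> ennreal (\<eta> * field_constant * ((L2_norm u)\<^sup>2 * Eu))"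
  proof (cases "L2_norm u = 0")
    case True
    have "Fourier (\<lambda>x. u x \<bullet> u x) k = 0" for k
      using Fourier_density_bound[OF uL uL, of k] True by simp
    then show ?thesis by simp
  next
    case False
    define p where "p = (L2_norm u)\<^sup>2"
    have p: "p > 0" using False unfolding p_def by simp
    then have Eu: "Eu > 0" "p \<le> Eu" using pE(1) unfolding p_def by linarith+
    \<comment> \<open>Cutting \<open>W2\<close> at height \<open>\<eta> r\<close> and averaging over cubes of side \<open>r\<close> balances both terms
      at \<open>p * Eu\<close> instead of \<open>Eu\<^sup>2\<close>.\<close>
    define r where "r = sqrt (p / Eu)"
    have r: "r > 0" "r\<^sup>2 = p / Eu" "r\<^sup>2 \<le> 1" unfolding r_def using p Eu by simp_all
    have "r\<^sup>2 * (L2_norm (weak_gradient u))\<^sup>2 \<le> r\<^sup>2 * Eu" by (rule mult_left_mono[OF pE(3)]) simp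
    also have "\<dots> = p" using r(2) Eu by simp
    finally have rD: "r\<^sup>2 * (L2_norm (weak_gradient u))\<^sup>2 \<le> p" .
    define Ku where "Ku = sqrt (K / r ^ 3) * p"
    have Ku: "Ku \<ge> 0" "Ku\<^sup>2 = K / r ^ 3 * p\<^sup>2" unfolding Ku_def using K r(1) p by (simp_all add: power_mult_distrib)
    have u4: "(\<integral>\<^sup>+x. ennreal ((norm (u x)) ^ 4) \<partial>lebesgue) \<le> ennreal (Ku\<^sup>2)"
      unfolding Ku(2) by (rule L4[OF u r(1) _ rD]) (simp add: p_def)
    have 1: "(1 + 8 / (3 * r\<^sup>2)) * (p * p) \<le> 11 / 3 * (p * Eu)"
    proof -
      have "r\<^sup>2 * Eu = p" using r(2) Eu by simp
      then have "(1 + 8 / (3 * r\<^sup>2)) * (p * p) = p * p + 8 / 3 * (p * Eu)"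
        using r(1) by (simp add: field_simps power2_eq_square)
      also have "p * p \<le> p * Eu" using p Eu by simp
      finally show ?thesis by linarith
    qed
    have 2: "r * (2 * pi) ^ 3 * (Ku * Ku) = (2 * pi) ^ 3 * (K * (p * Eu))"
    proof -
      have "r * (Ku * Ku) = K * (p * (p / r\<^sup>2))"
        using Ku(2) r(1) by (simp add: power2_eq_square power3_eq_cube)
      also have "p / r\<^sup>2 = Eu" unfolding r(2) using p Eu by simp
      finally have *: "r * (Ku * Ku) = K * (p * Eu)" .
      have "r * (2 * pi) ^ 3 * (Ku * Ku) = (2 * pi) ^ 3 * (r * (Ku * Ku))" by (simp only: mult_ac)
      then show ?thesis unfolding * .
    qed
    have "(1 + 8 / (3 * r\<^sup>2)) * (p * p) + r * (2 * pi) ^ 3 * (Ku * Ku) \<le> field_constant * (p * Eu)"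
      using 1 unfolding 2 field_constant_def K_def by (simp only: distrib_right mult.assoc)
    then have "\<eta> * ((1 + 8 / (3 * r\<^sup>2)) * (p * p) + r * (2 * pi) ^ 3 * (Ku * Ku)) \<le> \<eta> * (field_constant * (p * Eu))"
      using \<eta>(1) by (intro mult_left_mono) simp_all
    from order_trans[OF weighted_Fourier_bound[OF uL uL Ku(1) Ku(1) u4 u4 W12 W \<eta> r(1)], folded p_def, OF ennreal_leI[OF this]]
    show ?thesis by (simp only: mult.assoc p_def)
  qed
qed

section \<open>Reduction to the particle energy\<close>

lemma Fourier_add:
  assumes "integrable lebesgue \<rho>" "integrable lebesgue \<sigma>"
  shows "Fourier (\<lambda>x. \<rho> x + \<sigma> x) k = Fourier \<rho> k + Fourier \<sigma> k"
proof -
  have int: "integrable lebesgue (\<lambda>x. exp (\<i> * of_real (k \<bullet> x)) * of_real (\<rho> x) :: complex)" if "integrable lebesgue \<rho>" for \<rho>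
  proof (rule Bochner_Integration.integrable_bound[OF that])
    note [measurable] = borel_measurable_integrable[OF that]
    have [measurable]: "(\<lambda>x. exp (\<i> * complex_of_real (k \<bullet> x))) \<in> borel_measurable lebesgue"
      by (rule borel_imp_lebesgue) measurable
    show "(\<lambda>x. exp (\<i> * of_real (k \<bullet> x)) * of_real (\<rho> x) :: complex) \<in> borel_measurable lebesgue" by measurable
    show "AE x in lebesgue. norm (exp (\<i> * of_real (k \<bullet> x)) * of_real (\<rho> x) :: complex) \<le> norm (\<rho> x)"
      by (simp add: norm_mult)
  qed
  show ?thesis
    unfolding Fourier_def of_real_add distrib_left
    by (rule Bochner_Integration.integral_add[OF int[OF assms(1)] int[OF assms(2)]])
qed

lemma Fourier_scale: "Fourier (\<lambda>x. c * \<rho> x) k = of_real c * Fourier \<rho> k"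
proof -
  have "Fourier (\<lambda>x. c * \<rho> x) k = (LINT x|lebesgue. of_real c * (exp (\<i> * of_real (k \<bullet> x)) * of_real (\<rho> x)))"
    unfolding Fourier_def by (simp only: of_real_mult mult_ac)
  then show ?thesis unfolding Fourier_def by simp
qed

lemma Fourier_lebesgue_measurable: "\<rho> \<in> borel_measurable lebesgue \<Longrightarrow> Fourier \<rho> \<in> borel_measurable lebesgue"
  by (rule borel_imp_lebesgue[OF Fourier_measurable])

text \<open>The minimizing field for the particle state \<open>u\<close> is determined by \<open>- cnj (source h u u)\<close>; polarizing it
  makes the quartic energy a square norm of a bilinear map.\<close>

definition source :: "(R3 \<Rightarrow> real) \<Rightarrow> (R3 \<Rightarrow> complex) \<Rightarrow> (R3 \<Rightarrow> complex) \<Rightarrow> R3 \<Rightarrow> complex" where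
  "source h u w k = h k *\<^sub>R Fourier (\<lambda>x. u x \<bullet> w x) k"

lemma source_sym: "source h u w = source h w u"
  unfolding source_def by (simp only: inner_commute)

lemma source_add: "u \<in> L2 \<Longrightarrow> w \<in> L2 \<Longrightarrow> z \<in> L2 \<Longrightarrow> source h (u + w) z = source h u z + source h w z"
  unfolding source_def
  by (rule ext) (simp add: inner_add_left Fourier_add L2_form_integrable scaleR_add_right)

lemma source_scale: "source h (c *\<^sub>R u) z = c *\<^sub>R source h u z"
proof (rule ext)
  fix k
  have "Fourier (\<lambda>x. (c *\<^sub>R u) x \<bullet> z x) k = of_real c * Fourier (\<lambda>x. u x \<bullet> z x) k"
    unfolding Fourier_scale[THEN sym] by simp
  then show "source h (c *\<^sub>R u) z k = (c *\<^sub>R source h u z) k"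
    unfolding source_def by (simp add: scaleR_conv_of_real mult.left_commute)
qed

lemma source_diff: "u \<in> L2 \<Longrightarrow> w \<in> L2 \<Longrightarrow> z \<in> L2 \<Longrightarrow> source h (u - w) z = source h u z - source h w z"
  using source_add[of u "- w" z h] source_scale[of h "-1" w z] subspace_neg[OF L2_subspace, of w] by simp

lemma source_measurable:
  assumes "u \<in> L2" "w \<in> L2" "h \<in> borel_measurable lebesgue"
  shows "source h u w \<in> borel_measurable lebesgue"
proof -
  note [measurable] = assms(3) Fourier_lebesgue_measurable[OF borel_measurable_integrable[OF L2_form_integrable[OF assms(1,2)]]]
  show ?thesis unfolding source_def[abs_def] by measurable
qed

lemma source_mult_unit:
  assumes "cmod c = 1"
  shows "source h (\<lambda>x. c * u x) (\<lambda>x. c * u x) = source h u u"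
proof -
  have "(c * z) \<bullet> (c * z) = z \<bullet> z" for z :: complex
    unfolding power2_norm_eq_inner[THEN sym] using assms by (simp add: norm_mult)
  then show ?thesis unfolding source_def by simp
qed

text \<open>\<open>h\<close> is a square root of the field weight, later
  \<open>g * v / sqrt \<omega>\<close> with its sign. The particle sees the field through
  \<open>h\<close> alone, and \<open>\<eta>\<close> bounds both summands in a decomposition of its
  square.\<close>

locale coupled_system = schroedinger_potential +
  fixes h W1 W2 :: "R3 \<Rightarrow> real" and \<eta> :: real
  assumes h_meas: "h \<in> borel_measurable lebesgue"
    and W12_meas: "W1 \<in> borel_measurable lebesgue" "W2 \<in> borel_measurable lebesgue"
    and h_sq: "AE k in lebesgue. (h k)\<^sup>2 = W1 k + W2 k"
    and \<eta>: "\<eta> > 0" "L1_norm W1 \<le> ennreal \<eta>" "weak_L3_norm W2 \<le> ennreal \<eta>"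
begin

abbreviation S where "S \<equiv> source h"

definition \<kappa> where "\<kappa> = \<eta> * field_constant"

lemma \<kappa>_pos: "\<kappa> > 0"
  unfolding \<kappa>_def using \<eta>(1) field_constant_pos by simp

lemma B_nonneg: "0 \<le> B u u"
  unfolding B_def using part_forms_nonneg[of u] by simp

lemma H1_energy_le: "(L2_norm u)\<^sup>2 + (L2_norm (weak_gradient u))\<^sup>2 \<le> B u u"
  unfolding B_def sq_forms L2_form_sq by simp

lemma S_bound:
  assumes u: "u \<in> Q" and w: "w \<in> Q"
  shows S_L2: "S u w \<in> L2" and S_le: "L2_form (S u w) (S u w) \<le> \<kappa> * (B u u * B w w)"
    and S_diag_le: "L2_form (S u u) (S u u) \<le> \<kappa> * (L2_form u u * B u u)"
proof -
  have norm_S: "(norm (S y z k))\<^sup>2 = (h k)\<^sup>2 * (norm (Fourier (\<lambda>x. y x \<bullet> z x) k))\<^sup>2" for y z k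
    unfolding source_def by (simp add: power_mult_distrib)
  note bounds = weighted_Fourier_energy_bound[OF form_domain_H1 form_domain_H1 H1_energy_le H1_energy_le W12_meas h_sq \<eta>,
      folded norm_S \<kappa>_def]
  have L: "S y z \<in> L2" if "y \<in> Q" "z \<in> Q" for y z
  proof (rule L2I_nn_integral[OF source_measurable[OF form_domain_L2[OF that(1)] form_domain_L2[OF that(2)] h_meas]])
    show "(\<integral>\<^sup>+k. ennreal ((norm (S y z k))\<^sup>2) \<partial>lebesgue) < \<infinity>"
      by (rule le_less_trans[OF bounds(1)[OF that]]) simp
  qed
  show "S u w \<in> L2" by (rule L[OF u w])
  show "L2_form (S u w) (S u w) \<le> \<kappa> * (B u u * B w w)"
    using bounds(1)[OF u w] \<kappa>_pos B_nonneg[of u] B_nonneg[of w]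
    unfolding L2_nn_integral[OF L[OF u w]] L2_form_sq by (subst (asm) ennreal_le_iff) simp_all
  show "L2_form (S u u) (S u u) \<le> \<kappa> * (L2_form u u * B u u)"
    using bounds(2)[OF u u] \<kappa>_pos B_nonneg[of u]
    unfolding L2_nn_integral[OF L[OF u u]] L2_form_sq by (subst (asm) ennreal_le_iff) simp_all
qed

definition N where "N u = L2_form (S u u) (S u u)"

text \<open>By bilinearity and symmetry the two sources are \<open>X + Y\<close> and
  \<open>X - Y\<close> with \<open>Y = 2 S m d\<close>, so the parallelogram identity gives the
  second difference exactly. The 12 consists of 4 from the cross term inside \<open>X\<close> and 8
  from \<open>Y\<close>.\<close>

lemma N_mid:
  assumes m: "m \<in> Q" and d: "d \<in> Q"
  shows "N (m + d) + N (m - d) \<le> 2 * N m + 12 * \<kappa> * B m m * B d d + 2 * \<kappa> * (B d d)\<^sup>2"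
proof -
  note mL = form_domain_L2[OF m] and dL = form_domain_L2[OF d]
  note mdL = S.L.add_closed[OF mL dL] S.L.diff_closed[OF mL dL]
  define X where "X = S m m + S d d"
  have XL: "X \<in> L2" unfolding X_def by (intro S.L.add_closed S_L2 m d)
  have YL: "2 *\<^sub>R S m d \<in> L2" by (intro S.L.scale_closed S_L2 m d)
  have dm: "S d m = S m d" by (rule source_sym)
  have two: "2 *\<^sub>R S m d = S m d + S m d" by (rule scaleR_2)
  have plus: "S (m + d) (m + d) = X + 2 *\<^sub>R S m d"
    unfolding source_add[OF mL dL mdL(1)] source_sym[of h m "m + d"] source_sym[of h d "m + d"]
      source_add[OF mL dL mL] source_add[OF mL dL dL] X_def dm two by (simp only: ac_simps)
  have minus: "S (m - d) (m - d) = X - 2 *\<^sub>R S m d"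
    unfolding source_diff[OF mL dL mdL(2)] source_sym[of h m "m - d"] source_sym[of h d "m - d"]
      source_diff[OF mL dL mL] source_diff[OF mL dL dL] X_def dm two by (simp add: algebra_simps)
  have "N (m + d) + N (m - d) = 2 * L2_form X X + 2 * L2_form (2 *\<^sub>R S m d) (2 *\<^sub>R S m d)"
    unfolding N_def plus minus by (rule S.L.parallelogram[OF XL YL])
  also have "L2_form (2 *\<^sub>R S m d) (2 *\<^sub>R S m d) = 4 * L2_form (S m d) (S m d)"
    using S.L.quad_scale[OF S_L2[OF m d], of 2] by simp
  also have "L2_form X X = N m + 2 * L2_form (S m m) (S d d) + N d"
    unfolding X_def N_def by (rule S.L.quad_add[OF S_L2[OF m m] S_L2[OF d d]])
  finally have sum: "N (m + d) + N (m - d) = 2 * (N m + 2 * L2_form (S m m) (S d d) + N d) + 2 * (4 * L2_form (S m d) (S m d))" .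
  have "L2_form (S m m) (S d d) \<le> sqrt (L2_form (S m m) (S m m)) * sqrt (L2_form (S d d) (S d d))"
    using S.L.Cauchy_Schwarz_sqrt[OF S_L2[OF m m] S_L2[OF d d]] by linarith
  also have "\<dots> \<le> sqrt (\<kappa> * (B m m * B m m)) * sqrt (\<kappa> * (B d d * B d d))"
    by (intro mult_mono real_sqrt_le_mono S_le m d real_sqrt_ge_zero S.L.nonneg S_L2 mult_nonneg_nonneg B_nonneg less_imp_le[OF \<kappa>_pos])
  also have "\<dots> = \<kappa> * (B m m * B d d)"
  proof -
    have "sqrt (\<kappa> * (B m m * B m m)) * sqrt (\<kappa> * (B d d * B d d)) = sqrt ((\<kappa> * (B m m * B d d))\<^sup>2)"
      unfolding real_sqrt_mult[THEN sym] by (simp only: power2_eq_square mult_ac)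
    then show ?thesis using \<kappa>_pos B_nonneg[of m] B_nonneg[of d] by simp
  qed
  finally have 1: "L2_form (S m m) (S d d) \<le> \<kappa> * (B m m * B d d)" .
  have 2: "N d \<le> \<kappa> * (B d d * B d d)" unfolding N_def by (rule S_le[OF d d])
  have 3: "L2_form (S m d) (S m d) \<le> \<kappa> * (B m m * B d d)" by (rule S_le[OF m d])
  have arith: "2 * (n + 2 * q + n') + 2 * (4 * q') \<le> 2 * n + 12 * x + 2 * y" if "q \<le> x" "n' \<le> y" "q' \<le> x" for n n' q q' x y :: real
    using that by simp
  have "N (m + d) + N (m - d) \<le> 2 * N m + 12 * (\<kappa> * (B m m * B d d)) + 2 * (\<kappa> * (B d d * B d d))"
    unfolding sum by (rule arith[OF 1 2 3])
  then show ?thesis by (simp only: power2_eq_square mult.assoc)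
qed

text \<open>\<open>sqrt (N u)\<close> is the norm of \<open>S u u\<close>, and
  \<open>S u u - S w w = S (u - w) (u + w)\<close> because \<open>S\<close> is symmetric.\<close>

lemma N_cont:
  assumes u: "u \<in> Q" and w: "w \<in> Q"
  shows "sqrt (N u) \<le> sqrt (N w) + sqrt (\<kappa> * B (u - w) (u - w) * B (u + w) (u + w))"
proof -
  note uL = form_domain_L2[OF u] and wL = form_domain_L2[OF w]
  note pL = S.L.add_closed[OF uL wL]
  note uw = S.a.diff_closed[OF u w] S.a.add_closed[OF u w]
  have "S u u = S w w + S (u - w) (u + w)"
    unfolding source_diff[OF uL wL pL] source_sym[of h u "u + w"] source_sym[of h w "u + w"]
      source_add[OF uL wL uL] source_add[OF uL wL wL] source_sym[of h w u] by (simp add: algebra_simps)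
  then have "sqrt (N u) \<le> sqrt (N w) + sqrt (L2_form (S (u - w) (u + w)) (S (u - w) (u + w)))"
    unfolding N_def using S.L.sqrt_triangle[OF S_L2[OF w w] S_L2[OF uw]] by simp
  also have "\<dots> \<le> sqrt (N w) + sqrt (\<kappa> * B (u - w) (u - w) * B (u + w) (u + w))"
    using S_le[OF uw] by (intro add_left_mono real_sqrt_le_mono) (simp only: mult.assoc)
  finally show ?thesis .
qed

lemma N_scale: "u \<in> Q \<Longrightarrow> N (t *\<^sub>R u) = t ^ 4 * N u"
proof -
  assume u: "u \<in> Q"
  have "S (t *\<^sub>R u) (t *\<^sub>R u) = (t * t) *\<^sub>R S u u"
    unfolding source_scale[of h t u "t *\<^sub>R u"] source_sym[of h u "t *\<^sub>R u"] source_scale[of h t u u] by simp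
  then show ?thesis
    unfolding N_def using S.L.quad_scale[OF S_L2[OF u u], of "t * t"] by (simp add: power4_eq_xxxx power2_eq_square)
qed

lemma N_nonneg: "0 \<le> N u"
  unfolding N_def L2_form_sq by simp

lemma N_le: "u \<in> Q \<Longrightarrow> N u \<le> \<kappa> * L2_form u u * B u u"
  using S_diag_le[of u u] unfolding N_def by (simp only: mult.assoc)

lemma a_mult_unit:
  assumes u: "u \<in> Q" and c: "cmod c = 1"
  shows "a (\<lambda>x. c * u x) (\<lambda>x. c * u x) = a u u"
proof -
  note uH = form_domain_H1[OF u]
  have parts: "norm (plus_part (\<lambda>x. c * u x) x) = norm (plus_part u x)" "norm (minus_part (\<lambda>x. c * u x) x) = norm (minus_part u x)" for x
    unfolding plus_part_def minus_part_def using c by (simp_all add: norm_mult)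
  have v: "norm (\<chi> i. c * v $ i) = norm v" for v :: "complex^3"
    unfolding norm_vec_def using c by (simp add: norm_mult)
  have "L2_norm (weak_gradient (\<lambda>x. c * u x)) = L2_norm (\<lambda>x. \<chi> i. c * weak_gradient u x $ i)"
    by (rule L2_norm_cong_AE[OF L2_measurable[OF weak_gradient_spec(1)[OF H1_scale(1)[OF uH]]]
        L2_measurable[OF L2_linear[OF weak_gradient_spec(1)[OF uH] bounded_linear_mult_vec]] H1_scale(2)[OF uH]])
  also have "\<dots> = L2_norm (weak_gradient u)" unfolding L2_norm_def v ..
  finally show ?thesis unfolding a_def sq_forms L2_norm_def parts by simp
qed

lemma N_mult_unit: "cmod c = 1 \<Longrightarrow> N (\<lambda>x. c * u x) = N u"
  unfolding N_def using source_mult_unit[of c h u] by simp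

lemma S_cnj_L2: "u \<in> Q \<Longrightarrow> (\<lambda>k. cnj (S u u k)) \<in> L2"
  by (rule L2_linear[OF S_L2 bounded_linear_cnj])

end

section \<open>Elimination of the field\<close>

locale boson_system = coupled_system +
  fixes \<omega> v :: "R3 \<Rightarrow> real" and g :: real
  assumes \<omega>_meas: "\<omega> \<in> borel_measurable lebesgue" and v_meas: "v \<in> borel_measurable lebesgue"
    and \<omega>_nonneg: "0 \<le> \<omega> k" and \<omega>_pos: "AE k in lebesgue. \<omega> k > 0"
    and h_eq: "h k = g * v k / sqrt (\<omega> k)"
begin

definition residual :: "(R3 \<Rightarrow> complex) \<Rightarrow> (R3 \<Rightarrow> complex) \<Rightarrow> R3 \<Rightarrow> complex" where
  "residual u f = (\<lambda>k. sqrt (\<omega> k) *\<^sub>R f k) + (\<lambda>k. cnj (S u u k))"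

text \<open>The zero of \<open>residual u\<close>. Where \<open>\<omega>\<close> vanishes, division
  by zero gives the value 0; this concerns a null set only.\<close>

definition optimal_field :: "(R3 \<Rightarrow> complex) \<Rightarrow> R3 \<Rightarrow> complex" where
  "optimal_field u k = (- (1 / sqrt (\<omega> k))) *\<^sub>R cnj (S u u k)"

lemma residual_L2: "u \<in> Q \<Longrightarrow> f \<in> field_states \<omega> \<Longrightarrow> residual u f \<in> L2"
  unfolding residual_def by (rule S.L.add_closed[OF _ S_cnj_L2]) (simp_all add: field_states_def)

text \<open>The weight is redistributed by \<open>g * v = h * sqrt \<omega>\<close>, valid where
  \<open>\<omega> > 0\<close>. The interaction is linear in both \<open>f\<close> and the source,
  while \<open>L2_form\<close> is a Hermitian real part; hence the conjugate.\<close>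

lemma interaction_eq:
  assumes u: "u \<in> Q" and f: "f \<in> field_states \<omega>"
  shows "g * Re (LINT k|lebesgue. of_real (v k) * f k * Fourier (\<lambda>x. u x \<bullet> u x) k)
    = L2_form (\<lambda>k. sqrt (\<omega> k) *\<^sub>R f k) (\<lambda>k. cnj (S u u k))"
proof -
  define F where "F = Fourier (\<lambda>x. u x \<bullet> u x)"
  have fm: "f \<in> borel_measurable lebesgue" and \<phi>: "(\<lambda>k. sqrt (\<omega> k) *\<^sub>R f k) \<in> L2"
    using f unfolding field_states_def by auto
  note cS = S_cnj_L2[OF u] and uL = form_domain_L2[OF u]
  have Fm: "F \<in> borel_measurable lebesgue"
    unfolding F_def by (rule Fourier_lebesgue_measurable[OF borel_measurable_integrable[OF L2_form_integrable[OF uL uL]]])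
  note [measurable] = fm Fm v_meas
  have "of_real g * (LINT k|lebesgue. of_real (v k) * f k * F k) = (LINT k|lebesgue. of_real g * (of_real (v k) * f k * F k))"
    by simp
  also have "\<dots> = (LINT k|lebesgue. cnj (cnj (S u u k)) * (sqrt (\<omega> k) *\<^sub>R f k))"
  proof (rule integral_cong_AE)
    show "(\<lambda>k. of_real g * (of_real (v k) * f k * F k)) \<in> borel_measurable lebesgue" by measurable
    show "(\<lambda>k. cnj (cnj (S u u k)) * (sqrt (\<omega> k) *\<^sub>R f k)) \<in> borel_measurable lebesgue"
      by (rule borel_measurable_integrable[OF L2_cnj_integrable[OF cS \<phi>]])
    show "AE k in lebesgue. of_real g * (of_real (v k) * f k * F k) = cnj (cnj (S u u k)) * (sqrt (\<omega> k) *\<^sub>R f k)"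
      using \<omega>_pos
    proof eventually_elim
      case (elim k)
      have "cnj (cnj (S u u k)) * (sqrt (\<omega> k) *\<^sub>R f k) = of_real (h k * sqrt (\<omega> k)) * (f k * F k)"
        unfolding source_def F_def by (simp add: scaleR_conv_of_real)
      also have "h k * sqrt (\<omega> k) = g * v k" unfolding h_eq using elim by simp
      finally show ?case by simp
    qed
  qed
  also have "\<dots> = L2_inner (\<lambda>k. cnj (S u u k)) (\<lambda>k. sqrt (\<omega> k) *\<^sub>R f k)" unfolding L2_inner_def ..
  finally have "Re (of_real g * (LINT k|lebesgue. of_real (v k) * f k * F k)) = L2_form (\<lambda>k. cnj (S u u k)) (\<lambda>k. sqrt (\<omega> k) *\<^sub>R f k)"
    by (simp only: Re_L2_inner[OF cS \<phi>])
  then show ?thesis unfolding F_def S.L.sym[OF \<phi> cS] by simp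
qed

lemma energy_eq:
  assumes u: "u \<in> Q" and f: "f \<in> field_states \<omega>"
  shows "kgs_energy V \<omega> v g u f = a u u - N u + (L2_norm (residual u f))\<^sup>2"
proof -
  have \<phi>: "(\<lambda>k. sqrt (\<omega> k) *\<^sub>R f k) \<in> L2" using f unfolding field_states_def by auto
  note cS = S_cnj_L2[OF u]
  have 1: "(LINT x|lebesgue. (norm (weak_gradient u x))\<^sup>2) = D u u" unfolding sq_forms L2_norm_sq ..
  have "of_real (V x) * (cnj (u x) * u x) = complex_of_real (V x * (cmod (u x))\<^sup>2)" for x
    unfolding of_real_mult complex_norm_square by (simp only: mult_ac)
  then have 2: "(LINT x|lebesgue. V x * (cmod (u x))\<^sup>2) = P u u - Mi u u"
    using potential_pairing[OF u u] by (simp only: integral_complex_of_real Re_complex_of_real)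
  have 3: "(LINT k|lebesgue. \<omega> k * (cmod (f k))\<^sup>2) = L2_form (\<lambda>k. sqrt (\<omega> k) *\<^sub>R f k) (\<lambda>k. sqrt (\<omega> k) *\<^sub>R f k)"
    unfolding L2_form_sq L2_norm_sq using \<omega>_nonneg by (simp add: power_mult_distrib)
  have 4: "(LINT x|lebesgue. exp (\<i> * of_real (k \<bullet> x)) * of_real ((cmod (u x))\<^sup>2)) = Fourier (\<lambda>x. u x \<bullet> u x) k" for k
    unfolding Fourier_def power2_norm_eq_inner ..
  have 5: "N u = L2_form (\<lambda>k. cnj (S u u k)) (\<lambda>k. cnj (S u u k))"
    unfolding N_def L2_form_sq L2_norm_def by simp
  have 6: "2 * g * Re z = 2 * (g * Re z)" for z by simp
  have "(L2_norm (residual u f))\<^sup>2 = L2_form (\<lambda>k. sqrt (\<omega> k) *\<^sub>R f k) (\<lambda>k. sqrt (\<omega> k) *\<^sub>R f k)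
      + 2 * L2_form (\<lambda>k. sqrt (\<omega> k) *\<^sub>R f k) (\<lambda>k. cnj (S u u k)) + N u"
    unfolding L2_form_sq[THEN sym] residual_def 5 by (rule S.L.quad_add[OF \<phi> cS])
  then show ?thesis
    unfolding kgs_energy_def 1 2 3 4 6 interaction_eq[OF u f] a_def by simp
qed

lemma optimal_field:
  assumes u: "u \<in> Q"
  shows "optimal_field u \<in> field_states \<omega>" and "L2_norm (residual u (optimal_field u)) = 0"
proof -
  note cS = S_cnj_L2[OF u]
  note [measurable] = L2_measurable[OF cS] \<omega>_meas
  have m: "optimal_field u \<in> borel_measurable lebesgue" unfolding optimal_field_def[abs_def] by measurable
  then have m': "(\<lambda>k. sqrt (\<omega> k) *\<^sub>R optimal_field u k) \<in> borel_measurable lebesgue" by measurable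
  have eq: "AE k in lebesgue. (-1) *\<^sub>R cnj (S u u k) = sqrt (\<omega> k) *\<^sub>R optimal_field u k"
    using \<omega>_pos by eventually_elim (simp add: optimal_field_def)
  have "(\<lambda>k. sqrt (\<omega> k) *\<^sub>R optimal_field u k) \<in> L2" by (rule L2_cong_AE[OF L2_scaleR[OF cS] m' eq])
  with m show fs: "optimal_field u \<in> field_states \<omega>" unfolding field_states_def by simp
  have "L2_norm (residual u (optimal_field u)) = L2_norm (\<lambda>k. 0 :: complex)"
  proof (rule L2_norm_cong_AE[OF L2_measurable[OF residual_L2[OF u fs]]])
    show "AE k in lebesgue. residual u (optimal_field u) k = 0"
      using eq
    proof eventually_elim
      case (elim k)
      then have "sqrt (\<omega> k) *\<^sub>R optimal_field u k = - cnj (S u u k)" by simp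
      then show ?case by (simp add: residual_def)
    qed
  qed simp
  then show "L2_norm (residual u (optimal_field u)) = 0" by (simp add: L2_norm_def)
qed

lemma residual_zero_unique:
  assumes u: "u \<in> Q" and f: "f \<in> field_states \<omega>" and zero: "L2_norm (residual u f) = 0"
  shows "AE k in lebesgue. f k = optimal_field u k"
  using L2_norm_eq_0[OF residual_L2[OF u f] zero] \<omega>_pos
proof eventually_elim
  case (elim k)
  then have "sqrt (\<omega> k) *\<^sub>R f k = - cnj (S u u k)" by (simp add: residual_def add_eq_0_iff)
  then have "(1 / sqrt (\<omega> k)) *\<^sub>R (sqrt (\<omega> k) *\<^sub>R f k) = (1 / sqrt (\<omega> k)) *\<^sub>R (- cnj (S u u k))" by simp
  with elim(2) show ?case by (simp add: optimal_field_def)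
qed

lemma particle_states_iff: "u \<in> particle_states V \<longleftrightarrow> u \<in> Q \<and> L2_form u u = 1"
proof -
  have "L2_norm u = 1 \<longleftrightarrow> (L2_norm u)\<^sup>2 = 1"
  proof
    assume "(L2_norm u)\<^sup>2 = 1"
    then have "sqrt ((L2_norm u)\<^sup>2) = 1" by simp
    then show "L2_norm u = 1" by simp
  qed simp
  then show ?thesis unfolding particle_states_def L2_form_sq by simp
qed

text \<open>Every particle state has a field with zero residual, so the squared residual in
  \<open>energy_eq\<close> can be minimized independently of \<open>a u u - N u\<close>: the two
  minimizations decouple.\<close>

lemma kgs_minimizer_iff:
  "kgs_minimizer V \<omega> v g u f \<longleftrightarrow> u \<in> particle_states V \<and> f \<in> field_states \<omega> \<and> L2_norm (residual u f) = 0 \<and>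
     (\<forall>u'\<in>particle_states V. a u u - N u \<le> a u' u' - N u')"
proof (cases "u \<in> particle_states V \<and> f \<in> field_states \<omega>")
  case True
  then have u: "u \<in> Q" and uP: "u \<in> particle_states V" and f: "f \<in> field_states \<omega>" unfolding particle_states_iff by auto
  show ?thesis
  proof
    assume "kgs_minimizer V \<omega> v g u f"
    then have "\<forall>u'\<in>particle_states V. \<forall>f'\<in>field_states \<omega>. kgs_energy V \<omega> v g u f \<le> kgs_energy V \<omega> v g u' f'"
      unfolding kgs_minimizer_def by blast
    then have min: "kgs_energy V \<omega> v g u f \<le> kgs_energy V \<omega> v g u' f'" if "u' \<in> particle_states V" "f' \<in> field_states \<omega>" for u' f'
      using that by simp
    have J: "a u u - N u + (L2_norm (residual u f))\<^sup>2 \<le> a u' u' - N u'" if "u' \<in> particle_states V" for u'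
    proof -
      have u': "u' \<in> Q" using that unfolding particle_states_iff by blast
      from min[OF that optimal_field(1)[OF u']] show ?thesis
        unfolding energy_eq[OF u f] energy_eq[OF u' optimal_field(1)[OF u']] optimal_field(2)[OF u'] by simp
    qed
    have "(L2_norm (residual u f))\<^sup>2 \<le> 0" using J[OF uP] by simp
    then have "L2_norm (residual u f) = 0" by simp
    moreover have "\<forall>u'\<in>particle_states V. a u u - N u \<le> a u' u' - N u'"
    proof (rule ballI)
      fix u' assume "u' \<in> particle_states V"
      from order_trans[OF add_increasing2[OF zero_le_power2 order_refl] J[OF this]]
      show "a u u - N u \<le> a u' u' - N u'" .
    qed
    ultimately show "u \<in> particle_states V \<and> f \<in> field_states \<omega> \<and> L2_norm (residual u f) = 0 \<and>
     (\<forall>u'\<in>particle_states V. a u u - N u \<le> a u' u' - N u')" using uP f by simp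
  next
    assume *: "u \<in> particle_states V \<and> f \<in> field_states \<omega> \<and> L2_norm (residual u f) = 0 \<and>
     (\<forall>u'\<in>particle_states V. a u u - N u \<le> a u' u' - N u')"
    have min: "kgs_energy V \<omega> v g u f \<le> kgs_energy V \<omega> v g u' f'" if "u' \<in> particle_states V" and f': "f' \<in> field_states \<omega>" for u' f'
    proof -
      have u': "u' \<in> Q" using that(1) unfolding particle_states_iff by blast
      have le: "a u u - N u \<le> a u' u' - N u'" and r0: "L2_norm (residual u f) = 0" using * that(1) by blast+
      have "a u u - N u \<le> a u' u' - N u' + (L2_norm (residual u' f'))\<^sup>2" by (rule add_increasing2[OF zero_le_power2 le])
      then show ?thesis unfolding energy_eq[OF u f] energy_eq[OF u' f'] r0 by simp
    qed
    show "kgs_minimizer V \<omega> v g u f"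
      unfolding kgs_minimizer_def by (intro conjI uP f ballI) (rule min)
  qed
next
  case False
  then show ?thesis unfolding kgs_minimizer_def by blast
qed

lemma unique_minimizer:
  assumes gapped: "gapped_form Q L2_form (\<lambda>u w. a u w - \<mu> * L2_form u w) B e1 (\<lambda>x. \<i> * e1 x) c K"
    and small: "\<kappa> \<le> gapped_form.kappa_max B e1 c K"
    and uV: "uV \<in> L2" "AE x in lebesgue. e1 x = of_real (uV x)"
  shows "\<exists>u_gs f_gs. kgs_minimizer V \<omega> v g u_gs f_gs \<and> positive_overlap u_gs uV \<and>
     (\<forall>u f. kgs_minimizer V \<omega> v g u f \<and> positive_overlap u uV \<longrightarrow>
        (AE x in lebesgue. u x = u_gs x) \<and> (AE k in lebesgue. f k = f_gs k))"
proof -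
  interpret G: gapped_form Q L2_form "\<lambda>u w. a u w - \<mu> * L2_form u w" B e1 "\<lambda>x. \<i> * e1 x" c K by (rule gapped)
  note e1 = G.e_in(1) and e1L = form_domain_L2[OF G.e_in(1)]
  have overlap: "positive_overlap u uV \<longleftrightarrow> L2_form (\<lambda>x. \<i> * e1 x) u = 0 \<and> L2_form e1 u > 0" if "u \<in> Q" for u
  proof -
    have uL: "u \<in> L2" by (rule form_domain_L2[OF that])
    have uVc: "(\<lambda>x. complex_of_real (uV x)) \<in> L2" by (rule L2_linear[OF uV(1) bounded_linear_of_real])
    have "L2_inner u (\<lambda>x. of_real (uV x)) = L2_inner u e1"
      unfolding L2_inner_def
      by (rule integral_cong_AE[OF borel_measurable_integrable[OF L2_cnj_integrable[OF uL uVc]] borel_measurable_integrable[OF L2_cnj_integrable[OF uL e1L]]])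
        (use uV(2) in eventually_elim, simp)
    moreover have "Re (L2_inner u e1) = L2_form e1 u" using Re_L2_inner[OF uL e1L] S.L.sym[OF uL e1L] by simp
    \<comment> \<open>The minus sign is the conjugation of the overlap: \<open>u\<close> stands in
      the antilinear slot here and in the linear one in the alignment condition.\<close>
    moreover have "Im (L2_inner u e1) = - L2_form (\<lambda>x. \<i> * e1 x) u"
    proof -
      have "(\<i> * u x) \<bullet> e1 x = - ((\<i> * e1 x) \<bullet> u x)" for x by (simp add: inner_complex_def)
      then show ?thesis unfolding Im_L2_inner[OF uL e1L] L2_form_def by simp
    qed
    ultimately show ?thesis unfolding positive_overlap_def Let_def by (simp only: neg_equal_0_iff_equal)
  qed
  have "\<exists>l\<in>G.aligned. 0 < L2_form e1 l \<and> (\<forall>w\<in>G.aligned. G.J N l \<le> G.J N w) \<and>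
     (\<forall>w\<in>G.aligned. (\<forall>w'\<in>G.aligned. G.J N w \<le> G.J N w') \<longrightarrow> L2_form (w - l) (w - l) = 0)"
    by (rule G.unique_aligned_minimizer[OF \<kappa>_pos small N_nonneg]) (rule N_le N_mid N_scale N_cont; assumption)+
  then obtain l where l: "l \<in> G.aligned" "0 < L2_form e1 l" "\<forall>w\<in>G.aligned. G.J N l \<le> G.J N w"
    and uniq: "\<forall>w\<in>G.aligned. (\<forall>w'\<in>G.aligned. G.J N w \<le> G.J N w') \<longrightarrow> L2_form (w - l) (w - l) = 0" by blast
  have al: "w \<in> G.aligned \<longleftrightarrow> w \<in> Q \<and> L2_form w w = 1 \<and> L2_form (\<lambda>x. \<i> * e1 x) w = 0 \<and> 0 \<le> L2_form e1 w" for w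
    unfolding G.aligned_def by blast
  \<comment> \<open>On the unit sphere \<open>J\<close> and the particle energy differ by the
    constant \<open>\<mu>\<close>, so they have the same minimizers.\<close>
  have J: "G.J N w = a w w - N w - \<mu>" if "L2_form w w = 1" for w
  proof -
    have "G.J N w = (a w w - \<mu> * L2_form w w) - N w"
      by (rule G.J_def[OF \<kappa>_pos small N_nonneg]) (rule N_le N_mid N_scale N_cont; assumption)+
    then show ?thesis unfolding that by simp
  qed
  have lQ: "l \<in> Q" and lP: "l \<in> particle_states V" and l1: "L2_form l l = 1"
    using l(1) unfolding al particle_states_iff by auto
  have lmin: "a l l - N l \<le> a w w - N w" if "w \<in> particle_states V" for w
  proof -
    have w: "w \<in> Q" "L2_form w w = 1" using that unfolding particle_states_iff by auto
    define z where "z = L2_inner e1 w"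
    \<comment> \<open>The unit phase that makes the overlap of \<open>d w\<close> with
      \<open>e1\<close> equal to \<open>cmod z\<close>. It leaves \<open>a\<close> and
      \<open>N\<close> unchanged, so a minimum over aligned states is one over all states. For zero
      overlap any phase will do, and 1 is taken.\<close>
    define d where "d = (if z = 0 then 1 else cnj z / of_real (cmod z))"
    have d: "cmod d = 1" unfolding d_def by (simp add: norm_divide)
    have dz: "d * z = of_real (cmod z)"
    proof (cases "z = 0")
      case False
      have "cnj z * z = of_real ((cmod z)\<^sup>2)" using complex_norm_square[of z] by (simp add: mult.commute)
      with False show ?thesis unfolding d_def by (simp add: power2_eq_square)
    qed (simp add: d_def)
    have dwQ: "(\<lambda>x. d * w x) \<in> Q" by (rule form_domain_scale[OF w(1)])
    note dwL = form_domain_L2[OF dwQ]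
    have "L2_inner e1 (\<lambda>x. d * w x) = d * z"
    proof -
      have "L2_inner e1 (\<lambda>x. d * w x) = (LINT x|lebesgue. d * (cnj (e1 x) * w x))"
        unfolding L2_inner_def by (simp only: mult.left_commute)
      then show ?thesis unfolding z_def L2_inner_def by simp
    qed
    then have "L2_form e1 (\<lambda>x. d * w x) = cmod z" "L2_form (\<lambda>x. \<i> * e1 x) (\<lambda>x. d * w x) = 0"
      unfolding Re_L2_inner[OF e1L dwL, THEN sym] Im_L2_inner[OF e1L dwL, THEN sym] dz by simp_all
    moreover have dw1: "L2_form (\<lambda>x. d * w x) (\<lambda>x. d * w x) = 1"
      using w(2) d unfolding L2_form_sq L2_norm_sq by (simp add: norm_mult)
    ultimately have "(\<lambda>x. d * w x) \<in> G.aligned" unfolding al using dwQ by simp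
    from bspec[OF l(3) this] show ?thesis
      unfolding J[OF l1] J[OF dw1] a_mult_unit[OF w(1) d] N_mult_unit[OF d] by simp
  qed
  have lmin': "kgs_minimizer V \<omega> v g l (optimal_field l)"
    unfolding kgs_minimizer_iff by (intro conjI lP optimal_field[OF lQ] ballI) (rule lmin)
  have lpos: "positive_overlap l uV" unfolding overlap[OF lQ] using l(1,2) unfolding al by blast
  have unique: "(AE x in lebesgue. u x = l x) \<and> (AE k in lebesgue. f k = optimal_field l k)"
    if min: "kgs_minimizer V \<omega> v g u f" and pos: "positive_overlap u uV" for u f
  proof -
    have u: "u \<in> Q" "L2_form u u = 1" and f: "f \<in> field_states \<omega>" "L2_norm (residual u f) = 0"
      and umin: "\<forall>u'\<in>particle_states V. a u u - N u \<le> a u' u' - N u'"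
      using min unfolding kgs_minimizer_iff particle_states_iff by auto
    have "u \<in> G.aligned" using u pos unfolding al overlap[OF u(1)] by simp
    moreover have "\<forall>w'\<in>G.aligned. G.J N u \<le> G.J N w'"
    proof (rule ballI)
      fix w' assume "w' \<in> G.aligned"
      then have w': "w' \<in> particle_states V" "L2_form w' w' = 1" unfolding al particle_states_iff by auto
      from bspec[OF umin w'(1)] show "G.J N u \<le> G.J N w'" unfolding J[OF u(2)] J[OF w'(2)] by simp
    qed
    ultimately have "L2_form (u - l) (u - l) = 0" using uniq by blast
    then have "L2_norm (u - l) = 0" unfolding L2_form_sq by simp
    from L2_norm_eq_0[OF S.L.diff_closed[OF form_domain_L2[OF u(1)] form_domain_L2[OF lQ]] this]
    have ul: "AE x in lebesgue. u x = l x" by eventually_elim simp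
    \<comment> \<open>\<open>optimal_field\<close> depends on the particle state only through an
      integral, so equality almost everywhere of the states gives equality of the fields
      everywhere.\<close>
    have "Fourier (\<lambda>x. u x \<bullet> u x) = Fourier (\<lambda>x. l x \<bullet> l x)"
    proof (rule ext, rule Fourier_cong_AE)
      show "(\<lambda>x. u x \<bullet> u x) \<in> borel_measurable lebesgue" "(\<lambda>x. l x \<bullet> l x) \<in> borel_measurable lebesgue"
        by (rule borel_measurable_integrable[OF L2_form_integrable[OF form_domain_L2[OF u(1)] form_domain_L2[OF u(1)]]],
            rule borel_measurable_integrable[OF L2_form_integrable[OF form_domain_L2[OF lQ] form_domain_L2[OF lQ]]])
      show "AE x in lebesgue. u x \<bullet> u x = l x \<bullet> l x" using ul by eventually_elim simp
    qed
    then have "optimal_field u = optimal_field l" unfolding optimal_field_def source_def by simp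
    with ul residual_zero_unique[OF u(1) f] show ?thesis by simp
  qed
  show ?thesis
    by (intro exI[of _ l] exI[of _ "optimal_field l"] conjI[OF lmin'] conjI[OF lpos] allI impI) (elim conjE, rule unique)
qed

end

text \<open>The infimum in the norm need not be attained, so a decomposition is available only below
  a strictly larger value; twice the bound is taken.\<close>

lemma small_decomposition:
  assumes "L1_weak_L3_norm W \<le> ennreal \<epsilon>" "\<epsilon> > 0"
  obtains W1 W2 where "W1 \<in> borel_measurable lebesgue" "W2 \<in> borel_measurable lebesgue"
    "AE k in lebesgue. W k = W1 k + W2 k" "L1_norm W1 \<le> ennreal (2 * \<epsilon>)" "weak_L3_norm W2 \<le> ennreal (2 * \<epsilon>)"
proof -
  have "ennreal \<epsilon> < ennreal (2 * \<epsilon>)" using assms(2) by (intro ennreal_lessI) simp_all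
  with assms(1) have "L1_weak_L3_norm W < ennreal (2 * \<epsilon>)" by (rule le_less_trans)
  then obtain w where w: "w \<in> L1_weak_L3_decompositions W"
    "(case w of (W1, W2) \<Rightarrow> L1_norm W1 + weak_L3_norm W2) < ennreal (2 * \<epsilon>)"
    unfolding L1_weak_L3_norm_def INF_less_iff by blast
  obtain W1 W2 where W: "w = (W1, W2)" by (cases w)
  have lt: "L1_norm W1 + weak_L3_norm W2 \<le> ennreal (2 * \<epsilon>)" using w(2) unfolding W by simp
  have "L1_norm W1 \<le> ennreal (2 * \<epsilon>)" "weak_L3_norm W2 \<le> ennreal (2 * \<epsilon>)"
    by (rule order_trans[OF _ lt], simp)+
  with w(1) that show thesis unfolding W L1_weak_L3_decompositions_def L1_def weak_L3_def by blast
qed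

theorem theorem1p5:
  fixes V :: "R3 \<Rightarrow> real"
  assumes "V \<in> borel_measurable lebesgue"
    and "hypothesis_A V"
    and "hypothesis_B V"
  shows "\<exists>\<epsilon>\<^sub>V>0. \<forall>(uV :: R3 \<Rightarrow> real) (\<omega> :: R3 \<Rightarrow> real) (v :: R3 \<Rightarrow> real) (g :: real).
     positive_ground_state V uV \<longrightarrow>
     \<omega> \<in> borel_measurable lebesgue \<longrightarrow> (\<forall>k. \<omega> k \<ge> 0) \<longrightarrow> (AE k in lebesgue. \<omega> k > 0) \<longrightarrow>
     v \<in> borel_measurable lebesgue \<longrightarrow>
     hypothesis_C (field_weight \<omega> v g) \<longrightarrow>
     L1_weak_L3_norm (field_weight \<omega> v g) \<le> ennreal \<epsilon>\<^sub>V \<longrightarrow>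
     (\<exists>u_gs f_gs.
        kgs_minimizer V \<omega> v g u_gs f_gs \<and> positive_overlap u_gs uV \<and>
        (\<forall>u f. kgs_minimizer V \<omega> v g u f \<and> positive_overlap u uV \<longrightarrow>
           (AE x in lebesgue. u x = u_gs x) \<and> (AE k in lebesgue. f k = f_gs k)))"
proof -
  from assms(2) obtain \<alpha> \<beta> where \<alpha>: "0 \<le> \<alpha>" "\<alpha> < 1"
    and minus: "\<forall>u\<in>H1. integrable lebesgue (\<lambda>x. max (- V x) 0 * (cmod (u x))\<^sup>2) \<and>
           (LINT x|lebesgue. max (- V x) 0 * (cmod (u x))\<^sup>2) \<le> \<alpha> * (L2_norm (weak_gradient u))\<^sup>2 + \<beta> * (L2_norm u)\<^sup>2"
    unfolding hypothesis_A_def by blast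
  interpret P: schroedinger_potential V \<alpha> \<beta>
  proof
    show "V \<in> borel_measurable lebesgue" "0 \<le> \<alpha>" "\<alpha> < 1" by fact+
    fix u assume "u \<in> H1"
    from bspec[OF minus this] show "integrable lebesgue (\<lambda>x. max (- V x) 0 * (cmod (u x))\<^sup>2)"
      "(LINT x|lebesgue. max (- V x) 0 * (cmod (u x))\<^sup>2) \<le> \<alpha> * (L2_norm (weak_gradient u))\<^sup>2 + \<beta> * (L2_norm u)\<^sup>2" by auto
  qed
  from assms(3) obtain u0 where simple: "simple_eigenvalue V (ground_energy V)" and isolated: "isolated_in_spectrum V (ground_energy V)"
    and u0: "positive_ground_state V u0" and u0_unique: "\<forall>uV'. positive_ground_state V uV' \<longrightarrow> (AE x in lebesgue. uV' x = u0 x)"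
    unfolding hypothesis_B_def by blast
  \<comment> \<open>All constants are built from one ground state before \<open>\<omega>\<close>,
    \<open>v\<close> and \<open>g\<close> are introduced, so the threshold depends on
    \<open>V\<close> alone. Any other positive ground state agrees with \<open>u0\<close> almost
    everywhere.\<close>
  define e1 where "e1 = (\<lambda>x. complex_of_real (u0 x))"
  define K where "K = 1 + \<bar>ground_energy V\<bar>"
  obtain c where "gapped_form (form_domain V) L2_form (\<lambda>u w. P.a u w - ground_energy V * L2_form u w) P.B e1 (\<lambda>x. \<i> * e1 x) c K"
    using P.ground_state_gap[OF simple isolated u0] unfolding e1_def K_def by blast
  note gapped = this
  interpret G: gapped_form "form_domain V" L2_form "\<lambda>u w. P.a u w - ground_energy V * L2_form u w" P.B e1 "\<lambda>x. \<i> * e1 x" c K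
    by (rule gapped)
  \<comment> \<open>The 2 is that of \<open>small_decomposition\<close>: with
    \<open>2 * \<epsilon>\<close> in the place of \<open>\<eta>\<close>, the coupling constant
    \<open>\<eta> * field_constant\<close> becomes exactly \<open>kappa_max\<close>.\<close>
  define \<epsilon> where "\<epsilon> = G.kappa_max / (2 * field_constant)"
  have \<epsilon>: "\<epsilon> > 0" unfolding \<epsilon>_def using G.kappa_max_pos field_constant_pos by simp
  show ?thesis
  proof (intro exI[of _ \<epsilon>] conjI \<epsilon> allI impI)
    fix uV \<omega> v :: "R3 \<Rightarrow> real" and g :: real
    assume uV: "positive_ground_state V uV" and \<omega>: "\<omega> \<in> borel_measurable lebesgue" "\<forall>k. 0 \<le> \<omega> k" "AE k in lebesgue. 0 < \<omega> k"
      and v: "v \<in> borel_measurable lebesgue" and small: "L1_weak_L3_norm (field_weight \<omega> v g) \<le> ennreal \<epsilon>"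
    obtain W1 W2 where W: "W1 \<in> borel_measurable lebesgue" "W2 \<in> borel_measurable lebesgue"
      "AE k in lebesgue. field_weight \<omega> v g k = W1 k + W2 k" "L1_norm W1 \<le> ennreal (2 * \<epsilon>)" "weak_L3_norm W2 \<le> ennreal (2 * \<epsilon>)"
      by (rule small_decomposition[OF small \<epsilon>])
    define h where "h = (\<lambda>k. g * v k / sqrt (\<omega> k))"
    interpret F: boson_system V \<alpha> \<beta> h W1 W2 "2 * \<epsilon>" \<omega> v g
    proof
      note [measurable] = \<omega>(1) v
      show "h \<in> borel_measurable lebesgue" unfolding h_def by measurable
      have "(h k)\<^sup>2 = field_weight \<omega> v g k" for k
        unfolding h_def field_weight_def using \<omega>(2) by (simp add: power_mult_distrib power_divide)
      then show "AE k in lebesgue. (h k)\<^sup>2 = W1 k + W2 k" using W(3) by simp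
      show "0 < 2 * \<epsilon>" using \<epsilon> by simp
      show "h k = g * v k / sqrt (\<omega> k)" for k unfolding h_def ..
      show "0 \<le> \<omega> k" for k using \<omega>(2) by blast
    qed (fact W \<omega> v)+
    have "F.\<kappa> = 2 * \<epsilon> * field_constant" by (rule F.\<kappa>_def)
    also have "\<dots> = G.kappa_max" unfolding \<epsilon>_def using field_constant_pos by simp
    finally have "F.\<kappa> = G.kappa_max" .
    then have \<kappa>_le: "F.\<kappa> \<le> gapped_form.kappa_max P.B e1 c K" by simp
    have "uV \<in> L2" using uV unfolding positive_ground_state_def by blast
    moreover have "AE x in lebesgue. e1 x = of_real (uV x)"
      using u0_unique[rule_format, OF uV] unfolding e1_def by eventually_elim simp
    ultimately show "\<exists>u_gs f_gs. kgs_minimizer V \<omega> v g u_gs f_gs \<and> positive_overlap u_gs uV \<and>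
        (\<forall>u f. kgs_minimizer V \<omega> v g u f \<and> positive_overlap u uV \<longrightarrow>
           (AE x in lebesgue. u x = u_gs x) \<and> (AE k in lebesgue. f k = f_gs k))"
      by (rule F.unique_minimizer[OF gapped \<kappa>_le])
  qed
qed

end
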